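(* Let $0<p,q<\infty$ and $k\in\mathbb{N}$, and let $\omega$ be a radial weight. Then the following statements are equivalent: (i) $\omega\in\mathcal{D}$; (ii) $\displaystyle\|f\|_{AT_p^q(\omega)}\asymp\|f^{(k)}(1-|\cdot|)^k\|_{T_p^q(\omega)}+\sum_{j=0}^{k-1}|f^{(j)}(0)|$ for all $f\in\mathcal{H}(\mathbb{D})$; (iii) $\displaystyle\|f\|_{AL_p^q(\omega)}\asymp\|f^{(k)}(1-|\cdot|)^k\|_{L_p^q(\omega)}+\sum_{j=0}^{k-1}|f^{(j)}(0)|$ for all $f\in\mathcal{H}(\mathbb{D})$.
   Context: $\mathbb{D}$ is the open unit disc, $\mathbb{T}=\partial\mathbb{D}$, $\mathcal{H}(\mathbb{D})$ is the space of analytic functions in $\mathbb{D}$, and $dA=\frac{dx\,dy}{\pi}$. A weight is a function $\omega:\mathbb{D}\to[0,\infty)$ integrable over $\mathbb{D}$; it is radial if $\omega(z)=\omega(|z|)$ for all $z\in\mathbb{D}$. Throughout, it is assumed that $\widehat{\omega}(z)=\int_{|z|}^1\omega(s)\,ds>0$ for all $z\in\mathbb{D}$. A radial weight $\omega$ belongs to $\widehat{\mathcal{D}}$ if there exists $C=C(\omega)>0$ such that $\widehat{\omega}(r)\le C\,\widehat{\omega}\left(\frac{1+r}{2}\right)$ as $r\to1^-$ (i.e. for all $r<1$ sufficiently close to $1$), and to $\check{\mathcal{D}}$ if there exist $K=K(\omega)>1$ and $C=C(\omega)>1$ such that $\widehat{\omega}(r)\ge C\,\widehat{\omega}\left(1-\frac{1-r}{K}\right)$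 as $r\to1^-$. Here $\check{\mathcal D}$ is just a name of a class, and $\mathcal{D}=\widehat{\mathcal{D}}\cap\check{\mathcal{D}}$. For $\xi\in\overline{\mathbb{D}}$, $\Gamma(\xi)=\{z\in\mathbb{D}:|\arg z-\arg\xi|<|\xi|-|z|\}$ (difference of arguments modulo $2\pi$). For $0<p,q<\infty$ and a complex-valued measurable function $f$ on $\mathbb{D}$, $$\|f\|_{L^q_p(\omega)}=\left(\frac1{2\pi}\int_0^{2\pi}\left(\int_0^1|f(re^{i\theta})|^p\omega(r)r\,dr\right)^{q/p}d\theta\right)^{1/q},$$ $$\|f\|_{T^q_p(\omega)}=\left(\int_{\mathbb{T}}\left(\int_{\Gamma(\xi)}|f(z)|^p\omega(z)\frac{dA(z)}{1-|z|}\right)^{q/p}|d\xi|\right)^{1/q},$$ possibly $+\infty$. For $f\in\mathcal{H}(\mathbb{D})$ we write $\|f\|_{AL^q_p(\omega)}=\|f\|_{L^q_p(\omega)}$ and $\|f\|_{AT^q_p(\omega)}=\|f\|_{T^q_p(\omega)}$. $A\asymp B$ means $C^{-1}B\le A\le CB$ with a constant $C>0$ independent of $f$. $f^{(k)}(1-|\cdot|)^k$ denotes the function $z\mapsto f^{(k)}(z)(1-|z|)^k$. *)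

theory Defs
  imports "HOL-Complex_Analysis.Complex_Analysis"
begin

text \<open>
  The unit disc is \<^term>\<open>ball (0::complex) 1\<close>. Functions on the disc are total functions on
  \<^typ>\<open>complex\<close> of which only the values on the disc are constrained or used.
  Norms and tail integrals may be infinite, so they take values in \<^typ>\<open>ennreal\<close>.
\<close>

definition weight :: "(complex \<Rightarrow> real) \<Rightarrow> bool" where
  "weight \<omega> \<longleftrightarrow> (\<forall>z\<in>ball 0 1. 0 \<le> \<omega> z) \<and> set_integrable lebesgue (ball 0 1) \<omega>"

definition radial_weight :: "(complex \<Rightarrow> real) \<Rightarrow> bool" where
  "radial_weight \<omega> \<longleftrightarrow> weight \<omega> \<and> (\<forall>z\<in>ball 0 1. \<omega> z = \<omega> (of_real (norm z)))"

text \<open>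
  Integrability over the disc does not bound the integral of a radial weight over \<open>(0,1)\<close>, because
  of the area factor \<open>r\<close>; hence \<open>tail_integral \<omega> 0\<close> can be infinite.
\<close>

definition tail_integral :: "(complex \<Rightarrow> real) \<Rightarrow> complex \<Rightarrow> ennreal" where
  "tail_integral \<omega> z = (\<integral>\<^sup>+s\<in>{norm z..<1}. ennreal (\<omega> (of_real s)) \<partial>lebesgue)"

definition D_hat :: "(complex \<Rightarrow> real) set" where
  "D_hat = {\<omega>. radial_weight \<omega> \<and>
     (\<exists>C::real. C > 0 \<and>
       (\<forall>\<^sub>F r::real in at_left 1.
          tail_integral \<omega> (of_real r) \<le> ennreal C * tail_integral \<omega> (of_real ((1 + r) / 2))))}"

definition D_check :: "(complex \<Rightarrow> real) set" where
  "D_check = {\<omega>. radial_weight \<omega> \<and>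
     (\<exists>K C::real. K > 1 \<and> C > 1 \<and>
       (\<forall>\<^sub>F r::real in at_left 1.
          tail_integral \<omega> (of_real r) \<ge> ennreal C * tail_integral \<omega> (of_real (1 - (1 - r) / K))))}"

definition D_class :: "(complex \<Rightarrow> real) set" where
  "D_class = D_hat \<inter> D_check"

text \<open>
  The integer \<open>n\<close> takes the difference of arguments modulo \<open>2\<pi>\<close>. The library's convention
  \<open>Arg 0 = 0\<close> only affects whether the point \<open>0\<close> belongs to the region.
\<close>

definition tent_region :: "complex \<Rightarrow> complex set" where
  "tent_region \<xi> = {z \<in> ball 0 1.
     \<exists>n::int. \<bar>Arg z - Arg \<xi> + 2 * pi * of_int n\<bar> < norm \<xi> - norm z}"

text \<open>Powers with positive exponents only, so that \<open>\<infinity>\<close> is mapped to \<open>\<infinity>\<close>.\<close>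

definition ennreal_powr :: "ennreal \<Rightarrow> real \<Rightarrow> ennreal" where
  "ennreal_powr x a = (if x = \<infinity> then \<infinity> else ennreal (enn2real x powr a))"

definition L_norm :: "real \<Rightarrow> real \<Rightarrow> (complex \<Rightarrow> real) \<Rightarrow> (complex \<Rightarrow> complex) \<Rightarrow> ennreal" where
  "L_norm p q \<omega> f =
     ennreal_powr
       (ennreal (1 / (2 * pi)) *
        (\<integral>\<^sup>+\<theta>\<in>{0..2 * pi}.
           ennreal_powr
             (\<integral>\<^sup>+r\<in>{0..<1}. ennreal (norm (f (of_real r * cis \<theta>)) powr p * \<omega> (of_real r) * r) \<partial>lebesgue)
             (q / p) \<partial>lebesgue))
       (1 / q)"

text \<open>Here \<open>\<xi> = cis \<theta>\<close> parametrizes the circle by arc length, and the area measure is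
  normalized by \<open>1/\<pi>\<close>.\<close>

definition T_norm :: "real \<Rightarrow> real \<Rightarrow> (complex \<Rightarrow> real) \<Rightarrow> (complex \<Rightarrow> complex) \<Rightarrow> ennreal" where
  "T_norm p q \<omega> f =
     ennreal_powr
       (\<integral>\<^sup>+\<theta>\<in>{0..2 * pi}.
          ennreal_powr
            (ennreal (1 / pi) *
             (\<integral>\<^sup>+z\<in>tent_region (cis \<theta>). ennreal (norm (f z) powr p * \<omega> z / (1 - norm z)) \<partial>lebesgue))
            (q / p) \<partial>lebesgue)
       (1 / q)"

definition comparable_on_H ::
    "((complex \<Rightarrow> complex) \<Rightarrow> ennreal) \<Rightarrow> ((complex \<Rightarrow> complex) \<Rightarrow> ennreal) \<Rightarrow> bool" where
  "comparable_on_H A B \<longleftrightarrow>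
     (\<exists>C::real. C > 0 \<and>
       (\<forall>f. f holomorphic_on ball 0 1 \<longrightarrow>
          ennreal (inverse C) * B f \<le> A f \<and> A f \<le> ennreal C * B f))"

end

(*
Both norms are L^q norms over the circle of the L^p norm of (r, u) |-> f(r e^(i(theta + u(1-r)))) with
respect to a product of omega(r) r dr and a measure in u: a point mass for L^q_p, Lebesgue measure on
(-1,1) for T^q_p. So one argument serves both.

Sufficiency. Cut the disc into rings 1 - r ~ 2^(-ln). By subharmonicity, the supremum of |f|^p over the
part of a ring near a boundary point is dominated by dyadic averages over the next rings, and a
vector-valued inequality for such averages bounds the whole square-function-like sum by the norm of f.
Cauchy estimates on the rings (with doubling of the weight) then control the derivative. Conversely,
f is recovered from f' by telescoping along radii, and the decay of the tails of the weight makes the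
resulting double sum converge.

Necessity. On the monomials z^n the comparison becomes an inequality between moments of the weight;
moments of order n see the mass of omega at distance about 1/n from the circle. The bound of the
derivative gives the doubling condition, the reverse bound gives the decay.
*)
theory Submission
  imports Defs
begin

section \<open>Power inequalities\<close>

text \<open>A weight may vanish on many radii, so \<open>f\<close> cannot be sampled on single
  circles; it is averaged over rings, and the decay of the tails gives each ring a fixed share of
  the remaining mass. A value near ring \<open>n\<close> is estimated from ring
  \<open>n + 3\<close>: the Poisson kernel needs circles that lie outside the point by a proportion
  of its distance to the boundary, and doubling pays for the shift. The obstacle is the exponent
  \<open>q / p\<close>, which may be below 1, where averages of \<open>|f|^p\<close> are not
  controlled. Averages of \<open>|f|^s\<close> with \<open>s = p / aa\<close> are, since their
  \<open>aa\<close>-th powers fit a weighted Jensen inequality combined with an \<open>L^2\<close>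
  maximal inequality. The averages that occur are Poisson integrals, not dyadic ones; two shifted
  dyadic grids dominate them, with a geometric series over scales that survives both powers. In the
  necessity part the order matters: decay is extracted from an integral over all distances from the
  circle, and its part far from the circle is controlled by the doubling already obtained.\<close>

lemma sum_geometric_powr_le:
  fixes lam c :: real
  assumes "0 < lam" "lam < 1" "0 < c"
  shows "\<exists>C>0. \<forall>N y. (\<forall>j. 0 \<le> y j) \<longrightarrow>
     (\<Sum>j\<le>(N::nat). lam ^ j * y j) powr c \<le> C * (\<Sum>j\<le>N. (lam powr (c/2)) ^ j * y j powr c)"
proof (intro exI conjI allI impI)
  \<comment> \<open>The root splits the factor: one \<open>mu ^ j\<close> makes the series converge,
    the other stays with \<open>y j\<close>. The largest \<open>mu ^ j * y j\<close> is attained at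
    one index, so its \<open>c\<close>-th power is a single term of the right-hand side, for
    \<open>c\<close> below and above 1 alike.\<close>
  define mu where "mu = sqrt lam"
  have mu: "0 < mu" "mu < 1" "mu * mu = lam" using assms by (auto simp: mu_def)
  show "0 < (1 / (1 - mu)) powr c" using mu by simp
  fix N :: nat and y :: "nat \<Rightarrow> real"
  assume y: "\<forall>j. 0 \<le> y j"
  define z where "z j = mu ^ j * y j" for j
  have z: "0 \<le> z j" for j using y mu by (simp add: z_def)
  define Mx where "Mx = Max (z ` {..N})"
  have "Mx \<in> z ` {..N}" unfolding Mx_def by (rule Max_in) auto
  then obtain i where i: "i \<le> N" "Mx = z i" by auto
  have le: "z j \<le> Mx" if "j \<le> N" for j unfolding Mx_def using that by (intro Max_ge) auto
  have Mx0: "0 \<le> Mx" using z i by simp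
  have geo: "(\<Sum>j\<le>N. mu ^ j) \<le> 1 / (1 - mu)"
  proof -
    have "(\<Sum>j\<le>N. mu ^ j) \<le> (\<Sum>j. mu ^ j)"
      using mu by (intro sum_le_suminf summable_geometric) auto
    then show ?thesis using mu by (simp add: suminf_geometric)
  qed
  have "(\<Sum>j\<le>N. lam ^ j * y j) = (\<Sum>j\<le>N. mu ^ j * z j)"
    using mu by (intro sum.cong) (auto simp: z_def power_mult_distrib[symmetric] mult.assoc[symmetric])
  also have "\<dots> \<le> (\<Sum>j\<le>N. mu ^ j * Mx)"
    using mu le by (intro sum_mono mult_left_mono) auto
  also have "\<dots> = (\<Sum>j\<le>N. mu ^ j) * Mx" by (simp add: sum_distrib_right)
  also have "\<dots> \<le> 1 / (1 - mu) * Mx" using geo Mx0 by (intro mult_right_mono)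
  finally have "(\<Sum>j\<le>N. lam ^ j * y j) powr c \<le> (1 / (1 - mu) * Mx) powr c"
    using assms y by (intro powr_mono2 sum_nonneg) auto
  also have "\<dots> = (1 / (1 - mu)) powr c * Mx powr c" using mu Mx0 by (intro powr_mult)
  also have "Mx powr c \<le> (\<Sum>j\<le>N. (lam powr (c/2)) ^ j * y j powr c)"
  proof -
    have "Mx powr c = (mu ^ i) powr c * y i powr c"
      using mu y i by (simp add: z_def powr_mult)
    also have "(mu ^ i) powr c = (lam powr (c/2)) ^ i"
      using mu assms by (simp add: powr_powr powr_realpow[symmetric] mu_def powr_half_sqrt[symmetric] mult.commute)
    also have "(lam powr (c/2)) ^ i * y i powr c \<le> (\<Sum>j\<le>N. (lam powr (c/2)) ^ j * y j powr c)"
      using i by (intro member_le_sum[where f="\<lambda>j. (lam powr (c/2)) ^ j * y j powr c"]) auto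
    finally show ?thesis .
  qed
  finally show "(\<Sum>j\<le>N. lam ^ j * y j) powr c \<le>
     (1 / (1 - mu)) powr c * (\<Sum>j\<le>N. (lam powr (c/2)) ^ j * y j powr c)"
    by (simp add: mult_left_mono)
qed

text \<open>Young's inequality for the exponents \<open>c\<close> and \<open>c / (c - 1)\<close>,
  cleared of denominators so that \<open>c = 1\<close> is included. It is the tangent line
  inequality of \<open>t powr c\<close> at \<open>y\<close>.\<close>

lemma Young_powr:
  fixes x y c :: real
  assumes "1 \<le> c" "0 \<le> x" "0 \<le> y"
  shows "c * (x * y powr (c - 1)) \<le> x powr c + (c - 1) * y powr c"
proof (cases "x = 0 \<or> y = 0")
  case False
  then have "x * y powr (c - 1) = (x powr c) powr (1/c) * (y powr c) powr (1 - 1/c)"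
    using assms by (simp add: powr_powr right_diff_distrib)
  also have "\<dots> \<le> 1/c * x powr c + (1 - 1/c) * y powr c"
    using assms False by (intro Youngs_inequality_0) (auto simp: field_simps)
  finally have "x * y powr (c - 1) \<le> 1/c * x powr c + (1 - 1/c) * y powr c" .
  then have "c * (x * y powr (c - 1)) \<le> c * (1/c * x powr c + (1 - 1/c) * y powr c)"
    using assms by (intro mult_left_mono) auto
  moreover have "c * (1/c * x powr c + (1 - 1/c) * y powr c) = x powr c + (c - 1) * y powr c"
    using assms by (simp add: algebra_simps)
  ultimately show ?thesis by simp
qed (use assms in auto)

text \<open>A discrete form of d(X^c) = c X^(c-1) dX, by convexity at each step. The
  \<open>n\<close>-th factor contains only partial sums up to \<open>n\<close>; for averages of
  increasing generations these are constant on the cells of the \<open>n\<close>-th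
  generation.\<close>

lemma powr_sum_le_sum_partial:
  fixes x :: "nat \<Rightarrow> real"
  assumes "1 \<le> c" "\<And>n. 0 \<le> x n"
  shows "(\<Sum>n\<le>N. x n) powr c \<le> c * (\<Sum>n\<le>N. x n * (\<Sum>i\<le>n. x i) powr (c - 1))"
proof (induction N)
  case 0
  have "x 0 powr c = x 0 * x 0 powr (c - 1)" using assms(2)[of 0] by (simp add: powr_mult_base)
  then show ?case using assms using mult_right_mono[of 1 c "x 0 powr c"] by simp
next
  case (Suc N)
  define X where "X = (\<Sum>n\<le>N. x n)"
  define T where "T = X + x (Suc N)"
  have X0: "0 \<le> X" unfolding X_def by (intro sum_nonneg assms)
  have T0: "0 \<le> T" using X0 assms by (simp add: T_def)
  have TT: "T * T powr (c - 1) = T powr c" using T0 by (simp add: powr_mult_base)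
  have "T powr c - X powr c \<le> c * (T * T powr (c-1)) - c * (X * T powr (c-1))"
    using Young_powr[of c X T] assms X0 T0 TT by (simp add: algebra_simps)
  also have "\<dots> = c * (x (Suc N) * T powr (c - 1))" by (simp add: T_def algebra_simps)
  finally have "T powr c \<le> X powr c + c * (x (Suc N) * T powr (c - 1))" by simp
  then show ?case using Suc by (simp add: X_def T_def algebra_simps)
qed

lemma powr_add_le_subadditive:
  fixes x e c :: real
  assumes "0 < c" "c \<le> 1" "0 \<le> x" "0 < e"
  shows "(x + e) powr c \<le> x powr c + e powr c"
proof (cases "x = 0")
  case False
  then have x: "0 < x" using assms by simp
  have "(x + e) powr c = x * (x + e) powr (c - 1) + e * (x + e) powr (c - 1)"
    using powr_mult_base[of "x + e" "c - 1"] x assms by (simp add: distrib_right)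
  also have "\<dots> \<le> x * x powr (c - 1) + e * e powr (c - 1)"
    using x assms by (intro add_mono mult_left_mono powr_mono2') auto
  finally show ?thesis using x assms by (simp add: powr_mult_base)
qed (use assms in auto)

section \<open>Dyadic averages and a vector-valued maximal inequality\<close>

text \<open>A dyadic filtration given by labels of cells. Since every cell of generation
  \<open>m\<close> has measure 2^(-m), conditional expectations are plain normalized integrals,
  defined at every point and not only almost everywhere.\<close>

locale cell_system = finite_measure M for M :: "'a measure" +
  fixes cell :: "nat \<Rightarrow> 'a \<Rightarrow> int"
  assumes cell_measurable [measurable]: "cell m \<in> measurable M (count_space UNIV)"
    and cell_measure: "x \<in> space M \<Longrightarrow> measure M {y \<in> space M. cell m y = cell m x} = (1/2) ^ m"
    and cell_refine: "m \<le> m' \<Longrightarrow> x \<in> space M \<Longrightarrow> y \<in> space M \<Longrightarrow>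
        cell m' x = cell m' y \<Longrightarrow> cell m x = cell m y"
begin

text \<open>Boundedness keeps all integrals real and finite, as the absorbing arguments need;
  unbounded sums enter later as monotone limits.\<close>

definition bdd :: "('a \<Rightarrow> real) \<Rightarrow> bool" where
  "bdd g \<longleftrightarrow> g \<in> borel_measurable M \<and> (\<exists>B. \<forall>x\<in>space M. 0 \<le> g x \<and> g x \<le> B)"

definition cavg :: "nat \<Rightarrow> ('a \<Rightarrow> real) \<Rightarrow> 'a \<Rightarrow> real" where
  "cavg m g x = 2 ^ m * (\<integral>y. (if cell m y = cell m x then g y else 0) \<partial>M)"

definition cell_const :: "nat \<Rightarrow> ('a \<Rightarrow> real) \<Rightarrow> bool" where
  "cell_const m H \<longleftrightarrow> (\<forall>x\<in>space M. \<forall>y\<in>space M. cell m x = cell m y \<longrightarrow> H x = H y)"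

lemma cell_constD: "cell_const m H \<Longrightarrow> x \<in> space M \<Longrightarrow> y \<in> space M \<Longrightarrow> cell m x = cell m y \<Longrightarrow> H x = H y"
  unfolding cell_const_def by blast

lemma bdd_measurable: "bdd g \<Longrightarrow> g \<in> borel_measurable M"
  by (simp add: bdd_def)

lemma bdd_nonneg: "bdd g \<Longrightarrow> x \<in> space M \<Longrightarrow> 0 \<le> g x"
  by (auto simp: bdd_def)

lemma bdd_bound: 
  assumes "bdd g" obtains B where "0 \<le> B" "\<And>x. x \<in> space M \<Longrightarrow> g x \<le> B"
proof -
  obtain B where "\<forall>x\<in>space M. 0 \<le> g x \<and> g x \<le> B" using assms by (auto simp: bdd_def)
  then show ?thesis by (intro that[of "max 0 B"]) (auto simp: max_def intro: order_trans)
qed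

lemma bddI: "g \<in> borel_measurable M \<Longrightarrow> (\<And>x. x \<in> space M \<Longrightarrow> 0 \<le> g x) \<Longrightarrow>
   (\<And>x. x \<in> space M \<Longrightarrow> g x \<le> B) \<Longrightarrow> bdd g"
  by (auto simp: bdd_def)

lemma bdd_integrable: 
  assumes "bdd g" shows "integrable M g"
proof -
  obtain B where "0 \<le> B" "\<And>x. x \<in> space M \<Longrightarrow> g x \<le> B" using bdd_bound[OF assms] by blast
  then show ?thesis using assms
    by (intro integrable_const_bound[where B=B] AE_I2) (auto simp: bdd_nonneg bdd_measurable)
qed

lemma bdd_const: "0 \<le> c \<Longrightarrow> bdd (\<lambda>_. c)" by (intro bddI[where B=c]) auto

lemma bdd_add: assumes "bdd f" "bdd g" shows "bdd (\<lambda>x. f x + g x)"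
proof -
  obtain A where "\<And>x. x \<in> space M \<Longrightarrow> f x \<le> A" using bdd_bound[OF assms(1)] by blast
  moreover obtain B where "\<And>x. x \<in> space M \<Longrightarrow> g x \<le> B" using bdd_bound[OF assms(2)] by blast
  ultimately show ?thesis using assms
    by (intro bddI[where B="A+B"]) (auto intro!: add_mono borel_measurable_add simp: bdd_measurable bdd_nonneg)
qed

lemma bdd_mult: assumes "bdd f" "bdd g" shows "bdd (\<lambda>x. f x * g x)"
proof -
  obtain A where A: "0 \<le> A" "\<And>x. x \<in> space M \<Longrightarrow> f x \<le> A" using bdd_bound[OF assms(1)] by blast
  obtain B where B: "0 \<le> B" "\<And>x. x \<in> space M \<Longrightarrow> g x \<le> B" using bdd_bound[OF assms(2)] by blast
  show ?thesis using assms A B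
    by (intro bddI[where B="A*B"]) (auto intro!: mult_mono borel_measurable_times simp: bdd_measurable bdd_nonneg)
qed

lemma bdd_powr: assumes "bdd f" "0 \<le> c" shows "bdd (\<lambda>x. f x powr c)"
proof -
  obtain A where A: "0 \<le> A" "\<And>x. x \<in> space M \<Longrightarrow> f x \<le> A" using bdd_bound[OF assms(1)] by blast
  note [measurable] = bdd_measurable[OF assms(1)]
  show ?thesis using assms A
    by (intro bddI[where B="A powr c"]) (auto intro!: powr_mono2 simp: bdd_nonneg)
qed

lemma bdd_max: assumes "bdd f" "bdd g" shows "bdd (\<lambda>x. max (f x) (g x))"
proof -
  obtain A where A: "0 \<le> A" "\<And>x. x \<in> space M \<Longrightarrow> f x \<le> A" using bdd_bound[OF assms(1)] by blast
  obtain B where B: "0 \<le> B" "\<And>x. x \<in> space M \<Longrightarrow> g x \<le> B" using bdd_bound[OF assms(2)] by blast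
  note [measurable] = bdd_measurable[OF assms(1)] bdd_measurable[OF assms(2)]
  show ?thesis using assms A B
    by (intro bddI[where B="max A B"]) (auto intro!: max.mono simp del: max.bounded_iff simp: bdd_nonneg max.coboundedI1)
qed

lemma bdd_sum: "finite I \<Longrightarrow> (\<And>i. i \<in> I \<Longrightarrow> bdd (f i)) \<Longrightarrow> bdd (\<lambda>x. \<Sum>i\<in>I. f i x)"
  by (induction I rule: finite_induct) (auto intro: bdd_add bdd_const)

lemma bdd_restrict: 
  assumes "bdd g" shows "bdd (\<lambda>y. if cell m y = k then g y else 0)"
proof -
  note [measurable] = bdd_measurable[OF assms]
  obtain B where "0 \<le> B" "\<And>x. x \<in> space M \<Longrightarrow> g x \<le> B" using bdd_bound[OF assms] by blast
  then show ?thesis by (intro bddI[where B=B]) (auto simp: bdd_nonneg assms)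
qed

section \<open>Averages over cells\<close>

lemma cavg_mono:
  assumes "bdd f" "bdd g" "\<And>x. x \<in> space M \<Longrightarrow> f x \<le> g x"
  shows "cavg m f x \<le> cavg m g x"
  unfolding cavg_def using assms
  by (intro mult_left_mono integral_mono bdd_integrable bdd_restrict) auto

lemma cavg_const: "x \<in> space M \<Longrightarrow> cavg m (\<lambda>_. c) x = c"
proof -
  assume x: "x \<in> space M"
  have "(\<integral>y. (if cell m y = cell m x then c else 0) \<partial>M) = (\<integral>y. c * indicator {y \<in> space M. cell m y = cell m x} y \<partial>M)"
    by (intro Bochner_Integration.integral_cong) auto
  also have "\<dots> = c * (1/2) ^ m" using cell_measure[OF x] by simp
  finally show ?thesis by (simp add: cavg_def power_one_over)
qed

lemma cavg_nonneg: "bdd g \<Longrightarrow> 0 \<le> cavg m g x"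
  unfolding cavg_def by (intro mult_nonneg_nonneg Bochner_Integration.integral_nonneg) (auto simp: bdd_nonneg)

lemma cavg_add: "bdd f \<Longrightarrow> bdd g \<Longrightarrow> cavg m (\<lambda>x. f x + g x) x = cavg m f x + cavg m g x"
proof -
  assume a: "bdd f" "bdd g"
  have "(\<integral>y. (if cell m y = cell m x then f y + g y else 0) \<partial>M) = 
    (\<integral>y. (if cell m y = cell m x then f y else 0) + (if cell m y = cell m x then g y else 0) \<partial>M)"
    by (intro Bochner_Integration.integral_cong) auto
  also have "\<dots> = (\<integral>y. (if cell m y = cell m x then f y else 0) \<partial>M) + (\<integral>y. (if cell m y = cell m x then g y else 0) \<partial>M)"
    by (intro Bochner_Integration.integral_add bdd_integrable bdd_restrict a)
  finally show ?thesis by (simp add: cavg_def algebra_simps)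
qed

lemma cavg_cmult: "cavg m (\<lambda>x. c * f x) x = c * cavg m f x"
proof -
  have "(\<integral>y. (if cell m y = cell m x then c * f y else 0) \<partial>M) = 
    (\<integral>y. c * (if cell m y = cell m x then f y else 0) \<partial>M)"
    by (intro Bochner_Integration.integral_cong) auto
  then show ?thesis by (simp add: cavg_def)
qed

lemma cavg_cell_const: "cell_const m (cavg m g)"
  by (auto simp: cell_const_def cavg_def)

lemma cell_const_refine: "m \<le> m' \<Longrightarrow> cell_const m H \<Longrightarrow> cell_const m' H"
  unfolding cell_const_def using cell_refine by blast

lemma pair_sigma_finite_MM: "pair_sigma_finite M M"
  by (simp add: pair_sigma_finite_def sigma_finite_measure_axioms)

lemma measurable_cell_pair [measurable]:
  "Measurable.pred (M \<Otimes>\<^sub>M M) (\<lambda>p. cell m (snd p) = cell m (fst p))"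
  by measurable

lemma cavg_measurable: assumes "bdd g" shows "cavg m g \<in> borel_measurable M"
proof -
  note [measurable] = bdd_measurable[OF assms]
  have "(\<lambda>(x,y). if cell m y = cell m x then g y else 0) \<in> borel_measurable (M \<Otimes>\<^sub>M M)"
    using measurable_cell_pair[of m] by (simp add: split_beta')
  then show ?thesis unfolding cavg_def
    by (intro borel_measurable_times borel_measurable_const borel_measurable_lebesgue_integral) 
qed

lemma bdd_cavg: assumes "bdd g" shows "bdd (cavg m g)"
proof -
  obtain B where B: "0 \<le> B" "\<And>x. x \<in> space M \<Longrightarrow> g x \<le> B" using bdd_bound[OF assms] by blast
  have "cavg m g x \<le> B" if "x \<in> space M" for x
    using cavg_mono[OF assms bdd_const[OF B(1)] B(2), where m=m and x=x] cavg_const[OF that] by simp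
  then show ?thesis by (intro bddI[where B=B] cavg_measurable cavg_nonneg assms)
qed

text \<open>Conditional expectation is self-adjoint: in the double integral over pairs lying in one
  cell, \<open>H\<close> may be evaluated at either point.\<close>

lemma integral_cavg_mult:
  assumes g: "bdd g" and H: "bdd H" "cell_const m H"
  shows "(\<integral>x. cavg m g x * H x \<partial>M) = (\<integral>x. g x * H x \<partial>M)"
proof -
  interpret pair_sigma_finite M M by (rule pair_sigma_finite_MM)
  note [measurable] = bdd_measurable[OF g] bdd_measurable[OF H(1)]
  define F where "F x y = (if cell m y = cell m x then 2 ^ m * g y * H y else 0)" for x y
  obtain B where B: "0 \<le> B" "\<And>x. x \<in> space M \<Longrightarrow> g x * H x \<le> B" 
    using bdd_bound[OF bdd_mult[OF g H(1)]] by blast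
  have Fm: "case_prod F \<in> borel_measurable (M \<Otimes>\<^sub>M M)"
    unfolding F_def using measurable_cell_pair[of m] by (simp add: split_beta')
  interpret MM: finite_measure "M \<Otimes>\<^sub>M M"
    by (intro finite_measure_pair_measure finite_measure_axioms)
  have int: "integrable (M \<Otimes>\<^sub>M M) (case_prod F)"
  proof (rule MM.integrable_const_bound[where B="2^m * B"])
    show "AE x in M \<Otimes>\<^sub>M M. norm (case x of (x, xa) \<Rightarrow> F x xa) \<le> 2 ^ m * B"
      using B g H by (intro AE_I2) (auto simp: F_def space_pair_measure bdd_nonneg abs_mult mult.assoc)
  qed (rule Fm)
  have "(\<integral>x. cavg m g x * H x \<partial>M) = (\<integral>x. (\<integral>y. F x y \<partial>M) \<partial>M)"
  proof (intro Bochner_Integration.integral_cong refl)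
    fix x assume x: "x \<in> space M"
    have "cavg m g x * H x = (\<integral>y. (2 ^ m * H x) * (if cell m y = cell m x then g y else 0) \<partial>M)"
      by (subst Bochner_Integration.integral_mult_right_zero) (simp add: cavg_def)
    also have "\<dots> = (\<integral>y. F x y \<partial>M)"
    proof (intro Bochner_Integration.integral_cong refl)
      fix y assume y: "y \<in> space M"
      show "(2 ^ m * H x) * (if cell m y = cell m x then g y else 0) = F x y"
      proof (cases "cell m y = cell m x")
        case True
        then have "H y = H x" using H(2) x y unfolding cell_const_def by blast
        then show ?thesis using True by (simp add: F_def)
      qed (simp add: F_def)
    qed
    finally show "cavg m g x * H x = (\<integral>y. F x y \<partial>M)" .
  qed
  also have "\<dots> = (\<integral>y. (\<integral>x. F x y \<partial>M) \<partial>M)"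
    using Fubini_integral[OF int] by simp
  also have "\<dots> = (\<integral>y. g y * H y \<partial>M)"
  proof (intro Bochner_Integration.integral_cong refl)
    fix y assume y: "y \<in> space M"
    have "(\<integral>x. F x y \<partial>M) = cavg m (\<lambda>_. g y * H y) y"
      unfolding cavg_def F_def
      by (subst Bochner_Integration.integral_mult_right_zero[symmetric])
         (intro Bochner_Integration.integral_cong, auto)
    then show "(\<integral>x. F x y \<partial>M) = g y * H y" using cavg_const[OF y] by simp
  qed
  finally show ?thesis .
qed

lemma integral_cavg: 
  assumes g: "bdd g" shows "(\<integral>x. cavg m g x \<partial>M) = (\<integral>x. g x \<partial>M)"
  using integral_cavg_mult[OF g bdd_const[of 1], of m] by (simp add: cell_const_def)

text \<open>Jensen's inequality for \<open>g / V\<close> with respect to the weight \<open>V\<close>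
  on a cell. The tangent line of \<open>t powr a\<close> is taken at the weighted mean
  \<open>y\<close> of \<open>g / V\<close>. The lower bound \<open>e\<close> makes the divisions by
  \<open>V\<close> and by its average legitimate.\<close>

lemma cavg_weighted_Jensen:
  assumes g: "bdd g" and V: "bdd V" and e: "0 < e" "\<And>x. x \<in> space M \<Longrightarrow> e \<le> V x"
    and gV: "bdd (\<lambda>x. g x powr a * V x powr (1 - a))" and a: "1 \<le> a" and x: "x \<in> space M"
  shows "cavg m g x powr a \<le> cavg m V x powr (a - 1) * cavg m (\<lambda>x. g x powr a * V x powr (1 - a)) x"
proof (cases "cavg m g x = 0")
  case True
  then show ?thesis by (auto intro!: mult_nonneg_nonneg cavg_nonneg gV)
next
  case False
  let ?gV = "\<lambda>x. g x powr a * V x powr (1 - a)"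
  have Eg: "0 < cavg m g x" using False cavg_nonneg[OF g, of m x] by linarith
  have EV: "0 < cavg m V x"
    using cavg_mono[OF bdd_const[of e] V e(2), of m x] e(1) cavg_const[OF x] by simp
  define y where "y = cavg m g x / cavg m V x"
  have y: "0 < y" using Eg EV by (simp add: y_def)
  have pw: "(a * y powr (a - 1)) * g z \<le> ?gV z + ((a - 1) * y powr a) * V z" if z: "z \<in> space M" for z
  proof -
    have Vz: "0 < V z" using e z by force
    have gz: "0 \<le> g z" using g z by (rule bdd_nonneg)
    have "V z * (a * ((g z / V z) * y powr (a - 1))) \<le> V z * ((g z / V z) powr a + (a - 1) * y powr a)"
      using Young_powr[of a "g z / V z" y] a y Vz gz by (intro mult_left_mono) auto
    moreover have "V z * (g z / V z) powr a = ?gV z"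
      using Vz gz by (simp add: powr_divide powr_diff)
    ultimately show ?thesis using Vz by (simp add: algebra_simps)
  qed
  have "(a * y powr (a - 1)) * cavg m g x \<le> cavg m (\<lambda>z. ?gV z + ((a - 1) * y powr a) * V z) x"
    unfolding cavg_cmult[symmetric]
    using a by (intro cavg_mono bdd_mult[OF bdd_const g] bdd_add gV bdd_mult[OF bdd_const V] pw) auto
  also have "\<dots> = cavg m ?gV x + ((a - 1) * y powr a) * cavg m V x"
    using a by (subst cavg_add[OF gV]) (auto intro!: bdd_mult[OF bdd_const V] simp: cavg_cmult)
  finally have 1: "(a * y powr (a - 1)) * cavg m g x \<le> cavg m ?gV x + ((a - 1) * y powr a) * cavg m V x" .
  have "y powr (a - 1) * cavg m g x = y powr a * cavg m V x"
    using y EV Eg by (simp add: y_def powr_diff)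
  then have "y powr a * cavg m V x \<le> cavg m ?gV x"
    using 1 by (simp add: algebra_simps)
  then have "cavg m V x powr (a - 1) * (y powr a * cavg m V x) \<le> cavg m V x powr (a - 1) * cavg m ?gV x"
    by (intro mult_left_mono) auto
  moreover have "cavg m V x powr (a - 1) * (y powr a * cavg m V x) = cavg m g x powr a"
    using EV Eg by (simp add: y_def powr_diff powr_divide)
  ultimately show ?thesis by simp
qed

text \<open>Doob's maximal inequality in \<open>L^2\<close> with its constant 4, for finitely many
  generations. The running maximum grows only where it becomes the new average, and its increment is
  constant on cells, so under the integral the average can be replaced by \<open>V\<close>.
  Telescoping the squares bounds the integral of \<open>W^2\<close> by twice that of
  \<open>V * W\<close>.\<close>

lemma maximal_L2:
  assumes V: "bdd V" and m: "\<And>n. m n \<le> m (Suc n)"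
  obtains Vs where "bdd Vs" "\<And>n x. n \<le> (N::nat) \<Longrightarrow> cavg (m n) V x \<le> Vs x"
    "(\<integral>x. (Vs x)\<^sup>2 \<partial>M) \<le> 4 * (\<integral>x. (V x)\<^sup>2 \<partial>M)"
proof -
  define W where "W = rec_nat (cavg (m 0) V) (\<lambda>n r x. max (r x) (cavg (m (Suc n)) V x))"
  have W0: "W 0 = cavg (m 0) V" and WS: "W (Suc n) = (\<lambda>x. max (W n x) (cavg (m (Suc n)) V x))" for n
    by (auto simp: W_def)
  have bW: "bdd (W n)" for n
    by (induction n) (auto simp: W0 WS intro!: bdd_cavg V bdd_max)
  have cW: "cell_const (m n) (W n)" for n
  proof (induction n)
    case (Suc n)
    have "cell_const (m (Suc n)) (W n)" by (rule cell_const_refine[OF m Suc])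
    then show ?case using cavg_cell_const[of "m (Suc n)" V] unfolding WS cell_const_def by metis
  qed (auto simp: W0 cavg_cell_const)
  have bW2: "bdd (\<lambda>x. (W n x)\<^sup>2)" for n 
    using bdd_mult[OF bW bW] by (simp add: power2_eq_square)
  have bVW: "bdd (\<lambda>x. V x * W n x)" for n by (intro bdd_mult V bW)
  have key: "(\<integral>x. (W n x)\<^sup>2 \<partial>M) \<le> 2 * (\<integral>x. V x * W n x \<partial>M)" for n
  proof (induction n)
    case 0
    have "(\<integral>x. V x * W 0 x \<partial>M) = (\<integral>x. cavg (m 0) V x * W 0 x \<partial>M)"
      by (rule integral_cavg_mult[symmetric]) (auto intro!: V bW cW)
    then show ?case using Bochner_Integration.integral_nonneg[of M "\<lambda>x. (W 0 x)\<^sup>2"] 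
      by (simp add: W0 power2_eq_square)
  next
    case (Suc n)
    define D where "D x = W (Suc n) x - W n x" for x
    have bD: "bdd D"
    proof -
      obtain B where "\<And>x. x \<in> space M \<Longrightarrow> W (Suc n) x \<le> B" using bdd_bound[OF bW] by blast
      moreover have "0 \<le> W n x" if "x \<in> space M" for x using bdd_nonneg[OF bW that] .
      moreover note [measurable] = bdd_measurable[OF bW] bdd_measurable[OF bdd_cavg[OF V]]
      have "(\<lambda>x. W (Suc n) x - W n x) \<in> borel_measurable M" by measurable
      moreover have "W n x \<le> W (Suc n) x" for x by (simp add: WS)
      ultimately show ?thesis unfolding D_def
        by (intro bddI[where B=B]) (auto simp del: max.bounded_iff intro: diff_mono[of _ _ 0, simplified])
    qed
    have cD: "cell_const (m (Suc n)) D"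
      using cW[of "Suc n"] cell_const_refine[OF m cW[of n]] unfolding D_def cell_const_def by metis
    have "(\<integral>x. (W (Suc n) x)\<^sup>2 \<partial>M) - (\<integral>x. (W n x)\<^sup>2 \<partial>M) = (\<integral>x. (W (Suc n) x)\<^sup>2 - (W n x)\<^sup>2 \<partial>M)"
      by (intro Bochner_Integration.integral_diff[symmetric] bdd_integrable bW2)
    also have "\<dots> \<le> (\<integral>x. 2 * (cavg (m (Suc n)) V x * D x) \<partial>M)"
    proof (intro integral_mono Bochner_Integration.integrable_diff bdd_integrable bW2 bdd_mult bdd_cavg bdd_const V bD)
      fix x assume x: "x \<in> space M"
      show "(W (Suc n) x)\<^sup>2 - (W n x)\<^sup>2 \<le> 2 * (cavg (m (Suc n)) V x * D x)"
      proof (cases "W n x \<le> cavg (m (Suc n)) V x")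
        case True
        have "0 \<le> (cavg (m (Suc n)) V x - W n x)\<^sup>2" by simp
        then show ?thesis using True by (simp add: D_def WS power2_eq_square algebra_simps)
      qed (simp add: D_def WS)
    qed simp
    also have "\<dots> = 2 * (\<integral>x. cavg (m (Suc n)) V x * D x \<partial>M)" by simp
    also have "\<dots> = 2 * (\<integral>x. V x * D x \<partial>M)"
      by (simp add: integral_cavg_mult[OF V bD cD])
    also have "\<dots> = 2 * ((\<integral>x. V x * W (Suc n) x \<partial>M) - (\<integral>x. V x * W n x \<partial>M))"
      by (subst Bochner_Integration.integral_diff[symmetric]) (auto intro!: bdd_integrable bVW simp: D_def algebra_simps)
    finally show ?case using Suc by simp
  qed
  \<comment> \<open>Expanding the square of \<open>2 * V x - W N x\<close> lets half of the integral
    of \<open>(W N)^2\<close> be absorbed, which is where the 4 comes from.\<close>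
  have "(\<integral>x. 2 * (V x * W N x) \<partial>M) \<le> (\<integral>x. 2 * (V x)\<^sup>2 + (1/2) * (W N x)\<^sup>2 \<partial>M)"
  proof (intro integral_mono bdd_integrable bdd_add bdd_mult[OF bdd_const] bVW bW2)
    show "bdd (\<lambda>x. (V x)\<^sup>2)" using bdd_mult[OF V V] by (simp add: power2_eq_square)
    show "2 * (V x * W N x) \<le> 2 * (V x)\<^sup>2 + (1/2) * (W N x)\<^sup>2" for x
      using zero_le_power2[of "2 * V x - W N x"] by (simp add: power2_eq_square algebra_simps)
  qed auto
  also have "\<dots> = 2 * (\<integral>x. (V x)\<^sup>2 \<partial>M) + (1/2) * (\<integral>x. (W N x)\<^sup>2 \<partial>M)"
    using bdd_integrable[OF bdd_mult[OF V V]] bdd_integrable[OF bW2[of N]]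
    by (subst Bochner_Integration.integral_add) (auto simp: power2_eq_square)
  finally have "(\<integral>x. (W N x)\<^sup>2 \<partial>M) \<le> 4 * (\<integral>x. (V x)\<^sup>2 \<partial>M)" using key[of N] by simp
  moreover have "cavg (m n) V x \<le> W k x" if "n \<le> k" for n k x
    using that by (induction k) (auto simp: W0 WS le_Suc_eq max_def intro: order_trans)
  ultimately show ?thesis using that[of "W N"] bW by blast
qed

lemma vector_cavg_ge1:
  assumes c: "1 \<le> c" and w: "\<And>n. 0 \<le> w n" and g: "\<And>n. bdd (g n)" and m: "\<And>n. m n \<le> m (Suc n)"
  shows "(\<integral>x. (\<Sum>n\<le>(N::nat). w n * cavg (m n) (g n) x) powr c \<partial>M)
    \<le> c powr c * (\<integral>x. (\<Sum>n\<le>N. w n * g n x) powr c \<partial>M)"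
proof -
  define X where "X n x = (\<Sum>i\<le>n. w i * cavg (m i) (g i) x)" for n x
  define G where "G x = (\<Sum>n\<le>N. w n * g n x)" for x
  have mm: "i \<le> j \<Longrightarrow> m i \<le> m j" for i j using m by (rule lift_Suc_mono_le)
  have bw: "bdd (\<lambda>x. w i * cavg (m i) (g i) x)" for i by (intro bdd_mult[OF bdd_const] w bdd_cavg g)
  have bwg: "bdd (\<lambda>x. w i * g i x)" for i by (intro bdd_mult[OF bdd_const] w g)
  have bX: "bdd (X n)" for n unfolding X_def by (intro bdd_sum bw) auto
  have bG: "bdd G" unfolding G_def by (intro bdd_sum bwg) auto
  have bP: "bdd (\<lambda>x. X n x powr (c - 1))" for n using c by (intro bdd_powr bX) auto
  have cX: "cell_const (m n) (\<lambda>x. X n x powr (c - 1))" for n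
  proof -
    have "cell_const (m n) (X n)"
      unfolding cell_const_def X_def
    proof (intro ballI impI sum.cong refl)
      fix x y i assume *: "x \<in> space M" "y \<in> space M" "cell (m n) x = cell (m n) y" "i \<in> {..n}"
      have "cell_const (m n) (cavg (m i) (g i))"
        using * by (intro cell_const_refine[OF mm cavg_cell_const]) auto
      then show "w i * cavg (m i) (g i) x = w i * cavg (m i) (g i) y"
        using cell_constD[of "m n" "cavg (m i) (g i)" x y] * by simp
    qed
    then show ?thesis unfolding cell_const_def by metis
  qed
  have XN: "X n x powr (c - 1) \<le> X N x powr (c - 1)" if "n \<le> N" "x \<in> space M" for n x
    using c that bdd_nonneg[OF bX]
    by (intro powr_mono2) (auto simp: X_def intro!: sum_mono2 mult_nonneg_nonneg w cavg_nonneg g)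
  have "(\<integral>x. X N x powr c \<partial>M) \<le> (\<integral>x. c * (\<Sum>n\<le>N. (w n * cavg (m n) (g n) x) * X n x powr (c - 1)) \<partial>M)"
  proof (intro integral_mono bdd_integrable bdd_mult[OF bdd_const] bdd_sum bdd_mult[OF bw bP])
    show "bdd (\<lambda>x. X N x powr c)" using c by (intro bdd_powr bX) auto
    show "X N x powr c \<le> c * (\<Sum>n\<le>N. (w n * cavg (m n) (g n) x) * X n x powr (c - 1))" for x
      unfolding X_def by (rule powr_sum_le_sum_partial[OF c]) (intro mult_nonneg_nonneg w cavg_nonneg g)
  qed (use c in auto)
  also have "\<dots> = c * (\<Sum>n\<le>N. w n * (\<integral>x. cavg (m n) (g n) x * X n x powr (c - 1) \<partial>M))"
    by (simp add: Bochner_Integration.integral_sum bdd_integrable bdd_mult bdd_cavg g bP bw mult.assoc)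
  also have "\<dots> = c * (\<Sum>n\<le>N. w n * (\<integral>x. g n x * X n x powr (c - 1) \<partial>M))"
    by (simp add: integral_cavg_mult[OF g bP cX])
  also have "\<dots> = (\<integral>x. c * (\<Sum>n\<le>N. w n * (g n x * X n x powr (c - 1))) \<partial>M)"
    by (simp add: Bochner_Integration.integral_sum bdd_integrable bdd_mult g bP)
  \<comment> \<open>Young's inequality with \<open>c * G\<close> leaves the factor
    \<open>1 - 1/c < 1\<close> in front of the integral of \<open>X N powr c\<close>, which is
    finite and can be moved to the left.\<close>
  also have "\<dots> \<le> (\<integral>x. (c * G x) powr c / c + (1 - 1/c) * X N x powr c \<partial>M)"
  proof (intro integral_mono bdd_integrable bdd_mult[OF bdd_const] bdd_sum bdd_mult[OF g bP] bdd_add)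
    show "bdd (\<lambda>x. (c * G x) powr c / c)"
      using bdd_mult[OF bdd_powr[OF bdd_mult[OF bdd_const bG]] bdd_const, of c c "1/c"] c by simp
    show "bdd (\<lambda>x. X N x powr c)" using c by (intro bdd_powr bX) auto
    fix x assume x: "x \<in> space M"
    have "c * (\<Sum>n\<le>N. w n * (g n x * X n x powr (c - 1))) \<le> c * (\<Sum>n\<le>N. w n * (g n x * X N x powr (c - 1)))"
      using c x by (intro mult_left_mono sum_mono XN w) (auto simp: bdd_nonneg g)
    also have "\<dots> = (1/c) * (c * ((c * G x) * X N x powr (c - 1)))"
      using c by (simp add: G_def sum_distrib_right sum_distrib_left mult.assoc)
    also have "\<dots> \<le> (1/c) * ((c * G x) powr c + (c - 1) * X N x powr c)"
      using c x bdd_nonneg[OF bG] bdd_nonneg[OF bX] by (intro mult_left_mono Young_powr) auto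
    finally show "c * (\<Sum>n\<le>N. w n * (g n x * X n x powr (c - 1))) \<le> (c * G x) powr c / c + (1 - 1/c) * X N x powr c"
      using c by (simp add: field_simps)
  qed (use c w in auto)
  also have "\<dots> = c powr c / c * (\<integral>x. G x powr c \<partial>M) + (1 - 1/c) * (\<integral>x. X N x powr c \<partial>M)"
  proof -
    have "(\<integral>x. (c * G x) powr c / c \<partial>M) = (\<integral>x. (c powr c / c) * G x powr c \<partial>M)"
      using c bdd_nonneg[OF bG] by (intro Bochner_Integration.integral_cong) (auto simp: powr_mult)
    moreover have "integrable M (\<lambda>x. (c * G x) powr c / c)"
      using bdd_integrable[OF bdd_powr[OF bdd_mult[OF bdd_const bG]], of c c] c by simp
    moreover have "integrable M (\<lambda>x. (1 - 1/c) * X N x powr c)"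
      using bdd_integrable[OF bdd_powr[OF bX], of c N] c by simp
    ultimately show ?thesis by (subst Bochner_Integration.integral_add) auto
  qed
  finally have "(1/c) * (\<integral>x. X N x powr c \<partial>M) \<le> (1/c) * (c powr c * (\<integral>x. G x powr c \<partial>M))"
    by (simp add: algebra_simps)
  then show ?thesis using c by (simp add: X_def G_def divide_le_cancel)
qed

text \<open>With \<open>V = G powr (c/2)\<close>, weighted Jensen splits each power of an average
  into a power of the maximal function \<open>Vs\<close> and an average that is linear in
  \<open>g n powr a\<close>. Young's inequality with weights \<open>1 - c\<close> and
  \<open>c\<close> separates the two: the first is bounded by the \<open>L^2\<close> maximal
  inequality, in the second the averages integrate away. Both lead to the integral of
  \<open>G powr c\<close>.\<close>

lemma vector_cavg_lt1:
  assumes c: "0 < c" "c < 1" and w: "\<And>n. 0 \<le> w n" and g: "\<And>n. bdd (g n)" and m: "\<And>n. m n \<le> m (Suc n)"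
    and a: "a = 2 / c - 1"
  shows "(\<integral>x. (\<Sum>n\<le>(N::nat). w n * cavg (m n) (g n) x powr a) powr c \<partial>M)
    \<le> 4 * (\<integral>x. (\<Sum>n\<le>N. w n * g n x powr a) powr c \<partial>M)"
proof -
  have a1: "1 \<le> a" using c by (simp add: a field_simps)
  \<comment> \<open>These identities dictate \<open>a\<close>: the power of the maximal function
    must become its square when the factors are separated, and \<open>V powr (1 - a)\<close> must be
    \<open>G powr (c - 1)\<close>.\<close>
  have ac: "(a - 1) * c = 2 * (1 - c)" "c / 2 * (1 - a) = c - 1" using c by (auto simp: a field_simps)
  define S where "S x = (\<Sum>n\<le>N. w n * cavg (m n) (g n) x powr a)" for x
  define G where "G x = (\<Sum>n\<le>N. w n * g n x powr a)" for x
  have bwg: "bdd (\<lambda>x. w i * g i x powr a)" for i using a1 by (intro bdd_mult[OF bdd_const] bdd_powr w g) auto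
  have bG: "bdd G" unfolding G_def by (intro bdd_sum bwg) auto
  have bS: "bdd S" unfolding S_def using a1 by (intro bdd_sum bdd_mult[OF bdd_const] bdd_powr bdd_cavg w g) auto
  have main: "(\<integral>x. S x powr c \<partial>M) \<le> 4 * (\<integral>x. G x powr c \<partial>M) + 4 * (e powr c * measure M (space M))"
    if e: "0 < e" for e
  proof -
    \<comment> \<open>Adding \<open>e\<close> keeps the negative power
      \<open>Ge powr (c - 1)\<close> bounded where \<open>G\<close> vanishes. In the end
      \<open>e\<close> tends to 0, by subadditivity of \<open>t powr c\<close>.\<close>
    define Ge where "Ge x = G x + e" for x
    have Ge: "e \<le> Ge x" if "x \<in> space M" for x using bdd_nonneg[OF bG that] by (simp add: Ge_def)
    have Ge0: "0 < Ge x" if "x \<in> space M" for x using Ge[OF that] e by linarith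
    have bGe: "bdd Ge" unfolding Ge_def using e by (intro bdd_add bG bdd_const) auto
    define V where "V x = Ge x powr (c/2)" for x
    have bV: "bdd V" unfolding V_def using c by (intro bdd_powr bGe) auto
    have V2: "(V x)\<^sup>2 = Ge x powr c" if "x \<in> space M" for x
      using c by (simp add: V_def power2_eq_square powr_add[symmetric])
    have V1: "V x powr (1 - a) = Ge x powr (c - 1)" for x
      by (simp only: V_def powr_powr ac)
    have bGc: "bdd (\<lambda>x. Ge x powr (c - 1))"
      using bdd_measurable[OF bGe] Ge e c
      by (intro bddI[where B="e powr (c - 1)"]) (auto intro!: powr_mono2')
    obtain Vs where Vs: "bdd Vs" "\<And>n x. n \<le> N \<Longrightarrow> cavg (m n) V x \<le> Vs x"
      "(\<integral>x. (Vs x)\<^sup>2 \<partial>M) \<le> 4 * (\<integral>x. (V x)\<^sup>2 \<partial>M)"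
      by (rule maximal_L2[where m=m and N=N, OF bV]) (use m in auto)
    define r where "r n x = g n x powr a * Ge x powr (c - 1)" for n x
    have br: "bdd (r n)" for n unfolding r_def using a1 by (intro bdd_mult bdd_powr g bGc) auto
    define R where "R x = (\<Sum>n\<le>N. w n * cavg (m n) (r n) x)" for x
    have bR: "bdd R" unfolding R_def by (intro bdd_sum bdd_mult[OF bdd_const] bdd_cavg br w) auto
    have "(\<integral>x. S x powr c \<partial>M) \<le> (\<integral>x. (1 - c) * (Vs x)\<^sup>2 + c * R x \<partial>M)"
    proof (intro integral_mono bdd_integrable bdd_add bdd_mult[OF bdd_const] bR)
      show "bdd (\<lambda>x. S x powr c)" using c by (intro bdd_powr bS) auto
      show "bdd (\<lambda>x. (Vs x)\<^sup>2)" using bdd_mult[OF Vs(1) Vs(1)] by (simp add: power2_eq_square)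
      fix x assume x: "x \<in> space M"
      have R0: "0 \<le> R x" using bdd_nonneg[OF bR x] .
      have Vs0: "0 \<le> Vs x" using bdd_nonneg[OF Vs(1) x] .
      have "S x \<le> (\<Sum>n\<le>N. w n * (Vs x powr (a - 1) * cavg (m n) (r n) x))"
        unfolding S_def
      proof (intro sum_mono mult_left_mono w)
        fix n assume n: "n \<in> {..N}"
        have "cavg (m n) (g n) x powr a \<le> cavg (m n) V x powr (a - 1) * cavg (m n) (r n) x"
          unfolding r_def V1[symmetric]
          using Ge e c br[of n] x a1
          by (intro cavg_weighted_Jensen[where e="e powr (c/2)"] g bV)
             (auto simp: V1 r_def[abs_def] intro!: powr_mono2, auto simp: V_def intro!: powr_mono2)
        also have "\<dots> \<le> Vs x powr (a - 1) * cavg (m n) (r n) x"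
          using a1 Vs(2)[of n x] n by (intro mult_right_mono powr_mono2 cavg_nonneg br bV) auto
        finally show "cavg (m n) (g n) x powr a \<le> Vs x powr (a - 1) * cavg (m n) (r n) x" .
      qed
      also have "\<dots> = Vs x powr (a - 1) * R x"
        by (simp add: R_def sum_distrib_left algebra_simps)
      finally have "S x powr c \<le> (Vs x powr (a - 1) * R x) powr c"
        using c bdd_nonneg[OF bS x] by (intro powr_mono2) auto
      also have "\<dots> = (Vs x)\<^sup>2 powr (1 - c) * R x powr c"
      proof -
        have "(Vs x)\<^sup>2 = Vs x powr 2" using Vs0 by (cases "Vs x = 0") auto
        then have "(Vs x)\<^sup>2 powr (1 - c) = Vs x powr (2 * (1 - c))" by (simp only: powr_powr)
        then show ?thesis using Vs0 R0 by (simp only: powr_mult powr_powr ac)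
      qed
      also have "\<dots> \<le> (1 - c) * (Vs x)\<^sup>2 + c * R x"
      proof (cases "Vs x = 0 \<or> R x = 0")
        case False
        then show ?thesis using Vs0 R0 c by (intro Youngs_inequality_0) auto
      qed (use c R0 in auto)
      finally show "S x powr c \<le> (1 - c) * (Vs x)\<^sup>2 + c * R x" .
    qed (use c in auto)
    also have "\<dots> = (1 - c) * (\<integral>x. (Vs x)\<^sup>2 \<partial>M) + c * (\<integral>x. R x \<partial>M)"
      using bdd_integrable[OF bdd_mult[OF Vs(1) Vs(1)]] bdd_integrable[OF bR]
      by (subst Bochner_Integration.integral_add) (auto simp: power2_eq_square)
    also have "\<dots> \<le> (1 - c) * (4 * (\<integral>x. Ge x powr c \<partial>M)) + c * (4 * (\<integral>x. Ge x powr c \<partial>M))"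
    proof (intro add_mono mult_left_mono)
      have "(\<integral>x. (V x)\<^sup>2 \<partial>M) = (\<integral>x. Ge x powr c \<partial>M)"
        by (intro Bochner_Integration.integral_cong V2) auto
      then show "(\<integral>x. (Vs x)\<^sup>2 \<partial>M) \<le> 4 * (\<integral>x. Ge x powr c \<partial>M)" using Vs(3) by simp
      have "(\<integral>x. R x \<partial>M) = (\<integral>x. (\<Sum>n\<le>N. w n * r n x) \<partial>M)"
        unfolding R_def by (simp add: Bochner_Integration.integral_sum bdd_integrable bdd_cavg br integral_cavg)
      also have "\<dots> \<le> (\<integral>x. Ge x powr c \<partial>M)"
      proof (intro integral_mono bdd_integrable bdd_sum bdd_mult[OF bdd_const] br w)
        show "bdd (\<lambda>x. Ge x powr c)" using c by (intro bdd_powr bGe) auto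
        fix x assume x: "x \<in> space M"
        have "(\<Sum>n\<le>N. w n * r n x) = G x * Ge x powr (c - 1)"
          by (simp add: r_def G_def sum_distrib_right mult.assoc)
        also have "\<dots> \<le> Ge x * Ge x powr (c - 1)"
          using e by (intro mult_right_mono) (auto simp: Ge_def)
        also have "\<dots> = Ge x powr c" using Ge0[OF x] by (simp add: powr_mult_base)
        finally show "(\<Sum>n\<le>N. w n * r n x) \<le> Ge x powr c" .
      qed auto
      also have "\<dots> \<le> 4 * (\<integral>x. Ge x powr c \<partial>M)"
        using Bochner_Integration.integral_nonneg[of M "\<lambda>x. Ge x powr c"] by simp
      finally show "(\<integral>x. R x \<partial>M) \<le> 4 * (\<integral>x. Ge x powr c \<partial>M)" .
    qed (use c in auto)
    also have "\<dots> = 4 * (\<integral>x. Ge x powr c \<partial>M)" by (simp add: algebra_simps)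
    also have "(\<integral>x. Ge x powr c \<partial>M) \<le> (\<integral>x. G x powr c + e powr c \<partial>M)"
    proof (intro integral_mono bdd_integrable bdd_add bdd_const)
      show "bdd (\<lambda>x. Ge x powr c)" "bdd (\<lambda>x. G x powr c)" using c by (auto intro!: bdd_powr bGe bG)
      show "Ge x powr c \<le> G x powr c + e powr c" if "x \<in> space M" for x
        unfolding Ge_def using c e bdd_nonneg[OF bG that] by (intro powr_add_le_subadditive) auto
    qed auto
    also have "\<dots> = (\<integral>x. G x powr c \<partial>M) + e powr c * measure M (space M)"
      using bdd_integrable[OF bdd_powr[OF bG, of c]] c by (subst Bochner_Integration.integral_add) auto
    finally show ?thesis by simp
  qed
  have "(\<integral>x. S x powr c \<partial>M) \<le> 4 * (\<integral>x. G x powr c \<partial>M) + h" if h: "0 < h" for h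
  proof -
    define mm where "mm = 4 * measure M (space M) + 1"
    have mm: "0 < mm" unfolding mm_def using measure_nonneg[of M "space M"] by linarith
    define e where "e = (h / mm) powr (1 / c)"
    have e: "0 < e" "e powr c = h / mm" using h mm c by (auto simp: e_def powr_powr)
    have "e powr c * (4 * measure M (space M)) \<le> e powr c * mm"
      by (intro mult_left_mono) (auto simp: mm_def)
    then have "4 * (e powr c * measure M (space M)) \<le> h"
      using mm by (simp add: e mult.left_commute)
    then show ?thesis using main[OF e(1)] by linarith
  qed
  then have "(\<integral>x. S x powr c \<partial>M) \<le> 4 * (\<integral>x. G x powr c \<partial>M)"
    by (rule field_le_epsilon)
  then show ?thesis by (simp only: S_def G_def)
qed

text \<open>For \<open>c < 1\<close> the inequality fails with exponent \<open>1\<close> in place of \<open>2/c - 1\<close>, already for the average of a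
  small cell's indicator. The larger exponent costs nothing in the application, because
  \<open>|h|\<^sup>s\<close> is subharmonic for every \<open>s > 0\<close>.\<close>

lemma vector_cavg:
  fixes c :: real
  assumes c: "0 < c"
  obtains C where "0 < C" 
    "\<And>N w g m. (\<And>n. 0 \<le> w n) \<Longrightarrow> (\<And>n. bdd (g n)) \<Longrightarrow> (\<And>n. m n \<le> m (Suc n)) \<Longrightarrow>
     (\<integral>x. (\<Sum>n\<le>(N::nat). w n * cavg (m n) (g n) x powr max 1 (2/c - 1)) powr c \<partial>M)
     \<le> C * (\<integral>x. (\<Sum>n\<le>N. w n * g n x powr max 1 (2/c - 1)) powr c \<partial>M)"
proof (cases "c < 1")
  case True
  then have "max 1 (2/c - 1) = 2/c - 1" using c by (simp add: field_simps max_def)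
  then show ?thesis using vector_cavg_lt1[OF c True _ _ _ refl] by (intro that[of 4]) auto
next
  case False
  then have 1: "max 1 (2/c - 1) = 1" using c by (simp add: field_simps max_def)
  show ?thesis
  proof (rule that[of "c powr c"])
    fix N :: nat and w :: "nat \<Rightarrow> real" and g :: "nat \<Rightarrow> 'a \<Rightarrow> real" and m :: "nat \<Rightarrow> nat"
    assume *: "\<And>n. 0 \<le> w n" "\<And>n. bdd (g n)" "\<And>n. m n \<le> m (Suc n)"
    have "(\<integral>x. (\<Sum>n\<le>N. w n * g n x powr 1) powr c \<partial>M) = (\<integral>x. (\<Sum>n\<le>N. w n * g n x) powr c \<partial>M)"
      using * by (intro Bochner_Integration.integral_cong) (auto simp: bdd_nonneg)
    then show "(\<integral>x. (\<Sum>n\<le>N. w n * cavg (m n) (g n) x powr max 1 (2/c - 1)) powr c \<partial>M)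
      \<le> c powr c * (\<integral>x. (\<Sum>n\<le>N. w n * g n x powr max 1 (2/c - 1)) powr c \<partial>M)"
      unfolding 1 using vector_cavg_ge1[of c w g m N] * False by (simp add: cavg_nonneg)
  qed (use c in auto)
qed

end

section \<open>Subharmonicity of powers of holomorphic functions\<close>

lemma nn_integral_shift:
  fixes F :: "real \<Rightarrow> ennreal"
  assumes [measurable]: "F \<in> borel_measurable borel"
  shows "(\<integral>\<^sup>+x. F (x + t) \<partial>lborel) = (\<integral>\<^sup>+x. F x \<partial>lborel)"
  using nn_integral_real_affine[of F 1 t] by (simp add: add.commute)

lemma periodic_int_shift:
  fixes F :: "real \<Rightarrow> 'a"
  assumes "\<And>x. F (x + 1) = F x"
  shows "F (x + of_int n) = F x"
proof -
  have nat: "F (x + of_nat k) = F x" for k x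
  proof (induction k)
    case (Suc k)
    then show ?case using assms[of "x + of_nat k"] by (simp add: algebra_simps)
  qed simp
  show ?thesis
    using nat[of x "nat n"] nat[of "x + of_int n" "nat (- n)"] by (cases "0 \<le> n") auto
qed

lemma nn_integral_periodic:
  fixes F :: "real \<Rightarrow> ennreal"
  assumes [measurable]: "F \<in> borel_measurable borel" and per: "\<And>x. F (x + 1) = F x"
  shows "(\<integral>\<^sup>+x\<in>{a..<a+1}. F x \<partial>lborel) = (\<integral>\<^sup>+x\<in>{0..<1}. F x \<partial>lborel)"
proof -
  \<comment> \<open>The integer in \<open>[a, a + 1)\<close> cuts the interval into two pieces,
    which translations by \<open>m - 1\<close> and by \<open>m\<close> put side by side in
    \<open>[0, 1)\<close>.\<close>
  define m where "m = \<lceil>a\<rceil>"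
  have m: "a \<le> of_int m" "of_int m < a + 1" unfolding m_def by linarith+
  define b where "b = a + 1 - of_int m"
  have b: "0 < b" "b \<le> 1" using m by (auto simp: b_def)
  have P: "F (x + of_int n) = F x" for x n using per by (rule periodic_int_shift)
  have "(\<integral>\<^sup>+x\<in>{a..<a+1}. F x \<partial>lborel) = (\<integral>\<^sup>+x. F x * indicator {a..<of_int m} x + F x * indicator {of_int m..<a+1} x \<partial>lborel)"
    using m by (intro nn_integral_cong) (auto split: split_indicator)
  also have "\<dots> = (\<integral>\<^sup>+x. F x * indicator {a..<of_int m} x \<partial>lborel) + (\<integral>\<^sup>+x. F x * indicator {of_int m..<a+1} x \<partial>lborel)"
    by (intro nn_integral_add) measurable
  also have "(\<integral>\<^sup>+x. F x * indicator {a..<of_int m} x \<partial>lborel) = (\<integral>\<^sup>+x. F (x + (of_int m - 1)) * indicator {a..<of_int m} (x + (of_int m - 1)) \<partial>lborel)"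
    by (rule nn_integral_shift[symmetric]) measurable
  also have "\<dots> = (\<integral>\<^sup>+x. F x * indicator {b..<1} x \<partial>lborel)"
    using P[of _ "m - 1"] by (intro nn_integral_cong) (auto simp: b_def split: split_indicator)
  also have "(\<integral>\<^sup>+x. F x * indicator {of_int m..<a+1} x \<partial>lborel) = (\<integral>\<^sup>+x. F (x + of_int m) * indicator {of_int m..<a+1} (x + of_int m) \<partial>lborel)"
    by (rule nn_integral_shift[symmetric]) measurable
  also have "\<dots> = (\<integral>\<^sup>+x. F x * indicator {0..<b} x \<partial>lborel)"
    using P[of _ "m"] by (intro nn_integral_cong) (auto simp: b_def split: split_indicator)
  also have "(\<integral>\<^sup>+x. F x * indicator {b..<1} x \<partial>lborel) + (\<integral>\<^sup>+x. F x * indicator {0..<b} x \<partial>lborel) =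
     (\<integral>\<^sup>+x. F x * indicator {b..<1} x + F x * indicator {0..<b} x \<partial>lborel)"
    by (intro nn_integral_add[symmetric]) measurable
  also have "\<dots> = (\<integral>\<^sup>+x\<in>{0..<1}. F x \<partial>lborel)"
    using b by (intro nn_integral_cong) (auto split: split_indicator)
  finally show ?thesis .
qed

text \<open>The bound is uniform in the starting node \<open>y\<close>. This is needed because the
  nodes are later the \<open>N\<close>-th roots of unity, rotated to an arbitrary boundary
  point.\<close>

lemma Riemann_sum_le:
  fixes u :: "real \<Rightarrow> real"
  assumes u: "continuous_on UNIV u" and per: "\<And>x. u (x + 1) = u x" and e: "0 < e"
  obtains N :: nat where "0 < N"
    "\<And>y. 0 \<le> y \<Longrightarrow> y \<le> 1 \<Longrightarrow> (\<Sum>k<N. u (y + k / N)) / N \<le> integral {0..1} u + e"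
proof -
  have io: "u integrable_on {a..b}" for a b
    by (intro integrable_continuous_interval continuous_on_subset[OF u]) auto
  have shift: "integral {y..y+1} u = integral {0..1} u" if y: "0 \<le> y" "y \<le> 1" for y
  proof -
    have "integral {y..y+1} u = integral {y..1} u + integral {1..y+1} u"
      using y by (intro Henstock_Kurzweil_Integration.integral_combine[symmetric] io) auto
    also have "integral {1..y+1} u = integral {0..y} (u \<circ> (\<lambda>x. x + 1))"
      using integral_shift[of 0 1 y u] continuous_on_subset[OF u] by (auto simp: add.commute)
    also have "u \<circ> (\<lambda>x. x + 1) = u" using per by auto
    also have "integral {y..1} u + integral {0..y} u = integral {0..1} u"
      using y by (subst add.commute, intro Henstock_Kurzweil_Integration.integral_combine io) auto
    finally show ?thesis .
  qed
  \<comment> \<open>All nodes and integration points lie in \<open>[0, 2]\<close>, since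
    \<open>y <= 1\<close> and the mesh covers one period.\<close>
  have "uniformly_continuous_on {0..2} u"
    by (intro compact_uniformly_continuous continuous_on_subset[OF u]) auto
  then obtain d where d: "0 < d" "\<And>x x'. x \<in> {0..2} \<Longrightarrow> x' \<in> {0..2} \<Longrightarrow> dist x' x < d \<Longrightarrow> dist (u x') (u x) < e"
    using uniformly_continuous_onE[OF _ e] by blast
  obtain N where N: "0 < N" "1 / real N < d" using d(1) by (metis nat_approx_posE zero_less_Suc)
  show ?thesis
  proof (rule that[OF N(1)])
    fix y :: real assume y: "0 \<le> y" "y \<le> 1"
    have "(\<Sum>k<n. (u (y + k / N) - e) / N) \<le> integral {y..y + n / N} u" if "n \<le> N" for n :: nat
      using that
    proof (induction n)
      case (Suc n)
      have n1: "real (Suc n) / N \<le> 1" using Suc N by auto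
      have "(u (y + n / N) - e) / N = integral {y + n/N..y + Suc n/N} (\<lambda>_. u (y + n / N) - e)"
      proof -
        have "y + Suc n/N - (y + n/N) = 1 / N" "y + n/N \<le> y + Suc n/N" using N
          by (simp_all add: add_divide_distrib divide_right_mono)
        then show ?thesis by simp
      qed
      also have "\<dots> \<le> integral {y + n/N..y + Suc n/N} u"
      proof (intro integral_le io integrable_const_ivl)
        fix x assume x: "x \<in> {y + n/N..y + Suc n/N}"
        have nN: "0 \<le> real n / N" "real n / N \<le> 1" "real (Suc n) / N = n / N + 1/N"
          using Suc N by (auto simp: add_divide_distrib)
        have "dist (u x) (u (y + n/N)) < e"
        proof (rule d(2))
          show "y + n/N \<in> {0..2}" "x \<in> {0..2}" using x y n1 nN unfolding atLeastAtMost_iff nN(3) by linarith+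
          show "dist x (y + n/N) < d" using x nN N by (auto simp: dist_real_def)
        qed
        then show "u (y + n/N) - e \<le> u x" by (auto simp: dist_real_def)
      qed
      finally have 1: "(u (y + n / N) - e) / N \<le> integral {y + n/N..y + Suc n/N} u" .
      have "integral {y..y + n/N} u + integral {y + n/N..y + Suc n/N} u = integral {y..y + Suc n/N} u"
        using N by (intro Henstock_Kurzweil_Integration.integral_combine io) (auto simp: divide_right_mono)
      then show ?case using Suc 1 by simp
    qed simp
    from this[of N] N have "(\<Sum>k<N. (u (y + k / N) - e) / N) \<le> integral {0..1} u" using shift[OF y] by simp
    moreover have "(\<Sum>k<N. (u (y + k / N) - e) / N) = (\<Sum>k<N. u (y + k / N)) / N - e"
      using N by (simp add: sum_divide_distrib[symmetric] sum_subtractf diff_divide_distrib)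
    ultimately show "(\<Sum>k<N. u (y + k / N)) / N \<le> integral {0..1} u + e" by simp
  qed
qed

text \<open>The maximum principle is applied to the product of all rotations of \<open>h\<close> by \<open>N\<close>-th roots of unity;
  zeros of \<open>h\<close> need no special treatment.\<close>

lemma norm_powr_le_circle_mean:
  assumes h: "continuous_on (cball 0 1) h" "h holomorphic_on ball 0 1" and s: "0 < s"
  shows "norm (h 0) powr s \<le> integral {0..1} (\<lambda>x. norm (h (cis (2 * pi * x))) powr s)"
proof (rule field_le_epsilon)
  fix e :: real assume e: "0 < e"
  define u where "u x = norm (h (cis (2 * pi * x))) powr s" for x
  have ch: "continuous_on A (\<lambda>x. h (cis (2 * pi * g x)))" if "continuous_on A g" for A :: "real set" and g
    by (rule continuous_on_compose2[OF h(1)]) (auto intro!: continuous_intros that)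
  have cu: "continuous_on UNIV u" unfolding u_def
    using s by (intro continuous_on_powr' continuous_intros ch) auto
  have per: "u (x + 1) = u x" for x
  proof -
    have "cis (2 * pi * (x + 1)) = cis (2 * pi * x)"
      by (simp add: ring_distribs cis_mult[symmetric])
    then show ?thesis by (simp add: u_def)
  qed
  obtain N :: nat where N: "0 < N" "\<And>y. 0 \<le> y \<Longrightarrow> y \<le> 1 \<Longrightarrow> (\<Sum>k<N. u (y + k / N)) / N \<le> integral {0..1} u + e"
    using Riemann_sum_le[OF cu per e] by blast
  define I where "I = integral {0..1} u + e"
  define H where "H w = (\<Prod>k<N. h (cis (2 * pi * (k / N)) * w))" for w
  have I0: "0 \<le> I"
    unfolding I_def using e by (intro add_nonneg_nonneg Henstock_Kurzweil_Integration.integral_nonneg integrable_continuous_interval continuous_on_subset[OF cu]) (auto simp: u_def)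
  have "norm (H 0) \<le> (I ^ N) powr (1/s)"
  proof (rule maximum_modulus_frontier[where S="cball 0 1" and f=H and \<xi>=0])
    show "H holomorphic_on interior (cball 0 1)"
      unfolding H_def interior_cball
    proof (rule holomorphic_on_prod)
      fix k assume "k \<in> {..<N}"
      have "(h \<circ> (\<lambda>w. cis (2 * pi * (real k / N)) * w)) holomorphic_on ball 0 1"
        by (rule holomorphic_on_compose_gen[OF _ h(2)]) (auto intro!: holomorphic_intros simp: norm_mult)
      then show "(\<lambda>w. h (cis (2 * pi * (real k / N)) * w)) holomorphic_on ball 0 1" by (simp add: o_def)
    qed
    show "continuous_on (closure (cball 0 1)) H"
      unfolding H_def
    proof (rule continuous_on_prod)
      fix k assume "k \<in> {..<N}"
      show "continuous_on (closure (cball 0 1)) (\<lambda>w. h (cis (2 * pi * (real k / N)) * w))"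
        by (rule continuous_on_compose2[OF h(1)]) (auto intro!: continuous_intros simp: norm_mult)
    qed
    fix z :: complex assume "z \<in> frontier (cball 0 1)"
    then have z: "norm z = 1" by (simp add: frontier_cball)
    define y where "y = Arg2pi z / (2 * pi)"
    have y: "0 \<le> y" "y \<le> 1" using Arg2pi[of z] by (auto simp: y_def field_simps)
    have zy: "z = cis (2 * pi * y)" using Arg2pi_eq[of z] z by (simp add: y_def cis_conv_exp)
    have nH: "norm (H z) powr s = (\<Prod>k<N. u (y + k / N))"
    proof -
      have "norm (H z) powr s = (\<Prod>k<N. norm (h (cis (2 * pi * (k / N)) * z)) powr s)"
        by (simp add: H_def prod_norm[symmetric] prod_powr_distrib)
      also have "\<dots> = (\<Prod>k<N. u (y + k / N))"
        by (intro prod.cong refl) (simp add: u_def zy cis_mult ring_distribs add.commute)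
      finally show ?thesis .
    qed
    \<comment> \<open>The power \<open>s / N\<close> of \<open>norm (H z)\<close> is the geometric
      mean of \<open>|h|^s\<close> over the nodes; the arithmetic mean bounds it by
      \<open>I\<close>, uniformly on the circle.\<close>
    have "(\<Prod>k<N. u (y + k / N)) powr (1 / N) \<le> (\<Sum>k<N. u (y + k / N) / N)"
      using arith_geom_mean[of "{..<N}" "\<lambda>k. u (y + k / N)"] N by (auto simp: u_def)
    also have "\<dots> \<le> I" using N(2)[OF y] by (simp add: I_def sum_divide_distrib)
    finally have "((\<Prod>k<N. u (y + k / N)) powr (1 / N)) powr N \<le> I powr N"
      by (intro powr_mono2) auto
    then have "norm (H z) powr s \<le> I powr N"
      using N by (simp add: powr_powr nH prod_nonneg u_def)
    then have "(norm (H z) powr s) powr (1/s) \<le> (I powr N) powr (1/s)"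
      using s by (intro powr_mono2) auto
    moreover have "I powr N = I ^ N" using I0 N by (cases "I = 0") (auto simp: powr_realpow)
    ultimately show "norm (H z) \<le> (I ^ N) powr (1/s)" using s by (simp add: powr_powr)
  qed auto
  then have "norm (H 0) powr s \<le> ((I ^ N) powr (1/s)) powr s"
    using s by (intro powr_mono2) auto
  moreover have "norm (H 0) powr s = (norm (h 0) powr s) ^ N"
  proof -
    have "(x ^ n) powr s = (x powr s) ^ n" if "0 \<le> x" for x :: real and n :: nat
      using that s by (induction n) (simp_all add: powr_mult)
    then show ?thesis by (simp add: H_def norm_power)
  qed
  ultimately have "(norm (h 0) powr s) ^ N \<le> I ^ N" using s I0 by (simp add: powr_powr)
  then show "norm (h 0) powr s \<le> integral {0..1} u + e"
    using N I0 by (simp add: I_def power_mono_iff)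
qed

text \<open>The circle mean inequality is applied to \<open>h\<close> composed with the disc
  automorphism \<open>phi\<close> sending 0 to \<open>\<zeta>\<close>; the Poisson kernel is the
  Jacobian of the inverse boundary map.\<close>

lemma norm_powr_le_Poisson:
  assumes h: "continuous_on (cball 0 1) h" "h holomorphic_on ball 0 1" and s: "0 < s" and z: "norm \<zeta> < 1"
  shows "ennreal (norm (h \<zeta>) powr s) \<le> (\<integral>\<^sup>+x\<in>{0..<1}. ennreal ((1 - (norm \<zeta>)\<^sup>2) / (norm (cis (2 * pi * x) - \<zeta>))\<^sup>2
     * norm (h (cis (2 * pi * x))) powr s) \<partial>lborel)"
proof -
  define c where "c x = cis (2 * pi * x)" for x :: real
  define D where "D w = 1 + cnj \<zeta> * w" for w
  define phi where "phi w = (w + \<zeta>) / D w" for w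
  \<comment> \<open>A smooth lift of the boundary map, in turns. For \<open>|w| = 1\<close> the
    quotient \<open>phi w / w\<close> equals \<open>cnj (D w) / D w\<close>, whose argument is minus
    twice that of \<open>D w\<close>; and \<open>D w\<close> has positive real part, so
    \<open>Ln\<close> causes no jump.\<close>
  define T where "T x = x - Im (Ln (D (c x))) / pi" for x
  define T' where "T' x = (1 - (norm \<zeta>)\<^sup>2) / (norm (D (c x)))\<^sup>2" for x
  define P where "P x = (1 - (norm \<zeta>)\<^sup>2) / (norm (c x - \<zeta>))\<^sup>2" for x
  define f where "f x = P x * norm (h (c x)) powr s" for x
  have z2: "(norm \<zeta>)\<^sup>2 < 1" using z by (simp add: abs_square_less_1)
  have c1: "norm (c x) = 1" for x by (simp add: c_def)
  have ReD: "0 < Re (D w)" if "norm w \<le> 1" for w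
  proof -
    have "norm (cnj \<zeta> * w) < 1" using that z by (simp add: norm_mult) (metis mult_left_le norm_ge_zero order_le_less_trans)
    then show ?thesis using abs_Re_le_cmod[of "cnj \<zeta> * w"] by (auto simp: D_def)
  qed
  have D0: "D w \<noteq> 0" if "norm w \<le> 1" for w using ReD[OF that] by auto
  have id: "(norm (D w))\<^sup>2 - (norm (w + \<zeta>))\<^sup>2 = (1 - (norm w)\<^sup>2) * (1 - (norm \<zeta>)\<^sup>2)" for w
    unfolding D_def cmod_power2 by (simp add: power2_eq_square algebra_simps)
  have phi_le: "norm (phi w) \<le> 1" if "norm w \<le> 1" for w
  proof -
    have "0 \<le> (1 - (norm w)\<^sup>2) * (1 - (norm \<zeta>)\<^sup>2)"
      using that z2 by (intro mult_nonneg_nonneg) (auto simp: power_le_one)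
    then have "(norm (w + \<zeta>))\<^sup>2 \<le> (norm (D w))\<^sup>2" using id[of w] by linarith
    then have "norm (w + \<zeta>) \<le> norm (D w)" by (rule power2_le_imp_le) simp
    then show ?thesis using D0[OF that] by (simp add: phi_def norm_divide)
  qed
  have phi_lt: "norm (phi w) < 1" if "norm w < 1" for w
  proof -
    have "0 < (1 - (norm w)\<^sup>2) * (1 - (norm \<zeta>)\<^sup>2)"
      using that z2 by (intro mult_pos_pos) (auto simp: abs_square_less_1)
    then have "(norm (w + \<zeta>))\<^sup>2 < (norm (D w))\<^sup>2" using id[of w] by linarith
    then have "norm (w + \<zeta>) < norm (D w)" by (rule power2_less_imp_less) simp
    then show ?thesis using D0[of w] that by (simp add: phi_def norm_divide)
  qed
  have "norm ((h \<circ> phi) 0) powr s \<le> integral {0..1} (\<lambda>x. norm ((h \<circ> phi) (cis (2 * pi * x))) powr s)"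
  proof (rule norm_powr_le_circle_mean[OF _ _ s])
    have "continuous_on (cball 0 1) phi" unfolding phi_def D_def 
      using D0 by (intro continuous_intros) (auto simp: D_def)
    then show "continuous_on (cball 0 1) (h \<circ> phi)"
      using phi_le by (intro continuous_on_compose continuous_on_subset[OF h(1)]) auto
    have "phi holomorphic_on ball 0 1" unfolding phi_def D_def 
      using D0 by (intro holomorphic_intros) (auto simp: D_def)
    then show "(h \<circ> phi) holomorphic_on ball 0 1"
      using phi_lt by (intro holomorphic_on_compose_gen[OF _ h(2)]) auto
  qed
  also have "(\<lambda>x. norm ((h \<circ> phi) (cis (2 * pi * x))) powr s) = (\<lambda>x. norm (h (phi (c x))) powr s)"
    by (simp add: c_def)
  finally have 1: "norm (h \<zeta>) powr s \<le> integral {0..1} (\<lambda>x. norm (h (phi (c x))) powr s)"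
    by (simp add: phi_def D_def)
  have dT: "(T has_real_derivative T' x) (at x)" for x
  proof -
    have dc: "(c has_vector_derivative (2 * pi * \<i> * c x)) (at x)" for x
      unfolding c_def cis_conv_exp 
      by (auto intro!: derivative_eq_intros has_vector_derivative_real_field simp: scaleR_conv_of_real exp_of_real) 
    have "((\<lambda>x. Ln (D (c x))) has_vector_derivative (cnj \<zeta> * (2 * pi * \<i> * c x) / D (c x))) (at x)"
    proof -
      have "D (c x) \<notin> \<real>\<^sub>\<le>\<^sub>0" using ReD[of "c x"] c1 by (auto simp: complex_nonpos_Reals_iff)
      then have "(Ln has_field_derivative inverse (D (c x))) (at (D (c x)))" by (rule has_field_derivative_Ln)
      moreover have "((\<lambda>x. D (c x)) has_vector_derivative (cnj \<zeta> * (2 * pi * \<i> * c x))) (at x)"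
        unfolding D_def by (auto intro!: derivative_eq_intros dc)
      ultimately show ?thesis
        using field_vector_diff_chain_at[of "\<lambda>x. D (c x)" _ x Ln "inverse (D (c x))"] by (simp add: o_def divide_inverse)
    qed
    then have "((\<lambda>x. Im (Ln (D (c x)))) has_vector_derivative Im (cnj \<zeta> * (2 * pi * \<i> * c x) / D (c x))) (at x)"
      by (rule bounded_linear.has_vector_derivative[OF bounded_linear_Im])
    then have "((\<lambda>x. Im (Ln (D (c x)))) has_real_derivative Im (cnj \<zeta> * (2 * pi * \<i> * c x) / D (c x))) (at x)"
      by (simp add: has_real_derivative_iff_has_vector_derivative)
    then have "(T has_real_derivative 1 - Im (cnj \<zeta> * (2 * pi * \<i> * c x) / D (c x)) / pi) (at x)"
      unfolding T_def by (intro DERIV_diff DERIV_ident DERIV_cdivide)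
    moreover have "1 - Im (cnj \<zeta> * (2 * pi * \<i> * c x) / D (c x)) / pi = T' x"
    proof -
      have "cnj \<zeta> * (2 * pi * \<i> * c x) / D (c x) = of_real (2 * pi) * (\<i> * (cnj \<zeta> * c x / D (c x)))" by simp
      moreover have "Im (of_real (2 * pi) * (\<i> * v)) = 2 * pi * Re v" for v by simp
      ultimately have "Im (cnj \<zeta> * (2 * pi * \<i> * c x) / D (c x)) = 2 * pi * Re (cnj \<zeta> * c x / D (c x))"
        by metis
      then have "1 - Im (cnj \<zeta> * (2 * pi * \<i> * c x) / D (c x)) / pi = 1 - 2 * Re (cnj \<zeta> * c x / D (c x))" by simp
      also have "cnj \<zeta> * c x / D (c x) = (cnj \<zeta> * c x) * cnj (D (c x)) / of_real ((norm (D (c x)))\<^sup>2)"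
        using complex_div_cnj by blast
      also have "Re \<dots> = Re ((cnj \<zeta> * c x) * cnj (D (c x))) / (norm (D (c x)))\<^sup>2"
        by (rule Re_divide_of_real)
      also have "1 - 2 * \<dots> = ((norm (D (c x)))\<^sup>2 - 2 * Re ((cnj \<zeta> * c x) * cnj (D (c x)))) / (norm (D (c x)))\<^sup>2"
        using D0[of "c x"] c1 by (simp add: field_simps)
      also have "(norm (D (c x)))\<^sup>2 - 2 * Re ((cnj \<zeta> * c x) * cnj (D (c x))) = 1 - (norm (cnj \<zeta> * c x))\<^sup>2"
        unfolding D_def cmod_power2 by (simp add: power2_eq_square algebra_simps)
      also have "norm (cnj \<zeta> * c x) = norm \<zeta>" using c1 by (simp add: norm_mult)
      finally show ?thesis by (simp add: T'_def)
    qed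
    ultimately show ?thesis by simp
  qed
  have cc: "continuous_on A c" for A unfolding c_def by (intro continuous_intros)
  have T'0: "0 \<le> T' x" for x using z2 by (simp add: T'_def)
  have cT: "c (T x) = phi (c x)" for x
  proof -
    have ln: "exp (Ln (D (c x))) = D (c x)" using D0[of "c x"] c1 by simp
    define L where "L = Ln (D (c x))"
    have "c (T x) = c x * exp (- (2 * \<i> * Im L))"
    proof -
      have "2 * pi * T x = 2 * pi * x + - (2 * Im L)" by (simp add: T_def L_def right_diff_distrib)
      then have "c (T x) = c x * cis (- (2 * Im L))" by (simp only: c_def cis_mult)
      then show ?thesis by (simp add: cis_conv_exp mult.assoc mult.left_commute)
    qed
    also have "- (2 * \<i> * Im L) = cnj L - L" by (simp add: complex_eq_iff)
    also have "exp (cnj L - L) = cnj (D (c x)) / D (c x)"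
      by (simp add: exp_diff exp_cnj[symmetric] L_def ln)
    also have "c x * \<dots> = phi (c x)"
    proof -
      have "c x * cnj (c x) = 1" using complex_norm_square[of "c x"] c1 by simp
      then have "c x * cnj (D (c x)) = c x + \<zeta>" by (simp add: D_def algebra_simps)
      then show ?thesis by (simp add: phi_def)
    qed
    finally show ?thesis .
  qed
  have fT: "f (T x) * T' x = norm (h (phi (c x))) powr s" for x
  proof -
    have "phi (c x) - \<zeta> = c x * of_real (1 - (norm \<zeta>)\<^sup>2) / D (c x)"
    proof -
      have "c x + \<zeta> - \<zeta> * D (c x) = c x * of_real (1 - (norm \<zeta>)\<^sup>2)"
        using complex_norm_square[of \<zeta>] by (simp add: D_def algebra_simps)
      moreover have "phi (c x) - \<zeta> = (c x + \<zeta> - \<zeta> * D (c x)) / D (c x)"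
        using D0[of "c x"] c1 by (simp add: phi_def diff_divide_distrib)
      ultimately show ?thesis by simp
    qed
    then have "norm (phi (c x) - \<zeta>) = (1 - (norm \<zeta>)\<^sup>2) / norm (D (c x))"
      using z2 c1 by (simp add: norm_divide norm_mult del: of_real_diff)
    then have "P (T x) * T' x = 1"
      using z2 D0[of "c x"] c1 by (simp add: P_def T'_def cT power_divide) (simp add: power2_eq_square)
    then show ?thesis by (simp add: f_def cT)
  qed
  have cP: "continuous_on A P" for A
  proof -
    have "norm (c x - \<zeta>) \<noteq> 0" for x using c1[of x] z by auto
    then show ?thesis unfolding P_def by (intro continuous_intros cc) auto
  qed
  have chc: "continuous_on A (\<lambda>x. h (c x))" for A
    by (rule continuous_on_compose2[OF h(1) cc]) (auto simp: c1)
  have cf: "continuous_on UNIV f" unfolding f_def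
    using s by (intro continuous_intros continuous_on_powr' chc cP) auto
  have bf [measurable]: "f \<in> borel_measurable borel"
    using borel_measurable_continuous_onI[OF cf] .
  have c_per: "c (x + 1) = c x" for x unfolding c_def by (simp add: ring_distribs cis_mult[symmetric])
  have f_per: "f (x + 1) = f x" for x by (simp add: f_def P_def c_per)
  have cT': "continuous_on A T'" for A
    unfolding T'_def D_def using D0 c1 by (intro continuous_intros cc) (auto simp: D_def[symmetric])
  have contg: "continuous_on {0..1} (\<lambda>x. norm (h (phi (c x))) powr s)"
  proof -
    have "continuous_on UNIV T" using dT by (intro continuous_at_imp_continuous_on) (auto intro: DERIV_isCont)
    then have "continuous_on UNIV (\<lambda>x. f (T x) * T' x)"
      by (intro continuous_intros cT' continuous_on_compose2[OF cf]) auto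
    then show ?thesis unfolding fT by (rule continuous_on_subset) auto
  qed
  have "ennreal (norm (h \<zeta>) powr s) \<le> ennreal (integral {0..1} (\<lambda>x. norm (h (phi (c x))) powr s))"
    using 1 by (rule ennreal_leI)
  also have "\<dots> = (\<integral>\<^sup>+x\<in>{0..1}. ennreal (norm (h (phi (c x))) powr s) \<partial>lborel)"
    by (rule nn_integral_has_integral_lebesgue'[symmetric])
       (simp_all add: integrable_integral[OF integrable_continuous_interval[OF contg]])
  also have "\<dots> = (\<integral>\<^sup>+x. ennreal (f (T x) * T' x * indicator {0..1} x) \<partial>lborel)"
    by (intro nn_integral_cong) (auto simp: fT split: split_indicator)
  also have "\<dots> = (\<integral>\<^sup>+x. ennreal (f x * indicator {T 0..T 1} x) \<partial>lborel)"
    using dT cT' T'0 by (intro nn_integral_substitution[symmetric]) (auto simp: set_borel_measurable_def)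
  \<comment> \<open>The lift advances by exactly one turn, so the substitution covers one full
    period.\<close>
  also have "T 1 = T 0 + 1" using c_per[of 0] by (simp add: T_def)
  also have "(\<integral>\<^sup>+x. ennreal (f x * indicator {T 0..T 0 + 1} x) \<partial>lborel) = (\<integral>\<^sup>+x\<in>{T 0..<T 0 + 1}. ennreal (f x) \<partial>lborel)"
  proof (rule nn_integral_cong_AE)
    have "AE x in lborel. x \<noteq> T 0 + 1" by (rule AE_lborel_singleton)
    then show "AE x in lborel. ennreal (f x * indicator {T 0..T 0 + 1} x) = ennreal (f x) * indicator {T 0..<T 0 + 1} x"
      by eventually_elim (auto split: split_indicator)
  qed
  also have "\<dots> = (\<integral>\<^sup>+x\<in>{0..<1}. ennreal (f x) \<partial>lborel)"
    by (rule nn_integral_periodic) (auto simp: f_per)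
  finally show ?thesis by (simp add: f_def P_def c_def)
qed

section \<open>Domination of the Poisson kernel by two dyadic grids\<close>

text \<open>Angles are measured in turns, \<open>x\<close> standing for
  \<open>cis (2 * pi * x)\<close>: the total mass is 1 and the cells are dyadic intervals. The
  half-open interval represents each point once.\<close>

definition circle :: "real measure" where "circle = restrict_space lborel {0..<1}"

text \<open>\<open>frac\<close> makes the label periodic in \<open>x\<close>, so a shifted cell may
  wrap around the end of \<open>[0, 1)\<close>.\<close>

definition grid :: "real \<Rightarrow> nat \<Rightarrow> real \<Rightarrow> int" where
  "grid t m x = \<lfloor>2 ^ m * frac (x + t)\<rfloor>"

lemma space_circle [simp]: "space circle = {0..<1}"
  by (simp add: circle_def space_restrict_space)

lemma measurable_circle: "f \<in> borel_measurable borel \<Longrightarrow> f \<in> borel_measurable circle"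
  unfolding circle_def by (intro measurable_restrict_space1) simp

lemma nn_integral_circle: "(\<integral>\<^sup>+x. F x \<partial>circle) = (\<integral>\<^sup>+x\<in>{0..<1}. F x \<partial>lborel)"
  unfolding circle_def by (subst nn_integral_restrict_space) auto

lemma finite_measure_circle: "finite_measure circle"
  by (rule finite_measureI) (simp add: circle_def emeasure_restrict_space space_restrict_space)

lemma grid_measurable: "grid t m \<in> measurable borel (count_space UNIV)"
  unfolding grid_def frac_def by measurable

lemma grid_add_int: "grid t m (x + of_int i) = grid t m x"
proof -
  have "frac (x + of_int i + t) = frac (x + t)"
    using floor_add_int[of "x + t" i] by (simp add: frac_def algebra_simps)
  then show ?thesis by (simp add: grid_def)
qed

lemma grid_bounds: "0 \<le> grid t m x" "grid t m x < 2 ^ m"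
  by (simp_all add: grid_def floor_less_iff frac_lt_1)

text \<open>The coarser label is the integer quotient of the finer one by a power of 2.\<close>

lemma floor_pow2_refine:
  fixes a b :: real
  assumes "m \<le> m'" "\<lfloor>2 ^ m' * a\<rfloor> = \<lfloor>2 ^ m' * (b::real)\<rfloor>"
  shows "\<lfloor>2 ^ m * a\<rfloor> = \<lfloor>2 ^ m * b\<rfloor>"
proof -
  have "\<lfloor>2 ^ m * a\<rfloor> = \<lfloor>2 ^ m' * a\<rfloor> div 2 ^ (m' - m)" for a :: real
  proof -
    have "2 ^ m * a = 2 ^ m' * a / real_of_int (2 ^ (m' - m))"
    proof -
      have "(2::real) ^ m' = 2 ^ m * 2 ^ (m' - m)" using assms(1) by (simp add: power_add[symmetric])
      then show ?thesis by simp
    qed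
    then show ?thesis by (simp only: floor_divide_real_eq_div zero_le_power zero_le_numeral)
  qed
  then show ?thesis using assms(2) by simp
qed

text \<open>Equality of the unwrapped labels forces equal integer parts, which is refinement down to
  generation 0; so the wrapping by \<open>frac\<close> subtracts the same amount from both.\<close>

lemma grid_eqI:
  assumes "\<lfloor>2 ^ m * (x + t)\<rfloor> = \<lfloor>2 ^ m * (y + t)\<rfloor>"
  shows "grid t m x = grid t m y"
proof -
  have g: "grid t m x = \<lfloor>2 ^ m * (x + t)\<rfloor> - 2 ^ m * \<lfloor>x + t\<rfloor>" for x
  proof -
    have "2 ^ m * frac (x + t) = 2 ^ m * (x + t) - real_of_int (2 ^ m * \<lfloor>x + t\<rfloor>)"
      by (simp add: frac_def right_diff_distrib)
    then show ?thesis unfolding grid_def by (simp only: floor_diff_of_int)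
  qed
  have "\<lfloor>x + t\<rfloor> = \<lfloor>y + t\<rfloor>" using floor_pow2_refine[of 0 m "x + t" "y + t"] assms by simp
  then show ?thesis using assms by (simp add: g)
qed

lemma cell_system_grid: "cell_system circle (grid t)"
proof (intro cell_system.intro finite_measure_circle cell_system_axioms.intro)
  show "grid t m \<in> measurable circle (count_space UNIV)" for m
    unfolding circle_def using grid_measurable by (intro measurable_restrict_space1) simp
  show "grid t m x = grid t m y" if "m \<le> m'" "grid t m' x = grid t m' y" for m m' x y
    using that unfolding grid_def by (rule floor_pow2_refine)
  show "measure circle {y \<in> space circle. grid t m y = grid t m x} = (1/2) ^ m" for m x
  proof -
    define k where "k = grid t m x"
    have k: "0 \<le> k" "k + 1 \<le> 2 ^ m" using grid_bounds[of t m x] by (auto simp: k_def)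
    have "real_of_int (k + 1) \<le> real_of_int (2 ^ m)" using k(2) by (simp only: of_int_le_iff)
    then have k': "0 \<le> real_of_int k" "real_of_int k + 1 \<le> 2 ^ m" using k(1) by simp_all
    define F :: "real \<Rightarrow> ennreal" where "F y = (if grid 0 m y = k then 1 else 0)" for y
    have F [measurable]: "F \<in> borel_measurable borel"
      unfolding F_def using grid_measurable[of 0 m] by measurable
    have Fp: "F (y + 1) = F y" for y using grid_add_int[of 0 m y 1] by (simp add: F_def)
    have set: "{y \<in> space circle. grid t m y = k} \<in> sets circle"
      unfolding circle_def using measurable_restrict_space1[OF grid_measurable[of t m, folded sets_lborel], of "{0..<1}"]
      by measurable
    have "emeasure circle {y \<in> space circle. grid t m y = k} = (\<integral>\<^sup>+y. indicator {y \<in> space circle. grid t m y = k} y \<partial>circle)"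
      by (rule nn_integral_indicator[OF set, symmetric])
    also have "\<dots> = (\<integral>\<^sup>+y. F (y + t) \<partial>circle)"
      by (intro nn_integral_cong) (auto simp: F_def grid_def split: split_indicator)
    also have "\<dots> = (\<integral>\<^sup>+y. F (y + t) * indicator {t..<t+1} (y + t) \<partial>lborel)"
      unfolding nn_integral_circle by (intro nn_integral_cong) (auto split: split_indicator)
    also have "\<dots> = (\<integral>\<^sup>+y\<in>{t..<t+1}. F y \<partial>lborel)"
      by (rule nn_integral_shift) measurable
    also have "\<dots> = (\<integral>\<^sup>+y\<in>{0..<1}. F y \<partial>lborel)" by (rule nn_integral_periodic[OF F Fp])
    also have "\<dots> = (\<integral>\<^sup>+y. indicator {k / 2^m..<(k+1) / 2^m} y \<partial>lborel)"
    proof (intro nn_integral_cong)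
      fix y :: real
      have "(y \<in> {0..<1} \<and> grid 0 m y = k) \<longleftrightarrow> y \<in> {k / 2^m..<(k+1) / 2^m}"
      proof (cases "y \<in> {0..<1}")
        case True
        then have "grid 0 m y = \<lfloor>2 ^ m * y\<rfloor>" by (simp add: grid_def frac_eq)
        then show ?thesis using True by (auto simp: floor_eq_iff field_simps)
      next
        case False
        have "real_of_int (k + 1) / 2 ^ m \<le> 1" "0 \<le> k / 2 ^ m" using k' by auto
        then have "y \<notin> {k / 2^m..<(k+1) / 2^m}"
          using False unfolding atLeastLessThan_iff by linarith
        then show ?thesis using False by blast
      qed
      then show "F y * indicator {0..<1} y = indicator {k / 2^m..<(k+1) / 2^m} y"
        by (auto simp: F_def split: split_indicator)
    qed
    also have "\<dots> = ennreal ((1/2) ^ m)"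
    proof -
      have "k / 2^m \<le> (k+1) / 2^m" by (intro divide_right_mono) auto
      moreover have "(k+1) / 2^m - k / 2^m = (1/2) ^ m"
        by (simp add: diff_divide_distrib[symmetric] power_one_over)
      ultimately show ?thesis by (simp del: of_int_add)
    qed
    finally show ?thesis by (simp add: measure_def k_def)
  qed
qed

interpretation G0: cell_system circle "grid 0" by (rule cell_system_grid)
interpretation G1: cell_system circle "grid (1/3)" by (rule cell_system_grid)

text \<open>The one-third trick: two nearby points lie in a common cell of one of two shifted dyadic grids.\<close>

lemma grid_same_cell:
  assumes d: "\<bar>x - y\<bar> < (1/2) ^ m / 3"
  shows "grid 0 m x = grid 0 m y \<or> grid (1/3) m x = grid (1/3) m y"
proof -
  have main: "\<lfloor>2 ^ m * x\<rfloor> = \<lfloor>2 ^ m * y\<rfloor> \<or> \<lfloor>2 ^ m * (x + 1/3)\<rfloor> = \<lfloor>2 ^ m * (y + 1/3)\<rfloor>"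
    if xy: "x \<le> y" "y - x < (1/2) ^ m / 3" for x y :: real
  proof (rule ccontr)
    assume neq: "\<not> ?thesis"
    define X where "X = 2 ^ m * x"
    define Y where "Y = 2 ^ m * y"
    define q :: real where "q = 2 ^ m / 3"
    have XY: "X \<le> Y" "Y - X < 1/3"
      using xy mult_strict_left_mono[OF xy(2), of "2^m"]
      by (auto simp: X_def Y_def right_diff_distrib power_one_over)
    have ne: "\<lfloor>X\<rfloor> \<noteq> \<lfloor>Y\<rfloor>" "\<lfloor>X + q\<rfloor> \<noteq> \<lfloor>Y + q\<rfloor>"
      using neq by (auto simp: X_def Y_def q_def distrib_left)
    have a: "X < \<lfloor>Y\<rfloor>" "\<lfloor>Y\<rfloor> \<le> Y" using ne(1) XY by linarith+
    have b: "X + q < \<lfloor>Y + q\<rfloor>" "\<lfloor>Y + q\<rfloor> \<le> Y + q" using ne(2) XY by linarith+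
    \<comment> \<open>If both grids separated the points, an integer \<open>A\<close> and a point
      \<open>B - q\<close> with integral \<open>B\<close> would lie between \<open>X\<close> and
      \<open>Y\<close>, so that \<open>|B - A - q| < 1/3\<close>. Then the integer
      \<open>i = 3 * (B - A) - 2 ^ m\<close> would be 0, but 3 does not divide a power of 2.\<close>
    define i where "i = 3 * (\<lfloor>Y + q\<rfloor> - \<lfloor>Y\<rfloor>) - 2 ^ m"
    have iR: "real_of_int i = 3 * (real_of_int \<lfloor>Y + q\<rfloor> - real_of_int \<lfloor>Y\<rfloor> - q)" by (simp add: i_def q_def)
    have "\<bar>B - A - q\<bar> < 1/3" if "X < A" "A \<le> Y" "X + q < B" "B \<le> Y + q" for A B
      using that XY by linarith
    note this[OF a b]
    then have "\<bar>real_of_int i\<bar> < 1" unfolding iR abs_mult by simp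
    then have "i = 0" by linarith
    then have "(3::int) dvd 2 ^ m" unfolding i_def by (metis dvd_triv_left eq_iff_diff_eq_0)
    then have "(3::int) dvd 2" using prime_dvd_power[of "3::int" 2 m] by simp
    then show False by simp
  qed
  consider "x \<le> y" | "y \<le> x" by linarith
  then have "\<lfloor>2 ^ m * x\<rfloor> = \<lfloor>2 ^ m * y\<rfloor> \<or> \<lfloor>2 ^ m * (x + 1/3)\<rfloor> = \<lfloor>2 ^ m * (y + 1/3)\<rfloor>"
    using main[of x y] main[of y x] d by cases auto
  then show ?thesis using grid_eqI[of m x 0 y] grid_eqI[of m x "1/3" y] by auto
qed

text \<open>The chord has length \<open>2 * sin (pi * d)\<close>. The cheap bound
  \<open>sin (pi * d) >= d\<close> is enough: the mean value theorem gives it below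
  \<open>1/6\<close>, and beyond that the sine is at least \<open>1/2\<close>.\<close>

lemma norm_cis_diff_ge:
  assumes "\<bar>x - y\<bar> \<le> 1/2"
  shows "2 * \<bar>x - y\<bar> \<le> norm (cis (2 * pi * x) - cis (2 * pi * y))"
proof -
  define d where "d = \<bar>x - y\<bar>"
  have d: "0 \<le> d" "d \<le> 1/2" using assms by (auto simp: d_def)
  have sin: "d \<le> sin (pi * d)"
  proof (cases "d = 0 \<or> 1/6 \<le> d")
    case False
    then have "\<exists>z. 0 < z \<and> z < pi * d \<and> sin (pi * d) - sin 0 = (pi * d - 0) * cos z"
      using d by (intro MVT2) (auto intro!: derivative_eq_intros)
    then obtain z where z: "0 < z" "z < pi * d" "sin (pi * d) = pi * d * cos z" by auto
    have "z \<le> pi / 3" using z(2) False d mult_left_mono[of d "1/6" pi] pi_gt_zero by linarith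
    then have "1/2 \<le> cos z" using z(1) cos_monotone_0_pi_le[of z "pi/3"] by (simp add: cos_60)
    then have "pi * d * (1/2) \<le> pi * d * cos z" using d by (intro mult_left_mono) auto
    moreover have "d * 2 \<le> d * pi" using d pi_ge_two by (intro mult_left_mono) auto
    moreover have "pi * d * (1/2) = d * pi / 2" by simp
    ultimately show ?thesis unfolding z(3) by linarith
  next
    case True
    have "sin (pi / 6) \<le> sin (pi * d)" if "1/6 \<le> d" using d that by (intro sin_monotone_2pi_le) auto
    then show ?thesis using d True by (auto simp: sin_30)
  qed
  have "cis (2 * pi * x) = cis (2 * pi * y) * cis (2 * pi * (x - y))" by (simp add: cis_mult right_diff_distrib)
  then have "cis (2 * pi * x) - cis (2 * pi * y) = cis (2 * pi * y) * (exp (\<i> * of_real (2 * pi * (x - y))) - 1)"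
    by (simp add: cis_conv_exp algebra_simps)
  then have "norm (cis (2 * pi * x) - cis (2 * pi * y)) = 2 * \<bar>sin (pi * (x - y))\<bar>"
    by (simp only: norm_mult norm_cis dist_exp_i_1) simp
  also have "\<bar>sin (pi * (x - y))\<bar> = \<bar>sin (pi * d)\<bar>"
  proof -
    have "pi * d = pi * (x - y) \<or> pi * d = - (pi * (x - y))" by (auto simp: d_def abs_if algebra_simps)
    then show ?thesis by (metis sin_minus abs_minus_cancel)
  qed
  finally show ?thesis using sin d by (simp add: d_def[symmetric])
qed

text \<open>A model of the Poisson kernel for a point at distance about \<open>(1/2) ^ L\<close>
  from the boundary point \<open>cis (2 * pi * x)\<close>.\<close>

definition peak :: "nat \<Rightarrow> real \<Rightarrow> real \<Rightarrow> real" where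
  "peak L x y = (1/2) ^ L / (max ((1/2) ^ L) (norm (cis (2 * pi * x) - cis (2 * pi * y))))\<^sup>2"

text \<open>At distance about \<open>(1/2) ^ (L - j)\<close> the peak has height about
  \<open>(1/2) ^ j * 2 ^ (L - j)\<close>: the normalized indicator of a cell of generation
  \<open>L - j\<close> with the extra factor \<open>(1/2) ^ j\<close>. The separate term
  \<open>(1/2) ^ L\<close> serves distances of order 1.\<close>

definition dkernel :: "nat \<Rightarrow> real \<Rightarrow> real \<Rightarrow> real" where
  "dkernel L x y = (1/2) ^ L + (\<Sum>j<L. (1/2) ^ j * (2 ^ (L - j) *
     ((if grid 0 (L - j) y = grid 0 (L - j) x then 1 else 0) +
      (if grid (1/3) (L - j) y = grid (1/3) (L - j) x then 1 else 0))))"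

text \<open>For the least \<open>j\<close> such that the distance is below a third of the cell
  length of generation \<open>L - j\<close>, the points share a cell of one grid, and minimality
  bounds the distance from below. The factor 9 comes from squaring that third.\<close>

lemma peak_le_dkernel: "peak L x y \<le> 9 * dkernel L x y"
proof -
  \<comment> \<open>Both kernels are periodic in \<open>y\<close>, so \<open>y\<close> is replaced
    by the representative within half a turn of \<open>x\<close>.\<close>
  define i where "i = round (x - y)"
  define y' where "y' = y + of_int i"
  have d12: "\<bar>x - y'\<bar> \<le> 1/2" using of_int_round_abs_le[of "x - y"] by (simp add: y'_def i_def abs_minus_commute algebra_simps)
  have "cis (2 * pi * y') = cis (2 * pi * y)"
  proof -
    have "cis (2 * pi * y') = cis (2 * pi * y) * cis (2 * pi * of_int i)"
      by (simp only: y'_def distrib_left cis_mult)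
    then show ?thesis by (simp only: cis_multiple_2pi[OF Ints_of_int] mult_1_right)
  qed
  then have pk: "peak L x y = peak L x y'" by (simp add: peak_def)
  have dk: "dkernel L x y = dkernel L x y'" by (simp add: dkernel_def y'_def grid_add_int)
  define d where "d = \<bar>x - y'\<bar>"
  define e :: real where "e = (1/2) ^ L"
  have e: "0 < e" by (simp add: e_def)
  have cis: "2 * d \<le> norm (cis (2 * pi * x) - cis (2 * pi * y'))" unfolding d_def by (rule norm_cis_diff_ge[OF d12])
  have p0: "peak L x y' \<le> 1 / e"
  proof -
    have "e\<^sup>2 \<le> (max e (norm (cis (2 * pi * x) - cis (2 * pi * y'))))\<^sup>2" using e by (intro power_mono) auto
    then have "peak L x y' \<le> e / e\<^sup>2" unfolding peak_def e_def[symmetric] using e by (intro divide_left_mono) auto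
    then show ?thesis using e by (simp add: power2_eq_square)
  qed
  have p1: "peak L x y' \<le> e / (2 * b)\<^sup>2" if "0 < b" "b \<le> d" for b
  proof -
    have "(2 * b)\<^sup>2 \<le> (max e (norm (cis (2 * pi * x) - cis (2 * pi * y'))))\<^sup>2"
      using that cis by (intro power_mono) (auto simp: le_max_iff_disj)
    then show ?thesis unfolding peak_def e_def[symmetric] using e that by (intro divide_left_mono) auto
  qed
  have term_le: "(1/2) ^ j * 2 ^ (L - j) \<le> dkernel L x y'" if "j < L" "d < (1/2) ^ (L - j) / 3" for j
  proof -
    define t where "t j = (1/2) ^ j * (2 ^ (L - j) *
     ((if grid 0 (L - j) y' = grid 0 (L - j) x then 1 else 0) +
      (if grid (1/3) (L - j) y' = grid (1/3) (L - j) x then 1 else 0 :: real)))" for j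
    have "grid 0 (L - j) x = grid 0 (L - j) y' \<or> grid (1/3) (L - j) x = grid (1/3) (L - j) y'"
      using that by (intro grid_same_cell) (simp add: d_def)
    then have "1 \<le> (if grid 0 (L - j) y' = grid 0 (L - j) x then 1 else 0) +
      (if grid (1/3) (L - j) y' = grid (1/3) (L - j) x then 1 else 0 :: real)"
      by (elim disjE) simp_all
    then have "(1/2) ^ j * (2 ^ (L - j) * 1) \<le> t j"
      unfolding t_def by (intro mult_left_mono) simp_all
    also have "t j \<le> (\<Sum>j<L. t j)"
      using that(1) by (intro member_le_sum) (simp_all add: t_def)
    also have "\<dots> \<le> dkernel L x y'" by (simp add: dkernel_def t_def)
    finally show ?thesis by simp
  qed
  show ?thesis
  proof (cases "\<exists>j<L. d < (1/2) ^ (L - j) / 3")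
    case True
    define j where "j = (LEAST j. j < L \<and> d < (1/2) ^ (L - j) / 3)"
    have j: "j < L" "d < (1/2) ^ (L - j) / 3" using LeastI_ex[OF True] by (auto simp: j_def)
    have eq: "(1/2) ^ j * 2 ^ (L - j) = (1 / e) * ((1/2) ^ j)\<^sup>2"
      using j(1) by (simp add: e_def power_diff power_one_over power2_eq_square)
    have "peak L x y' \<le> 9 * ((1/2) ^ j * 2 ^ (L - j))"
    proof (cases j)
      case 0
      have "0 \<le> 1 / e" using e by simp
      then have "peak L x y' \<le> 9 * (1 / e)" using p0 by linarith
      then show ?thesis unfolding eq using 0 by simp
    next
      case (Suc k)
      have "\<not> (k < L \<and> d < (1/2) ^ (L - k) / 3)" 
        using not_less_Least[of k "\<lambda>j. j < L \<and> d < (1/2) ^ (L - j) / 3"] Suc unfolding j_def by simp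
      then have "(1/2) ^ (L - k) / 3 \<le> d" using j(1) Suc by auto
      moreover have "(1/2) ^ (L - k) = e * 2 ^ k"
      proof -
        have "(1/2 :: real) ^ L = (1/2) ^ (L - k) * (1/2) ^ k" using j(1) Suc by (simp add: power_add[symmetric])
        then show ?thesis by (simp add: e_def power_mult_distrib[symmetric])
      qed
      ultimately have "peak L x y' \<le> e / (2 * (e * 2 ^ k / 3))\<^sup>2" using e by (intro p1) auto
      also have "\<dots> = 9 * ((1 / e) * ((1/2) ^ j)\<^sup>2)"
        using e by (simp add: Suc power2_eq_square field_simps power_one_over)
      finally show ?thesis by (simp only: eq)
    qed
    also have "\<dots> \<le> 9 * dkernel L x y'" using term_le[OF j] by simp
    finally show ?thesis by (simp add: pk dk)
  next
    case False
    have "e \<le> dkernel L x y'" by (simp add: dkernel_def e_def sum_nonneg)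
    moreover have "peak L x y' \<le> 9 * e"
    proof (cases L)
      case 0
      then show ?thesis using p0 by (simp add: e_def)
    next
      case (Suc k)
      then have "k < L" by simp
      then have "(1/2) ^ (L - k) / 3 \<le> d" using False not_less by blast
      moreover have "L - k = 1" using Suc by simp
      ultimately have "1/6 \<le> d" by (simp only:) simp
      then show ?thesis using p1[of "1/6"] by (simp add: power2_eq_square)
    qed
    ultimately show ?thesis by (simp add: pk dk)
  qed
qed

text \<open>The integral of \<open>g\<close> against \<open>dkernel L x\<close>, written as a
  combination of cell averages of both grids.\<close>

definition favg :: "nat \<Rightarrow> (real \<Rightarrow> real) \<Rightarrow> real \<Rightarrow> real" where
  "favg L g x = (1/2) ^ L * G0.cavg 0 g x + (\<Sum>j<L. (1/2) ^ j * (G0.cavg (L - j) g x + G1.cavg (L - j) g x))"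

lemma nn_integral_peak_le:
  assumes g: "G0.bdd g" and x: "x \<in> {0..<1}"
  shows "(\<integral>\<^sup>+y. ennreal (peak L x y * g y) \<partial>circle) \<le> ennreal (9 * favg L g x)"
proof -
  have x': "x \<in> space circle" using x by simp
  have i0: "integrable circle (\<lambda>y. if grid 0 m y = grid 0 m x then g y else 0)" for m
    by (intro G0.bdd_integrable G0.bdd_restrict g)
  have i1: "integrable circle (\<lambda>y. if grid (1/3) m y = grid (1/3) m x then g y else 0)" for m
    by (intro G1.bdd_integrable G1.bdd_restrict g)
  have ig: "integrable circle g" by (intro G0.bdd_integrable g)
  define k where "k y = (1/2) ^ L * g y + (\<Sum>j<L. (1/2) ^ j * (2 ^ (L - j) * 
      ((if grid 0 (L - j) y = grid 0 (L - j) x then g y else 0) + (if grid (1/3) (L - j) y = grid (1/3) (L - j) x then g y else 0))))" for y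
  have k: "dkernel L x y * g y = k y" for y
    unfolding dkernel_def k_def distrib_right sum_distrib_right
  proof (intro arg_cong2[where f="(+)"] refl sum.cong)
    fix j
    show "(1/2) ^ j * (2 ^ (L - j) *
     ((if grid 0 (L - j) y = grid 0 (L - j) x then 1 else 0) +
      (if grid (1/3) (L - j) y = grid (1/3) (L - j) x then 1 else 0))) * g y =
     (1/2) ^ j * (2 ^ (L - j) * 
      ((if grid 0 (L - j) y = grid 0 (L - j) x then g y else 0) + (if grid (1/3) (L - j) y = grid (1/3) (L - j) x then g y else 0)))"
      by (cases "grid 0 (L - j) y = grid 0 (L - j) x"; cases "grid (1/3) (L - j) y = grid (1/3) (L - j) x") simp_all
  qed
  have ik: "integrable circle k" unfolding k_def using i0 i1 ig by auto
  have g0: "0 \<le> g y" if "y \<in> space circle" for y using G0.bdd_nonneg[OF g that] .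
  have Ik: "(\<integral>y. k y \<partial>circle) = favg L g x"
  proof -
    have "G0.cavg 0 g x = (\<integral>y. g y \<partial>circle)"
      unfolding G0.cavg_def using x
      by (simp, intro Bochner_Integration.integral_cong) (auto simp: grid_def frac_def)
    moreover have "(\<integral>y. k y \<partial>circle) = (1/2) ^ L * (\<integral>y. g y \<partial>circle) + (\<Sum>j<L. (1/2) ^ j * (2 ^ (L - j) * 
      ((\<integral>y. (if grid 0 (L - j) y = grid 0 (L - j) x then g y else 0) \<partial>circle) + (\<integral>y. (if grid (1/3) (L - j) y = grid (1/3) (L - j) x then g y else 0) \<partial>circle))))"
      unfolding k_def using i0 i1 ig
      by (subst Bochner_Integration.integral_add) (auto simp: Bochner_Integration.integral_sum)
    ultimately show ?thesis by (simp add: favg_def G0.cavg_def G1.cavg_def distrib_left)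
  qed
  have "(\<integral>\<^sup>+y. ennreal (peak L x y * g y) \<partial>circle) \<le> (\<integral>\<^sup>+y. ennreal (9 * k y) \<partial>circle)"
  proof (intro nn_integral_mono ennreal_leI)
    fix y assume "y \<in> space circle"
    then have "peak L x y * g y \<le> (9 * dkernel L x y) * g y"
      using peak_le_dkernel g0 by (intro mult_right_mono) auto
    then show "peak L x y * g y \<le> 9 * k y" by (simp add: k[symmetric])
  qed
  also have "\<dots> = ennreal (\<integral>y. 9 * k y \<partial>circle)"
  proof (intro nn_integral_eq_integral AE_I2)
    show "integrable circle (\<lambda>y. 9 * k y)" using ik by simp
    have "0 \<le> dkernel L x y" for y unfolding dkernel_def by (intro add_nonneg_nonneg sum_nonneg) simp_all
    then show "0 \<le> 9 * k y" if "y \<in> space circle" for y using g0[OF that] unfolding k[symmetric] by simp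
  qed
  finally show ?thesis by (simp add: Ik)
qed

section \<open>Integration in polar coordinates\<close>

lemma lborel_complex_eq: "(lborel :: complex measure) = distr (lborel \<Otimes>\<^sub>M lborel) borel (\<lambda>(x, y). Complex x y)"
proof (rule lborel_eqI)
  have m [measurable]: "(\<lambda>(x, y). Complex x y) \<in> borel_measurable (borel \<Otimes>\<^sub>M borel)"
  proof -
    have "(\<lambda>(x, y). Complex x y) = (\<lambda>p. of_real (fst p) + \<i> * of_real (snd p))"
      by (auto simp: fun_eq_iff complex_eq_iff)
    then show ?thesis by simp
  qed
  fix l u :: complex
  assume lu: "\<And>b. b \<in> Basis \<Longrightarrow> l \<bullet> b \<le> u \<bullet> b"
  have le: "Re l \<le> Re u" "Im l \<le> Im u" using lu[of 1] lu[of "\<i>"] by (auto simp: Basis_complex_def inner_complex_def)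
  have "emeasure (distr (lborel \<Otimes>\<^sub>M lborel) borel (\<lambda>(x, y). Complex x y)) (box l u) =
    emeasure (lborel \<Otimes>\<^sub>M lborel) ({Re l<..<Re u} \<times> {Im l<..<Im u})"
    by (subst emeasure_distr) (auto simp: space_pair_measure box_def Basis_complex_def inner_complex_def intro!: arg_cong2[where f=emeasure] measurable_compose[OF _ m])
  also have "\<dots> = ennreal (Re u - Re l) * ennreal (Im u - Im l)"
    using le by (subst lborel.emeasure_pair_measure_Times) auto
  also have "\<dots> = ennreal (\<Prod>b\<in>Basis. (u - l) \<bullet> b)"
    using le by (simp add: Basis_complex_def inner_complex_def ennreal_mult)
  finally show "emeasure (distr (lborel \<Otimes>\<^sub>M lborel) borel (\<lambda>(x, y). Complex x y)) (box l u) = ennreal (\<Prod>b\<in>Basis. (u - l) \<bullet> b)" .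
qed simp

lemma nn_integral_complex:
  fixes g :: "complex \<Rightarrow> ennreal"
  assumes [measurable]: "g \<in> borel_measurable borel"
  shows "(\<integral>\<^sup>+z. g z \<partial>lborel) = (\<integral>\<^sup>+x. \<integral>\<^sup>+y. g (Complex x y) \<partial>lborel \<partial>lborel)"
proof -
  have m [measurable]: "(\<lambda>(x, y). Complex x y) \<in> borel_measurable (borel \<Otimes>\<^sub>M borel)"
  proof -
    have "(\<lambda>(x, y). Complex x y) = (\<lambda>p. of_real (fst p) + \<i> * of_real (snd p))"
      by (auto simp: fun_eq_iff complex_eq_iff)
    then show ?thesis by simp
  qed
  have "(\<integral>\<^sup>+z. g z \<partial>lborel) = (\<integral>\<^sup>+p. g (case p of (x, y) \<Rightarrow> Complex x y) \<partial>(lborel \<Otimes>\<^sub>M lborel))"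
    by (subst lborel_complex_eq, subst nn_integral_distr) auto
  also have "\<dots> = (\<integral>\<^sup>+x. \<integral>\<^sup>+y. g (Complex x y) \<partial>lborel \<partial>lborel)"
    by (subst lborel.nn_integral_fst[symmetric]) auto
  finally show ?thesis .
qed

text \<open>Turns integrals over slopes into integrals over angles. Substitution on
  \<open>[-n, n]\<close> and a monotone limit identify the two measures on Borel sets; general
  integrands follow from that.\<close>

lemma nn_integral_arctan:
  fixes F :: "real \<Rightarrow> ennreal"
  assumes [measurable]: "F \<in> borel_measurable borel"
  shows "(\<integral>\<^sup>+t. ennreal (1 / (1 + t\<^sup>2)) * F (arctan t) \<partial>lborel) = (\<integral>\<^sup>+\<phi>\<in>{-pi/2<..<pi/2}. F \<phi> \<partial>lborel)"
proof -
  have arctan [measurable]: "arctan \<in> borel_measurable borel"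
    by (intro borel_measurable_continuous_onI continuous_intros)
  have eq: "distr (density lborel (\<lambda>t. ennreal (1 / (1 + t\<^sup>2)))) borel arctan = density lborel (indicator {-pi/2<..<pi/2})"
  proof (rule measure_eqI)
    fix A assume "A \<in> sets (distr (density lborel (\<lambda>t. ennreal (1 / (1 + t\<^sup>2)))) borel arctan)"
    then have A [measurable]: "A \<in> sets borel" by simp
    have step: "(\<integral>\<^sup>+\<phi>. indicator A \<phi> * indicator {arctan (- real n)..arctan (real n)} \<phi> \<partial>lborel) =
       (\<integral>\<^sup>+t. ennreal (1 / (1 + t\<^sup>2)) * indicator A (arctan t) * indicator {-real n..real n} t \<partial>lborel)" for n
    proof -
      have "(\<integral>\<^sup>+\<phi>. ennreal (indicator A \<phi> * indicator {arctan (- real n)..arctan (real n)} \<phi>) \<partial>lborel) =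
         (\<integral>\<^sup>+t. ennreal (indicator A (arctan t) * (1 / (1 + t\<^sup>2)) * indicator {-real n..real n} t) \<partial>lborel)"
      proof (rule nn_integral_substitution)
        show "(arctan has_real_derivative 1 / (1 + x\<^sup>2)) (at x)" for x
          using DERIV_arctan[of x] by (simp add: inverse_eq_divide)
        show "continuous_on {- real n..real n} (\<lambda>x. 1 / (1 + x\<^sup>2))"
          by (intro continuous_intros) (metis add_nonneg_eq_0_iff one_neq_zero zero_le_one zero_le_power2)
      qed (auto simp: set_borel_measurable_def)
      moreover have "ennreal (indicator A \<phi> * indicator {arctan (- real n)..arctan (real n)} \<phi>) = indicator A \<phi> * indicator {arctan (- real n)..arctan (real n)} \<phi>" for \<phi>
        by (auto split: split_indicator)
      moreover have "ennreal (indicator A (arctan t) * (1 / (1 + t\<^sup>2)) * indicator {-real n..real n} t) = ennreal (1 / (1 + t\<^sup>2)) * indicator A (arctan t) * indicator {-real n..real n} t" for t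
        by (auto split: split_indicator)
      ultimately show ?thesis by simp
    qed
    have "(\<lambda>n. \<integral>\<^sup>+\<phi>. indicator A \<phi> * indicator {arctan (- real n)..arctan (real n)} \<phi> \<partial>lborel) \<longlonglongrightarrow> (\<integral>\<^sup>+\<phi>. indicator A \<phi> * indicator {-pi/2<..<pi/2} \<phi> \<partial>lborel)"
    proof (rule nn_integral_LIMSEQ)
      show "incseq (\<lambda>n \<phi>. indicator A \<phi> * indicator {arctan (- real n)..arctan (real n)} \<phi> :: ennreal)"
      proof (intro incseq_SucI le_funI mult_left_mono)
        fix n :: nat and \<phi> :: real
        have "arctan (- real (Suc n)) \<le> arctan (- real n)" "arctan (real n) \<le> arctan (real (Suc n))"
          by (simp_all add: arctan_le_iff)
        then show "indicator {arctan (- real n)..arctan (real n)} \<phi> \<le> (indicator {arctan (- real (Suc n))..arctan (real (Suc n))} \<phi> :: ennreal)"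
          by (auto simp del: of_nat_Suc split: split_indicator)
      qed simp
      show "(\<lambda>n. indicator A \<phi> * indicator {arctan (- real n)..arctan (real n)} \<phi> :: ennreal) \<longlonglongrightarrow> indicator A \<phi> * indicator {-pi/2<..<pi/2} \<phi>" for \<phi>
      proof (cases "\<phi> \<in> {-pi/2<..<pi/2}")
        case True
        obtain N where N: "\<bar>tan \<phi>\<bar> \<le> real N" using real_arch_simple by blast
        have "\<phi> \<in> {arctan (- real n)..arctan (real n)}" if "N \<le> n" for n
        proof -
          have "arctan (- real n) \<le> arctan (tan \<phi>)" "arctan (tan \<phi>) \<le> arctan (real n)"
            using N that by (auto simp: arctan_le_iff)
          then show ?thesis using True by (simp add: arctan_tan)
        qed
        then have "\<forall>\<^sub>F n in sequentially. indicator A \<phi> * indicator {arctan (- real n)..arctan (real n)} \<phi> = (indicator A \<phi> * indicator {-pi/2<..<pi/2} \<phi> :: ennreal)"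
          using True by (intro eventually_sequentiallyI[of N]) auto
        then show ?thesis by (rule tendsto_eventually)
      next
        case False
        then have "\<phi> \<notin> {arctan (- real n)..arctan (real n)}" for n
          using arctan_bounded[of "real n"] by (auto simp: arctan_minus)
        then show ?thesis using False by simp
      qed
    qed measurable
    moreover have "(\<lambda>n. \<integral>\<^sup>+t. ennreal (1 / (1 + t\<^sup>2)) * indicator A (arctan t) * indicator {-real n..real n} t \<partial>lborel) \<longlonglongrightarrow> (\<integral>\<^sup>+t. ennreal (1 / (1 + t\<^sup>2)) * indicator A (arctan t) \<partial>lborel)"
    proof (rule nn_integral_LIMSEQ)
      show "incseq (\<lambda>n t. ennreal (1 / (1 + t\<^sup>2)) * indicator A (arctan t) * indicator {-real n..real n} t)"
        by (intro incseq_SucI le_funI mult_left_mono) (auto split: split_indicator)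
      show "(\<lambda>n. ennreal (1 / (1 + t\<^sup>2)) * indicator A (arctan t) * indicator {-real n..real n} t) \<longlonglongrightarrow> ennreal (1 / (1 + t\<^sup>2)) * indicator A (arctan t)" for t
      proof -
        obtain N where N: "\<bar>t\<bar> \<le> real N" using real_arch_simple by blast
        show ?thesis using N by (intro tendsto_eventually eventually_sequentiallyI[of N]) (auto simp: abs_le_iff split: split_indicator)
      qed
    qed measurable
    ultimately have "(\<integral>\<^sup>+\<phi>. indicator A \<phi> * indicator {-pi/2<..<pi/2} \<phi> \<partial>lborel) = (\<integral>\<^sup>+t. ennreal (1 / (1 + t\<^sup>2)) * indicator A (arctan t) \<partial>lborel)"
      unfolding step by (rule LIMSEQ_unique)
    moreover have "emeasure (density lborel (indicator {-pi/2<..<pi/2})) A = (\<integral>\<^sup>+\<phi>. indicator A \<phi> * indicator {-pi/2<..<pi/2} \<phi> \<partial>lborel)"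
      by (subst emeasure_density) (auto simp: mult.commute)
    moreover have "emeasure (distr (density lborel (\<lambda>t. ennreal (1 / (1 + t\<^sup>2)))) borel arctan) A = (\<integral>\<^sup>+t. ennreal (1 / (1 + t\<^sup>2)) * indicator A (arctan t) \<partial>lborel)"
      
    proof -
      have "arctan -` A \<in> sets borel" using measurable_sets[OF arctan A] by simp
      then show ?thesis
        by (subst emeasure_distr, simp, simp, subst emeasure_density) (auto intro!: nn_integral_cong split: split_indicator)
    qed
    ultimately show "emeasure (distr (density lborel (\<lambda>t. ennreal (1 / (1 + t\<^sup>2)))) borel arctan) A = emeasure (density lborel (indicator {-pi/2<..<pi/2})) A" by simp
  qed simp
  have "(\<integral>\<^sup>+t. ennreal (1 / (1 + t\<^sup>2)) * F (arctan t) \<partial>lborel) = (\<integral>\<^sup>+\<phi>. F \<phi> \<partial>distr (density lborel (\<lambda>t. ennreal (1 / (1 + t\<^sup>2)))) borel arctan)"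
    by (subst nn_integral_distr, simp, simp, subst nn_integral_density) auto
  also have "\<dots> = (\<integral>\<^sup>+\<phi>\<in>{-pi/2<..<pi/2}. F \<phi> \<partial>lborel)"
    unfolding eq by (subst nn_integral_density) (auto simp: mult.commute)
  finally show ?thesis .
qed

definition ray :: "(complex \<Rightarrow> ennreal) \<Rightarrow> real \<Rightarrow> ennreal" where
  "ray g \<phi> = (\<integral>\<^sup>+r\<in>{0<..}. ennreal r * g (of_real r * cis \<phi>) \<partial>lborel)"

lemma ray_measurable [measurable]:
  assumes [measurable]: "g \<in> borel_measurable borel"
  shows "ray g \<in> borel_measurable borel"
proof -
  have [measurable]: "cis \<in> borel_measurable borel"
    by (intro borel_measurable_continuous_onI continuous_intros)
  show ?thesis unfolding ray_def by measurable
qed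

text \<open>Two one-dimensional substitutions replace a planar one: \<open>y = x * t\<close> for
  fixed \<open>x\<close>, then \<open>x = c * r\<close> with \<open>c = cos (arctan t)\<close> for
  fixed slope \<open>t\<close>. Together they produce the factor \<open>c^2 * r\<close>, and
  \<open>c^2 dt\<close> is the element of angle.\<close>

lemma nn_integral_half_plane:
  fixes g :: "complex \<Rightarrow> ennreal"
  assumes [measurable]: "g \<in> borel_measurable borel"
  shows "(\<integral>\<^sup>+x\<in>{0<..}. \<integral>\<^sup>+y. g (Complex x y) \<partial>lborel \<partial>lborel) = (\<integral>\<^sup>+\<phi>\<in>{-pi/2<..<pi/2}. ray g \<phi> \<partial>lborel)"
proof -
  have Complex: "Complex x y = of_real x + \<i> * of_real y" for x y by (simp add: complex_eq_iff)
  have m [measurable]: "(\<lambda>y. g (Complex x (h y))) \<in> borel_measurable borel" if "h \<in> borel_measurable borel" for x and h :: "real \<Rightarrow> real"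
    using that unfolding Complex by measurable
  have "(\<integral>\<^sup>+x\<in>{0<..}. \<integral>\<^sup>+y. g (Complex x y) \<partial>lborel \<partial>lborel) =
    (\<integral>\<^sup>+x. \<integral>\<^sup>+t. ennreal x * g (Complex x (x * t)) * indicator {0<..} x \<partial>lborel \<partial>lborel)"
  proof (intro nn_integral_cong)
    fix x :: real
    show "(\<integral>\<^sup>+y. g (Complex x y) \<partial>lborel) * indicator {0<..} x = (\<integral>\<^sup>+t. ennreal x * g (Complex x (x * t)) * indicator {0<..} x \<partial>lborel)"
    proof (cases "0 < x")
      case True
      have "(\<integral>\<^sup>+y. g (Complex x y) \<partial>lborel) = \<bar>x\<bar> * (\<integral>\<^sup>+t. g (Complex x (0 + x * t)) \<partial>lborel)"
        using True by (intro nn_integral_real_affine) auto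
      also have "\<dots> = (\<integral>\<^sup>+t. ennreal x * g (Complex x (x * t)) \<partial>lborel)"
        using True by (subst nn_integral_cmult) auto
      finally show ?thesis using True by simp
    qed simp
  qed
  also have "\<dots> = (\<integral>\<^sup>+t. \<integral>\<^sup>+x. ennreal x * g (Complex x (x * t)) * indicator {0<..} x \<partial>lborel \<partial>lborel)"
    unfolding Complex by (rule lborel_pair.Fubini') measurable
  also have "\<dots> = (\<integral>\<^sup>+t. ennreal (1 / (1 + t\<^sup>2)) * ray g (arctan t) \<partial>lborel)"
  proof (intro nn_integral_cong)
    fix t :: real
    define c where "c = cos (arctan t)"
    have c: "0 < c" unfolding c_def cos_arctan by (simp add: add_pos_nonneg)
    have c2: "c * c = 1 / (1 + t\<^sup>2)" by (simp add: c_def cos_arctan)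
    have ct: "c * t = sin (arctan t)" by (simp add: c_def cos_arctan sin_arctan)
    have "(\<integral>\<^sup>+x. ennreal x * g (Complex x (x * t)) * indicator {0<..} x \<partial>lborel) =
       \<bar>c\<bar> * (\<integral>\<^sup>+r. ennreal (0 + c * r) * g (Complex (0 + c * r) ((0 + c * r) * t)) * indicator {0<..} (0 + c * r) \<partial>lborel)"
      using c by (intro nn_integral_real_affine) (auto simp: Complex)
    also have "\<dots> = (\<integral>\<^sup>+r. ennreal c * (ennreal (c * r) * g (Complex (c * r) ((c * r) * t)) * indicator {0<..} (c * r)) \<partial>lborel)"
      using c by (subst nn_integral_cmult) (auto simp: Complex)
    also have "\<dots> = (\<integral>\<^sup>+r. ennreal (1 / (1 + t\<^sup>2)) * (ennreal r * g (of_real r * cis (arctan t)) * indicator {0<..} r) \<partial>lborel)"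
    proof (intro nn_integral_cong)
      fix r :: real
      show "ennreal c * (ennreal (c * r) * g (Complex (c * r) ((c * r) * t)) * indicator {0<..} (c * r)) =
        ennreal (1 / (1 + t\<^sup>2)) * (ennreal r * g (of_real r * cis (arctan t)) * indicator {0<..} r)"
      proof (cases "0 < r")
        case True
        have "Complex (c * r) ((c * r) * t) = of_real r * cis (arctan t)"
          using ct by (auto simp: complex_eq_iff c_def[symmetric] mult.commute mult.left_commute)
        moreover have "ennreal c * ennreal (c * r) = ennreal (1 / (1 + t\<^sup>2)) * ennreal r"
          using c True by (simp add: ennreal_mult[symmetric] c2[symmetric] mult.assoc)
        ultimately show ?thesis using c True by (simp add: mult.assoc[symmetric])
      qed (use c in \<open>simp add: zero_less_mult_iff\<close>)
    qed
    also have "\<dots> = ennreal (1 / (1 + t\<^sup>2)) * ray g (arctan t)"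
    proof -
      have [measurable]: "(\<lambda>r. g (complex_of_real r * cis (arctan t))) \<in> borel_measurable borel" by measurable
      show ?thesis unfolding ray_def by (rule nn_integral_cmult) measurable
    qed
    finally show "(\<integral>\<^sup>+x. ennreal x * g (Complex x (x * t)) * indicator {0<..} x \<partial>lborel) = ennreal (1 / (1 + t\<^sup>2)) * ray g (arctan t)" .
  qed
  also have "\<dots> = (\<integral>\<^sup>+\<phi>\<in>{-pi/2<..<pi/2}. ray g \<phi> \<partial>lborel)"
    by (rule nn_integral_arctan) measurable
  finally show ?thesis .
qed

text \<open>The left half-plane is carried to the right one by negation, that is by half a turn of
  the ray, and the imaginary axis is a null set. Angles are again in turns, hence the factor
  \<open>2 * pi\<close>.\<close>

theorem nn_integral_polar:
  fixes g :: "complex \<Rightarrow> ennreal"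
  assumes [measurable]: "g \<in> borel_measurable borel"
  shows "(\<integral>\<^sup>+z. g z \<partial>lborel) = ennreal (2 * pi) * (\<integral>\<^sup>+x\<in>{0..<1}. ray g (2 * pi * x) \<partial>lborel)"
proof -
  have Complex: "Complex x y = of_real x + \<i> * of_real y" for x y by (simp add: complex_eq_iff)
  define G where "G x = (\<integral>\<^sup>+y. g (Complex x y) \<partial>lborel)" for x
  have G [measurable]: "G \<in> borel_measurable borel" unfolding G_def Complex by measurable
  define g' where "g' z = g (- z)" for z
  have g' [measurable]: "g' \<in> borel_measurable borel" unfolding g'_def by measurable
  have ray': "ray g' \<phi> = ray g (\<phi> + pi)" for \<phi>
    by (simp add: ray_def g'_def cis_mult[symmetric])
  have "(\<integral>\<^sup>+z. g z \<partial>lborel) = (\<integral>\<^sup>+x. G x \<partial>lborel)" unfolding G_def by (rule nn_integral_complex) measurable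
  also have "\<dots> = (\<integral>\<^sup>+x. G x * indicator {0<..} x + G x * indicator {..<0} x \<partial>lborel)"
    using AE_lborel_singleton[of "0::real"]
    by (intro nn_integral_cong_AE) (auto split: split_indicator elim!: eventually_mono)
  also have "\<dots> = (\<integral>\<^sup>+x\<in>{0<..}. G x \<partial>lborel) + (\<integral>\<^sup>+x\<in>{..<0}. G x \<partial>lborel)"
    by (intro nn_integral_add) measurable
  also have "(\<integral>\<^sup>+x\<in>{..<0}. G x \<partial>lborel) = (\<integral>\<^sup>+x\<in>{0<..}. \<integral>\<^sup>+y. g' (Complex x y) \<partial>lborel \<partial>lborel)"
  proof -
    have "(\<integral>\<^sup>+x\<in>{..<0}. G x \<partial>lborel) = \<bar>-1::real\<bar> * (\<integral>\<^sup>+x. G (0 + -1 * x) * indicator {..<0} (0 + -1 * x) \<partial>lborel)"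
      by (rule nn_integral_real_affine) auto
    also have "\<dots> = (\<integral>\<^sup>+x\<in>{0<..}. G (- x) \<partial>lborel)"
      by (auto intro!: nn_integral_cong split: split_indicator)
    also have "(\<lambda>x. G (- x)) = (\<lambda>x. \<integral>\<^sup>+y. g' (Complex x y) \<partial>lborel)"
    proof
      fix x
      show "G (- x) = (\<integral>\<^sup>+y. g' (Complex x y) \<partial>lborel)"
    proof -
      have "G (- x) = \<bar>-1::real\<bar> * (\<integral>\<^sup>+y. g (Complex (- x) (0 + -1 * y)) \<partial>lborel)"
        unfolding G_def by (rule nn_integral_real_affine) (auto simp: Complex)
      moreover have "- Complex x y = Complex (- x) (- y)" for y by (simp add: complex_eq_iff)
      ultimately show ?thesis by (simp add: g'_def)
      qed
    qed
    finally show ?thesis .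
  qed
  also have "\<dots> = (\<integral>\<^sup>+\<phi>\<in>{-pi/2<..<pi/2}. ray g (\<phi> + pi) \<partial>lborel)"
    unfolding ray'[symmetric] by (rule nn_integral_half_plane) measurable
  also have "\<dots> = (\<integral>\<^sup>+\<phi>. ray g (\<phi> + pi) * indicator {pi/2<..<3*pi/2} (\<phi> + pi) \<partial>lborel)"
    by (intro nn_integral_cong) (auto split: split_indicator)
  also have "\<dots> = (\<integral>\<^sup>+\<phi>\<in>{pi/2<..<3*pi/2}. ray g \<phi> \<partial>lborel)"
    by (rule nn_integral_shift) measurable
  also have "(\<integral>\<^sup>+x\<in>{0<..}. G x \<partial>lborel) = (\<integral>\<^sup>+\<phi>\<in>{-pi/2<..<pi/2}. ray g \<phi> \<partial>lborel)"
    unfolding G_def by (rule nn_integral_half_plane) measurable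
  also have "(\<integral>\<^sup>+\<phi>\<in>{-pi/2<..<pi/2}. ray g \<phi> \<partial>lborel) + (\<integral>\<^sup>+\<phi>\<in>{pi/2<..<3*pi/2}. ray g \<phi> \<partial>lborel) =
    (\<integral>\<^sup>+\<phi>. ray g \<phi> * indicator {-pi/2<..<pi/2} \<phi> + ray g \<phi> * indicator {pi/2<..<3*pi/2} \<phi> \<partial>lborel)"
    by (intro nn_integral_add[symmetric]) measurable
  also have "\<dots> = (\<integral>\<^sup>+\<phi>\<in>{-pi/2..<3*pi/2}. ray g \<phi> \<partial>lborel)"
    using AE_lborel_singleton[of "pi/2"] AE_lborel_singleton[of "-pi/2"]
    by (intro nn_integral_cong_AE, eventually_elim) (auto split: split_indicator)
  also have "\<dots> = \<bar>2 * pi\<bar> * (\<integral>\<^sup>+x. ray g (0 + 2 * pi * x) * indicator {-pi/2..<3*pi/2} (0 + 2 * pi * x) \<partial>lborel)"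
    by (rule nn_integral_real_affine) auto
  also have "(\<integral>\<^sup>+x. ray g (0 + 2 * pi * x) * indicator {-pi/2..<3*pi/2} (0 + 2 * pi * x) \<partial>lborel) = (\<integral>\<^sup>+x\<in>{-1/4..<-1/4+1}. ray g (2 * pi * x) \<partial>lborel)"
  proof (intro nn_integral_cong)
    fix x :: real
    have "0 + 2 * pi * x \<in> {-pi/2..<3*pi/2} \<longleftrightarrow> x \<in> {-1/4..<-1/4+1}"
    proof -
      have "-pi/2 \<le> 2 * pi * x \<longleftrightarrow> (2*pi) * (-1/4) \<le> (2*pi) * x" by simp
      also have "\<dots> \<longleftrightarrow> -1/4 \<le> x" by (subst mult_le_cancel_left_pos) auto
      finally have 1: "-pi/2 \<le> 2 * pi * x \<longleftrightarrow> -1/4 \<le> x" .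
      have "2 * pi * x < 3*pi/2 \<longleftrightarrow> (2*pi) * x < (2*pi) * (-1/4+1)" by simp
      also have "\<dots> \<longleftrightarrow> x < -1/4+1" by (subst mult_less_cancel_left_pos) auto
      finally show ?thesis using 1 by simp
    qed
    then show "ray g (0 + 2 * pi * x) * indicator {-pi/2..<3*pi/2} (0 + 2 * pi * x) = ray g (2 * pi * x) * indicator {-1/4..<-1/4+1} x"
      by (auto split: split_indicator)
  qed
  also have "\<dots> = (\<integral>\<^sup>+x\<in>{0..<1}. ray g (2 * pi * x) \<partial>lborel)"
  proof (rule nn_integral_periodic)
    show "(\<lambda>x. ray g (2 * pi * x)) \<in> borel_measurable borel" by measurable
    show "ray g (2 * pi * (x + 1)) = ray g (2 * pi * x)" for x
      by (simp add: ray_def distrib_left cis_mult[symmetric])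
  qed
  finally show ?thesis by simp
qed

section \<open>Pointwise bounds by averages over the circle\<close>

lemma ennreal_powr_ennreal [simp]: "0 \<le> x \<Longrightarrow> ennreal_powr (ennreal x) a = ennreal (x powr a)"
  by (simp add: ennreal_powr_def)

lemma ennreal_powr_top [simp]: "ennreal_powr top a = top"
  by (simp add: ennreal_powr_def)

lemma ennreal_powr_mono: 
  assumes "x \<le> y" "0 \<le> a" shows "ennreal_powr x a \<le> ennreal_powr y a"
proof (cases y)
  case (real y')
  then obtain x' where "0 \<le> x'" "x = ennreal x'" using assms by (cases x) (auto simp: top_unique)
  then show ?thesis using assms real by (auto intro!: ennreal_leI powr_mono2)
qed simp

lemma ennreal_powr_cmult:
  assumes "0 \<le> c" shows "ennreal_powr (ennreal c * x) a = ennreal (c powr a) * ennreal_powr x a"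
proof (cases x)
  case (real x')
  then show ?thesis using assms by (simp add: ennreal_mult[symmetric] powr_mult)
next
  case top
  then show ?thesis using assms by (cases "c = 0") (auto simp: ennreal_mult_top ennreal_powr_def[of 0] )
qed

lemma ennreal_powr_powr: "ennreal_powr (ennreal_powr x a) b = ennreal_powr x (a * b)"
  by (cases x) (auto simp: powr_powr)

lemma ennreal_powr_1 [simp]: "ennreal_powr x 1 = x"
  by (cases x) auto

lemma ennreal_powr_add:
  assumes "0 \<le> a" shows "ennreal_powr (x + y) a \<le> ennreal (2 powr a) * (ennreal_powr x a + ennreal_powr y a)"
proof -
  have "ennreal_powr (x + y) a \<le> ennreal_powr (ennreal 2 * max x y) a"
    by (intro ennreal_powr_mono assms) (simp add: mult_2 add_mono)
  also have "\<dots> = ennreal (2 powr a) * ennreal_powr (max x y) a" by (rule ennreal_powr_cmult) simp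
  also have "\<dots> \<le> ennreal (2 powr a) * (ennreal_powr x a + ennreal_powr y a)"
    by (intro mult_left_mono) (auto simp: max_def)
  finally show ?thesis .
qed

lemma ennreal_powr_measurable [measurable]: "(\<lambda>x. ennreal_powr x a) \<in> borel_measurable borel"
  unfolding ennreal_powr_def by measurable

lemma ennreal_powr_SUP_le:
  assumes a: "0 < a" shows "ennreal_powr (SUP n. f n) a \<le> (SUP n. ennreal_powr (f n) a)"
proof -
  define y where "y = (SUP n. ennreal_powr (f n) a)"
  have "f n \<le> ennreal_powr y (1/a)" for n
  proof -
    have "ennreal_powr (ennreal_powr (f n) a) (1/a) \<le> ennreal_powr y (1/a)"
      using a unfolding y_def by (intro ennreal_powr_mono SUP_upper) auto
    then show ?thesis using a by (simp add: ennreal_powr_powr)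
  qed
  then have "(SUP n. f n) \<le> ennreal_powr y (1/a)" by (intro SUP_least)
  then have "ennreal_powr (SUP n. f n) a \<le> ennreal_powr (ennreal_powr y (1/a)) a"
    using a by (intro ennreal_powr_mono) auto
  then show ?thesis using a by (simp add: ennreal_powr_powr y_def)
qed

lemma powr_add_le:
  fixes x y a :: real
  assumes "0 \<le> x" "0 \<le> y" "0 \<le> a"
  shows "(x + y) powr a \<le> 2 powr a * (x powr a + y powr a)"
proof -
  have "ennreal ((x + y) powr a) \<le> ennreal (2 powr a * (x powr a + y powr a))"
    using ennreal_powr_add[OF assms(3), of "ennreal x" "ennreal y"] assms
    by (simp add: ennreal_plus[symmetric] ennreal_mult[symmetric] del: ennreal_plus)
  then show ?thesis by (subst (asm) ennreal_le_iff) auto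
qed

section \<open>Smoothing by both grids\<close>

lemma bdd_favg: assumes "G0.bdd g" shows "G0.bdd (favg L g)"
  unfolding favg_def
  by (intro G0.bdd_add G0.bdd_mult[OF G0.bdd_const] G0.bdd_sum G0.bdd_cavg G1.bdd_cavg assms) auto

lemma favg_nonneg: "G0.bdd g \<Longrightarrow> 0 \<le> favg L g x"
  unfolding favg_def by (intro add_nonneg_nonneg sum_nonneg mult_nonneg_nonneg G0.cavg_nonneg G1.cavg_nonneg) auto

text \<open>Subtraction of naturals stops at 0, so terms with \<open>j > L\<close> are averages over
  the whole circle and the sum may run up to any \<open>J >= L\<close>; the separate term goes into
  the term \<open>j = L\<close>. A range of \<open>j\<close> common to all \<open>L\<close> is what
  permits interchanging sums later.\<close>

lemma favg_le:
  assumes g: "G0.bdd g" and L: "L \<le> J"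
  shows "favg L g x \<le> (\<Sum>j\<le>J. (1/2) ^ j * (G0.cavg (L - j) g x + G1.cavg (L - j) g x))"
proof -
  define t where "t j = (1/2) ^ j * (G0.cavg (L - j) g x + G1.cavg (L - j) g x)" for j
  have t0: "0 \<le> t j" for j unfolding t_def by (intro mult_nonneg_nonneg add_nonneg_nonneg G0.cavg_nonneg G1.cavg_nonneg g) auto
  have "(1/2) ^ L * G0.cavg 0 g x \<le> t L" unfolding t_def
    using G1.cavg_nonneg[OF g, of 0 x] by (intro mult_left_mono) auto
  then have "favg L g x \<le> t L + (\<Sum>j<L. t j)" by (simp add: favg_def t_def)
  also have "\<dots> = (\<Sum>j\<le>L. t j)" by (simp add: lessThan_Suc_atMost[symmetric] add.commute)
  also have "\<dots> \<le> (\<Sum>j\<le>J. t j)" using L t0 by (intro sum_mono2) auto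
  finally show ?thesis by (simp add: t_def)
qed

text \<open>For fixed \<open>j\<close> the generations \<open>L n - j\<close> are still
  nondecreasing in \<open>n\<close>, so the inequality for averages applies with a constant
  independent of \<open>j\<close>. The factors \<open>(1/2) ^ j\<close> lose only part of their
  decay when the powers \<open>a\<close> and \<open>c\<close> are taken in turn.\<close>

lemma vector_favg:
  fixes c :: real
  assumes c: "0 < c"
  obtains C where "0 < C"
    "\<And>N v g L. (\<And>n. 0 \<le> v n) \<Longrightarrow> (\<And>n. G0.bdd (g n)) \<Longrightarrow> (\<And>n. L n \<le> L (Suc n)) \<Longrightarrow>
     (\<integral>x. (\<Sum>n\<le>(N::nat). v n * favg (L n) (g n) x powr max 1 (2/c - 1)) powr c \<partial>circle)
     \<le> C * (\<integral>x. (\<Sum>n\<le>N. v n * g n x powr max 1 (2/c - 1)) powr c \<partial>circle)"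
proof -
  define a where "a = max 1 (2/c - 1)"
  have a: "1 \<le> a" by (simp add: a_def)
  obtain C0 where C0: "0 < C0" 
    "\<And>N w g m. (\<And>n. 0 \<le> w n) \<Longrightarrow> (\<And>n. G0.bdd (g n)) \<Longrightarrow> (\<And>n. m n \<le> m (Suc n)) \<Longrightarrow>
     (\<integral>x. (\<Sum>n\<le>(N::nat). w n * G0.cavg (m n) (g n) x powr a) powr c \<partial>circle)
     \<le> C0 * (\<integral>x. (\<Sum>n\<le>N. w n * g n x powr a) powr c \<partial>circle)"
  proof (rule G0.vector_cavg[OF c, folded a_def])
    fix C assume "0 < C" and "\<And>N w g m. (\<And>n. 0 \<le> w n) \<Longrightarrow> (\<And>n. G0.bdd (g n)) \<Longrightarrow> (\<And>n. m n \<le> m (Suc n)) \<Longrightarrow>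
     (\<integral>x. (\<Sum>n\<le>(N::nat). w n * G0.cavg (m n) (g n) x powr a) powr c \<partial>circle)
     \<le> C * (\<integral>x. (\<Sum>n\<le>N. w n * g n x powr a) powr c \<partial>circle)"
    then show thesis by (rule that)
  qed
  obtain C1 where C1: "0 < C1" 
    "\<And>N w g m. (\<And>n. 0 \<le> w n) \<Longrightarrow> (\<And>n. G0.bdd (g n)) \<Longrightarrow> (\<And>n. m n \<le> m (Suc n)) \<Longrightarrow>
     (\<integral>x. (\<Sum>n\<le>(N::nat). w n * G1.cavg (m n) (g n) x powr a) powr c \<partial>circle)
     \<le> C1 * (\<integral>x. (\<Sum>n\<le>N. w n * g n x powr a) powr c \<partial>circle)"
  proof (rule G1.vector_cavg[OF c, folded a_def])
    fix C assume "0 < C" and "\<And>N w g m. (\<And>n. 0 \<le> w n) \<Longrightarrow> (\<And>n. G0.bdd (g n)) \<Longrightarrow> (\<And>n. m n \<le> m (Suc n)) \<Longrightarrow>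
     (\<integral>x. (\<Sum>n\<le>(N::nat). w n * G1.cavg (m n) (g n) x powr a) powr c \<partial>circle)
     \<le> C * (\<integral>x. (\<Sum>n\<le>N. w n * g n x powr a) powr c \<partial>circle)"
    then show thesis by (rule that)
  qed
  obtain P where P: "0 < P" "\<And>N y. (\<And>j. 0 \<le> y j) \<Longrightarrow>
     (\<Sum>j\<le>(N::nat). (1/2) ^ j * y j) powr a \<le> P * (\<Sum>j\<le>N. ((1/2) powr (a/2)) ^ j * y j powr a)"
    using sum_geometric_powr_le[of "1/2" a] a by fastforce
  define k where "k = (1/2::real) powr (a/2)"
  have k: "0 < k" "k < 1" using a powr_less_mono2[of "a/2" "1/2" 1] by (auto simp: k_def)
  obtain Q where Q: "0 < Q" "\<And>N y. (\<And>j. 0 \<le> y j) \<Longrightarrow>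
     (\<Sum>j\<le>(N::nat). k ^ j * y j) powr c \<le> Q * (\<Sum>j\<le>N. (k powr (c/2)) ^ j * y j powr c)"
    using sum_geometric_powr_le[OF k c] by fastforce
  define k' where "k' = k powr (c/2)"
  have k': "0 < k'" "k' < 1" using k c powr_less_mono2[of "c/2" k 1] by (auto simp: k'_def)
  define R where "R = (P * 2 powr a) powr c * Q * 2 powr c"
  have R: "0 < R" unfolding R_def using P(1) Q(1) by simp
  define C where "C = R * (1 / (1 - k')) * (C0 + C1)"
  show ?thesis
  proof (rule that[of C])
    show "0 < C" unfolding C_def using R k' C0 C1 by (intro mult_pos_pos) auto
    fix N :: nat and v :: "nat \<Rightarrow> real" and g :: "nat \<Rightarrow> real \<Rightarrow> real" and L :: "nat \<Rightarrow> nat"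
    assume v: "\<And>n. 0 \<le> v n" and g: "\<And>n. G0.bdd (g n)" and L: "\<And>n. L n \<le> L (Suc n)"
    define J where "J = L N"
    have LJ: "L n \<le> J" if "n \<le> N" for n unfolding J_def using lift_Suc_mono_le[of L n N] L that by auto
    define S0 where "S0 j x = (\<Sum>n\<le>N. v n * G0.cavg (L n - j) (g n) x powr a)" for j x
    define S1 where "S1 j x = (\<Sum>n\<le>N. v n * G1.cavg (L n - j) (g n) x powr a)" for j x
    define I where "I = (\<integral>x. (\<Sum>n\<le>N. v n * g n x powr a) powr c \<partial>circle)"
    have a0: "0 \<le> a" using a by simp
    have S0b: "G0.bdd (S0 j)" for j unfolding S0_def
      by (intro G0.bdd_sum G0.bdd_mult[OF G0.bdd_const] G0.bdd_powr G0.bdd_cavg v g a0) auto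
    have S1b: "G0.bdd (S1 j)" for j unfolding S1_def
      by (intro G0.bdd_sum G0.bdd_mult[OF G0.bdd_const] G0.bdd_powr G1.bdd_cavg v g a0) auto
    have S0n: "0 \<le> S0 j x" for j x unfolding S0_def by (intro sum_nonneg mult_nonneg_nonneg v) auto
    have S1n: "0 \<le> S1 j x" for j x unfolding S1_def by (intro sum_nonneg mult_nonneg_nonneg v) auto
    have bS: "G0.bdd (\<lambda>x. S0 j x powr c + S1 j x powr c)" for j
      using c by (intro G0.bdd_add G0.bdd_powr S0b S1b) auto
    have pw: "(\<Sum>n\<le>N. v n * favg (L n) (g n) x powr a) powr c \<le> R * (\<Sum>j\<le>J. k' ^ j * (S0 j x powr c + S1 j x powr c))" for x
    proof -
      have "(\<Sum>n\<le>N. v n * favg (L n) (g n) x powr a) \<le>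
         (\<Sum>n\<le>N. v n * (P * (\<Sum>j\<le>J. k ^ j * (2 powr a * (G0.cavg (L n - j) (g n) x powr a + G1.cavg (L n - j) (g n) x powr a)))))"
      proof (intro sum_mono mult_left_mono v)
        fix n assume n: "n \<in> {..N}"
        have nn: "0 \<le> G0.cavg m (g n) x" "0 \<le> G1.cavg m (g n) x" for m
          by (auto intro: G0.cavg_nonneg G1.cavg_nonneg g)
        have "favg (L n) (g n) x powr a \<le> (\<Sum>j\<le>J. (1/2) ^ j * (G0.cavg (L n - j) (g n) x + G1.cavg (L n - j) (g n) x)) powr a"
          using n a by (intro powr_mono2 favg_le g LJ favg_nonneg) auto
        also have "\<dots> \<le> P * (\<Sum>j\<le>J. k ^ j * (G0.cavg (L n - j) (g n) x + G1.cavg (L n - j) (g n) x) powr a)"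
          unfolding k_def by (intro P(2) add_nonneg_nonneg nn)
        also have "\<dots> \<le> P * (\<Sum>j\<le>J. k ^ j * (2 powr a * (G0.cavg (L n - j) (g n) x powr a + G1.cavg (L n - j) (g n) x powr a)))"
          using P(1) k a by (intro mult_left_mono sum_mono powr_add_le nn) auto
        finally show "favg (L n) (g n) x powr a \<le> P * (\<Sum>j\<le>J. k ^ j * (2 powr a * (G0.cavg (L n - j) (g n) x powr a + G1.cavg (L n - j) (g n) x powr a)))" .
      qed
      also have "\<dots> = (P * 2 powr a) * (\<Sum>n\<le>N. \<Sum>j\<le>J. k ^ j * (v n * G0.cavg (L n - j) (g n) x powr a + v n * G1.cavg (L n - j) (g n) x powr a))"
        by (simp add: sum_distrib_left algebra_simps)
      also have "(\<Sum>n\<le>N. \<Sum>j\<le>J. k ^ j * (v n * G0.cavg (L n - j) (g n) x powr a + v n * G1.cavg (L n - j) (g n) x powr a)) =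
         (\<Sum>j\<le>J. k ^ j * (S0 j x + S1 j x))"
        by (subst sum.swap) (simp add: S0_def S1_def sum_distrib_left sum.distrib distrib_left)
      finally have "(\<Sum>n\<le>N. v n * favg (L n) (g n) x powr a) powr c \<le> ((P * 2 powr a) * (\<Sum>j\<le>J. k ^ j * (S0 j x + S1 j x))) powr c"
        using c by (intro powr_mono2 sum_nonneg mult_nonneg_nonneg v) auto
      also have "\<dots> = (P * 2 powr a) powr c * (\<Sum>j\<le>J. k ^ j * (S0 j x + S1 j x)) powr c"
        using P(1) k S0n S1n by (intro powr_mult) 
      also have "\<dots> \<le> (P * 2 powr a) powr c * (Q * (\<Sum>j\<le>J. k' ^ j * (S0 j x + S1 j x) powr c))"
        unfolding k'_def by (intro mult_left_mono Q(2) add_nonneg_nonneg S0n S1n) auto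
      also have "\<dots> \<le> (P * 2 powr a) powr c * (Q * (\<Sum>j\<le>J. k' ^ j * (2 powr c * (S0 j x powr c + S1 j x powr c))))"
        using Q(1) k' c by (intro mult_left_mono sum_mono powr_add_le S0n S1n) auto
      also have "\<dots> = R * (\<Sum>j\<le>J. k' ^ j * (S0 j x powr c + S1 j x powr c))"
        by (simp add: R_def sum_distrib_left mult.assoc mult.left_commute)
      finally show ?thesis .
    qed
    have "(\<integral>x. (\<Sum>n\<le>N. v n * favg (L n) (g n) x powr a) powr c \<partial>circle) \<le> (\<integral>x. R * (\<Sum>j\<le>J. k' ^ j * (S0 j x powr c + S1 j x powr c)) \<partial>circle)"
    proof (intro integral_mono G0.bdd_integrable pw)
      show "G0.bdd (\<lambda>x. (\<Sum>n\<le>N. v n * favg (L n) (g n) x powr a) powr c)"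
        using c by (intro G0.bdd_powr G0.bdd_sum G0.bdd_mult[OF G0.bdd_const] bdd_favg v g a0) auto
      show "G0.bdd (\<lambda>x. R * (\<Sum>j\<le>J. k' ^ j * (S0 j x powr c + S1 j x powr c)))"
        using R k' by (intro G0.bdd_mult[OF G0.bdd_const] G0.bdd_sum bS) auto
    qed
    also have "\<dots> = R * (\<Sum>j\<le>J. k' ^ j * ((\<integral>x. S0 j x powr c \<partial>circle) + (\<integral>x. S1 j x powr c \<partial>circle)))"
    proof -
      have i: "integrable circle (\<lambda>x. S0 j x powr c)" "integrable circle (\<lambda>x. S1 j x powr c)" for j
        using c by (auto intro!: G0.bdd_integrable G0.bdd_powr S0b S1b)
      show ?thesis by (simp add: Bochner_Integration.integral_sum i)
    qed
    also have "\<dots> \<le> R * (\<Sum>j\<le>J. k' ^ j * (C0 * I + C1 * I))"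
    proof (intro mult_left_mono sum_mono add_mono)
      have "L n - j \<le> L (Suc n) - j" for n j using L[of n] by simp
      then show "(\<integral>x. S0 j x powr c \<partial>circle) \<le> C0 * I" "(\<integral>x. S1 j x powr c \<partial>circle) \<le> C1 * I" for j
        unfolding S0_def S1_def I_def by (auto intro!: C0(2) C1(2) v g)
    qed (use R k' in auto)
    also have "\<dots> = R * (\<Sum>j\<le>J. k' ^ j) * (C0 + C1) * I"
      by (simp only: sum_distrib_right[symmetric]) (simp add: algebra_simps)
    also have "\<dots> \<le> R * (1 / (1 - k')) * (C0 + C1) * I"
    proof (intro mult_right_mono mult_left_mono)
      have "(\<Sum>j\<le>J. k' ^ j) \<le> (\<Sum>j. k' ^ j)" using k' by (intro sum_le_suminf summable_geometric) auto
      then show "(\<Sum>j\<le>J. k' ^ j) \<le> 1 / (1 - k')" using k' by (simp add: suminf_geometric)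
      show "0 \<le> I" unfolding I_def by (intro Bochner_Integration.integral_nonneg) auto
    qed (use R C0 C1 in auto)
    finally show "(\<integral>x. (\<Sum>n\<le>N. v n * favg (L n) (g n) x powr max 1 (2/c - 1)) powr c \<partial>circle)
     \<le> C * (\<integral>x. (\<Sum>n\<le>N. v n * g n x powr max 1 (2/c - 1)) powr c \<partial>circle)"
      by (simp add: C_def I_def a_def)
  qed
qed

section \<open>The Poisson kernel and its dyadic model\<close>

lemma norm_cis_diff_le: "norm (cis a - cis b) \<le> \<bar>a - b\<bar>"
proof -
  have "cis a = cis b * cis (a - b)" by (simp add: cis_mult)
  then have "cis a - cis b = cis b * (exp (\<i> * of_real (a - b)) - 1)"
    by (simp add: cis_conv_exp algebra_simps)
  then have "norm (cis a - cis b) = 2 * \<bar>sin ((a - b) / 2)\<bar>"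
    by (simp only: norm_mult norm_cis dist_exp_i_1)
  also have "\<dots> \<le> 2 * \<bar>(a - b) / 2\<bar>" by (intro mult_left_mono abs_sin_x_le_abs_x) auto
  finally show ?thesis by simp
qed

definition pt :: "real \<Rightarrow> real \<Rightarrow> real \<Rightarrow> complex" where
  "pt x r u = of_real r * cis (2 * pi * x + u * (1 - r))"

text \<open>The factor 8 comes from bounding \<open>1 - |z|^2\<close>, the square from comparing
  distances between boundary points with distances to the interior point \<open>z\<close>.\<close>

definition pcst :: "real \<Rightarrow> real" where
  "pcst c = 8 * (1 + 10 / c)\<^sup>2"

text \<open>The radius \<open>r\<close> exceeds \<open>norm w\<close> by a fixed part of
  \<open>(1/2) ^ L\<close>, so \<open>z = w / r\<close> keeps that distance from the circle. All
  other displacements (of \<open>w\<close> from the boundary point, of \<open>z\<close> from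
  \<open>w\<close>, of the angle by \<open>u * (1 - r)\<close>) are at most multiples of
  \<open>(1/2) ^ L\<close>, hence of the distance to \<open>z\<close>.\<close>

lemma Poisson_kernel_le_peak:
  fixes c :: real
  assumes c: "0 < c" "c \<le> 1" 
    and w: "norm (w - cis (2 * pi * x)) \<le> 3 * (1/2) ^ L" "norm w \<le> 1 - c * (1/2) ^ L"
    and r: "1 - c / 2 * (1/2) ^ L \<le> r" "r < 1" "0 < r" and u: "\<bar>u\<bar> \<le> 1"
  shows "norm (w / r) < 1"
    "(1 - (norm (w / r))\<^sup>2) / (norm (cis (2 * pi * y + u * (1 - r)) - w / r))\<^sup>2 \<le> pcst c * peak L x y"
proof -
  define e :: real where "e = (1/2) ^ L"
  define z where "z = w / r"
  define b where "b = cis (2 * pi * x)"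
  define b' where "b' = cis (2 * pi * y)"
  define b'' where "b'' = cis (2 * pi * y + u * (1 - r))"
  have e: "0 < e" by (simp add: e_def)
  have ce: "c * e \<le> e" using c e by simp
  have "c / 2 * (1/2) ^ L = c * e / 2" by (simp add: e_def)
  then have re: "1 - r \<le> e" using r(1) ce e by linarith
  have wz: "norm w = r * norm z" using r by (simp add: z_def norm_divide)
  have 1: "c * e / 2 \<le> r - norm w" using w(2) r by (simp add: e_def)
  have "r - norm w = r * (1 - norm z)" by (simp add: wz right_diff_distrib)
  moreover have "0 < r - norm w" using 1 c e by (smt (verit) mult_pos_pos divide_pos_pos)
  ultimately have z1: "0 < 1 - norm z" using r by (simp add: zero_less_mult_iff)
  have "r * (1 - norm z) \<le> 1 * (1 - norm z)" using r z1 by (intro mult_right_mono) auto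
  then have z2: "c * e / 2 \<le> 1 - norm z" using 1 by (simp add: wz right_diff_distrib)
  show "norm (w / r) < 1" using z1 by (simp add: z_def)
  have zw: "norm (z - w) \<le> e"
  proof -
    have "z - w = of_real (1 - r) * z" using r by (simp add: z_def divide_simps) (simp add: algebra_simps)
    then have "norm (z - w) = (1 - r) * norm z" using r by (simp add: norm_mult del: of_real_diff)
    also have "\<dots> \<le> (1 - r) * 1" using r z1 by (intro mult_left_mono) auto
    also have "\<dots> \<le> e" using re by simp
    finally show ?thesis .
  qed
  have bz: "norm (b - z) \<le> 4 * e"
  proof -
    have "norm (b - z) \<le> norm (w - b) + norm (z - w)"
      using norm_triangle_ineq[of "b - w" "w - z"] by (simp add: norm_minus_commute)
    then show ?thesis using w(1) zw by (simp add: b_def e_def)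
  qed
  have num: "1 - (norm z)\<^sup>2 \<le> 8 * e"
  proof -
    have "1 - norm z \<le> norm (b - z)" using norm_triangle_ineq2[of b z] by (simp add: b_def)
    then have "(1 - norm z) * 2 \<le> (4 * e) * 2" using bz by (intro mult_right_mono order_trans[OF _ bz]) auto
    moreover have "1 - (norm z)\<^sup>2 \<le> (1 - norm z) * 2"
    proof -
      have "1 - (norm z)\<^sup>2 = (1 - norm z) * (1 + norm z)" by (simp add: power2_eq_square algebra_simps)
      also have "\<dots> \<le> (1 - norm z) * 2" using z1 by (intro mult_left_mono) auto
      finally show ?thesis .
    qed
    ultimately have "1 - (norm z)\<^sup>2 \<le> (4 * e) * 2" by (rule order_trans[rotated])
    then show ?thesis by simp
  qed
  define X where "X = norm (b'' - z)"
  define K where "K = 1 + 10 / c"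
  have X: "c * e / 2 \<le> X" using norm_triangle_ineq2[of b'' z] z2 by (simp add: b''_def X_def)
  have X0: "0 < X" using X c e by (smt (verit) mult_pos_pos divide_pos_pos)
  have eX: "e \<le> 2 / c * X" using X c by (simp add: field_simps)
  have "norm (b'' - b') \<le> \<bar>u * (1 - r)\<bar>" 
    unfolding b''_def b'_def using norm_cis_diff_le[of "2 * pi * y + u * (1 - r)" "2 * pi * y"] by simp
  also have "\<dots> \<le> 1 * (1 - r)" unfolding abs_mult using u r by (intro mult_mono) auto
  also have "\<dots> \<le> e" using re by simp
  finally have bb: "norm (b'' - b') \<le> e" .
  have "norm (b - b') \<le> norm (b - z) + norm (b'' - z) + norm (b'' - b')"
  proof -
    show ?thesis
      using norm_triangle_ineq[of "(b - z) - (b'' - z)" "b'' - b'"] norm_triangle_ineq4[of "b - z" "b'' - z"] by simp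
  qed
  \<comment> \<open>The 5 collects \<open>4 * e\<close> from \<open>b - z\<close> and
    \<open>e\<close> from the turn by \<open>u * (1 - r)\<close>.\<close>
  then have "norm (b - b') \<le> X + 5 * e" using bz bb by (simp add: X_def)
  also have "\<dots> \<le> X + 5 * (2 / c * X)" using eX by simp
  also have "\<dots> = K * X" by (simp add: K_def algebra_simps)
  finally have d1: "norm (b - b') \<le> K * X" .
  have "2 / c * X \<le> K * X" using X0 c by (intro mult_right_mono) (auto simp: K_def field_simps)
  then have "e \<le> K * X" using eX by linarith
  then have m: "max e (norm (b - b')) \<le> K * X" using d1 by simp
  have K: "0 < K" using c by (simp add: K_def add_pos_pos)
  have mpos: "0 < max e (norm (b - b'))" using e by simp
  have "(1 - (norm z)\<^sup>2) / X\<^sup>2 \<le> 8 * e / X\<^sup>2" using num by (intro divide_right_mono) auto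
  also have "\<dots> = 8 * K\<^sup>2 * (e / (K * X)\<^sup>2)" using K X0 by (simp add: power_mult_distrib)
  also have "\<dots> \<le> 8 * K\<^sup>2 * (e / (max e (norm (b - b')))\<^sup>2)"
    using m mpos e K X0 by (intro mult_left_mono divide_left_mono power_mono mult_pos_pos zero_less_power) auto
  finally show "(1 - (norm (w / r))\<^sup>2) / (norm (cis (2 * pi * y + u * (1 - r)) - w / r))\<^sup>2 \<le> pcst c * peak L x y"
    by (simp add: z_def X_def b''_def pcst_def K_def peak_def e_def b_def b'_def)
qed

text \<open>The Poisson inequality on the disc of radius \<open>r\<close>, through the dilation
  \<open>k\<close>. Periodicity lets the variable be shifted by \<open>t\<close>, which is the
  offset \<open>u * (1 - r)\<close> in turns.\<close>

lemma norm_powr_le_peak: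
  fixes c :: real
  assumes h: "h holomorphic_on ball 0 1" and s: "0 < s" and c: "0 < c" "c \<le> 1" 
    and w: "norm (w - cis (2 * pi * x)) \<le> 3 * (1/2) ^ L" "norm w \<le> 1 - c * (1/2) ^ L"
    and r: "1 - c / 2 * (1/2) ^ L \<le> r" "r < 1" "0 < r" and u: "\<bar>u\<bar> \<le> 1"
  shows "ennreal (norm (h w) powr s) \<le> ennreal (pcst c) * (\<integral>\<^sup>+y. ennreal (peak L x y * norm (h (pt y r u)) powr s) \<partial>circle)"
proof -
  define z where "z = w / r"
  define t where "t = u * (1 - r) / (2 * pi)"
  have z: "norm z < 1" unfolding z_def using Poisson_kernel_le_peak(1)[OF c w r u] .
  have sub: "of_real r * v \<in> ball 0 1" if "v \<in> cball 0 1" for v :: complex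
  proof -
    have "r * norm v \<le> r * 1" using that r by (intro mult_left_mono) auto
    then have "r * norm v < 1" using r by linarith
    then show ?thesis using r by (simp add: norm_mult)
  qed
  have hc: "continuous_on (ball 0 1) h" using h by (rule holomorphic_on_imp_continuous_on)
  define k where "k v = h (of_real r * v)" for v
  have k1: "continuous_on (cball 0 1) k" unfolding k_def
    by (rule continuous_on_compose2[OF hc]) (use sub in \<open>auto intro!: continuous_intros\<close>)
  have k2: "k holomorphic_on ball 0 1"
  proof -
    have "(h \<circ> (\<lambda>v. of_real r * v)) holomorphic_on ball 0 1"
      by (rule holomorphic_on_compose_gen[OF _ h]) (use sub in \<open>auto intro!: holomorphic_intros\<close>)
    then show ?thesis by (simp add: k_def[abs_def] o_def)
  qed
  have kz: "k z = h w" using r by (simp add: k_def z_def)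
  define P where "P y = (1 - (norm z)\<^sup>2) / (norm (cis (2 * pi * y) - z))\<^sup>2 * norm (k (cis (2 * pi * y))) powr s" for y
  have cP: "continuous_on UNIV P"
  proof -
    have ck: "continuous_on UNIV (\<lambda>y. k (cis (2 * pi * y)))"
      by (rule continuous_on_compose2[OF k1]) (auto intro!: continuous_intros)
    have "norm (cis (2 * pi * y) - z) \<noteq> 0" for y using z by auto
    then show ?thesis unfolding P_def using s by (intro continuous_intros continuous_on_powr' ck) auto
  qed
  have Pm [measurable]: "P \<in> borel_measurable borel" using cP by (rule borel_measurable_continuous_onI)
  have Pp: "P (y + 1) = P y" for y by (simp add: P_def distrib_left cis_mult[symmetric])
  have "ennreal (norm (h w) powr s) \<le> (\<integral>\<^sup>+y\<in>{0..<1}. ennreal (P y) \<partial>lborel)"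
    using norm_powr_le_Poisson[OF k1 k2 s z] by (simp add: kz P_def)
  also have "\<dots> = (\<integral>\<^sup>+y\<in>{t..<t+1}. ennreal (P y) \<partial>lborel)"
    by (rule nn_integral_periodic[symmetric]) (auto simp: Pp)
  also have "\<dots> = (\<integral>\<^sup>+y. ennreal (P (y + t)) * indicator {t..<t+1} (y + t) \<partial>lborel)"
    by (rule nn_integral_shift[symmetric]) measurable
  also have "\<dots> = (\<integral>\<^sup>+y. ennreal (P (y + t)) \<partial>circle)"
    unfolding nn_integral_circle by (intro nn_integral_cong) (auto split: split_indicator)
  also have "\<dots> \<le> (\<integral>\<^sup>+y. ennreal (pcst c) * ennreal (peak L x y * norm (h (pt y r u)) powr s) \<partial>circle)"
  proof (intro nn_integral_mono)
    fix y :: real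
    have a: "2 * pi * (y + t) = 2 * pi * y + u * (1 - r)" by (simp add: t_def distrib_left)
    have "P (y + t) \<le> (pcst c * peak L x y) * norm (h (pt y r u)) powr s"
      unfolding P_def a k_def pt_def z_def
      by (intro mult_right_mono Poisson_kernel_le_peak[OF c w r u]) auto
    then show "ennreal (P (y + t)) \<le> ennreal (pcst c) * ennreal (peak L x y * norm (h (pt y r u)) powr s)"
      by (simp add: ennreal_mult'[symmetric] pcst_def mult.assoc ennreal_leI)
  qed
  also have "\<dots> = ennreal (pcst c) * (\<integral>\<^sup>+y. ennreal (peak L x y * norm (h (pt y r u)) powr s) \<partial>circle)"
  proof (rule nn_integral_cmult)
    have cpt: "continuous_on UNIV (\<lambda>y. h (pt y r u))"
      by (rule continuous_on_compose2[OF hc]) (use sub r in \<open>auto simp: pt_def norm_mult intro!: continuous_intros\<close>)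
    have "continuous_on UNIV (\<lambda>y. norm (h (pt y r u)) powr s)"
      using s by (intro continuous_on_powr' continuous_intros cpt) auto
    then have [measurable]: "(\<lambda>y. norm (h (pt y r u)) powr s) \<in> borel_measurable borel" by (rule borel_measurable_continuous_onI)
    have "0 < max ((1/2) ^ L) (norm (cis (2 * pi * x) - cis (2 * pi * y)))" for y
      by (simp add: less_max_iff_disj)
    then have "(max ((1/2) ^ L) (norm (cis (2 * pi * x) - cis (2 * pi * y))))\<^sup>2 \<noteq> 0" for y
      by (metis less_irrefl power_eq_0_iff)
    then have "continuous_on UNIV (\<lambda>y. peak L x y)" unfolding peak_def
      by (intro continuous_intros) simp
    then have [measurable]: "(\<lambda>y. peak L x y) \<in> borel_measurable borel" by (rule borel_measurable_continuous_onI)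
    show "(\<lambda>y. ennreal (peak L x y * norm (h (pt y r u)) powr s)) \<in> borel_measurable circle"
      by (rule measurable_circle) measurable
  qed
  finally show ?thesis .
qed

section \<open>Mixed norms\<close>

lemma continuous_on_cball_bound:
  fixes h :: "complex \<Rightarrow> complex"
  assumes "continuous_on (ball 0 1) h" "b < 1"
  obtains B where "0 \<le> B" "\<And>z. norm z \<le> b \<Longrightarrow> norm (h z) \<le> B"
proof -
  have "compact (h ` cball 0 b)"
    using assms by (intro compact_continuous_image continuous_on_subset[OF assms(1)]) auto
  then obtain B where B: "\<And>y. y \<in> h ` cball 0 b \<Longrightarrow> norm y \<le> B"
    using compact_imp_bounded bounded_iff by metis
  show ?thesis by (rule that[of "max 0 B"]) (use B in \<open>auto simp: le_max_iff_disj\<close>)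
qed

text \<open>Extension by zero turns continuity on the disc into Borel measurability on the
  plane.\<close>

definition trunc :: "(complex \<Rightarrow> complex) \<Rightarrow> complex \<Rightarrow> complex" where
  "trunc h z = (if z \<in> ball 0 1 then h z else 0)"

lemma trunc_measurable:
  assumes "continuous_on (ball 0 1) h" shows "trunc h \<in> borel_measurable borel"
proof -
  have "(\<lambda>z. indicator (ball 0 1) z *\<^sub>R h z) \<in> borel_measurable borel"
    using assms by (intro borel_measurable_continuous_on_indicator) auto
  moreover have "(\<lambda>z. indicator (ball 0 1) z *\<^sub>R h z) = trunc h"
    by (auto simp: trunc_def fun_eq_iff)
  ultimately show ?thesis by simp
qed

lemma norm_pt: "0 \<le> r \<Longrightarrow> norm (pt x r u) = r"
  by (simp add: pt_def norm_mult)

lemma pt_per: "pt (x + 1) r u = pt x r u"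
proof -
  have "2 * pi * (x + 1) + u * (1 - r) = (2 * pi * x + u * (1 - r)) + 2 * pi" by (simp add: distrib_left)
  then show ?thesis by (simp only: pt_def cis_mult[symmetric] cis_2pi mult_1_right)
qed

definition wd :: "(complex \<Rightarrow> complex) \<Rightarrow> nat \<Rightarrow> complex \<Rightarrow> complex" where
  "wd h kap z = h z * of_real ((1 - norm z) ^ kap)"

lemma wd_continuous: "continuous_on (ball 0 1) h \<Longrightarrow> continuous_on (ball 0 1) (wd h kap)"
  unfolding wd_def by (intro continuous_intros)

lemma norm_wd: "norm z < 1 \<Longrightarrow> norm (wd h kap z) = norm (h z) * (1 - norm z) ^ kap"
  by (simp add: wd_def norm_mult norm_power del: of_real_power of_real_diff)

text \<open>The measure \<open>mu\<close> will be \<open>\<omega>(r) r dr\<close>. A point mass \<open>sg\<close> at \<open>0\<close> gives the norms of \<open>L\<^sup>q\<^sub>p(\<omega>)\<close>; normalized Lebesgue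
  measure on \<open>(-1,1)\<close> gives those of \<open>T\<^sup>q\<^sub>p(\<omega>)\<close>, since \<open>u \<mapsto> pt x r u\<close> then runs through the arc of radius \<open>r\<close> in
  the tent with vertex \<open>cis (2 * pi * x)\<close>.\<close>

locale mixed_norm =
  fixes mu sg :: "real measure" and p q :: real
  assumes p: "0 < p" and q: "0 < q"
    and mu: "finite_measure mu" and sets_mu [measurable_cong, simp]: "sets mu = sets borel"
    and sg: "finite_measure sg" and sets_sg [measurable_cong, simp]: "sets sg = sets borel"
    and AE_mu: "AE r in mu. 0 < r \<and> r < 1" and AE_sg: "AE u in sg. \<bar>u\<bar> \<le> 1"
    and sg_pos: "0 < measure sg UNIV"
    and mu_pos: "\<And>d. 0 < d \<Longrightarrow> 0 < measure mu {1 - d..<1}"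
begin

sublocale mu: finite_measure mu by (rule mu)
sublocale sg: finite_measure sg by (rule sg)

lemma space_mu [simp]: "space mu = UNIV" using sets_eq_imp_space_eq[OF sets_mu] by simp
lemma space_sg [simp]: "space sg = UNIV" using sets_eq_imp_space_eq[OF sets_sg] by simp

definition inner :: "(complex \<Rightarrow> complex) \<Rightarrow> real \<Rightarrow> ennreal" where
  "inner f x = (\<integral>\<^sup>+r. \<integral>\<^sup>+u. ennreal (norm (trunc f (pt x r u)) powr p) \<partial>sg \<partial>mu)"

text \<open>This is the \<open>q\<close>-th power of the norm; the outer root is taken only when the
  two sides are compared.\<close>

definition mnorm :: "(complex \<Rightarrow> complex) \<Rightarrow> ennreal" where
  "mnorm f = (\<integral>\<^sup>+x. ennreal_powr (inner f x) (q / p) \<partial>circle)"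

text \<open>For the measure \<open>\<omega>(r) r dr\<close> this is the tail integral at
  \<open>1 - d\<close> up to the factor \<open>r\<close>. It is finite for every \<open>d\<close>,
  also where the tail integral is not.\<close>

definition mh :: "real \<Rightarrow> real" where "mh d = measure mu {1 - d..<1}"

lemma mh_mono: "d \<le> d' \<Longrightarrow> mh d \<le> mh d'"
  unfolding mh_def by (intro mu.finite_measure_mono) auto

lemma pt_measurable [measurable]: "(\<lambda>(x, r, u). pt x r u) \<in> borel_measurable (borel \<Otimes>\<^sub>M borel \<Otimes>\<^sub>M borel)"
proof -
  have [measurable]: "cis \<in> borel_measurable borel"
    by (intro borel_measurable_continuous_onI continuous_intros)
  show ?thesis unfolding pt_def by measurable
qed

lemma norm_trunc_measurable:
  assumes "continuous_on (ball 0 1) h"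
  shows "(\<lambda>(x, r, u). ennreal (norm (trunc h (pt x r u)) powr s)) \<in> borel_measurable (borel \<Otimes>\<^sub>M borel \<Otimes>\<^sub>M borel)"
proof -
  note [measurable] = trunc_measurable[OF assms]
  have "(\<lambda>w. ennreal (norm (trunc h ((\<lambda>(x, r, u). pt x r u) w)) powr s)) \<in> borel_measurable (borel \<Otimes>\<^sub>M borel \<Otimes>\<^sub>M borel)"
    by measurable
  then show ?thesis by (simp add: split_beta')
qed

lemma norm_trunc_measurable_ru:
  assumes "continuous_on (ball 0 1) h"
  shows "(\<lambda>(r, u). ennreal (norm (trunc h (pt x r u)) powr s)) \<in> borel_measurable (mu \<Otimes>\<^sub>M sg)"
proof -
  have "(\<lambda>w. (x, fst w, snd w)) \<in> borel \<Otimes>\<^sub>M borel \<rightarrow>\<^sub>M borel \<Otimes>\<^sub>M borel \<Otimes>\<^sub>M borel" by measurable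
  from measurable_compose[OF this norm_trunc_measurable[OF assms, of s]]
  have "(\<lambda>w. ennreal (norm (trunc h (pt x (fst w) (snd w))) powr s)) \<in> borel_measurable (borel \<Otimes>\<^sub>M borel)"
    by (simp only: split_beta' fst_conv snd_conv)
  moreover have sets: "sets (mu \<Otimes>\<^sub>M sg) = sets (borel \<Otimes>\<^sub>M borel)" by (intro sets_pair_measure_cong) auto
  ultimately show ?thesis unfolding split_beta' measurable_cong_sets[OF sets refl] by blast
qed

lemma norm_trunc_measurable_u:
  assumes "continuous_on (ball 0 1) h"
  shows "(\<lambda>u. ennreal (norm (trunc h (pt x r u)) powr s)) \<in> borel_measurable sg"
  using measurable_Pair2[OF norm_trunc_measurable_ru[OF assms, of x s], of r] by simp

lemma norm_trunc_measurable_r: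
  assumes "continuous_on (ball 0 1) h"
  shows "(\<lambda>r. \<integral>\<^sup>+u. ennreal (norm (trunc h (pt x r u)) powr s) \<partial>sg) \<in> borel_measurable mu"
  using sg.borel_measurable_nn_integral[of "\<lambda>r u. ennreal (norm (trunc h (pt x r u)) powr s)" mu]
    norm_trunc_measurable_ru[OF assms, of x s] by simp

lemma norm_trunc_measurable_x:
  assumes h: "continuous_on (ball 0 1) h" and A: "A \<in> sets borel"
  shows "(\<lambda>x. \<integral>\<^sup>+r\<in>A. (\<integral>\<^sup>+u. ennreal (norm (trunc h (pt x r u)) powr s) \<partial>sg) \<partial>mu) \<in> borel_measurable borel"
proof -
  note [measurable] = A
  have "sets (borel \<Otimes>\<^sub>M borel \<Otimes>\<^sub>M borel) = sets ((borel :: real measure) \<Otimes>\<^sub>M mu \<Otimes>\<^sub>M sg)" 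
    by (intro sets_pair_measure_cong) auto
  then have m [measurable]: "(\<lambda>(x, r, u). ennreal (norm (trunc h (pt x r u)) powr s)) \<in> borel_measurable (borel \<Otimes>\<^sub>M mu \<Otimes>\<^sub>M sg)"
    using norm_trunc_measurable[OF h, of s] measurable_cong_sets by blast
  have "(\<lambda>w. (fst (fst w), snd (fst w), snd w)) \<in> (borel \<Otimes>\<^sub>M mu) \<Otimes>\<^sub>M sg \<rightarrow>\<^sub>M borel \<Otimes>\<^sub>M mu \<Otimes>\<^sub>M sg" by measurable
  from measurable_compose[OF this m]
  have "(\<lambda>w. ennreal (norm (trunc h (pt (fst (fst w)) (snd (fst w)) (snd w))) powr s)) \<in> borel_measurable ((borel \<Otimes>\<^sub>M mu) \<Otimes>\<^sub>M sg)" by simp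
  then have "(\<lambda>w. \<integral>\<^sup>+u. ennreal (norm (trunc h (pt (fst w) (snd w) u)) powr s) \<partial>sg) \<in> borel_measurable (borel \<Otimes>\<^sub>M mu)"
    using sg.borel_measurable_nn_integral[of "\<lambda>w u. ennreal (norm (trunc h (pt (fst w) (snd w) u)) powr s)" "borel \<Otimes>\<^sub>M mu"]
    by (simp add: split_beta')
  then have "(\<lambda>w. (\<integral>\<^sup>+u. ennreal (norm (trunc h (pt (fst w) (snd w) u)) powr s) \<partial>sg) * indicator A (snd w)) \<in> borel_measurable (borel \<Otimes>\<^sub>M mu)"
    by measurable
  then show ?thesis
    using mu.borel_measurable_nn_integral[of "\<lambda>x r. (\<integral>\<^sup>+u. ennreal (norm (trunc h (pt x r u)) powr s) \<partial>sg) * indicator A r" borel]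
    by (simp add: split_beta')
qed

lemma inner_measurable:
  assumes h: "continuous_on (ball 0 1) h"
  shows "inner h \<in> borel_measurable borel"
  using norm_trunc_measurable_x[OF h, of UNIV p] unfolding inner_def[abs_def] by simp

section \<open>Means over a set of radii\<close>

definition avg_int :: "(complex \<Rightarrow> complex) \<Rightarrow> real \<Rightarrow> real set \<Rightarrow> real \<Rightarrow> ennreal" where
  "avg_int h s A x = (\<integral>\<^sup>+r\<in>A. (\<integral>\<^sup>+u. ennreal (norm (trunc h (pt x r u)) powr s) \<partial>sg) \<partial>mu)"

definition mass :: "real set \<Rightarrow> real" where "mass A = measure mu A * measure sg UNIV"

text \<open>Applied to sets of radii at a positive distance from 1, where \<open>avg_int\<close> is
  finite for continuous \<open>h\<close>; so passing to reals by \<open>enn2real\<close> loses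
  nothing.\<close>

definition gav :: "(complex \<Rightarrow> complex) \<Rightarrow> real \<Rightarrow> real set \<Rightarrow> real \<Rightarrow> real" where
  "gav h s A x = enn2real (avg_int h s A x) / mass A"

lemma nn_integral_mass:
  assumes "A \<in> sets borel" "0 \<le> B" shows "(\<integral>\<^sup>+r\<in>A. (\<integral>\<^sup>+u. ennreal B \<partial>sg) \<partial>mu) = ennreal (B * mass A)"
proof -
  have "(\<integral>\<^sup>+u. ennreal B \<partial>sg) = ennreal (B * measure sg UNIV)"
    using assms(2) by (simp add: sg.emeasure_eq_measure ennreal_mult)
  then have "(\<integral>\<^sup>+r\<in>A. (\<integral>\<^sup>+u. ennreal B \<partial>sg) \<partial>mu) = ennreal (B * measure sg UNIV) * emeasure mu A"
    using assms(1) by (simp only:) (rule nn_integral_cmult_indicator, simp)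
  also have "\<dots> = ennreal (B * measure sg UNIV * measure mu A)"
    using assms(2) unfolding mu.emeasure_eq_measure by (intro ennreal_mult[symmetric]) auto
  finally show ?thesis by (simp add: mass_def mult.commute mult.left_commute)
qed

lemma nn_integral_mass_mono_bound:
  assumes "A \<in> sets borel" "0 \<le> B" "\<And>r u. r \<in> A \<Longrightarrow> 0 < r \<Longrightarrow> r < 1 \<Longrightarrow> \<bar>u\<bar> \<le> 1 \<Longrightarrow> F r u \<le> ennreal B"
  shows "(\<integral>\<^sup>+r\<in>A. (\<integral>\<^sup>+u. F r u \<partial>sg) \<partial>mu) \<le> ennreal (B * mass A)"
proof -
  have "(\<integral>\<^sup>+r\<in>A. (\<integral>\<^sup>+u. F r u \<partial>sg) \<partial>mu) \<le> (\<integral>\<^sup>+r\<in>A. (\<integral>\<^sup>+u. ennreal B \<partial>sg) \<partial>mu)"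
  proof (rule nn_integral_mono_AE)
    show "AE r in mu. (\<integral>\<^sup>+u. F r u \<partial>sg) * indicator A r \<le> (\<integral>\<^sup>+u. ennreal B \<partial>sg) * indicator A r"
      using AE_mu
    proof eventually_elim
      case (elim r)
      show ?case
      proof (cases "r \<in> A")
        case True
        have "(\<integral>\<^sup>+u. F r u \<partial>sg) \<le> (\<integral>\<^sup>+u. ennreal B \<partial>sg)"
          by (rule nn_integral_mono_AE) (use AE_sg assms(3)[OF True] elim in \<open>auto elim!: eventually_mono\<close>)
        then show ?thesis using True by simp
      qed simp
    qed
  qed
  then show ?thesis by (simp only: nn_integral_mass[OF assms(1,2)])
qed

lemma nn_integral_mass_lower_bound:
  assumes "A \<in> sets borel" "0 \<le> B" "\<And>r u. r \<in> A \<Longrightarrow> 0 < r \<Longrightarrow> r < 1 \<Longrightarrow> \<bar>u\<bar> \<le> 1 \<Longrightarrow> ennreal B \<le> F r u"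
  shows "ennreal (B * mass A) \<le> (\<integral>\<^sup>+r\<in>A. (\<integral>\<^sup>+u. F r u \<partial>sg) \<partial>mu)"
proof -
  have "(\<integral>\<^sup>+r\<in>A. (\<integral>\<^sup>+u. ennreal B \<partial>sg) \<partial>mu) \<le> (\<integral>\<^sup>+r\<in>A. (\<integral>\<^sup>+u. F r u \<partial>sg) \<partial>mu)"
  proof (rule nn_integral_mono_AE)
    show "AE r in mu. (\<integral>\<^sup>+u. ennreal B \<partial>sg) * indicator A r \<le> (\<integral>\<^sup>+u. F r u \<partial>sg) * indicator A r"
      using AE_mu
    proof eventually_elim
      case (elim r)
      show ?case
      proof (cases "r \<in> A")
        case True
        have "(\<integral>\<^sup>+u. ennreal B \<partial>sg) \<le> (\<integral>\<^sup>+u. F r u \<partial>sg)"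
          by (rule nn_integral_mono_AE) (use AE_sg assms(3)[OF True] elim in \<open>auto elim!: eventually_mono\<close>)
        then show ?thesis using True by simp
      qed simp
    qed
  qed
  then show ?thesis by (simp only: nn_integral_mass[OF assms(1,2)])
qed

context
  fixes h :: "complex \<Rightarrow> complex" and s b :: real and A :: "real set"
  assumes h: "continuous_on (ball 0 1) h" and s: "0 < s" 
    and A: "A \<in> sets borel" "\<And>r. r \<in> A \<Longrightarrow> r \<le> b" and b: "b < 1" and mA: "0 < measure mu A"
begin

lemma mass_pos: "0 < mass A"
  using mA sg_pos by (simp add: mass_def)

lemma avg_int_bound: obtains B where "0 \<le> B" "\<And>x. avg_int h s A x \<le> ennreal B"
proof -
  obtain B where B: "0 \<le> B" "\<And>z. norm z \<le> b \<Longrightarrow> norm (h z) \<le> B"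
    using continuous_on_cball_bound[OF h b] by blast
  have "avg_int h s A x \<le> ennreal (B powr s * mass A)" for x
    unfolding avg_int_def
  proof (rule nn_integral_mass_mono_bound[OF A(1)])
    fix r u assume r: "r \<in> A" "0 < r" "r < 1"
    have "norm (trunc h (pt x r u)) \<le> B"
      using B A(2)[OF r(1)] r by (auto simp: trunc_def norm_pt)
    then show "ennreal (norm (trunc h (pt x r u)) powr s) \<le> ennreal (B powr s)"
      using s by (intro ennreal_leI powr_mono2) auto
  qed simp
  then show ?thesis by (intro that[of "B powr s * mass A"]) (use mass_pos in auto)
qed

lemma ennreal_gav: "ennreal (mass A * gav h s A x) = avg_int h s A x"
proof -
  obtain B where "avg_int h s A x \<le> ennreal B" using avg_int_bound by blast
  then have "avg_int h s A x < \<infinity>" by (simp add: le_less_trans)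
  then show ?thesis using mass_pos by (simp add: gav_def)
qed

lemma gav_nonneg: "0 \<le> gav h s A x" using mass_pos by (simp add: gav_def)

lemma bdd_gav: "G0.bdd (gav h s A)"
proof -
  obtain B where B: "0 \<le> B" "\<And>x. avg_int h s A x \<le> ennreal B" using avg_int_bound by blast
  show ?thesis
  proof (rule G0.bddI)
    have m: "(\<lambda>x. avg_int h s A x) \<in> borel_measurable borel"
      unfolding avg_int_def by (rule norm_trunc_measurable_x[OF h A(1)])
    show "gav h s A \<in> borel_measurable circle"
      unfolding gav_def[abs_def]
      by (intro measurable_circle borel_measurable_divide borel_measurable_const borel_measurable_enn2real m)
    have "enn2real (avg_int h s A x) \<le> B" for x using B by (intro enn2real_leI) auto
    then show "gav h s A x \<le> B / mass A" for x using mass_pos unfolding gav_def by (intro divide_right_mono) auto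
  qed (rule gav_nonneg)
qed

text \<open>Jensen's inequality for the product of \<open>mu\<close> on \<open>A\<close> with
  \<open>sg\<close>, by integrating the tangent line inequality of \<open>t powr a\<close> at the
  mean value \<open>y\<close>.\<close>

lemma gav_Jensen:
  assumes a: "1 \<le> a"
  shows "ennreal (mass A * gav h s A x powr a) \<le> avg_int h (s * a) A x"
proof -
  define y where "y = gav h s A x"
  have y0: "0 \<le> y" unfolding y_def by (rule gav_nonneg)
  define k where "k = a * y powr (a - 1)"
  have k: "0 \<le> k" using a by (simp add: k_def)
  define T where "T r u = norm (trunc h (pt x r u)) powr s" for r u
  have Tm [measurable]: "(\<lambda>u. ennreal (T r u)) \<in> borel_measurable sg" for r
    unfolding T_def by (rule norm_trunc_measurable_u[OF h])
  have Tm2: "(\<lambda>r. \<integral>\<^sup>+u. ennreal (T r u) \<partial>sg) \<in> borel_measurable mu"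
    unfolding T_def by (rule norm_trunc_measurable_r[OF h])
  define S where "S r u = norm (trunc h (pt x r u)) powr (s * a)" for r u
  have Sm [measurable]: "(\<lambda>u. ennreal (S r u)) \<in> borel_measurable sg" for r
    unfolding S_def by (rule norm_trunc_measurable_u[OF h])
  have Sm2: "(\<lambda>r. \<integral>\<^sup>+u. ennreal (S r u) \<partial>sg) \<in> borel_measurable mu"
    unfolding S_def by (rule norm_trunc_measurable_r[OF h])
  have ind [measurable]: "indicator A \<in> borel_measurable mu" using A(1) by simp
  have "ennreal k * avg_int h s A x = (\<integral>\<^sup>+r\<in>A. (\<integral>\<^sup>+u. ennreal (k * T r u) \<partial>sg) \<partial>mu)"
    unfolding avg_int_def T_def[symmetric]
    using Tm2 k by (simp add: nn_integral_cmult ennreal_mult' mult.assoc)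
  also have "\<dots> \<le> (\<integral>\<^sup>+r\<in>A. (\<integral>\<^sup>+u. ennreal (S r u) + ennreal ((a - 1) * y powr a) \<partial>sg) \<partial>mu)"
  proof (intro nn_integral_mono mult_right_mono)
    fix r u
    have "k * T r u \<le> S r u + (a - 1) * y powr a"
      using Young_powr[OF a, of "T r u" y] y0 by (simp add: k_def T_def S_def powr_powr mult.commute mult.left_commute)
    then have "ennreal (k * T r u) \<le> ennreal (S r u + (a - 1) * y powr a)" by (rule ennreal_leI)
    also have "\<dots> = ennreal (S r u) + ennreal ((a - 1) * y powr a)"
      using a by (intro ennreal_plus) (auto simp: S_def)
    finally show "ennreal (k * T r u) \<le> ennreal (S r u) + ennreal ((a - 1) * y powr a)" .
  qed simp
  also have "\<dots> = (\<integral>\<^sup>+r\<in>A. (\<integral>\<^sup>+u. ennreal (S r u) \<partial>sg) \<partial>mu) + (\<integral>\<^sup>+r\<in>A. (\<integral>\<^sup>+u. ennreal ((a - 1) * y powr a) \<partial>sg) \<partial>mu)"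
    using Sm2 by (subst nn_integral_add[symmetric]) (auto simp: nn_integral_add distrib_right)
  also have "(\<integral>\<^sup>+r\<in>A. (\<integral>\<^sup>+u. ennreal ((a - 1) * y powr a) \<partial>sg) \<partial>mu) = ennreal ((a - 1) * y powr a * mass A)"
    using a by (intro nn_integral_mass A) auto
  also have "(\<integral>\<^sup>+r\<in>A. (\<integral>\<^sup>+u. ennreal (S r u) \<partial>sg) \<partial>mu) = avg_int h (s * a) A x"
    by (simp add: avg_int_def S_def)
  finally have 1: "ennreal k * avg_int h s A x \<le> avg_int h (s * a) A x + ennreal ((a - 1) * y powr a * mass A)" .
  have "ennreal k * avg_int h s A x = ennreal (a * (mass A * y powr a))"
  proof -
    have "k * (mass A * y) = a * (mass A * (y * y powr (a - 1)))" by (simp add: k_def)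
    also have "y * y powr (a - 1) = y powr a" using y0 by (simp add: powr_mult_base)
    finally have e: "k * (mass A * y) = a * (mass A * y powr a)" .
    have "ennreal k * ennreal (mass A * y) = ennreal (k * (mass A * y))"
      using k by (rule ennreal_mult'[symmetric])
    then show ?thesis unfolding ennreal_gav[symmetric] y_def[symmetric] e .
  qed
  with 1 have 2: "ennreal (a * (mass A * y powr a)) \<le> avg_int h (s * a) A x + ennreal ((a - 1) * y powr a * mass A)" by simp
  show ?thesis
  proof (cases "avg_int h (s * a) A x")
    case (real I)
    have "ennreal (a * (mass A * y powr a)) \<le> ennreal (I + (a - 1) * y powr a * mass A)"
      using 2 real a mass_pos by (subst ennreal_plus) auto
    then have "a * (mass A * y powr a) \<le> I + (a - 1) * y powr a * mass A"
      using real a mass_pos by (subst (asm) ennreal_le_iff) auto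
    then have "mass A * y powr a \<le> I" by (simp add: algebra_simps)
    then show ?thesis using real by (simp add: y_def[symmetric] ennreal_leI)
  qed simp
qed

end

end

section \<open>Mixed norms of weights in the doubling classes\<close>

lemma suminf_ennreal_atMost: "(\<Sum>n. f n :: ennreal) = (SUP N. \<Sum>n\<le>N. f n)"
proof -
  have "(\<lambda>N. \<Sum>n\<le>N. f n) \<longlonglongrightarrow> (\<Sum>n. f n)" by (rule summable_LIMSEQ'[OF summableI])
  moreover have "(\<lambda>N. \<Sum>n\<le>N. f n) \<longlonglongrightarrow> (SUP N. \<Sum>n\<le>N. f n)"
    by (intro LIMSEQ_SUP incseq_SucI) (simp add: le_iff_add)
  ultimately show ?thesis by (rule LIMSEQ_unique)
qed

text \<open>Both tail conditions, read at the distances \<open>(1/2) ^ (l * n)\<close>. The step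
  \<open>l\<close> will be so large that one step passes the factor \<open>K\<close> of the decay
  condition; doubling over one step then costs a power of its constant.\<close>

locale mixed_norm_D = mixed_norm +
  fixes l :: nat and lam A0 :: real
  assumes l: "1 \<le> l" and lam: "0 < lam" "lam < 1" and A0: "1 \<le> A0"
    and mh_decay: "\<And>n. mh ((1/2) ^ (l * Suc n)) \<le> lam * mh ((1/2) ^ (l * n))"
    and mh_doubling: "\<And>n. mh ((1/2) ^ (l * n)) \<le> A0 * mh ((1/2) ^ (l * Suc n))"
begin

section \<open>Rings and their masses\<close>

definition dn :: "nat \<Rightarrow> real" where "dn n = (1/2) ^ (l * n)"
definition ring :: "nat \<Rightarrow> real set" where "ring n = {1 - dn n..<1 - dn (Suc n)}"
definition wt :: "nat \<Rightarrow> real" where "wt n = mh (dn n)"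
text \<open>Half the ratio of consecutive distances. Radii of ring \<open>n\<close> stay at least
  \<open>2 * cc * dn n\<close> away from the circle, so discs reaching half way to the circle still
  keep the distance \<open>cc * dn n\<close>.\<close>

definition cc :: real where "cc = (1/2) ^ (l + 1)"

lemma dn_pos: "0 < dn n" and dn_le1: "dn n \<le> 1" 
  by (simp_all add: dn_def power_le_one)

lemma dn_0 [simp]: "dn 0 = 1" by (simp add: dn_def)

lemma dn_add: "dn (n + m) = dn n * (1/2) ^ (l * m)"
  by (simp add: dn_def power_add[symmetric] distrib_left)

lemma dn_Suc: "dn (Suc n) = dn n * (2 * cc)"
  using dn_add[of n 1] by (simp add: cc_def)

lemma dn_mono: "m \<le> n \<Longrightarrow> dn n \<le> dn m"
  unfolding dn_def by (intro power_decreasing mult_left_mono) auto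

lemma cc: "0 < cc" "cc \<le> 1" unfolding cc_def by (simp, intro power_le_one) auto

text \<open>Three steps suffice for every \<open>l >= 1\<close>, as \<open>3 * l >= l + 2\<close>.
  This places ring \<open>n + 3\<close> outside the points to be estimated on ring \<open>n\<close>,
  with the margin that the Poisson kernel estimate requires of \<open>r\<close>.\<close>

lemma dn_3: "dn (n + 3) \<le> cc / 2 * dn n"
proof -
  have "(1/2::real) ^ (l * 3) \<le> (1/2) ^ (l + 2)" using l by (intro power_decreasing) auto
  also have "\<dots> = cc / 2" by (simp add: cc_def)
  finally have "dn n * (1/2) ^ (l * 3) \<le> dn n * (cc / 2)" using dn_pos[of n] by (intro mult_left_mono) auto
  then show ?thesis unfolding dn_add[of n 3] by (simp add: mult.commute)
qed

lemma ring_sets [measurable]: "ring n \<in> sets borel" by (simp add: ring_def)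

lemma ringD: "r \<in> ring n \<Longrightarrow> 1 - dn n \<le> r" "r \<in> ring n \<Longrightarrow> r < 1 - dn (Suc n)" "r \<in> ring n \<Longrightarrow> 0 \<le> r" "r \<in> ring n \<Longrightarrow> r < 1"
  using dn_le1[of n] dn_pos[of "Suc n"] by (auto simp: ring_def)

lemma wt_pos: "0 < wt n" unfolding wt_def mh_def by (intro mu_pos dn_pos)

lemma measure_ring: "measure mu (ring n) = wt n - wt (Suc n)"
proof -
  have "ring n = {1 - dn n..<1} - {1 - dn (Suc n)..<1}"
    using dn_pos[of "Suc n"] by (auto simp: ring_def)
  moreover have "measure mu ({1 - dn n..<1} - {1 - dn (Suc n)..<1}) = measure mu {1 - dn n..<1} - measure mu {1 - dn (Suc n)..<1}"
    using dn_mono[of n "Suc n"] by (intro mu.finite_measure_Diff) auto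
  ultimately show ?thesis by (simp add: wt_def mh_def)
qed

text \<open>Decay in the form that permits averaging over a ring: the tail beyond the ring is too
  small to hold all the mass.\<close>

lemma ring_ge: "(1 - lam) * wt n \<le> measure mu (ring n)"
  using mh_decay[of n] unfolding measure_ring by (simp add: wt_def dn_def algebra_simps)

lemma ring_le: "measure mu (ring n) \<le> wt n"
  using wt_pos[of "Suc n"] unfolding measure_ring by simp

lemma ring_pos: "0 < measure mu (ring n)"
  using ring_ge[of n] wt_pos[of n] lam by (smt (verit) mult_pos_pos)

text \<open>Doubling, in the form that pays for the passage from ring \<open>n\<close> to ring
  \<open>n + 3\<close>.\<close>

lemma wt_3: "wt n \<le> A0 ^ 3 * wt (n + 3)"
proof -
  have 1: "wt m \<le> A0 * wt (Suc m)" for m using mh_doubling[of m] by (simp add: wt_def dn_def)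
  have "wt n \<le> A0 * wt (Suc n)" by (rule 1)
  also have "\<dots> \<le> A0 * (A0 * wt (Suc (Suc n)))" using A0 by (intro mult_left_mono 1) auto
  also have "\<dots> \<le> A0 * (A0 * (A0 * wt (Suc (Suc (Suc n)))))" using A0 by (intro mult_left_mono 1) auto
  finally show ?thesis by (simp add: power3_eq_cube numeral_3_eq_3 mult.assoc)
qed

lemma wt_decay: "m \<le> n \<Longrightarrow> wt n \<le> lam ^ (n - m) * wt m"
proof (induction n)
  case (Suc n)
  show ?case
  proof (cases "m = Suc n")
    case False
    then have m: "m \<le> n" using Suc by simp
    have "wt (Suc n) \<le> lam * wt n" using mh_decay[of n] by (simp add: wt_def dn_def)
    also have "\<dots> \<le> lam * (lam ^ (n - m) * wt m)" using lam Suc m by (intro mult_left_mono) auto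
    finally show ?thesis using m by (simp add: Suc_diff_le)
  qed simp
qed simp

lemma ring_bound: "r \<in> ring n \<Longrightarrow> r \<le> 1 - dn (Suc n)" "1 - dn (Suc n) < 1"
  using dn_pos[of "Suc n"] by (auto simp: ring_def)

lemma mass_ring_pos: "0 < mass (ring n)"
  using ring_pos sg_pos by (simp add: mass_def)

lemma bdd_gav_ring:
  assumes "continuous_on (ball 0 1) h" "0 < s" shows "G0.bdd (gav h s (ring n))"
  by (rule bdd_gav[OF assms ring_sets ring_bound ring_pos])

text \<open>Fubini in the three variables \<open>y\<close>, \<open>u\<close>, \<open>r\<close>; for
  fixed \<open>x\<close> the kernel depends on \<open>y\<close> alone and is pulled out.\<close>

lemma avg_int_swap:
  assumes h: "continuous_on (ball 0 1) h"
  shows "(\<integral>\<^sup>+r\<in>ring n. (\<integral>\<^sup>+u. (\<integral>\<^sup>+y. ennreal (peak L x y * norm (trunc h (pt y r u)) powr s) \<partial>circle) \<partial>sg) \<partial>mu)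
    = (\<integral>\<^sup>+y. ennreal (peak L x y) * avg_int h s (ring n) y \<partial>circle)"
proof -
  have [measurable]: "cis \<in> borel_measurable borel"
    by (intro borel_measurable_continuous_onI continuous_intros)
  note [measurable] = trunc_measurable[OF h]
  have pk [measurable]: "peak L x \<in> borel_measurable borel" unfolding peak_def by measurable
  have pk0: "0 \<le> peak L x y" for y by (simp add: peak_def)
  interpret ps: pair_sigma_finite lborel sg by unfold_locales
  interpret pm: pair_sigma_finite lborel mu by unfold_locales
  define T where "T y r u = ennreal (norm (trunc h (pt y r u)) powr s)" for y r u
  have Tm: "(\<lambda>w. T (a w) (b w) (c w)) \<in> borel_measurable N"
    if "a \<in> borel_measurable N" "b \<in> borel_measurable N" "c \<in> borel_measurable N" for a b c :: "'z \<Rightarrow> real" and N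
    using that unfolding T_def pt_def by measurable
  have "(\<integral>\<^sup>+r\<in>ring n. (\<integral>\<^sup>+u. (\<integral>\<^sup>+y. ennreal (peak L x y * norm (trunc h (pt y r u)) powr s) \<partial>circle) \<partial>sg) \<partial>mu) =
    (\<integral>\<^sup>+r. (\<integral>\<^sup>+u. (\<integral>\<^sup>+y. ennreal (peak L x y) * T y r u * indicator {0..<1} y \<partial>lborel) \<partial>sg) * indicator (ring n) r \<partial>mu)"
    unfolding nn_integral_circle using pk0 by (simp add: T_def ennreal_mult')
  also have "\<dots> = (\<integral>\<^sup>+r. (\<integral>\<^sup>+y. (\<integral>\<^sup>+u. ennreal (peak L x y) * T y r u * indicator {0..<1} y \<partial>sg) \<partial>lborel) * indicator (ring n) r \<partial>mu)"
    by (intro nn_integral_cong arg_cong2[where f="(*)"] refl ps.Fubini') (measurable, intro Tm, measurable)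
  also have "\<dots> = (\<integral>\<^sup>+r. (\<integral>\<^sup>+y. ennreal (peak L x y) * (\<integral>\<^sup>+u. T y r u \<partial>sg) * indicator {0..<1} y * indicator (ring n) r \<partial>lborel) \<partial>mu)"
  proof (intro nn_integral_cong)
    fix r
    have 1: "(\<lambda>y. \<integral>\<^sup>+u. T y r u \<partial>sg) \<in> borel_measurable lborel"
      by (intro sg.borel_measurable_nn_integral) (simp add: split_beta', intro Tm, measurable)
    have 2: "(\<lambda>u. T y r u) \<in> borel_measurable sg" for y by (intro Tm) measurable
    have "(\<integral>\<^sup>+u. ennreal (peak L x y) * T y r u * indicator {0..<1} y \<partial>sg) = ennreal (peak L x y) * (\<integral>\<^sup>+u. T y r u \<partial>sg) * indicator {0..<1} y" for y
      using 2 by (simp add: nn_integral_cmult nn_integral_multc)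
    then show "(\<integral>\<^sup>+y. (\<integral>\<^sup>+u. ennreal (peak L x y) * T y r u * indicator {0..<1} y \<partial>sg) \<partial>lborel) * indicator (ring n) r =
      (\<integral>\<^sup>+y. ennreal (peak L x y) * (\<integral>\<^sup>+u. T y r u \<partial>sg) * indicator {0..<1} y * indicator (ring n) r \<partial>lborel)"
      using 1 by (simp add: nn_integral_multc)
  qed
  also have "\<dots> = (\<integral>\<^sup>+y. (\<integral>\<^sup>+r. ennreal (peak L x y) * (\<integral>\<^sup>+u. T y r u \<partial>sg) * indicator {0..<1} y * indicator (ring n) r \<partial>mu) \<partial>lborel)"
  proof (rule pm.Fubini')
    have "(\<lambda>w. \<integral>\<^sup>+u. T (fst w) (snd w) u \<partial>sg) \<in> borel_measurable (lborel \<Otimes>\<^sub>M mu)"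
      by (intro sg.borel_measurable_nn_integral) (simp add: split_beta', intro Tm, measurable)
    then show "(\<lambda>(y, r). ennreal (peak L x y) * (\<integral>\<^sup>+u. T y r u \<partial>sg) * indicator {0..<1} y * indicator (ring n) r) \<in> borel_measurable (lborel \<Otimes>\<^sub>M mu)"
      by (simp add: split_beta')
  qed
  also have "\<dots> = (\<integral>\<^sup>+y. ennreal (peak L x y) * avg_int h s (ring n) y * indicator {0..<1} y \<partial>lborel)"
  proof (intro nn_integral_cong)
    fix y
    have "(\<lambda>r. \<integral>\<^sup>+u. T y r u \<partial>sg) \<in> borel_measurable mu"
      by (intro sg.borel_measurable_nn_integral) (simp add: split_beta', intro Tm, measurable)
    moreover have "indicator (ring n) \<in> borel_measurable mu" by simp
    ultimately have "(\<lambda>r. (\<integral>\<^sup>+u. T y r u \<partial>sg) * indicator (ring n) r) \<in> borel_measurable mu"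
      by (rule borel_measurable_times_ennreal)
    then have "(\<integral>\<^sup>+r. (ennreal (peak L x y) * indicator {0..<1} y) * ((\<integral>\<^sup>+u. T y r u \<partial>sg) * indicator (ring n) r) \<partial>mu) =
      (ennreal (peak L x y) * indicator {0..<1} y) * (\<integral>\<^sup>+r. (\<integral>\<^sup>+u. T y r u \<partial>sg) * indicator (ring n) r \<partial>mu)"
      by (rule nn_integral_cmult)
    then show "(\<integral>\<^sup>+r. ennreal (peak L x y) * (\<integral>\<^sup>+u. T y r u \<partial>sg) * indicator {0..<1} y * indicator (ring n) r \<partial>mu) =
      ennreal (peak L x y) * avg_int h s (ring n) y * indicator {0..<1} y"
      by (simp add: avg_int_def T_def mult_ac)
  qed
  finally show ?thesis by (simp add: nn_integral_circle)
qed

section \<open>Ring means as pointwise majorants\<close>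

definition Cf :: real where "Cf = pcst cc * 9"

lemma Cf_pos: "0 < Cf"
proof -
  have "0 < 1 + 10 / cc" using cc by (simp add: add_pos_pos)
  then show ?thesis unfolding Cf_def pcst_def by (simp del: zero_less_power2)
qed

text \<open>The kernel estimate holds for every radius of ring \<open>n + 3\<close> and every offset
  \<open>u\<close>, so it may be averaged against \<open>mu\<close> and \<open>sg\<close>. After
  exchanging integrals the kernel acts on the mean \<open>gav\<close>, and the dyadic grids take
  over.\<close>

lemma norm_powr_le_favg:
  assumes h: "h holomorphic_on ball 0 1" and s: "0 < s" and x: "x \<in> {0..<1}"
    and w: "norm (w - cis (2 * pi * x)) \<le> 3 * dn n" "norm w \<le> 1 - cc * dn n"
  shows "norm (h w) powr s \<le> Cf * favg (l * n) (gav h s (ring (n + 3))) x"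
proof -
  define R where "R = ring (n + 3)"
  define L where "L = l * n"
  have hc: "continuous_on (ball 0 1) h" using h by (rule holomorphic_on_imp_continuous_on)
  have pc: "0 \<le> pcst cc" by (simp add: pcst_def)
  have mR: "0 < mass R" unfolding R_def by (rule mass_ring_pos)
  have bg: "G0.bdd (gav h s R)" unfolding R_def by (rule bdd_gav_ring[OF hc s])
  have eg: "ennreal (mass R * gav h s R y) = avg_int h s R y" for y
    unfolding R_def by (rule ennreal_gav[OF hc s ring_sets ring_bound ring_pos])
  have "ennreal (norm (h w) powr s * mass R) \<le> (\<integral>\<^sup>+r\<in>R. (\<integral>\<^sup>+u. ennreal (pcst cc) * (\<integral>\<^sup>+y. ennreal (peak L x y * norm (trunc h (pt y r u)) powr s) \<partial>circle) \<partial>sg) \<partial>mu)"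
  proof (rule nn_integral_mass_lower_bound)
    show "R \<in> sets borel" by (simp add: R_def)
    fix r u :: real assume r: "r \<in> R" "0 < r" "r < 1" and u: "\<bar>u\<bar> \<le> 1"
    have "trunc h (pt y r u) = h (pt y r u)" for y using r by (simp add: trunc_def norm_pt)
    moreover have "ennreal (norm (h w) powr s) \<le> ennreal (pcst cc) * (\<integral>\<^sup>+y. ennreal (peak L x y * norm (h (pt y r u)) powr s) \<partial>circle)"
      by (rule norm_powr_le_peak[OF h s cc])
         (use w r u ringD(1)[of r "n+3"] dn_3[of n] in \<open>auto simp: L_def dn_def R_def\<close>)
    ultimately show "ennreal (norm (h w) powr s) \<le> ennreal (pcst cc) * (\<integral>\<^sup>+y. ennreal (peak L x y * norm (trunc h (pt y r u)) powr s) \<partial>circle)" by simp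
  qed simp
  also have "\<dots> = ennreal (pcst cc) * (\<integral>\<^sup>+r\<in>R. (\<integral>\<^sup>+u. (\<integral>\<^sup>+y. ennreal (peak L x y * norm (trunc h (pt y r u)) powr s) \<partial>circle) \<partial>sg) \<partial>mu)"
  proof -
    have [measurable]: "cis \<in> borel_measurable borel"
      by (intro borel_measurable_continuous_onI continuous_intros)
    note [measurable] = trunc_measurable[OF hc]
    have pk [measurable]: "peak L x \<in> borel_measurable borel" unfolding peak_def by measurable
    have 1: "(\<lambda>w. \<integral>\<^sup>+y. ennreal (peak L x y * norm (trunc h (pt y (fst w) (snd w))) powr s) \<partial>circle) \<in> borel_measurable (mu \<Otimes>\<^sub>M sg)"
      unfolding nn_integral_circle pt_def by measurable
    have 2: "(\<lambda>u. \<integral>\<^sup>+y. ennreal (peak L x y * norm (trunc h (pt y r u)) powr s) \<partial>circle) \<in> borel_measurable sg" for r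
      unfolding nn_integral_circle pt_def by measurable
    have 3: "(\<lambda>r. \<integral>\<^sup>+u. \<integral>\<^sup>+y. ennreal (peak L x y * norm (trunc h (pt y r u)) powr s) \<partial>circle \<partial>sg) \<in> borel_measurable mu"
      using 1 by (intro sg.borel_measurable_nn_integral) (simp add: split_beta')
    have RS [measurable]: "R \<in> sets borel" by (simp add: R_def)
    have "(\<integral>\<^sup>+r\<in>R. (\<integral>\<^sup>+u. ennreal (pcst cc) * (\<integral>\<^sup>+y. ennreal (peak L x y * norm (trunc h (pt y r u)) powr s) \<partial>circle) \<partial>sg) \<partial>mu) =
      (\<integral>\<^sup>+r. ennreal (pcst cc) * ((\<integral>\<^sup>+u. (\<integral>\<^sup>+y. ennreal (peak L x y * norm (trunc h (pt y r u)) powr s) \<partial>circle) \<partial>sg) * indicator R r) \<partial>mu)"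
      using 2 by (simp add: nn_integral_cmult mult.assoc)
    then show ?thesis using 3 by (simp add: nn_integral_cmult)
  qed
  also have "(\<integral>\<^sup>+r\<in>R. (\<integral>\<^sup>+u. (\<integral>\<^sup>+y. ennreal (peak L x y * norm (trunc h (pt y r u)) powr s) \<partial>circle) \<partial>sg) \<partial>mu) =
    (\<integral>\<^sup>+y. ennreal (peak L x y) * avg_int h s R y \<partial>circle)"
    unfolding R_def by (rule avg_int_swap[OF hc])
  also have "\<dots> = (\<integral>\<^sup>+y. ennreal (peak L x y * (mass R * gav h s R y)) \<partial>circle)"
    unfolding eg[symmetric] by (intro nn_integral_cong ennreal_mult'[symmetric]) (simp add: peak_def)
  also have "\<dots> \<le> ennreal (9 * favg L (\<lambda>y. mass R * gav h s R y) x)"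
    using mR x by (intro nn_integral_peak_le G0.bdd_mult[OF G0.bdd_const] bg) auto
  also have "favg L (\<lambda>y. mass R * gav h s R y) x = mass R * favg L (gav h s R) x"
    by (simp add: favg_def G0.cavg_cmult G1.cavg_cmult sum_distrib_left distrib_left mult.assoc mult.left_commute)
  finally have "ennreal (norm (h w) powr s * mass R) \<le> ennreal (pcst cc) * ennreal (9 * (mass R * favg L (gav h s R) x))"
    by (simp add: mult_left_mono)
  also have "\<dots> = ennreal (Cf * favg L (gav h s R) x * mass R)"
    using pc by (simp add: ennreal_mult'[symmetric] Cf_def mult_ac)
  finally have "norm (h w) powr s * mass R \<le> Cf * favg L (gav h s R) x * mass R"
    using mR Cf_pos favg_nonneg[OF bg] by (subst (asm) ennreal_le_iff) auto
  then show ?thesis using mR by (simp add: L_def R_def)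
qed

text \<open>\<open>aa\<close> is the exponent of the vector-valued inequality for
  \<open>c = q / p\<close>. Means are formed of the subharmonic function \<open>|h|^ss\<close>, and
  the power \<open>aa\<close> of the mean restores the exponent \<open>p\<close>.\<close>

definition aa :: real where "aa = max 1 (2 / (q / p) - 1)"
definition ss :: real where "ss = p / aa"

lemma aa: "1 \<le> aa" by (simp add: aa_def)
lemma ss: "0 < ss" "ss * aa = p" using aa p by (auto simp: ss_def)

text \<open>Up to a constant, a bound for \<open>|h|^p\<close> on the part of the disc at distance
  about \<open>dn n\<close> from \<open>cis (2 * pi * x)\<close>.\<close>

definition Kn :: "(complex \<Rightarrow> complex) \<Rightarrow> nat \<Rightarrow> real \<Rightarrow> real" where
  "Kn h n x = favg (l * n) (gav h ss (ring (n + 3))) x powr aa"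

text \<open>Up to a constant, a discrete majorant of the inner integral of \<open>wd h kap\<close>:
  on ring \<open>n\<close> the factor \<open>(1 - r) ^ kap\<close> is at most
  \<open>dn n ^ kap\<close>, and the mass of the ring is at most that of the whole tail,
  \<open>wt n\<close>.\<close>

definition Phi :: "(complex \<Rightarrow> complex) \<Rightarrow> nat \<Rightarrow> real \<Rightarrow> ennreal" where
  "Phi h kap x = (\<Sum>n. ennreal (wt n * (dn n ^ kap) powr p * Kn h n x))"

lemma Kn_nonneg: "0 \<le> Kn h n x" by (simp add: Kn_def)

lemma norm_powr_le_Kn:
  assumes h: "h holomorphic_on ball 0 1" and x: "x \<in> {0..<1}"
    and w: "norm (w - cis (2 * pi * x)) \<le> 3 * dn n" "norm w \<le> 1 - cc * dn n"
  shows "norm (h w) powr p \<le> Cf powr aa * Kn h n x"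
proof -
  have hc: "continuous_on (ball 0 1) h" using h by (rule holomorphic_on_imp_continuous_on)
  have "(norm (h w) powr ss) powr aa \<le> (Cf * favg (l * n) (gav h ss (ring (n + 3))) x) powr aa"
    using norm_powr_le_favg[OF h ss(1) x w] aa by (intro powr_mono2) auto
  also have "\<dots> = Cf powr aa * Kn h n x"
    unfolding Kn_def using Cf_pos favg_nonneg[OF bdd_gav_ring[OF hc ss(1)]] by (intro powr_mult)
  finally show ?thesis by (simp add: powr_powr ss)
qed

lemma inner_eq_suminf:
  assumes hc: "continuous_on (ball 0 1) h"
  shows "inner h x = (\<Sum>n. avg_int h p (ring n) x)"
proof -
  have disj: "disjoint_family ring"
  proof -
    have "ring m \<inter> ring n = {}" if "m < n" for m n
      using that dn_mono[of "Suc m" n] by (auto simp: ring_def)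
    then show ?thesis unfolding disjoint_family_on_def by (metis Int_commute linorder_neqE_nat)
  qed
  have U: "r \<in> (\<Union>n. ring n)" if "0 < r" "r < 1" for r
  proof -
    have "\<exists>N. (1/2::real) ^ N < 1 - r" using real_arch_pow_inv[of "1 - r" "1/2"] that by simp
    then obtain N where "(1/2::real) ^ N < 1 - r" by blast
    moreover have "(1/2::real) ^ (l * N) \<le> (1/2) ^ N" using l by (intro power_decreasing) auto
    ultimately have "dn N < 1 - r" unfolding dn_def by linarith
    then have ex: "\<exists>n. r < 1 - dn n" by (intro exI[of _ N]) simp
    define n where "n = (LEAST n. r < 1 - dn n)"
    have n: "r < 1 - dn n" unfolding n_def by (rule LeastI_ex[OF ex])
    have "n \<noteq> 0" using n that by (intro notI) simp
    then obtain k where k: "n = Suc k" by (cases n) auto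
    have "\<not> r < 1 - dn k" using not_less_Least[of k "\<lambda>n. r < 1 - dn n"] k by (simp add: n_def)
    then have "r \<in> ring k" using n k by (simp add: ring_def)
    then show ?thesis by blast
  qed
  define G where "G r = (\<integral>\<^sup>+u. ennreal (norm (trunc h (pt x r u)) powr p) \<partial>sg)" for r
  have G [measurable]: "G \<in> borel_measurable mu" unfolding G_def[abs_def] by (rule norm_trunc_measurable_r[OF hc])
  have "inner h x = (\<integral>\<^sup>+r\<in>(\<Union>n. ring n). G r \<partial>mu)"
    unfolding inner_def G_def[symmetric]
  proof (rule nn_integral_cong_AE)
    show "AE r in mu. G r = G r * indicator (\<Union>n. ring n) r"
      using AE_mu
    proof eventually_elim
      case (elim r)
      then have "indicator (\<Union>n. ring n) r = (1::ennreal)" using U[of r] by (intro indicator_eq_1_iff[THEN iffD2]) auto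
      then show ?case by simp
    qed
  qed
  also have "\<dots> = (\<Sum>n. \<integral>\<^sup>+r\<in>ring n. G r \<partial>mu)"
    by (rule nn_integral_disjoint_family) (auto simp: disj)
  finally show ?thesis by (simp add: avg_int_def G_def)
qed

text \<open>Ring \<open>n + 3\<close> ends at the distance \<open>dn (n + 4)\<close>, which explains
  the four steps in the constant \<open>2 ^ (4 * l)\<close>.\<close>

lemma avg_int_wd_le:
  assumes hc: "continuous_on (ball 0 1) h"
  shows "ennreal ((dn n ^ kap) powr p) * avg_int h p (ring (n + 3)) x
     \<le> ennreal (((2 ^ (4 * l)) ^ kap) powr p) * avg_int (wd h kap) p (ring (n + 3)) x"
proof -
  define B where "B = (((2::real) ^ (4 * l)) ^ kap) powr p"
  have whc: "continuous_on (ball 0 1) (wd h kap)" by (rule wd_continuous[OF hc])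
  have pw: "(dn n ^ kap) powr p * norm (trunc h (pt x r u)) powr p \<le> B * norm (trunc (wd h kap) (pt x r u)) powr p"
    if r: "r \<in> ring (n + 3)" for r u
  proof -
    have r01: "0 \<le> r" "r < 1" using ringD[OF r] by auto
    have "dn (n + 4) \<le> 1 - r" using ringD(2)[OF r] by (simp add: numeral_eq_Suc)
    moreover have "dn n = 2 ^ (4 * l) * dn (n + 4)"
    proof -
      have "(2::real) ^ (4 * l) * (1/2) ^ (l * 4) = 1" by (simp add: mult.commute power_mult_distrib[symmetric])
      then show ?thesis unfolding dn_add[of n 4] by simp
    qed
    ultimately have "dn n \<le> 2 ^ (4 * l) * (1 - r)" by simp
    then have "dn n ^ kap \<le> (2 ^ (4 * l) * (1 - r)) ^ kap" using dn_pos[of n] by (intro power_mono) auto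
    then have "dn n ^ kap * norm (h (pt x r u)) \<le> (2 ^ (4 * l) * (1 - r)) ^ kap * norm (h (pt x r u))"
      by (intro mult_right_mono) auto
    also have "\<dots> = (2 ^ (4 * l)) ^ kap * norm (wd h kap (pt x r u))"
      using r01 by (subst norm_wd) (auto simp: norm_pt power_mult_distrib)
    finally have "(dn n ^ kap * norm (h (pt x r u))) powr p \<le> ((2 ^ (4 * l)) ^ kap * norm (wd h kap (pt x r u))) powr p"
      using p dn_pos[of n] by (intro powr_mono2) auto
    then have "(dn n ^ kap) powr p * norm (h (pt x r u)) powr p \<le> B * norm (wd h kap (pt x r u)) powr p"
      using dn_pos[of n] by (simp add: powr_mult B_def)
    then show ?thesis using r01 by (simp add: trunc_def norm_pt)
  qed
  have "ennreal ((dn n ^ kap) powr p) * avg_int h p (ring (n + 3)) x =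
    (\<integral>\<^sup>+r\<in>ring (n + 3). (\<integral>\<^sup>+u. ennreal ((dn n ^ kap) powr p * norm (trunc h (pt x r u)) powr p) \<partial>sg) \<partial>mu)"
    unfolding avg_int_def
    using norm_trunc_measurable_r[OF hc, of x p] norm_trunc_measurable_u[OF hc]
    by (simp add: ennreal_mult' nn_integral_cmult mult.assoc)
  also have "\<dots> \<le> (\<integral>\<^sup>+r\<in>ring (n + 3). (\<integral>\<^sup>+u. ennreal (B * norm (trunc (wd h kap) (pt x r u)) powr p) \<partial>sg) \<partial>mu)"
  proof (intro nn_integral_mono)
    fix r
    show "(\<integral>\<^sup>+u. ennreal ((dn n ^ kap) powr p * norm (trunc h (pt x r u)) powr p) \<partial>sg) * indicator (ring (n + 3)) r
      \<le> (\<integral>\<^sup>+u. ennreal (B * norm (trunc (wd h kap) (pt x r u)) powr p) \<partial>sg) * indicator (ring (n + 3)) r"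
      using pw[of r] by (cases "r \<in> ring (n + 3)") (auto intro!: nn_integral_mono ennreal_leI)
  qed
  also have "\<dots> = ennreal B * avg_int (wd h kap) p (ring (n + 3)) x"
    unfolding avg_int_def
    using norm_trunc_measurable_r[OF whc, of x p] norm_trunc_measurable_u[OF whc]
    by (simp add: B_def ennreal_mult' nn_integral_cmult mult.assoc)
  finally show ?thesis by (simp add: B_def)
qed

lemma sum_avg_int_le_inner:
  assumes hc: "continuous_on (ball 0 1) f"
  shows "(\<Sum>n\<le>N. avg_int f p (ring (n + 3)) x) \<le> inner f x"
proof -
  have "(\<Sum>n\<le>N. avg_int f p (ring (n + 3)) x) = (\<Sum>n\<in>(\<lambda>n. n + 3) ` {..N}. avg_int f p (ring n) x)"
    by (subst sum.reindex) (auto simp: inj_on_def)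
  also have "\<dots> \<le> (\<Sum>n. avg_int f p (ring n) x)" by (intro sum_le_suminf) auto
  finally show ?thesis by (simp add: inner_eq_suminf[OF hc])
qed

lemma Phi_measurable:
  assumes hc: "continuous_on (ball 0 1) h"
  shows "(\<lambda>x. ennreal (wt n * (dn n ^ kap) powr p * Kn h n x)) \<in> borel_measurable circle"
proof -
  have [measurable]: "favg (l * n) (gav h ss (ring (n + 3))) \<in> borel_measurable circle"
    by (rule G0.bdd_measurable[OF bdd_favg[OF bdd_gav_ring[OF hc ss(1)]]])
  show ?thesis unfolding Kn_def by measurable
qed

text \<open>The vector-valued inequality removes the smoothing \<open>favg\<close>, and Jensen's
  inequality turns the means on ring \<open>n + 3\<close> into integrals of \<open>|h|^p\<close>
  there. The estimate is made for partial sums, which are bounded functions, and the limit is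
  monotone.\<close>

lemma Phi_bound:
  obtains C where "0 < C" "\<And>h. h holomorphic_on ball 0 1 \<Longrightarrow>
     (\<integral>\<^sup>+x. ennreal_powr (Phi h kap x) (q / p) \<partial>circle) \<le> ennreal C * mnorm (wd h kap)"
proof -
  define c where "c = q / p"
  have c: "0 < c" using p q by (simp add: c_def)
  obtain C0 where C0: "0 < C0"
    "\<And>N v g L. (\<And>n. 0 \<le> v n) \<Longrightarrow> (\<And>n. G0.bdd (g n)) \<Longrightarrow> (\<And>n. L n \<le> L (Suc n)) \<Longrightarrow>
     (\<integral>x. (\<Sum>n\<le>(N::nat). v n * favg (L n) (g n) x powr aa) powr c \<partial>circle)
     \<le> C0 * (\<integral>x. (\<Sum>n\<le>N. v n * g n x powr aa) powr c \<partial>circle)"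
  proof (rule vector_favg[OF c])
    fix C assume "0 < C" and "\<And>N v g L. (\<And>n. 0 \<le> v n) \<Longrightarrow> (\<And>n. G0.bdd (g n)) \<Longrightarrow> (\<And>n. L n \<le> L (Suc n)) \<Longrightarrow>
     (\<integral>x. (\<Sum>n\<le>(N::nat). v n * favg (L n) (g n) x powr max 1 (2/c - 1)) powr c \<partial>circle)
     \<le> C * (\<integral>x. (\<Sum>n\<le>N. v n * g n x powr max 1 (2/c - 1)) powr c \<partial>circle)"
    then show thesis unfolding aa_def[folded c_def, symmetric] by (rule that)
  qed
  define B where "B = (((2::real) ^ (4 * l)) ^ kap) powr p"
  \<comment> \<open>\<open>A0 ^ 3\<close> moves the tail mass three rings outwards, and
    \<open>1 - lam\<close> compares that tail with its first ring.\<close>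
  define D where "D = A0 ^ 3 / ((1 - lam) * measure sg UNIV)"
  have D: "0 < D" using A0 lam sg_pos by (simp add: D_def)
  have B: "0 < B" by (simp add: B_def)
  define C where "C = C0 * (D * B) powr c"
  show thesis
  proof (rule that[of C])
    show "0 < C" using C0 D B by (simp add: C_def)
    fix h :: "complex \<Rightarrow> complex" assume h: "h holomorphic_on ball 0 1"
    have hc: "continuous_on (ball 0 1) h" using h by (rule holomorphic_on_imp_continuous_on)
    have whc: "continuous_on (ball 0 1) (wd h kap)" by (rule wd_continuous[OF hc])
    define g where "g n = gav h ss (ring (n + 3))" for n
    define v where "v n = wt n * (dn n ^ kap) powr p" for n
    have v: "0 \<le> v n" for n using wt_pos[of n] by (simp add: v_def)
    have bg: "G0.bdd (g n)" for n unfolding g_def by (rule bdd_gav_ring[OF hc ss(1)])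
    have aa0: "0 \<le> aa" using aa by simp
    have vD: "v n \<le> D * (dn n ^ kap) powr p * mass (ring (n + 3))" for n
    proof -
      have "wt n \<le> A0 ^ 3 * wt (n + 3)" by (rule wt_3)
      also have "\<dots> = D * (((1 - lam) * wt (n + 3)) * measure sg UNIV)" using lam sg_pos by (simp add: D_def)
      also have "\<dots> \<le> D * (measure mu (ring (n + 3)) * measure sg UNIV)"
        using D sg_pos by (intro mult_left_mono mult_right_mono ring_ge) auto
      finally have "wt n * (dn n ^ kap) powr p \<le> D * mass (ring (n + 3)) * (dn n ^ kap) powr p"
        by (intro mult_right_mono) (auto simp: mass_def)
      then show ?thesis by (simp add: v_def mult_ac)
    qed
    have gle: "ennreal (\<Sum>n\<le>N. v n * g n x powr aa) \<le> ennreal (D * B) * inner (wd h kap) x" for N x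
    proof -
      have "ennreal (v n * g n x powr aa) \<le> ennreal (D * B) * avg_int (wd h kap) p (ring (n + 3)) x" for n
      proof -
        have "v n * g n x powr aa \<le> D * ((dn n ^ kap) powr p * (mass (ring (n + 3)) * g n x powr aa))"
          using mult_right_mono[OF vD[of n], of "g n x powr aa"] by (simp add: mult_ac)
        then have "ennreal (v n * g n x powr aa) \<le> ennreal D * (ennreal ((dn n ^ kap) powr p) * ennreal (mass (ring (n + 3)) * g n x powr aa))"
          using D by (simp add: ennreal_mult'[symmetric] ennreal_leI)
        also have "\<dots> \<le> ennreal D * (ennreal ((dn n ^ kap) powr p) * avg_int h (ss * aa) (ring (n + 3)) x)"
          unfolding g_def by (intro mult_left_mono gav_Jensen[OF hc ss(1) ring_sets ring_bound ring_pos aa]) auto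
        also have "\<dots> \<le> ennreal D * (ennreal B * avg_int (wd h kap) p (ring (n + 3)) x)"
          unfolding ss(2) B_def by (intro mult_left_mono avg_int_wd_le[OF hc]) auto
        finally show ?thesis using D B by (simp add: ennreal_mult' mult.assoc)
      qed
      then have "(\<Sum>n\<le>N. ennreal (v n * g n x powr aa)) \<le> (\<Sum>n\<le>N. ennreal (D * B) * avg_int (wd h kap) p (ring (n + 3)) x)"
        by (intro sum_mono)
      also have "\<dots> \<le> ennreal (D * B) * inner (wd h kap) x"
        unfolding sum_distrib_left[symmetric] by (intro mult_left_mono sum_avg_int_le_inner[OF whc]) auto
      finally show ?thesis using v by (subst (asm) sum_ennreal) auto
    qed
    define S where "S N x = (\<Sum>n\<le>N. v n * Kn h n x)" for N x
    have bS: "G0.bdd (\<lambda>x. S N x powr c)" for N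
      unfolding S_def Kn_def using c bg[unfolded g_def]
      by (intro G0.bdd_powr G0.bdd_sum G0.bdd_mult[OF G0.bdd_const] bdd_favg v aa0) auto
    have fin: "(\<integral>\<^sup>+x. ennreal (S N x powr c) \<partial>circle) \<le> ennreal C * mnorm (wd h kap)" for N
    proof -
      have bG: "G0.bdd (\<lambda>x. (\<Sum>n\<le>N. v n * g n x powr aa) powr c)"
        using c by (intro G0.bdd_powr G0.bdd_sum G0.bdd_mult[OF G0.bdd_const] bg v aa0) auto
      have lm: "l * n \<le> l * Suc n" for n by simp
      have "(\<integral>\<^sup>+x. ennreal (S N x powr c) \<partial>circle) = ennreal (\<integral>x. S N x powr c \<partial>circle)"
        by (intro nn_integral_eq_integral G0.bdd_integrable bS) auto
      also have "\<dots> \<le> ennreal (C0 * (\<integral>x. (\<Sum>n\<le>N. v n * g n x powr aa) powr c \<partial>circle))"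
        unfolding S_def Kn_def g_def[symmetric] by (intro ennreal_leI C0(2) v bg lm)
      also have "\<dots> = ennreal C0 * (\<integral>\<^sup>+x. ennreal ((\<Sum>n\<le>N. v n * g n x powr aa) powr c) \<partial>circle)"
        using C0(1) by (subst nn_integral_eq_integral) (auto intro!: G0.bdd_integrable bG simp: ennreal_mult')
      also have "\<dots> \<le> ennreal C0 * (\<integral>\<^sup>+x. ennreal ((D * B) powr c) * ennreal_powr (inner (wd h kap) x) c \<partial>circle)"
      proof (intro mult_left_mono nn_integral_mono)
        fix x
        have "ennreal ((\<Sum>n\<le>N. v n * g n x powr aa) powr c) = ennreal_powr (ennreal (\<Sum>n\<le>N. v n * g n x powr aa)) c"
          using v by (subst ennreal_powr_ennreal) (auto intro!: sum_nonneg)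
        also have "\<dots> \<le> ennreal_powr (ennreal (D * B) * inner (wd h kap) x) c"
          using c by (intro ennreal_powr_mono gle) auto
        also have "\<dots> = ennreal ((D * B) powr c) * ennreal_powr (inner (wd h kap) x) c"
          using D B by (intro ennreal_powr_cmult) auto
        finally show "ennreal ((\<Sum>n\<le>N. v n * g n x powr aa) powr c) \<le> ennreal ((D * B) powr c) * ennreal_powr (inner (wd h kap) x) c" .
      qed auto
      also have "\<dots> = ennreal C0 * (ennreal ((D * B) powr c) * mnorm (wd h kap))"
        unfolding mnorm_def c_def[symmetric]
        by (subst nn_integral_cmult) (auto intro!: measurable_circle measurable_compose[OF inner_measurable[OF whc] ennreal_powr_measurable])
      also have "\<dots> = ennreal C * mnorm (wd h kap)" using C0(1) by (simp add: C_def ennreal_mult' mult.assoc)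
      finally show ?thesis .
    qed
    have PhiS: "Phi h kap x = (SUP N. ennreal (S N x))" for x
    proof -
      have "Phi h kap x = (SUP N. \<Sum>n\<le>N. ennreal (v n * Kn h n x))"
        unfolding Phi_def v_def by (rule suminf_ennreal_atMost)
      then show ?thesis by (simp add: S_def sum_ennreal v Kn_nonneg)
    qed
    have "(\<integral>\<^sup>+x. ennreal_powr (Phi h kap x) (q / p) \<partial>circle) \<le> (\<integral>\<^sup>+x. (SUP N. ennreal (S N x powr c)) \<partial>circle)"
    proof (intro nn_integral_mono)
      fix x
      have "ennreal_powr (Phi h kap x) c \<le> (SUP N. ennreal_powr (ennreal (S N x)) c)"
        unfolding PhiS by (rule ennreal_powr_SUP_le[OF c])
      moreover have "0 \<le> S N x" for N unfolding S_def by (intro sum_nonneg mult_nonneg_nonneg v Kn_nonneg)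
      ultimately show "ennreal_powr (Phi h kap x) (q / p) \<le> (SUP N. ennreal (S N x powr c))"
        by (simp add: c_def)
    qed
    also have "\<dots> = (SUP N. (\<integral>\<^sup>+x. ennreal (S N x powr c) \<partial>circle))"
    proof (rule nn_integral_monotone_convergence_SUP)
      show "incseq (\<lambda>N x. ennreal (S N x powr c))"
        using c by (intro incseq_SucI le_funI ennreal_leI powr_mono2) (auto simp: S_def intro!: sum_nonneg mult_nonneg_nonneg v Kn_nonneg)
      show "(\<lambda>x. ennreal (S N x powr c)) \<in> borel_measurable circle" for N
        using G0.bdd_measurable[OF bS] by measurable
    qed
    also have "\<dots> \<le> ennreal C * mnorm (wd h kap)" by (intro SUP_least fin)
    finally show "(\<integral>\<^sup>+x. ennreal_powr (Phi h kap x) (q / p) \<partial>circle) \<le> ennreal C * mnorm (wd h kap)" .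
  qed
qed

end

section \<open>Sufficiency\<close>

text \<open>The convolution satisfies \<open>c (Suc n) = a (Suc n) + s * c n\<close>; summing this
  recursion leaves \<open>1 - s\<close> times the sum of the \<open>c n\<close>.\<close>

lemma sum_geometric_convolution_le:
  fixes a :: "nat \<Rightarrow> real"
  assumes s: "0 \<le> s" "s < 1" and a: "\<And>m. 0 \<le> a m"
  shows "(\<Sum>n\<le>N. \<Sum>i\<le>n. s ^ i * a (n - i)) \<le> (\<Sum>m\<le>N. a m) / (1 - s)"
proof -
  define c where "c n = (\<Sum>i\<le>n. s ^ i * a (n - i))" for n
  have c0: "0 \<le> c n" for n unfolding c_def using s a by (intro sum_nonneg) auto
  have cS: "c (Suc n) = a (Suc n) + s * c n" for n
    unfolding c_def by (subst sum.atMost_Suc_shift) (simp add: sum_distrib_left mult.assoc)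
  have "(1 - s) * (\<Sum>n\<le>N. c n) + s * c N = (\<Sum>m\<le>N. a m)"
  proof (induction N)
    case (Suc N)
    have "(1 - s) * (\<Sum>n\<le>Suc N. c n) + s * c (Suc N) = (1 - s) * (\<Sum>n\<le>N. c n) + c (Suc N)"
      by (simp add: algebra_simps)
    also have "\<dots> = ((1 - s) * (\<Sum>n\<le>N. c n) + s * c N) + a (Suc N)" by (simp add: cS)
    finally show ?case using Suc by simp
  qed (simp add: c_def algebra_simps)
  moreover have "0 \<le> s * c N" using s c0 by simp
  ultimately have "(1 - s) * (\<Sum>n\<le>N. c n) \<le> (\<Sum>m\<le>N. a m)" by linarith
  then show ?thesis using s by (simp add: c_def pos_le_divide_eq mult.commute)
qed

lemma pt_dist:
  assumes "0 \<le> r" "r \<le> 1" "\<bar>u\<bar> \<le> 1"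
  shows "norm (pt x r u - cis (2 * pi * x)) \<le> 2 * (1 - r)"
proof -
  define c where "c = cis (2 * pi * x + u * (1 - r))"
  have "pt x r u - c = - (of_real (1 - r) * c)" by (simp add: pt_def c_def algebra_simps)
  then have 1: "norm (pt x r u - c) = 1 - r" using assms by (simp add: norm_mult c_def del: of_real_diff)
  have "norm (c - cis (2 * pi * x)) \<le> \<bar>u * (1 - r)\<bar>"
    unfolding c_def using norm_cis_diff_le[of "2 * pi * x + u * (1 - r)" "2 * pi * x"] by simp
  also have "\<dots> \<le> 1 * (1 - r)" unfolding abs_mult using assms by (intro mult_mono) auto
  finally show ?thesis using 1 norm_triangle_ineq[of "pt x r u - c" "c - cis (2 * pi * x)"] by simp
qed

lemma emeasure_circle: "emeasure circle (space circle) = 1"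
  by (simp add: circle_def emeasure_restrict_space space_restrict_space)

lemma holomorphic_on_funpow_deriv: "f holomorphic_on ball 0 1 \<Longrightarrow> (deriv ^^ k) f holomorphic_on ball 0 1"
  by (rule holomorphic_higher_deriv) auto

context mixed_norm_D
begin

section \<open>Derivatives bounded by the function\<close>

lemma avg_int_le_wt:
  assumes b: "0 \<le> b" "\<And>r u. r \<in> ring n \<Longrightarrow> 0 < r \<Longrightarrow> \<bar>u\<bar> \<le> 1 \<Longrightarrow> norm (f (pt x r u)) powr p \<le> b"
  shows "avg_int f p (ring n) x \<le> ennreal (measure sg UNIV * (wt n * b))"
proof -
  have "avg_int f p (ring n) x \<le> ennreal (b * mass (ring n))"
    unfolding avg_int_def
  proof (rule nn_integral_mass_mono_bound[OF ring_sets b(1)])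
    fix r u :: real assume r: "r \<in> ring n" "0 < r" "r < 1" "\<bar>u\<bar> \<le> 1"
    then show "ennreal (norm (trunc f (pt x r u)) powr p) \<le> ennreal b"
      using b(2)[of r u] by (intro ennreal_leI) (simp add: trunc_def norm_pt)
  qed
  also have "b * mass (ring n) \<le> b * (wt n * measure sg UNIV)"
    unfolding mass_def using b(1) sg_pos by (intro mult_left_mono mult_right_mono ring_le) auto
  finally show ?thesis by (simp add: ennreal_leI mult_ac)
qed

lemma Kn_root:
  assumes h: "h holomorphic_on ball 0 1" and x: "x \<in> {0..<1}"
    and w: "norm (w - cis (2 * pi * x)) \<le> 3 * dn n" "norm w \<le> 1 - cc * dn n"
  shows "norm (h w) \<le> (Cf powr aa * Kn h n x) powr (1/p)"
proof -
  have "(norm (h w) powr p) powr (1/p) \<le> (Cf powr aa * Kn h n x) powr (1/p)"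
    using norm_powr_le_Kn[OF assms] p by (intro powr_mono2) auto
  then show ?thesis using p by (simp add: powr_powr)
qed

lemma Cauchy_Kn:
  assumes f: "f holomorphic_on ball 0 1" and x: "x \<in> {0..<1}" and t: "0 < t"
    and w: "\<And>w. norm (w - z) \<le> t \<Longrightarrow> norm (w - cis (2 * pi * x)) \<le> 3 * dn n"
      "\<And>w. norm (w - z) \<le> t \<Longrightarrow> norm w \<le> 1 - cc * dn n"
  shows "(norm ((deriv ^^ k) f z) * t ^ k) powr p \<le> fact k powr p * (Cf powr aa * Kn f n x)"
proof -
  define B where "B = (Cf powr aa * Kn f n x) powr (1/p)"
  have c0: "0 < cc * dn n" using cc dn_pos by simp
  have sub: "cball z t \<subseteq> ball 0 1"
    using w(2) c0 by (auto simp: dist_norm norm_minus_commute) (smt (verit))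
  have "norm ((deriv ^^ k) f z) \<le> fact k * B / t ^ k"
  proof (rule Cauchy_inequality[OF _ _ t])
    show "f holomorphic_on ball z t" using sub by (intro holomorphic_on_subset[OF f]) auto
    show "continuous_on (cball z t) f" using sub by (intro continuous_on_subset[OF holomorphic_on_imp_continuous_on[OF f]]) auto
    show "norm (f w) \<le> B" if "norm (z - w) = t" for w
      unfolding B_def using that w[of w] by (intro Kn_root[OF f x]) (auto simp: norm_minus_commute)
  qed
  then have "norm ((deriv ^^ k) f z) * t ^ k \<le> fact k * B" using t by (simp add: field_simps)
  then have "(norm ((deriv ^^ k) f z) * t ^ k) powr p \<le> (fact k * B) powr p"
    using t p by (intro powr_mono2) auto
  also have "\<dots> = fact k powr p * (Cf powr aa * Kn f n x)"
    using p Kn_nonneg[of f n x] Cf_pos by (simp add: powr_mult B_def powr_powr)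
  finally show ?thesis .
qed

lemma Phi_0: "Phi h 0 x = (\<Sum>n. ennreal (wt n * Kn h n x))"
  by (simp add: Phi_def)

lemma nn_integral_Phi_mono:
  assumes C: "0 \<le> C" and le: "\<And>x. x \<in> {0..<1} \<Longrightarrow> F x \<le> ennreal C * Phi h kap x"
    and hc: "continuous_on (ball 0 1) h"
  shows "(\<integral>\<^sup>+x. ennreal_powr (F x) (q / p) \<partial>circle) \<le> ennreal (C powr (q / p)) * (\<integral>\<^sup>+x. ennreal_powr (Phi h kap x) (q / p) \<partial>circle)"
proof -
  have [measurable]: "Phi h kap \<in> borel_measurable circle"
    unfolding Phi_def[abs_def] by (intro borel_measurable_suminf_order Phi_measurable[OF hc])
  have "(\<integral>\<^sup>+x. ennreal_powr (F x) (q / p) \<partial>circle) \<le> (\<integral>\<^sup>+x. ennreal (C powr (q / p)) * ennreal_powr (Phi h kap x) (q / p) \<partial>circle)"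
  proof (rule nn_integral_mono)
    fix x assume "x \<in> space circle"
    then have "ennreal_powr (F x) (q / p) \<le> ennreal_powr (ennreal C * Phi h kap x) (q / p)"
      using p q by (intro ennreal_powr_mono le) auto
    then show "ennreal_powr (F x) (q / p) \<le> ennreal (C powr (q / p)) * ennreal_powr (Phi h kap x) (q / p)"
      using C by (simp add: ennreal_powr_cmult)
  qed
  also have "\<dots> = ennreal (C powr (q / p)) * (\<integral>\<^sup>+x. ennreal_powr (Phi h kap x) (q / p) \<partial>circle)"
    by (rule nn_integral_cmult) measurable
  finally show ?thesis .
qed

text \<open>Cauchy's estimate on the disc reaching half way to the circle. That disc stays in the
  region where \<open>Kn f n x\<close> bounds \<open>|f|^p\<close>: its points are at most
  \<open>2.5 * dn n\<close> from the boundary point.\<close>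

lemma mnorm_deriv_le:
  obtains C where "0 < C" "\<And>f. f holomorphic_on ball 0 1 \<Longrightarrow>
    mnorm (wd ((deriv ^^ k) f) k) \<le> ennreal C * mnorm f"
proof -
  obtain C0 where C0: "0 < C0" "\<And>h. h holomorphic_on ball 0 1 \<Longrightarrow>
     (\<integral>\<^sup>+x. ennreal_powr (Phi h 0 x) (q / p) \<partial>circle) \<le> ennreal C0 * mnorm (wd h 0)"
    using Phi_bound by blast
  \<comment> \<open>\<open>2 ^ k\<close> compensates the radius \<open>(1 - r) / 2\<close> in
    Cauchy's estimate, whose own constant is \<open>fact k\<close>.\<close>
  define E where "E = (2 ^ k * fact k) powr p * Cf powr aa"
  have E: "0 < E" using Cf_pos by (simp add: E_def)
  define S where "S = measure sg UNIV"
  have S: "0 < S" using sg_pos by (simp add: S_def)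
  show ?thesis
  proof (rule that)
    show "0 < (S * E) powr (q / p) * C0" using C0 E S by simp
    fix f :: "complex \<Rightarrow> complex" assume f: "f holomorphic_on ball 0 1"
    have fc: "continuous_on (ball 0 1) f" using f by (rule holomorphic_on_imp_continuous_on)
    have fk: "continuous_on (ball 0 1) ((deriv ^^ k) f)"
      using holomorphic_on_funpow_deriv[OF f] by (rule holomorphic_on_imp_continuous_on)
    have "inner (wd ((deriv ^^ k) f) k) x \<le> ennreal (S * E) * Phi f 0 x" if x: "x \<in> {0..<1}" for x
    proof -
      have "avg_int (wd ((deriv ^^ k) f) k) p (ring n) x \<le> ennreal (S * E) * ennreal (wt n * Kn f n x)" for n
      proof -
        have "avg_int (wd ((deriv ^^ k) f) k) p (ring n) x \<le> ennreal (S * (wt n * (E * Kn f n x)))"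
          unfolding S_def
        proof (rule avg_int_le_wt)
          fix r u :: real assume r: "r \<in> ring n" "0 < r" and u: "\<bar>u\<bar> \<le> 1"
          define t where "t = (1 - r) / 2"
          have r1: "r < 1" using ringD[OF r(1)] by simp
          have t: "0 < t" "2 * t \<le> dn n" "cc * dn n \<le> t"
            using ringD[OF r(1)] dn_Suc[of n] by (auto simp: t_def mult_ac)
          have np: "norm (pt x r u) = r" using r by (simp add: norm_pt)
          have "(norm ((deriv ^^ k) f (pt x r u)) * t ^ k) powr p \<le> fact k powr p * (Cf powr aa * Kn f n x)"
          proof (rule Cauchy_Kn[OF f x t(1)])
            fix w assume w: "norm (w - pt x r u) \<le> t"
            show "norm (w - cis (2 * pi * x)) \<le> 3 * dn n"
              using norm_triangle_ineq[of "w - pt x r u" "pt x r u - cis (2 * pi * x)"] w pt_dist[of r u x] r r1 u t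
              by (simp add: t_def)
            show "norm w \<le> 1 - cc * dn n"
              using norm_triangle_ineq[of "w - pt x r u" "pt x r u"] w np t by (simp add: t_def)
          qed
          then have le: "(2 ^ k) powr p * (norm ((deriv ^^ k) f (pt x r u)) * t ^ k) powr p \<le> (2 ^ k) powr p * (fact k powr p * (Cf powr aa * Kn f n x))"
            by (intro mult_left_mono) auto
          have eq: "(2 ^ k) powr p * (norm ((deriv ^^ k) f (pt x r u)) * t ^ k) powr p = norm (wd ((deriv ^^ k) f) k (pt x r u)) powr p"
          proof -
            have "2 ^ k * (norm ((deriv ^^ k) f (pt x r u)) * t ^ k) = norm (wd ((deriv ^^ k) f) k (pt x r u))"
              using r r1 np by (simp add: norm_wd t_def power_divide)
            then show ?thesis using t by (subst powr_mult[symmetric]) simp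
          qed
          have "norm (wd ((deriv ^^ k) f) k (pt x r u)) powr p \<le> (2 ^ k) powr p * (fact k powr p * (Cf powr aa * Kn f n x))"
            using le unfolding eq .
          then show "norm (wd ((deriv ^^ k) f) k (pt x r u)) powr p \<le> E * Kn f n x"
            by (simp add: E_def powr_mult mult_ac)
        qed (use E in \<open>simp add: Kn_nonneg\<close>)
        then show ?thesis using S E by (simp add: ennreal_mult'[symmetric] mult_ac)
      qed
      then have "inner (wd ((deriv ^^ k) f) k) x \<le> (\<Sum>n. ennreal (S * E) * ennreal (wt n * Kn f n x))"
        unfolding inner_eq_suminf[OF wd_continuous[OF fk]] by (intro suminf_le) auto
      then show ?thesis by (simp add: Phi_0)
    qed
    then have "mnorm (wd ((deriv ^^ k) f) k) \<le> ennreal ((S * E) powr (q / p)) * (\<integral>\<^sup>+x. ennreal_powr (Phi f 0 x) (q / p) \<partial>circle)"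
      unfolding mnorm_def using S E by (intro nn_integral_Phi_mono fc) auto
    also have "\<dots> \<le> ennreal ((S * E) powr (q / p)) * (ennreal C0 * mnorm (wd f 0))"
      by (intro mult_left_mono C0(2) f) auto
    also have "wd f 0 = f" by (simp add: wd_def fun_eq_iff)
    finally show "mnorm (wd ((deriv ^^ k) f) k) \<le> ennreal ((S * E) powr (q / p) * C0) * mnorm f"
      using C0 by (simp add: ennreal_mult' mult.assoc)
  qed
qed

text \<open>The disc of radius \<open>1/4\<close> about 0 lies in the region of ring 0 for every
  \<open>x\<close>, so the first term of \<open>Phi f 0 x\<close> bounds the derivative at 0 for all
  \<open>x\<close> at once. Integrating the constant costs nothing, as the circle has mass
  1.\<close>

lemma deriv_0_le_mnorm:
  obtains C where "0 < C" "\<And>f. f holomorphic_on ball 0 1 \<Longrightarrow>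
    ennreal (norm ((deriv ^^ k) f 0) powr q) \<le> ennreal C * mnorm f"
proof -
  obtain C0 where C0: "0 < C0" "\<And>h. h holomorphic_on ball 0 1 \<Longrightarrow>
     (\<integral>\<^sup>+x. ennreal_powr (Phi h 0 x) (q / p) \<partial>circle) \<le> ennreal C0 * mnorm (wd h 0)"
    using Phi_bound by blast
  define E where "E = (4 ^ k * fact k) powr p * Cf powr aa / wt 0"
  have E: "0 < E" using Cf_pos wt_pos[of 0] by (simp add: E_def)
  show ?thesis
  proof (rule that)
    show "0 < E powr (q / p) * C0" using C0 E by simp
    fix f :: "complex \<Rightarrow> complex" assume f: "f holomorphic_on ball 0 1"
    have fc: "continuous_on (ball 0 1) f" using f by (rule holomorphic_on_imp_continuous_on)
    have "ennreal (norm ((deriv ^^ k) f 0) powr p) \<le> ennreal E * Phi f 0 x" if x: "x \<in> {0..<1}" for x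
    proof -
      have cc4: "cc \<le> 1/4"
      proof -
        have "cc \<le> (1/2) ^ 2" unfolding cc_def using l by (intro power_decreasing) auto
        then show ?thesis by (simp add: power2_eq_square)
      qed
      have "(norm ((deriv ^^ k) f 0) * (1/4) ^ k) powr p \<le> fact k powr p * (Cf powr aa * Kn f 0 x)"
      proof (rule Cauchy_Kn[OF f x])
        fix w :: complex assume w: "norm (w - 0) \<le> 1/4"
        show "norm (w - cis (2 * pi * x)) \<le> 3 * dn 0"
          using norm_triangle_ineq4[of w "cis (2 * pi * x)"] w by simp
        show "norm w \<le> 1 - cc * dn 0" using w cc4 by simp
      qed simp
      then have le: "(4 ^ k) powr p * (norm ((deriv ^^ k) f 0) * (1/4) ^ k) powr p \<le> (4 ^ k) powr p * (fact k powr p * (Cf powr aa * Kn f 0 x))"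
        by (intro mult_left_mono) auto
      have eq: "(4 ^ k) powr p * (norm ((deriv ^^ k) f 0) * (1/4) ^ k) powr p = norm ((deriv ^^ k) f 0) powr p"
        by (subst powr_mult[symmetric]) (simp add: power_one_over)
      have "norm ((deriv ^^ k) f 0) powr p \<le> (4 ^ k) powr p * (fact k powr p * (Cf powr aa * Kn f 0 x))"
        using le unfolding eq .
      then have "norm ((deriv ^^ k) f 0) powr p \<le> E * (wt 0 * Kn f 0 x)"
        using wt_pos[of 0] by (simp add: E_def powr_mult mult_ac)
      then have "ennreal (norm ((deriv ^^ k) f 0) powr p) \<le> ennreal E * ennreal (wt 0 * Kn f 0 x)"
        using E by (simp add: ennreal_mult'[symmetric] ennreal_leI)
      also have "\<dots> \<le> ennreal E * Phi f 0 x"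
        unfolding Phi_0 using sum_le_suminf[of "\<lambda>n. ennreal (wt n * Kn f n x)" "{0}"] by (intro mult_left_mono) auto
      finally show ?thesis .
    qed
    then have "(\<integral>\<^sup>+x. ennreal_powr (ennreal (norm ((deriv ^^ k) f 0) powr p)) (q / p) \<partial>circle) \<le> ennreal (E powr (q / p)) * (\<integral>\<^sup>+x. ennreal_powr (Phi f 0 x) (q / p) \<partial>circle)"
      using E by (intro nn_integral_Phi_mono fc) auto
    also have "\<dots> \<le> ennreal (E powr (q / p)) * (ennreal C0 * mnorm (wd f 0))"
      by (intro mult_left_mono C0(2) f) auto
    also have "wd f 0 = f" by (simp add: wd_def fun_eq_iff)
    also have "(\<integral>\<^sup>+x. ennreal_powr (ennreal (norm ((deriv ^^ k) f 0) powr p)) (q / p) \<partial>circle) = ennreal (norm ((deriv ^^ k) f 0) powr q)"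
      using p emeasure_circle by (simp add: powr_powr)
    finally show "ennreal (norm ((deriv ^^ k) f 0) powr q) \<le> ennreal (E powr (q / p) * C0) * mnorm f"
      using C0 by (simp add: ennreal_mult' mult.assoc)
  qed
qed

text \<open>The mean value bound for \<open>F\<close> is applied along one ray, ring by ring. The
  angle \<open>\<tau>\<close> is fixed, and since \<open>dn n <= dn m\<close> for
  \<open>m <= n\<close> the ray lies in the region governed by \<open>Kn (deriv F) m x\<close> in
  every ring that it crosses.\<close>

lemma radial_growth:
  assumes F: "F holomorphic_on ball 0 1" and x: "x \<in> {0..<1}"
    and t: "1 - dn n \<le> t" "t \<le> 1 - dn (Suc n)" and tau: "\<bar>\<tau> - 2 * pi * x\<bar> \<le> dn n"
  shows "norm (F (of_real t * cis \<tau>)) \<le> norm (F 0) + (\<Sum>m\<le>n. dn m * (Cf powr aa * Kn (deriv F) m x) powr (1/p))"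
  using t tau
proof (induction n arbitrary: t)
  have step: "norm (F (of_real t * cis \<tau>) - F (of_real (1 - dn n) * cis \<tau>)) \<le> dn n * (Cf powr aa * Kn (deriv F) n x) powr (1/p)"
    if t: "1 - dn n \<le> t" "t \<le> 1 - dn (Suc n)" and tau: "\<bar>\<tau> - 2 * pi * x\<bar> \<le> dn n" for n t
  proof -
    define a where "a = 1 - dn n"
    have a0: "0 \<le> a" using dn_le1[of n] by (simp add: a_def)
    have F': "deriv F holomorphic_on ball 0 1" using F by (intro holomorphic_deriv) auto
    define S where "S = closed_segment (of_real a * cis \<tau>) (of_real t * cis \<tau>)"
    have S: "\<exists>b. a \<le> b \<and> b \<le> t \<and> w = of_real b * cis \<tau>" if wS: "w \<in> S" for w
    proof -
      obtain v where v: "0 \<le> v" "v \<le> 1" "w = (1 - v) *\<^sub>R (of_real a * cis \<tau>) + v *\<^sub>R (of_real t * cis \<tau>)"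
        using wS unfolding S_def closed_segment_def by auto
      have "w = of_real ((1 - v) * a + v * t) * cis \<tau>" by (simp add: v(3) scaleR_conv_of_real algebra_simps)
      moreover have "(1 - v) * a + v * t = a + v * (t - a)" by (simp add: algebra_simps)
      moreover have "0 \<le> v * (t - a)" "v * (t - a) \<le> 1 * (t - a)"
        using v t mult_right_mono[of v 1 "t - a"] by (auto simp: a_def)
      ultimately show ?thesis by (intro exI[of _ "(1 - v) * a + v * t"]) auto
    qed
    have b1: "norm w < 1 \<and> norm (deriv F w) \<le> (Cf powr aa * Kn (deriv F) n x) powr (1/p)" if "w \<in> S" for w
    proof -
      obtain b where b: "a \<le> b" "b \<le> t" "w = of_real b * cis \<tau>" using S[OF \<open>w \<in> S\<close>] by blast
      have b01: "0 \<le> b" "b \<le> 1 - 2 * cc * dn n" using b a0 t dn_Suc[of n] by (auto simp: mult_ac)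
      have c0: "0 < cc * dn n" using cc dn_pos by simp
      have nw: "norm w = b" using b01 by (simp add: b norm_mult)
      have "w - cis \<tau> = - (of_real (1 - b) * cis \<tau>)" by (simp add: b algebra_simps)
      then have "norm (w - cis \<tau>) = \<bar>1 - b\<bar>" by (simp add: norm_mult del: of_real_diff)
      then have 1: "norm (w - cis \<tau>) = 1 - b" using b01 c0 by simp
      have "norm (w - cis (2 * pi * x)) \<le> 3 * dn n"
        using norm_triangle_ineq[of "w - cis \<tau>" "cis \<tau> - cis (2 * pi * x)"] 1 b norm_cis_diff_le[of \<tau> "2 * pi * x"] tau dn_pos[of n]
        by (simp add: a_def)
      moreover have "norm w \<le> 1 - cc * dn n" using nw b01 c0 by simp
      ultimately show ?thesis using c0 by (auto intro!: Kn_root[OF F' x])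
    qed
    have "norm (F (of_real t * cis \<tau>) - F (of_real a * cis \<tau>)) \<le> (Cf powr aa * Kn (deriv F) n x) powr (1/p) * norm (of_real t * cis \<tau> - of_real a * cis \<tau>)"
    proof (rule field_differentiable_bound[where S=S and f'="deriv F"])
      show "convex S" by (simp add: S_def)
      fix z assume z: "z \<in> S"
      show "(F has_field_derivative deriv F z) (at z within S)"
        using b1[OF z] holomorphic_derivI[OF F open_ball, of z] by (auto intro: has_field_derivative_at_within)
      show "norm (deriv F z) \<le> (Cf powr aa * Kn (deriv F) n x) powr (1/p)" using b1[OF z] by simp
    qed (auto simp: S_def)
    also have "norm (of_real t * cis \<tau> - of_real a * cis \<tau>) = t - a"
    proof -
      have "of_real t * cis \<tau> - of_real a * cis \<tau> = of_real (t - a) * cis \<tau>" by (simp add: algebra_simps)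
      then show ?thesis using t by (simp add: norm_mult a_def del: of_real_diff)
    qed
    also have "(Cf powr aa * Kn (deriv F) n x) powr (1/p) * (t - a) \<le> (Cf powr aa * Kn (deriv F) n x) powr (1/p) * dn n"
      using t dn_pos[of "Suc n"] by (intro mult_left_mono) (auto simp: a_def)
    finally show ?thesis by (simp add: a_def mult.commute)
  qed
  {
    case 0
    from step[OF this] have "norm (F (of_real t * cis \<tau>) - F 0) \<le> dn 0 * (Cf powr aa * Kn (deriv F) 0 x) powr (1/p)" by simp
    then show ?case using norm_triangle_sub[of "F (of_real t * cis \<tau>)" "F 0"] by simp
  next
    case (Suc n)
    have "norm (F (of_real (1 - dn (Suc n)) * cis \<tau>)) \<le> norm (F 0) + (\<Sum>m\<le>n. dn m * (Cf powr aa * Kn (deriv F) m x) powr (1/p))"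
      using Suc.prems dn_mono[of n "Suc n"] by (intro Suc.IH) auto
    then show ?case
      using step[OF Suc.prems] norm_triangle_sub[of "F (of_real t * cis \<tau>)" "F (of_real (1 - dn (Suc n)) * cis \<tau>)"] by simp
  }
qed

text \<open>The sum over coarser rings given by radial growth meets the weights
  \<open>wt n <= lam ^ (n - m) * wt m\<close>. Half of this decay is spent on taking the
  \<open>p\<close>-th power of the sum, the other half on summing the convolution that
  remains.\<close>

lemma mnorm_le_deriv:
  obtains C where "0 < C" "\<And>F. F holomorphic_on ball 0 1 \<Longrightarrow>
    mnorm (wd F j) \<le> ennreal C * (ennreal (norm (F 0) powr q) + mnorm (wd (deriv F) (Suc j)))"
proof -
  obtain C0 where C0: "0 < C0" "\<And>h. h holomorphic_on ball 0 1 \<Longrightarrow>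
     (\<integral>\<^sup>+x. ennreal_powr (Phi h (Suc j) x) (q / p) \<partial>circle) \<le> ennreal C0 * mnorm (wd h (Suc j))"
    using Phi_bound by blast
  \<comment> \<open>Chosen so that \<open>th powr p = lam\<close>. Inserting
    \<open>th ^ i * (1 / th) ^ i\<close> into the sum and taking the \<open>p\<close>-th power
    leaves \<open>sl ^ i * (1 / lam) ^ i\<close>; the decay of the tail masses cancels
    \<open>(1 / lam) ^ i\<close>.\<close>
  define th where "th = lam powr (1 / p)"
  have th: "0 < th" "th < 1" using lam p powr_less_mono2[of "1/p" lam 1] by (auto simp: th_def)
  obtain Q where Q: "0 < Q" "\<And>N y. (\<And>j. 0 \<le> y j) \<Longrightarrow>
     (\<Sum>j\<le>(N::nat). th ^ j * y j) powr p \<le> Q * (\<Sum>j\<le>N. (th powr (p/2)) ^ j * y j powr p)"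
    using sum_geometric_powr_le[OF th p] by blast
  define sl where "sl = sqrt lam"
  have sl: "0 < sl" "sl < 1" "sl * sl = lam" using lam by (auto simp: sl_def)
  have thsl: "th powr (p/2) = sl" using p lam by (simp add: th_def powr_powr sl_def powr_half_sqrt)
  have thp: "(th ^ i) powr p = lam ^ i" for i
    using p lam by (simp add: th_def powr_powr powr_realpow[symmetric] mult.commute)
  define S where "S = measure sg UNIV"
  have S: "0 < S" using sg_pos by (simp add: S_def)
  define E1 where "E1 = S * 2 powr p * (wt 0 / (1 - lam))"
  define E2 where "E2 = S * 2 powr p * Q * Cf powr aa / (1 - sl)"
  have E1: "0 < E1" using S wt_pos[of 0] lam by (simp add: E1_def)
  have E2: "0 < E2" using S Q(1) Cf_pos sl by (simp add: E2_def)
  define c where "c = q / p"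
  have c: "0 < c" using p q by (simp add: c_def)
  define C where "C = 2 powr c * (E1 powr c + E2 powr c * C0)"
  show ?thesis
  proof (rule that[of C])
    show "0 < C" using E1 E2 C0 by (simp add: C_def add_pos_pos)
    fix F :: "complex \<Rightarrow> complex" assume F: "F holomorphic_on ball 0 1"
    have Fc: "continuous_on (ball 0 1) F" using F by (rule holomorphic_on_imp_continuous_on)
    have F': "deriv F holomorphic_on ball 0 1" using F by (intro holomorphic_deriv) auto
    have F'c: "continuous_on (ball 0 1) (deriv F)" using F' by (rule holomorphic_on_imp_continuous_on)
    define A where "A = norm (F 0)"
    have inner_le: "inner (wd F j) x \<le> ennreal (E1 * A powr p) + ennreal E2 * Phi (deriv F) (Suc j) x" if x: "x \<in> {0..<1}" for x
    proof -
      define M where "M m = (Cf powr aa * Kn (deriv F) m x) powr (1/p)" for m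
      define H where "H m = dn m ^ Suc j * M m" for m
      define a where "a m = wt m * H m powr p" for m
      have M0: "0 \<le> M m" and H0: "0 \<le> H m" and a0: "0 \<le> a m" for m
        using dn_pos[of m] wt_pos[of m] by (auto simp: M_def H_def a_def)
      have Mp: "M m powr p = Cf powr aa * Kn (deriv F) m x" for m
        using p Cf_pos Kn_nonneg[of "deriv F" m x] by (simp add: M_def powr_powr)
      have am: "a m = Cf powr aa * (wt m * (dn m ^ Suc j) powr p * Kn (deriv F) m x)" for m
        using dn_pos[of m] M0 by (simp add: a_def H_def powr_mult Mp mult_ac del: power_Suc)
      \<comment> \<open>A bound for the \<open>p\<close>-th power of the weighted function on ring
        \<open>n\<close>; the index \<open>i = n - m\<close> counts the rings back to the
        contributing ring \<open>m\<close>.\<close>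
      define b where "b n = 2 powr p * (A powr p + Q * (\<Sum>i\<le>n. sl ^ i * ((1 / lam) ^ i * H (n - i) powr p)))" for n
      have b0: "0 \<le> b n" for n using Q sl lam by (simp add: b_def sum_nonneg)
      have pw: "norm (wd F j (pt x r u)) powr p \<le> b n" if r: "r \<in> ring n" "0 < r" and u: "\<bar>u\<bar> \<le> 1" for n r u
      proof -
        have r1: "r < 1" using ringD[OF r(1)] by simp
        have "\<bar>u * (1 - r)\<bar> \<le> 1 * (1 - r)" unfolding abs_mult using u r1 by (intro mult_mono) auto
        then have tau: "\<bar>(2 * pi * x + u * (1 - r)) - 2 * pi * x\<bar> \<le> dn n" using ringD(1)[OF r(1)] by simp
        have "norm (F (pt x r u)) \<le> A + (\<Sum>m\<le>n. dn m * M m)"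
          unfolding pt_def A_def M_def
          using ringD[OF r(1)] by (intro radial_growth[OF F x _ _ tau]) auto
        then have "norm (F (pt x r u)) * (1 - r) ^ j \<le> (A + (\<Sum>m\<le>n. dn m * M m)) * (1 - r) ^ j"
          using r1 by (intro mult_right_mono) auto
        also have "\<dots> = A * (1 - r) ^ j + (\<Sum>m\<le>n. dn m * M m * (1 - r) ^ j)"
          by (simp add: distrib_right sum_distrib_right)
        also have "\<dots> \<le> A * 1 + (\<Sum>m\<le>n. H m)"
        proof (intro add_mono mult_left_mono sum_mono)
          show "(1 - r) ^ j \<le> 1" using r r1 by (intro power_le_one) auto
          fix m assume "m \<in> {..n}"
          then have "1 - r \<le> dn m" using ringD(1)[OF r(1)] dn_mono[of m n] by simp
          then have "(1 - r) ^ j \<le> dn m ^ j" using r1 by (intro power_mono) auto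
          then have "(dn m * M m) * (1 - r) ^ j \<le> (dn m * M m) * dn m ^ j"
            using dn_pos[of m] M0 by (intro mult_left_mono) auto
          then show "dn m * M m * (1 - r) ^ j \<le> H m" by (simp add: H_def mult_ac)
        qed (simp add: A_def)
        also have "(\<Sum>m\<le>n. H m) = (\<Sum>i\<le>n. th ^ i * ((1 / th) ^ i * H (n - i)))"
        proof -
          have "(\<Sum>m\<le>n. H m) = (\<Sum>i\<le>n. H (n - i))" by (rule sum.nat_diff_reindex[symmetric, of H "Suc n", simplified lessThan_Suc_atMost diff_Suc_Suc])
          also have "\<dots> = (\<Sum>i\<le>n. th ^ i * ((1 / th) ^ i * H (n - i)))"
            using th by (intro sum.cong refl) (simp add: power_one_over)
          finally show ?thesis .
        qed
        finally have "norm (wd F j (pt x r u)) \<le> A + (\<Sum>i\<le>n. th ^ i * ((1 / th) ^ i * H (n - i)))"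
          using r r1 by (simp add: norm_wd norm_pt)
        then have "norm (wd F j (pt x r u)) powr p \<le> (A + (\<Sum>i\<le>n. th ^ i * ((1 / th) ^ i * H (n - i)))) powr p"
          using p by (intro powr_mono2) auto
        also have "\<dots> \<le> 2 powr p * (A powr p + (\<Sum>i\<le>n. th ^ i * ((1 / th) ^ i * H (n - i))) powr p)"
          using p th H0 by (intro powr_add_le sum_nonneg mult_nonneg_nonneg) (auto simp: A_def)
        also have "\<dots> \<le> 2 powr p * (A powr p + Q * (\<Sum>i\<le>n. (th powr (p/2)) ^ i * ((1 / th) ^ i * H (n - i)) powr p))"
          using th H0 by (intro mult_left_mono add_left_mono Q(2) mult_nonneg_nonneg) auto
        also have "\<dots> = b n"
        proof -
          have "((1 / th) ^ i * H (n - i)) powr p = (1 / lam) ^ i * H (n - i) powr p" for i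
            using th H0 thp[of i] by (simp add: powr_mult powr_divide power_one_over)
          then show ?thesis by (simp add: b_def thsl)
        qed
        finally show ?thesis .
      qed
      have part: "(\<Sum>n\<le>N. wt n * b n) \<le> 2 powr p * (wt 0 / (1 - lam)) * A powr p + 2 powr p * Q / (1 - sl) * (\<Sum>m\<le>N. a m)" for N
      proof -
        have w1: "(\<Sum>n\<le>N. wt n) \<le> wt 0 / (1 - lam)"
        proof -
          have "(\<Sum>n\<le>N. wt n) \<le> (\<Sum>n\<le>N. lam ^ n * wt 0)" using wt_decay[of 0] by (intro sum_mono) simp
          also have "\<dots> = (\<Sum>n\<le>N. lam ^ n) * wt 0" by (simp add: sum_distrib_right)
          also have "\<dots> \<le> (1 / (1 - lam)) * wt 0"
          proof (intro mult_right_mono)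
            have "(\<Sum>n\<le>N. lam ^ n) \<le> (\<Sum>n. lam ^ n)" using lam by (intro sum_le_suminf summable_geometric) auto
            then show "(\<Sum>n\<le>N. lam ^ n) \<le> 1 / (1 - lam)" using lam by (simp add: suminf_geometric)
          qed (use wt_pos[of 0] in simp)
          finally show ?thesis by simp
        qed
        have w2: "wt n * (\<Sum>i\<le>n. sl ^ i * ((1 / lam) ^ i * H (n - i) powr p)) \<le> (\<Sum>i\<le>n. sl ^ i * a (n - i))" for n
          unfolding sum_distrib_left
        proof (intro sum_mono)
          fix i assume i: "i \<in> {..n}"
          have "wt n * (sl ^ i * ((1 / lam) ^ i * H (n - i) powr p)) \<le> (lam ^ i * wt (n - i)) * (sl ^ i * ((1 / lam) ^ i * H (n - i) powr p))"
            using wt_decay[of "n - i" n] i sl lam by (intro mult_right_mono) auto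
          also have "\<dots> = sl ^ i * a (n - i) * (lam ^ i * (1 / lam) ^ i)" by (simp add: a_def mult_ac)
          also have "lam ^ i * (1 / lam) ^ i = 1" using lam by (simp add: power_mult_distrib[symmetric])
          finally show "wt n * (sl ^ i * ((1 / lam) ^ i * H (n - i) powr p)) \<le> sl ^ i * a (n - i)" by simp
        qed
        have "(\<Sum>n\<le>N. wt n * b n) = 2 powr p * (A powr p * (\<Sum>n\<le>N. wt n) + Q * (\<Sum>n\<le>N. wt n * (\<Sum>i\<le>n. sl ^ i * ((1 / lam) ^ i * H (n - i) powr p))))"
        proof -
          define X where "X n = (\<Sum>i\<le>n. sl ^ i * ((1 / lam) ^ i * H (n - i) powr p))" for n
          have "wt n * b n = 2 powr p * (A powr p * wt n + Q * (wt n * X n))" for n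
            unfolding b_def X_def[symmetric] by (simp add: algebra_simps)
          then show ?thesis unfolding X_def[symmetric] by (simp only: sum_distrib_left[symmetric] sum.distrib)
        qed
        also have "\<dots> \<le> 2 powr p * (A powr p * (wt 0 / (1 - lam)) + Q * (\<Sum>n\<le>N. \<Sum>i\<le>n. sl ^ i * a (n - i)))"
          using Q(1) by (intro mult_left_mono add_mono w1 sum_mono w2) auto
        also have "\<dots> \<le> 2 powr p * (A powr p * (wt 0 / (1 - lam)) + Q * ((\<Sum>m\<le>N. a m) / (1 - sl)))"
          using Q(1) sl a0 by (intro mult_left_mono add_left_mono sum_geometric_convolution_le) auto
        finally show ?thesis by (simp add: algebra_simps)
      qed
      have "inner (wd F j) x \<le> (\<Sum>n. ennreal (S * (wt n * b n)))"
        unfolding inner_eq_suminf[OF wd_continuous[OF Fc]] S_def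
        by (intro suminf_le avg_int_le_wt b0 pw summableI)
      also have "\<dots> = (SUP N. \<Sum>n\<le>N. ennreal (S * (wt n * b n)))" by (rule suminf_ennreal_atMost)
      also have "\<dots> \<le> ennreal (E1 * A powr p) + ennreal E2 * Phi (deriv F) (Suc j) x"
      proof (rule SUP_least)
        fix N
        have nn: "0 \<le> wt m * (dn m ^ Suc j) powr p * Kn (deriv F) m x" for m
          using wt_pos[of m] by (intro mult_nonneg_nonneg Kn_nonneg) auto
        have "(\<Sum>n\<le>N. ennreal (S * (wt n * b n))) = ennreal (S * (\<Sum>n\<le>N. wt n * b n))"
          using S b0 wt_pos by (subst sum_ennreal) (auto simp: sum_distrib_left less_imp_le)
        also have "\<dots> \<le> ennreal (S * (2 powr p * (wt 0 / (1 - lam)) * A powr p + 2 powr p * Q / (1 - sl) * (\<Sum>m\<le>N. a m)))"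
          using S by (intro ennreal_leI mult_left_mono part) auto
        also have "S * (2 powr p * (wt 0 / (1 - lam)) * A powr p + 2 powr p * Q / (1 - sl) * (\<Sum>m\<le>N. a m)) =
           E1 * A powr p + E2 * (\<Sum>m\<le>N. wt m * (dn m ^ Suc j) powr p * Kn (deriv F) m x)"
          unfolding am sum_distrib_left[symmetric] E1_def E2_def by (simp add: distrib_left mult_ac)
        also have "ennreal \<dots> = ennreal (E1 * A powr p) + ennreal E2 * (\<Sum>m\<le>N. ennreal (wt m * (dn m ^ Suc j) powr p * Kn (deriv F) m x))"
        proof -
          define Z where "Z = (\<Sum>m\<le>N. wt m * (dn m ^ Suc j) powr p * Kn (deriv F) m x)"
          have Z: "0 \<le> Z" unfolding Z_def by (intro sum_nonneg nn)
          have "ennreal Z = (\<Sum>m\<le>N. ennreal (wt m * (dn m ^ Suc j) powr p * Kn (deriv F) m x))"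
            unfolding Z_def by (intro sum_ennreal[symmetric] nn)
          moreover have "ennreal (E1 * A powr p + E2 * Z) = ennreal (E1 * A powr p) + ennreal E2 * ennreal Z"
            using E1 E2 Z by (subst ennreal_plus) (auto simp: ennreal_mult')
          ultimately show ?thesis by (simp only: Z_def)
        qed
        also have "\<dots> \<le> ennreal (E1 * A powr p) + ennreal E2 * Phi (deriv F) (Suc j) x"
          unfolding Phi_def by (intro add_left_mono mult_left_mono sum_le_suminf) auto
        finally show "(\<Sum>n\<le>N. ennreal (S * (wt n * b n))) \<le> ennreal (E1 * A powr p) + ennreal E2 * Phi (deriv F) (Suc j) x" .
      qed
      finally show ?thesis .
    qed
    have Pm [measurable]: "Phi (deriv F) (Suc j) \<in> borel_measurable circle"
      unfolding Phi_def[abs_def] by (intro borel_measurable_suminf_order Phi_measurable[OF F'c])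
    have "mnorm (wd F j) \<le> (\<integral>\<^sup>+x. ennreal (2 powr c) * (ennreal (E1 powr c * A powr q) + ennreal (E2 powr c) * ennreal_powr (Phi (deriv F) (Suc j) x) c) \<partial>circle)"
      unfolding mnorm_def c_def[symmetric]
    proof (rule nn_integral_mono)
      fix x assume "x \<in> space circle"
      then have "ennreal_powr (inner (wd F j) x) c \<le> ennreal_powr (ennreal (E1 * A powr p) + ennreal E2 * Phi (deriv F) (Suc j) x) c"
        using c by (intro ennreal_powr_mono inner_le) auto
      also have "\<dots> \<le> ennreal (2 powr c) * (ennreal_powr (ennreal (E1 * A powr p)) c + ennreal_powr (ennreal E2 * Phi (deriv F) (Suc j) x) c)"
        using c by (intro ennreal_powr_add) auto
      also have "ennreal_powr (ennreal (E1 * A powr p)) c = ennreal (E1 powr c * A powr q)"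
        using E1 p by (simp add: powr_mult powr_powr c_def)
      also have "ennreal_powr (ennreal E2 * Phi (deriv F) (Suc j) x) c = ennreal (E2 powr c) * ennreal_powr (Phi (deriv F) (Suc j) x) c"
        using E2 by (intro ennreal_powr_cmult) auto
      finally show "ennreal_powr (inner (wd F j) x) c \<le> ennreal (2 powr c) * (ennreal (E1 powr c * A powr q) + ennreal (E2 powr c) * ennreal_powr (Phi (deriv F) (Suc j) x) c)" .
    qed
    also have "\<dots> = ennreal (2 powr c) * (ennreal (E1 powr c * A powr q) + ennreal (E2 powr c) * (\<integral>\<^sup>+x. ennreal_powr (Phi (deriv F) (Suc j) x) c \<partial>circle))"
      using emeasure_circle by (simp add: nn_integral_cmult nn_integral_add)
    also have "\<dots> \<le> ennreal (2 powr c) * (ennreal (E1 powr c * A powr q) + ennreal (E2 powr c) * (ennreal C0 * mnorm (wd (deriv F) (Suc j))))"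
      using C0(2)[OF F'] by (intro mult_left_mono add_left_mono) (auto simp: c_def)
    also have "\<dots> = ennreal (2 powr c * E1 powr c) * ennreal (A powr q) + ennreal (2 powr c * (E2 powr c * C0)) * mnorm (wd (deriv F) (Suc j))"
      using C0(1) by (simp add: ennreal_mult' distrib_left mult.assoc)
    also have "\<dots> \<le> ennreal C * ennreal (A powr q) + ennreal C * mnorm (wd (deriv F) (Suc j))"
      using C0(1) by (intro add_mono mult_right_mono ennreal_leI) (auto simp: C_def distrib_left)
    finally show "mnorm (wd F j) \<le> ennreal C * (ennreal (norm (F 0) powr q) + mnorm (wd (deriv F) (Suc j)))"
      by (simp add: A_def distrib_left)
  qed
qed

text \<open>Each step raises the order of the derivative and the exponent of the weight together;
  the values at 0 are the constants of integration.\<close>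

lemma mnorm_le_higher_deriv:
  "\<exists>C>0. \<forall>f. f holomorphic_on ball 0 1 \<longrightarrow>
    mnorm f \<le> ennreal C * ((\<Sum>j<k. ennreal (norm ((deriv ^^ j) f 0) powr q)) + mnorm (wd ((deriv ^^ k) f) k))"
proof (induction k)
  case 0
  have "wd f 0 = f" for f by (simp add: wd_def fun_eq_iff)
  then show ?case by (intro exI[of _ 1]) simp
next
  case (Suc k)
  then obtain C where C: "0 < C" "\<And>f. f holomorphic_on ball 0 1 \<Longrightarrow>
    mnorm f \<le> ennreal C * ((\<Sum>j<k. ennreal (norm ((deriv ^^ j) f 0) powr q)) + mnorm (wd ((deriv ^^ k) f) k))" by blast
  obtain D where D: "0 < D" "\<And>F. F holomorphic_on ball 0 1 \<Longrightarrow>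
    mnorm (wd F k) \<le> ennreal D * (ennreal (norm (F 0) powr q) + mnorm (wd (deriv F) (Suc k)))"
    using mnorm_le_deriv by blast
  show ?case
  proof (intro exI[of _ "C * (1 + D)"] conjI allI impI)
    show "0 < C * (1 + D)" using C D by simp
    fix f :: "complex \<Rightarrow> complex" assume f: "f holomorphic_on ball 0 1"
    define s where "s = (\<Sum>j<k. ennreal (norm ((deriv ^^ j) f 0) powr q))"
    define v where "v = ennreal (norm ((deriv ^^ k) f 0) powr q)"
    define m where "m = mnorm (wd ((deriv ^^ Suc k) f) (Suc k))"
    have "mnorm f \<le> ennreal C * (s + mnorm (wd ((deriv ^^ k) f) k))" unfolding s_def by (rule C(2)[OF f])
    also have "\<dots> \<le> ennreal C * (s + ennreal D * (v + m))"
      unfolding v_def m_def using D(2)[OF holomorphic_on_funpow_deriv[OF f, of k]]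
      by (intro mult_left_mono add_left_mono) auto
    also have "\<dots> \<le> ennreal C * (ennreal (1 + D) * s + ennreal (1 + D) * (v + m))"
    proof (intro mult_left_mono add_mono mult_right_mono ennreal_leI)
      have "1 * s \<le> ennreal (1 + D) * s" using D by (intro mult_right_mono) auto
      then show "s \<le> ennreal (1 + D) * s" by simp
    qed auto
    also have "\<dots> = ennreal (C * (1 + D)) * ((s + v) + m)"
    proof -
      have "ennreal (C * (1 + D)) = ennreal C * ennreal (1 + D)" using C(1) by (intro ennreal_mult') auto
      then show ?thesis by (simp only: distrib_left add.assoc mult.assoc)
    qed
    finally show "mnorm f \<le> ennreal (C * (1 + D)) * ((\<Sum>j<Suc k. ennreal (norm ((deriv ^^ j) f 0) powr q)) + mnorm (wd ((deriv ^^ Suc k) f) (Suc k)))"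
      by (simp add: s_def v_def m_def)
  qed
qed

theorem comparable_mnorm:
  "comparable_on_H (\<lambda>f. ennreal_powr (mnorm f) (1 / q))
     (\<lambda>f. ennreal_powr (mnorm (wd ((deriv ^^ k) f) k)) (1 / q) + ennreal (\<Sum>j<k. norm ((deriv ^^ j) f 0)))"
proof -
  obtain C where C: "0 < C" "\<And>f. f holomorphic_on ball 0 1 \<Longrightarrow>
    mnorm f \<le> ennreal C * ((\<Sum>j<k. ennreal (norm ((deriv ^^ j) f 0) powr q)) + mnorm (wd ((deriv ^^ k) f) k))"
    using mnorm_le_higher_deriv by blast
  obtain D where D: "0 < D" "\<And>f. f holomorphic_on ball 0 1 \<Longrightarrow> mnorm (wd ((deriv ^^ k) f) k) \<le> ennreal D * mnorm f"
    using mnorm_deriv_le by blast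
  have "\<exists>B>0. \<forall>f. f holomorphic_on ball 0 1 \<longrightarrow> ennreal (norm ((deriv ^^ j) f 0) powr q) \<le> ennreal B * mnorm f" for j
    using deriv_0_le_mnorm[of j] by metis
  then obtain B where B: "\<And>j. 0 < B j" "\<And>j f. f holomorphic_on ball 0 1 \<Longrightarrow> ennreal (norm ((deriv ^^ j) f 0) powr q) \<le> ennreal (B j) * mnorm f"
    by metis
  define s where "s = 1 / q"
  have s: "0 < s" using q by (simp add: s_def)
  define U where "U = C powr s * 2 powr s * (real k powr s + 1)"
  define W where "W = D powr s + (\<Sum>j<k. B j powr s)"
  have U: "0 < U" using C by (simp add: U_def add_nonneg_pos)
  have W: "0 < W" using D by (simp add: W_def add_pos_nonneg sum_nonneg)
  show ?thesis
    unfolding comparable_on_H_def s_def[symmetric]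
  proof (intro exI[of _ "U + W"] conjI allI impI)
    show "0 < U + W" using U W by simp
    fix f :: "complex \<Rightarrow> complex" assume f: "f holomorphic_on ball 0 1"
    define Y where "Y = ennreal_powr (mnorm (wd ((deriv ^^ k) f) k)) s"
    define \<Sigma> where "\<Sigma> = (\<Sum>j<k. norm ((deriv ^^ j) f 0))"
    define N where "N = ennreal_powr (mnorm f) s"
    have \<Sigma>0: "0 \<le> \<Sigma>" by (simp add: \<Sigma>_def sum_nonneg)
    have "(\<Sum>j<k. ennreal (norm ((deriv ^^ j) f 0) powr q)) \<le> (\<Sum>j<k. ennreal (\<Sigma> powr q))"
    proof (intro sum_mono ennreal_leI powr_mono2)
      fix j assume j: "j \<in> {..<k}"
      show "norm ((deriv ^^ j) f 0) \<le> \<Sigma>" unfolding \<Sigma>_def using j by (intro member_le_sum) auto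
    qed (use q in auto)
    also have "\<dots> = ennreal (real k) * ennreal (\<Sigma> powr q)" by (simp add: ennreal_of_nat_eq_real_of_nat)
    finally have "mnorm f \<le> ennreal C * (ennreal (real k) * ennreal (\<Sigma> powr q) + mnorm (wd ((deriv ^^ k) f) k))"
      by (intro order_trans[OF C(2)[OF f]] mult_left_mono add_right_mono) auto
    then have "N \<le> ennreal_powr (ennreal C * (ennreal (real k) * ennreal (\<Sigma> powr q) + mnorm (wd ((deriv ^^ k) f) k))) s"
      unfolding N_def using s by (intro ennreal_powr_mono) auto
    also have "\<dots> = ennreal (C powr s) * ennreal_powr (ennreal (real k) * ennreal (\<Sigma> powr q) + mnorm (wd ((deriv ^^ k) f) k)) s"
      using C by (intro ennreal_powr_cmult) auto
    also have "\<dots> \<le> ennreal (C powr s) * (ennreal (2 powr s) * (ennreal_powr (ennreal (real k) * ennreal (\<Sigma> powr q)) s + Y))"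
      unfolding Y_def using s by (intro mult_left_mono ennreal_powr_add) auto
    also have "ennreal_powr (ennreal (real k) * ennreal (\<Sigma> powr q)) s = ennreal (real k powr s) * ennreal \<Sigma>"
      using q \<Sigma>0 by (subst ennreal_powr_cmult) (auto simp: powr_powr s_def)
    also have "ennreal (C powr s) * (ennreal (2 powr s) * (ennreal (real k powr s) * ennreal \<Sigma> + Y)) \<le> 
      ennreal (C powr s) * (ennreal (2 powr s) * (ennreal (real k powr s + 1) * ennreal \<Sigma> + ennreal (real k powr s + 1) * Y))"
    proof (intro mult_left_mono add_mono mult_right_mono ennreal_leI)
      have "1 * Y \<le> ennreal (real k powr s + 1) * Y" by (intro mult_right_mono) auto
      then show "Y \<le> ennreal (real k powr s + 1) * Y" by simp
    qed auto
    also have "\<dots> = ennreal U * (Y + ennreal \<Sigma>)"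
    proof -
      have "ennreal U = ennreal (C powr s) * (ennreal (2 powr s) * ennreal (real k powr s + 1))"
        by (simp add: U_def ennreal_mult' mult.assoc del: ennreal_plus)
      then show ?thesis by (simp only: distrib_left mult.assoc add.commute)
    qed
    also have "\<dots> \<le> ennreal (U + W) * (Y + ennreal \<Sigma>)" using W by (intro mult_right_mono ennreal_leI) auto
    finally show "N \<le> ennreal (U + W) * (Y + ennreal \<Sigma>)" .
    have Y: "Y \<le> ennreal (D powr s) * N"
    proof -
      have "Y \<le> ennreal_powr (ennreal D * mnorm f) s" unfolding Y_def using s by (intro ennreal_powr_mono D(2)[OF f]) auto
      then show ?thesis using D by (simp add: ennreal_powr_cmult N_def)
    qed
    have S1: "ennreal (norm ((deriv ^^ j) f 0)) \<le> ennreal (B j powr s) * N" for j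
    proof -
      have "ennreal_powr (ennreal (norm ((deriv ^^ j) f 0) powr q)) s \<le> ennreal_powr (ennreal (B j) * mnorm f) s"
        using s by (intro ennreal_powr_mono B(2)[OF f]) auto
      then show ?thesis using B(1)[of j] q by (simp add: ennreal_powr_cmult N_def powr_powr s_def)
    qed
    have "ennreal \<Sigma> = (\<Sum>j<k. ennreal (norm ((deriv ^^ j) f 0)))" unfolding \<Sigma>_def by (subst sum_ennreal) auto
    also have "\<dots> \<le> (\<Sum>j<k. ennreal (B j powr s) * N)" by (intro sum_mono S1)
    also have "\<dots> = ennreal (\<Sum>j<k. B j powr s) * N" by (simp add: sum_distrib_right[symmetric])
    finally have "Y + ennreal \<Sigma> \<le> ennreal (D powr s) * N + ennreal (\<Sum>j<k. B j powr s) * N" using Y by (intro add_mono)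
    also have "\<dots> = ennreal W * N" by (simp add: W_def distrib_right[symmetric] sum_nonneg)
    also have "\<dots> \<le> ennreal (U + W) * N" using U by (intro mult_right_mono ennreal_leI) auto
    finally have "ennreal (inverse (U + W)) * (Y + ennreal \<Sigma>) \<le> ennreal (inverse (U + W)) * (ennreal (U + W) * N)"
      by (intro mult_left_mono) auto
    also have "\<dots> = N"
    proof -
      have "ennreal (inverse (U + W)) * ennreal (U + W) = ennreal (inverse (U + W) * (U + W))"
        using U W by (intro ennreal_mult'[symmetric]) auto
      also have "inverse (U + W) * (U + W) = 1" using U W by simp
      finally show ?thesis by (simp only: mult.assoc[symmetric]) simp
    qed
    finally show "ennreal (inverse (U + W)) * (Y + ennreal \<Sigma>) \<le> N" .
  qed
qed

end

section \<open>Necessity: testing on monomials\<close>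

lemma one_minus_ge_exp:
  fixes t :: real assumes "0 \<le> t" "t \<le> 1/2" shows "exp (- 2 * t) \<le> 1 - t"
proof -
  have "1 / (1 - t) = 1 + t / (1 - t)" using assms by (simp add: field_simps)
  also have "\<dots> \<le> exp (t / (1 - t))" by (rule exp_ge_add_one_self)
  also have "\<dots> \<le> exp (2 * t)"
  proof -
    have "t * 1 \<le> t * (2 * (1 - t))" using assms by (intro mult_left_mono) auto
    then show ?thesis using assms by (simp add: pos_divide_le_eq mult.assoc mult.left_commute)
  qed
  finally have "1 \<le> exp (2 * t) * (1 - t)" using assms by (simp add: pos_divide_le_eq)
  then have "exp (- 2 * t) * 1 \<le> exp (- 2 * t) * (exp (2 * t) * (1 - t))" by (intro mult_left_mono) auto
  also have "\<dots> = (exp (- 2 * t) * exp (2 * t)) * (1 - t)" by simp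
  also have "exp (- 2 * t) * exp (2 * t) = 1" by (simp add: exp_add[symmetric])
  finally show ?thesis by simp
qed

lemma powr_mult_exp_small:
  fixes b c e :: real
  assumes "0 < c" "0 < e"
  obtains X where "1 \<le> X" "\<And>x. X \<le> x \<Longrightarrow> x powr b * exp (- c * x) \<le> e"
proof -
  have "((\<lambda>x. x powr b * exp (- c * x)) \<longlongrightarrow> 0) at_top" using assms(1) by real_asymp
  then have "\<forall>\<^sub>F x in at_top. x powr b * exp (- c * x) < e" using assms(2) by (rule order_tendstoD)
  then obtain X where "\<And>x. X \<le> x \<Longrightarrow> x powr b * exp (- c * x) < e" by (auto simp: eventually_at_top_linorder)
  then show ?thesis by (intro that[of "max 1 X"]) (auto intro: less_imp_le)
qed

context mixed_norm
begin

section \<open>Moments of the radial measure\<close>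

lemma mh_pos: "0 < d \<Longrightarrow> 0 < mh d" unfolding mh_def by (rule mu_pos)

lemma integrable_mu_bounded:
  fixes f :: "real \<Rightarrow> real"
  assumes "f \<in> borel_measurable borel" "\<And>r. 0 < r \<Longrightarrow> r < 1 \<Longrightarrow> \<bar>f r\<bar> \<le> B"
  shows "integrable mu f"
proof (rule mu.integrable_const_bound[where B=B])
  show "AE r in mu. norm (f r) \<le> B" using AE_mu by eventually_elim (use assms(2) in auto)
  show "f \<in> borel_measurable mu" using assms(1) by measurable
qed

lemma integral_mu_mono:
  fixes f g :: "real \<Rightarrow> real"
  assumes "f \<in> borel_measurable borel" "g \<in> borel_measurable borel"
    "\<And>r. 0 < r \<Longrightarrow> r < 1 \<Longrightarrow> \<bar>f r\<bar> \<le> B" "\<And>r. 0 < r \<Longrightarrow> r < 1 \<Longrightarrow> \<bar>g r\<bar> \<le> B'"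
    "\<And>r. 0 < r \<Longrightarrow> r < 1 \<Longrightarrow> f r \<le> g r"
  shows "(\<integral>r. f r \<partial>mu) \<le> (\<integral>r. g r \<partial>mu)"
proof (rule integral_mono_AE)
  show "AE r in mu. f r \<le> g r" using AE_mu by eventually_elim (use assms(5) in auto)
  show "integrable mu f" by (rule integrable_mu_bounded[OF assms(1,3)])
  show "integrable mu g" by (rule integrable_mu_bounded[OF assms(2,4)])
qed

text \<open>Up to the mass of \<open>sg\<close>, the \<open>p\<close>-th power of the norm of
  \<open>z^n * (1 - |z|)^k\<close>.\<close>

definition mom :: "nat \<Rightarrow> nat \<Rightarrow> real" where
  "mom n k = (\<integral>r. (r ^ n * (1 - r) ^ k) powr p \<partial>mu)"

lemma abs_radial_powr_le_1: "0 < r \<Longrightarrow> r < 1 \<Longrightarrow> \<bar>(r ^ n * (1 - r) ^ k) powr p\<bar> \<le> 1"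
  using p by (auto intro!: powr_le1 mult_le_one power_le_one)

lemma mom_nonneg: "0 \<le> mom n k" unfolding mom_def by (intro Bochner_Integration.integral_nonneg) auto

text \<open>When the modulus is radial the inner integral does not depend on the boundary point, so
  the exponent \<open>q\<close> cancels.\<close>

lemma norm_radial:
  assumes f: "continuous_on (ball 0 1) f" and c: "0 \<le> c"
    and nf: "\<And>z. norm z < 1 \<Longrightarrow> norm (f z) = c * (norm z ^ n * (1 - norm z) ^ k)"
  shows "ennreal_powr (mnorm f) (1 / q) = ennreal (c * (measure sg UNIV * mom n k) powr (1 / p))"
proof -
  define S where "S = measure sg UNIV"
  have S: "0 < S" using sg_pos by (simp add: S_def)
  have inn: "inner f x = ennreal (c powr p * (S * mom n k))" for x
  proof -
    have "inner f x = (\<integral>\<^sup>+r. ennreal (c powr p * (r ^ n * (1 - r) ^ k) powr p * S) \<partial>mu)"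
      unfolding inner_def
    proof (rule nn_integral_cong_AE)
      show "AE r in mu. (\<integral>\<^sup>+u. ennreal (norm (trunc f (pt x r u)) powr p) \<partial>sg) = ennreal (c powr p * (r ^ n * (1 - r) ^ k) powr p * S)"
        using AE_mu
      proof eventually_elim
        case (elim r)
        have "norm (trunc f (pt x r u)) powr p = c powr p * (r ^ n * (1 - r) ^ k) powr p" for u
          using elim c nf[of "pt x r u"] by (simp add: trunc_def norm_pt powr_mult)
        then show ?case by (simp add: sg.emeasure_eq_measure ennreal_mult S_def)
      qed
    qed
    also have "\<dots> = ennreal (\<integral>r. c powr p * (r ^ n * (1 - r) ^ k) powr p * S \<partial>mu)"
    proof (rule nn_integral_eq_integral)
      have "integrable mu (\<lambda>r. (r ^ n * (1 - r) ^ k) powr p)"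
        by (rule integrable_mu_bounded[OF _ abs_radial_powr_le_1]) auto
      then show "integrable mu (\<lambda>r. c powr p * (r ^ n * (1 - r) ^ k) powr p * S)" by simp
    qed (use S in auto)
    finally show ?thesis by (simp add: mom_def mult_ac)
  qed
  have m0: "0 \<le> S * mom n k" using S mom_nonneg by simp
  have "mnorm f = ennreal ((c powr p * (S * mom n k)) powr (q / p))"
    unfolding mnorm_def inn using m0 emeasure_restrict_space[of "{0..<1::real}" lborel "{0..<1}"]
    by (simp add: circle_def space_restrict_space)
  then have "ennreal_powr (mnorm f) (1 / q) = ennreal ((c powr p * (S * mom n k)) powr (1 / p))"
    using p q by (simp add: powr_powr)
  also have "(c powr p * (S * mom n k)) powr (1 / p) = c * (S * mom n k) powr (1 / p)"
    using p c by (simp add: powr_mult powr_powr)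
  finally show ?thesis by (simp add: S_def)
qed

text \<open>The test functions are \<open>z^n\<close>, with \<open>n >= 2 * k\<close> so that all
  derivatives at 0 of order below \<open>k\<close> vanish.\<close>

lemma monomial_comparison:
  assumes comp: "comparable_on_H (\<lambda>f. ennreal_powr (mnorm f) (1 / q))
     (\<lambda>f. ennreal_powr (mnorm (wd ((deriv ^^ k) f) k)) (1 / q) + ennreal (\<Sum>j<k. norm ((deriv ^^ j) f 0)))"
    and k: "1 \<le> k"
  obtains C where "1 \<le> C"
    "\<And>n. 2 * k \<le> n \<Longrightarrow> (real n ^ k) powr p * mom n k \<le> C * mom n 0"
    "\<And>n. 2 * k \<le> n \<Longrightarrow> mom n 0 \<le> C * ((real n ^ k) powr p * mom (n - k) k)"
proof -
  obtain C0 where C0: "0 < C0" "\<And>f. f holomorphic_on ball 0 1 \<Longrightarrow>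
     ennreal (inverse C0) * (ennreal_powr (mnorm (wd ((deriv ^^ k) f) k)) (1 / q) + ennreal (\<Sum>j<k. norm ((deriv ^^ j) f 0))) \<le> ennreal_powr (mnorm f) (1 / q)"
    "\<And>f. f holomorphic_on ball 0 1 \<Longrightarrow> ennreal_powr (mnorm f) (1 / q) \<le>
      ennreal C0 * (ennreal_powr (mnorm (wd ((deriv ^^ k) f) k)) (1 / q) + ennreal (\<Sum>j<k. norm ((deriv ^^ j) f 0)))"
    using comp unfolding comparable_on_H_def by blast
  define S where "S = measure sg UNIV"
  have S: "0 < S" using sg_pos by (simp add: S_def)
  define C where "C = max 1 (max (C0 powr p * (2 ^ k) powr p) (C0 powr p))"
  have key: "(real n ^ k) powr p * mom n k \<le> C * mom n 0 \<and> mom n 0 \<le> C * ((real n ^ k) powr p * mom (n - k) k)" if n: "2 * k \<le> n" for n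
  proof -
    \<comment> \<open>The coefficient of the \<open>k\<close>-th derivative, a product of
      \<open>k\<close> consecutive integers ending at \<open>n\<close>; for
      \<open>n >= 2 * k\<close> each factor lies between \<open>n / 2\<close> and
      \<open>n\<close>.\<close>
    define d where "d = pochhammer (real (Suc n - k)) k"
    have dprod: "d = (\<Prod>i<k. real (Suc n - k) + real i)" by (simp add: d_def pochhammer_prod lessThan_atLeast0)
    have d1: "(real n / 2) ^ k \<le> d"
    proof -
      have "(\<Prod>i<k. real n / 2) \<le> (\<Prod>i<k. real (Suc n - k) + real i)"
        using n by (intro prod_mono) (auto simp: of_nat_diff)
      then show ?thesis by (simp add: dprod)
    qed
    have d2: "d \<le> real n ^ k"
    proof -
      have "(\<Prod>i<k. real (Suc n - k) + real i) \<le> (\<Prod>i<k. real n)"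
        using n by (intro prod_mono) (auto simp: of_nat_diff)
      then show ?thesis by (simp add: dprod)
    qed
    have d0: "0 \<le> d" using d1 order_trans[OF _ d1] by simp
    define f where "f z = z ^ n" for z :: complex
    have f: "f holomorphic_on ball 0 1" unfolding f_def by (intro holomorphic_intros)
    have der: "(deriv ^^ j) f z = pochhammer (of_nat (Suc n - j)) j * z ^ (n - j)" for j z
      using higher_deriv_power[of j 0 n z] by (simp add: f_def[abs_def])
    have z0: "(\<Sum>j<k. norm ((deriv ^^ j) f 0)) = 0"
      using n by (intro sum.neutral) (auto simp: der)
    have n1: "ennreal_powr (mnorm f) (1 / q) = ennreal (1 * (S * mom n 0) powr (1 / p))"
      unfolding S_def by (rule norm_radial) (auto simp: f_def norm_power intro!: continuous_intros)
    have n2: "ennreal_powr (mnorm (wd ((deriv ^^ k) f) k)) (1 / q) = ennreal (d * (S * mom (n - k) k) powr (1 / p))"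
      unfolding S_def
    proof (rule norm_radial)
      show "continuous_on (ball 0 1) (wd ((deriv ^^ k) f) k)"
        by (intro wd_continuous holomorphic_on_imp_continuous_on holomorphic_higher_deriv[OF f]) auto
      fix z :: complex assume z: "norm z < 1"
      have "pochhammer (of_nat (Suc n - k)) k = (of_real d :: complex)"
        unfolding d_def by (simp add: pochhammer_of_real[symmetric] del: of_nat_diff)
      then show "norm (wd ((deriv ^^ k) f) k z) = d * (norm z ^ (n - k) * (1 - norm z) ^ k)"
        using d0 by (simp add: norm_wd[OF z] der norm_mult norm_power)
    qed (rule d0)
    have pp: "(y powr (1 / p)) powr p = y" if "0 \<le> y" for y using that p by (simp add: powr_powr)
    have "ennreal (inverse C0) * ennreal (d * (S * mom (n - k) k) powr (1 / p)) \<le> ennreal ((S * mom n 0) powr (1 / p))"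
      using C0(2)[OF f] by (simp add: n1 n2 z0)
    then have "ennreal (inverse C0 * (d * (S * mom (n - k) k) powr (1 / p))) \<le> ennreal ((S * mom n 0) powr (1 / p))"
      using C0(1) by (subst ennreal_mult') auto
    then have "inverse C0 * (d * (S * mom (n - k) k) powr (1 / p)) \<le> (S * mom n 0) powr (1 / p)"
      by (subst (asm) ennreal_le_iff) auto
    then have "d * (S * mom (n - k) k) powr (1 / p) \<le> C0 * (S * mom n 0) powr (1 / p)"
      using C0(1) by (simp add: field_simps)
    then have "(d * (S * mom (n - k) k) powr (1 / p)) powr p \<le> (C0 * (S * mom n 0) powr (1 / p)) powr p"
      using p d0 by (intro powr_mono2) auto
    then have "d powr p * (S * mom (n - k) k) \<le> C0 powr p * (S * mom n 0)"
      using d0 C0(1) by (simp add: powr_mult pp mom_nonneg less_imp_le[OF S])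
    then have a: "d powr p * mom (n - k) k \<le> C0 powr p * mom n 0" using S by (simp add: mult.left_commute)
    have "ennreal ((S * mom n 0) powr (1 / p)) \<le> ennreal C0 * ennreal (d * (S * mom (n - k) k) powr (1 / p))"
      using C0(3)[OF f] by (simp add: n1 n2 z0)
    then have "ennreal ((S * mom n 0) powr (1 / p)) \<le> ennreal (C0 * (d * (S * mom (n - k) k) powr (1 / p)))"
      using C0(1) by (subst ennreal_mult') auto
    then have "(S * mom n 0) powr (1 / p) \<le> C0 * (d * (S * mom (n - k) k) powr (1 / p))"
      using C0(1) d0 by (subst (asm) ennreal_le_iff) auto
    then have "((S * mom n 0) powr (1 / p)) powr p \<le> (C0 * (d * (S * mom (n - k) k) powr (1 / p))) powr p"
      using p by (intro powr_mono2) auto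
    then have "S * mom n 0 \<le> C0 powr p * (d powr p * (S * mom (n - k) k))"
      using d0 C0(1) by (simp add: powr_mult pp mom_nonneg less_imp_le[OF S])
    then have b: "mom n 0 \<le> C0 powr p * (d powr p * mom (n - k) k)" using S by (simp add: mult.left_commute)
    have mm: "mom n k \<le> mom (n - k) k"
      unfolding mom_def
    proof (rule integral_mu_mono[where B=1 and B'=1])
      fix r :: real assume r: "0 < r" "r < 1"
      have "r ^ n \<le> r ^ (n - k)" using r by (intro power_decreasing) auto
      then show "(r ^ n * (1 - r) ^ k) powr p \<le> (r ^ (n - k) * (1 - r) ^ k) powr p"
        using r p by (intro powr_mono2 mult_right_mono) auto
    qed (use abs_radial_powr_le_1 in simp_all)
    have "(real n ^ k) powr p = (2 ^ k) powr p * ((real n / 2) ^ k) powr p"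
      by (simp add: powr_mult[symmetric] power_divide)
    also have "\<dots> \<le> (2 ^ k) powr p * d powr p" using d1 p by (intro mult_left_mono powr_mono2) auto
    finally have "(real n ^ k) powr p * mom n k \<le> ((2 ^ k) powr p * d powr p) * mom (n - k) k"
      using mm mom_nonneg by (intro mult_mono) auto
    also have "\<dots> \<le> (2 ^ k) powr p * (C0 powr p * mom n 0)"
      using a by (simp add: mult.assoc mult_left_mono)
    also have "\<dots> \<le> C * mom n 0"
      using mom_nonneg[of n 0] by (simp add: C_def mult.assoc[symmetric] mult.commute[of "(2 ^ k) powr p"] mult_right_mono le_max_iff_disj)
    finally have 1: "(real n ^ k) powr p * mom n k \<le> C * mom n 0" .
    have "C0 powr p * (d powr p * mom (n - k) k) \<le> C * ((real n ^ k) powr p * mom (n - k) k)"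
      using d2 d0 p mom_nonneg by (intro mult_mono mult_right_mono powr_mono2) (auto simp: C_def le_max_iff_disj)
    then have 2: "mom n 0 \<le> C * ((real n ^ k) powr p * mom (n - k) k)" using b by linarith
    show ?thesis using 1 2 by simp
  qed
  show ?thesis by (rule that[of C]) (use key in \<open>auto simp: C_def\<close>)
qed

text \<open>For \<open>r >= 1 - d\<close> the power \<open>r ^ n\<close> is at least
  \<open>exp (- 2 * B)\<close>, because \<open>1 - d >= exp (- 2 * d)\<close>.\<close>

lemma mom0_ge:
  assumes "0 < d" "d \<le> 1/2" "d * real n \<le> B"
  shows "exp (- 2 * B * p) * mh d \<le> mom n 0"
proof -
  have "exp (- 2 * B * p) * mh d = (\<integral>r. exp (- 2 * B * p) * indicator {1 - d..<1} r \<partial>mu)"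
    by (simp add: mh_def)
  also have "\<dots> \<le> mom n 0"
    unfolding mom_def
  proof (rule integral_mu_mono[where B="exp (- 2 * B * p)" and B'=1])
    fix r :: real assume r: "0 < r" "r < 1"
    show "exp (- 2 * B * p) * indicator {1 - d..<1} r \<le> (r ^ n * (1 - r) ^ 0) powr p"
    proof (cases "1 - d \<le> r")
      case True
      have "exp (- 2 * B) \<le> exp (real n * (- 2 * d))" using assms by (simp add: mult.commute)
      also have "\<dots> = exp (- 2 * d) ^ n" by (rule exp_of_nat_mult)
      also have "\<dots> \<le> (1 - d) ^ n" using assms by (intro power_mono one_minus_ge_exp) auto
      also have "\<dots> \<le> r ^ n" using assms True by (intro power_mono) auto
      finally have "exp (- 2 * B) powr p \<le> (r ^ n) powr p" using p by (intro powr_mono2) auto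
      moreover have "exp (- 2 * B) powr p = exp (- 2 * B * p)" by (simp add: powr_def mult_ac)
      ultimately show ?thesis by (simp split: split_indicator)
    qed (use r in \<open>simp split: split_indicator\<close>)
  qed (use abs_radial_powr_le_1[of _ n 0] in \<open>simp_all split: split_indicator\<close>)
  finally show ?thesis .
qed

text \<open>Where \<open>n * (1 - r) >= B\<close>, the extra factor of the weighted moment is at
  least \<open>2 * C\<close>. Hence the part of \<open>mom n 0\<close> far from the circle is at
  most half of \<open>mom n 0\<close> and is absorbed.\<close>

lemma mom0_le:
  assumes C: "1 \<le> C" "(real n ^ k) powr p * mom n k \<le> C * mom n 0" and n: "0 < n" and k: "1 \<le> k"
    and B: "(B ^ k) powr p = 2 * C" "0 < B"
  shows "mom n 0 \<le> 2 * mh (B / n)"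
proof -
  have "mom n 0 \<le> (\<integral>r. indicator {1 - B / n..<1} r + (1 / (2 * C)) * ((real n ^ k) powr p * (r ^ n * (1 - r) ^ k) powr p) \<partial>mu)"
    unfolding mom_def
  proof (rule integral_mu_mono[where B=1 and B'="1 + (1 / (2 * C)) * ((real n ^ k) powr p * 1)"])
    fix r :: real assume r: "0 < r" "r < 1"
    show "\<bar>indicator {1 - B / n..<1} r + (1 / (2 * C)) * ((real n ^ k) powr p * (r ^ n * (1 - r) ^ k) powr p)\<bar> \<le> 1 + (1 / (2 * C)) * ((real n ^ k) powr p * 1)"
      using C abs_radial_powr_le_1[OF r, of n k]
      by (intro order_trans[OF abs_triangle_ineq] add_mono) (auto simp: abs_mult intro!: divide_right_mono mult_left_le split: split_indicator)
    show "(r ^ n * (1 - r) ^ 0) powr p \<le> indicator {1 - B / n..<1} r + (1 / (2 * C)) * ((real n ^ k) powr p * (r ^ n * (1 - r) ^ k) powr p)"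
    proof (cases "1 - B / n \<le> r")
      case True
      then show ?thesis using r abs_radial_powr_le_1[OF r, of n 0] C by (simp add: add_increasing2)
    next
      case False
      then have "B \<le> real n * (1 - r)" using n by (simp add: field_simps)
      then have "B ^ k \<le> (real n * (1 - r)) ^ k" using B by (intro power_mono) auto
      then have "(B ^ k) powr p \<le> ((real n * (1 - r)) ^ k) powr p" using p B by (intro powr_mono2) auto
      then have "2 * C * (r ^ n) powr p \<le> ((real n * (1 - r)) ^ k) powr p * (r ^ n) powr p"
        unfolding B(1) by (intro mult_right_mono) auto
      also have "\<dots> = (real n ^ k) powr p * (r ^ n * (1 - r) ^ k) powr p"
        using r by (simp add: powr_mult power_mult_distrib mult_ac)
      finally have "(r ^ n) powr p \<le> (1 / (2 * C)) * ((real n ^ k) powr p * (r ^ n * (1 - r) ^ k) powr p)"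
        using C by (simp add: field_simps)
      then show ?thesis using False by simp
    qed
  qed (use abs_radial_powr_le_1[of _ n 0] in simp_all)
  also have "\<dots> = mh (B / n) + (1 / (2 * C)) * ((real n ^ k) powr p * mom n k)"
  proof -
    have "integrable mu (\<lambda>r. (r ^ n * (1 - r) ^ k) powr p)" by (rule integrable_mu_bounded[OF _ abs_radial_powr_le_1]) auto
    moreover have "integrable mu (indicator {1 - B / n..<1} :: real \<Rightarrow> real)"
      by (rule integrable_mu_bounded[where B=1]) (auto split: split_indicator)
    ultimately show ?thesis by (subst Bochner_Integration.integral_add) (auto simp: mh_def mom_def)
  qed
  also have "\<dots> \<le> mh (B / n) + (1 / (2 * C)) * (C * mom n 0)"
    using C by (intro add_left_mono mult_left_mono) auto
  also have "\<dots> = mh (B / n) + mom n 0 / 2" using C by simp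
  finally show ?thesis by simp
qed

lemma mh_le_total: "mh d \<le> measure mu UNIV"
  unfolding mh_def by (intro mu.finite_measure_mono) auto

text \<open>The same moment is at least a constant times the mass within \<open>2 * B / n\<close> of
  the circle and at most twice the mass within \<open>B / n\<close>. Two such steps, at
  \<open>n\<close> and at \<open>2 * n\<close>, absorb the rounding of \<open>2 * B / d\<close> to
  an integer.\<close>

lemma doubling_of_comparison:
  assumes C: "1 \<le> C" "\<And>n. 2 * k \<le> n \<Longrightarrow> (real n ^ k) powr p * mom n k \<le> C * mom n 0" and k: "1 \<le> k"
  obtains B D where "1 \<le> B" "\<And>n. 2 * k \<le> n \<Longrightarrow> mom n 0 \<le> 2 * mh (B / n)"
    "1 \<le> D" "\<And>d. 0 < d \<Longrightarrow> d \<le> 1 \<Longrightarrow> mh d \<le> D * mh (d / 2)"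
proof -
  define B where "B = (2 * C) powr (1 / (k * p))"
  have B1: "1 \<le> B" unfolding B_def using C(1) p k by (intro ge_one_powr_ge_zero) auto
  have Bk: "(B ^ k) powr p = 2 * C"
  proof -
    have "(B ^ k) powr p = B powr (real k * p)" using B1 by (simp add: powr_realpow[symmetric] powr_powr)
    also have "\<dots> = 2 * C" using C(1) p k by (simp add: B_def powr_powr)
    finally show ?thesis .
  qed
  have m: "mom n 0 \<le> 2 * mh (B / n)" if "2 * k \<le> n" for n
    using that k by (intro mom0_le[OF C(1) C(2)[OF that] _ k Bk]) (use B1 in auto)
  define n0 where "n0 = max (2 * k) (nat \<lceil>4 * B\<rceil>)"
  define E where "E = 2 * exp (4 * B * p)"
  have E: "0 < E" by (simp add: E_def)
  have step: "mh (2 * B / n) \<le> E * mh (B / n)" if n: "n0 \<le> n" for n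
  proof -
    have nk: "2 * k \<le> n" "4 * B \<le> n" using n by (auto simp: n0_def nat_le_iff ceiling_le_iff)
    have np: "0 < real n" using nk B1 by linarith
    have "exp (- 2 * (2 * B) * p) * mh (2 * B / n) \<le> mom n 0"
      using nk np B1 by (intro mom0_ge) (auto simp: field_simps)
    also have "\<dots> \<le> 2 * mh (B / n)" by (rule m[OF nk(1)])
    finally have h1: "exp (4 * B * p) * (exp (- 2 * (2 * B) * p) * mh (2 * B / n)) \<le> exp (4 * B * p) * (2 * mh (B / n))"
      by (intro mult_left_mono) auto
    have h2: "exp (4 * B * p) * (exp (- 2 * (2 * B) * p) * mh (2 * B / n)) = mh (2 * B / n)"
      by (simp add: mult.assoc[symmetric] exp_add[symmetric])
    have "mh (2 * B / n) \<le> exp (4 * B * p) * (2 * mh (B / n))" using h1 unfolding h2 .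
    then show ?thesis by (simp add: E_def mult_ac)
  qed
  define d1 where "d1 = min 1 (B / (n0 + 1))"
  have d1: "0 < d1" using B1 by (simp add: d1_def)
  \<comment> \<open>The last entry serves \<open>d > d1\<close>, where \<open>mh d\<close> is at
    most the total mass and \<open>mh (d / 2)\<close> is at least
    \<open>mh (d1 / 2)\<close>.\<close>
  define D where "D = max (max 1 (E * E)) (measure mu UNIV / mh (d1 / 2))"
  have "mh d \<le> D * mh (d / 2)" if d: "0 < d" "d \<le> 1" for d
  proof (cases "d \<le> d1")
    case True
    define n where "n = nat \<lfloor>2 * B / d\<rfloor>"
    have Bd: "real n0 + 1 \<le> B / d"
    proof -
      have "d \<le> B / (n0 + 1)" using True by (simp add: d1_def)
      then show ?thesis using d B1 by (simp add: field_simps)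
    qed
    have n1: "real n \<le> 2 * B / d" "2 * B / d - 1 < real n"
      unfolding n_def using d B1 by (simp_all add: of_nat_nat)
    have n2: "B / d \<le> real n" using n1 Bd by simp
    have nn: "n0 \<le> n" using n2 Bd by simp
    have np: "0 < real n" using n2 Bd by linarith
    have "d \<le> 2 * B / n" using n1(1) np d by (simp add: field_simps)
    then have "mh d \<le> mh (2 * B / n)" by (rule mh_mono)
    also have "\<dots> \<le> E * mh (B / n)" by (rule step[OF nn])
    also have "B / n = 2 * B / (2 * n)" by simp
    also have "E * mh (2 * B / (2 * n)) \<le> E * (E * mh (B / (2 * n)))"
      using step[of "2 * n"] nn E by (intro mult_left_mono) auto
    also have "\<dots> \<le> E * (E * mh (d / 2))"
      using n2 np d E by (intro mult_left_mono mh_mono) (auto simp: field_simps)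
    also have "\<dots> \<le> D * mh (d / 2)"
      unfolding mult.assoc[symmetric] using mh_pos[of "d/2"] d by (intro mult_right_mono) (auto simp: D_def)
    finally show ?thesis .
  next
    case False
    have p1: "0 < mh (d1 / 2)" using d1 by (intro mh_pos) auto
    have "mh d \<le> measure mu UNIV / mh (d1 / 2) * mh (d1 / 2)" using mh_le_total[of d] p1 by simp
    also have "\<dots> \<le> D * mh (d / 2)"
      using False p1 by (intro mult_mono mh_mono) (auto simp: D_def)
    finally show ?thesis .
  qed
  then show ?thesis using m B1 by (intro that[of B D]) (auto simp: D_def)
qed

text \<open>Put \<open>x = n * (1 - r)\<close>. In the weighted moment the zone
  \<open>x <= 1 / A\<close> is small because of the factor \<open>x powr b\<close>, the zone
  \<open>x > A'\<close> because of exponential decay; each amounts to at most a quarter of the lower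
  bound for \<open>mom n 0\<close>. So the middle zone must carry mass, and this is decay between
  the distances \<open>A' / n\<close> and \<open>1 / (A * n)\<close>.\<close>

lemma decay_of_comparison:
  assumes C: "1 \<le> C" "\<And>n. 2 * k \<le> n \<Longrightarrow> mom n 0 \<le> C * ((real n ^ k) powr p * mom (n - k) k)" and k: "1 \<le> k"
    and B: "1 \<le> B" "\<And>n. 2 * k \<le> n \<Longrightarrow> mom n 0 \<le> 2 * mh (B / n)"
    and D: "1 \<le> D" "\<And>d. 0 < d \<Longrightarrow> d \<le> 1 \<Longrightarrow> mh d \<le> D * mh (d / 2)"
  obtains K e d0 where "1 < K" "0 < e" "0 < d0" "\<And>d. 0 < d \<Longrightarrow> d \<le> d0 \<Longrightarrow> (1 + e) * mh (d / K) \<le> mh d"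
proof -
  define b where "b = real k * p"
  have b: "0 < b" using k p by (simp add: b_def)
  define c where "c = exp (- 2 * p)"
  have c: "0 < c" by (simp add: c_def)
  \<comment> \<open>Makes the zone \<open>x <= 1 / A\<close>, after multiplication by
    \<open>C\<close>, contribute at most \<open>c / 4\<close> times its mass.\<close>
  define A where "A = max 1 ((4 * C / c) powr (1 / b))"
  have A1: "1 \<le> A" by (simp add: A_def)
  have Ab: "C * (1 / A) powr b \<le> c / 4"
  proof -
    have "4 * C / c = ((4 * C / c) powr (1 / b)) powr b" using C(1) c b by (simp add: powr_powr)
    also have "\<dots> \<le> A powr b" using b by (intro powr_mono2) (auto simp: A_def)
    finally have "4 * C / c \<le> A powr b" .
    moreover have "0 < A powr b" using A1 by simp
    ultimately show ?thesis using c A1 by (simp add: powr_divide field_simps)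
  qed
  \<comment> \<open>The far zone will be bounded by the mass within \<open>8 * B / n\<close>;
    \<open>j\<close> halvings lead from there to \<open>1 / (A * n)\<close>. Their cost
    \<open>D ^ j\<close> is built into \<open>ep\<close>, so that
    \<open>C * ep * 2 * D ^ j = c / 4\<close>.\<close>
  obtain j where j: "8 * B * A \<le> 2 ^ j" using real_arch_pow[of 2 "8 * B * A"] by (auto intro: less_imp_le)
  define ep where "ep = c / (8 * C * D ^ j)"
  have ep: "0 < ep" using c C(1) D(1) by (simp add: ep_def)
  obtain A' where A': "1 \<le> A'" "\<And>x. A' \<le> x \<Longrightarrow> x powr b * exp (- (p/8) * x) \<le> ep"
    using powr_mult_exp_small[of "p/8" ep b] p ep by auto
  define e where "e = c / (2 * C * A' powr b)"
  have e: "0 < e" using c C(1) A' by (simp add: e_def)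
  have Dj: "mh d \<le> D ^ i * mh (d / 2 ^ i)" if "0 < d" "d \<le> 1" for d i
  proof (induction i)
    case (Suc i)
    have "d / 2 ^ i \<le> 1" using that by (simp add: divide_le_eq_1) (meson order_trans one_le_numeral one_le_power)
    then have "D ^ i * mh (d / 2 ^ i) \<le> D ^ i * (D * mh (d / 2 ^ i / 2))"
      using D that by (intro mult_left_mono D(2)) auto
    then show ?case using Suc by (simp add: mult_ac)
  qed simp
  have main: "(1 + e) * mh (1 / (A * n)) \<le> mh (A' / n)" if n: "8 * k + 8 + nat \<lceil>8 * B\<rceil> \<le> n" for n
  proof -
    have nB: "8 * B \<le> real n" using n by linarith
    have n8: "8 \<le> n" "2 * k \<le> n" "8 * k \<le> n" using n by auto
    have np: "0 < real n" using n8 by simp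
    \<comment> \<open>\<open>r ^ (n - k)\<close> contains \<open>r ^ n4\<close> twice: one copy
      supplies the exponential decay, the other is kept so that the far zone is bounded by the
      moment \<open>mom n4 0\<close>.\<close>
    define n4 where "n4 = n div 4"
    have n4: "2 * k \<le> n4" "real n \<le> 8 * real n4" "4 * n4 \<le> n" "0 < n4"
      unfolding n4_def using n8 by linarith+
    define m1 where "m1 = mh (1 / (A * n))"
    define m2 where "m2 = mh (A' / n)"
    have An: "1 / (A * n) \<le> A' / n"
    proof -
      have "1 / A \<le> 1" using A1 by simp
      then have "1 / A \<le> A'" using A'(1) by linarith
      then have "(1 / A) / n \<le> A' / n" using np by (intro divide_right_mono) auto
      then show ?thesis by simp
    qed
    have pw: "(real n ^ k) powr p * (r ^ (n - k) * (1 - r) ^ k) powr p \<le>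
        (1 / A) powr b * indicator {1 - 1 / (A * n)..<1} r +
        A' powr b * indicator ({1 - A' / n..<1} - {1 - 1 / (A * n)..<1}) r +
        ep * (r ^ n4 * (1 - r) ^ 0) powr p" if r: "0 < r" "r < 1" for r
    proof -
      define x where "x = real n * (1 - r)"
      have x: "0 < x" using np r by (simp add: x_def)
      have r1: "(r ^ (n - k)) powr p \<le> 1" using r p by (auto intro!: powr_le1 power_le_one)
      have lhs: "(real n ^ k) powr p * (r ^ (n - k) * (1 - r) ^ k) powr p = x powr b * (r ^ (n - k)) powr p"
      proof -
        have "x powr b = (x ^ k) powr p" using x by (simp add: b_def powr_realpow[symmetric] powr_powr)
        then show ?thesis using r by (simp add: x_def power_mult_distrib powr_mult mult_ac)
      qed
      have t3: "0 \<le> ep * (r ^ n4 * (1 - r) ^ 0) powr p" using ep by simp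
      consider "x \<le> 1 / A" | "1 / A < x" "x \<le> A'" | "A' < x" by linarith
      then show ?thesis
      proof cases
        case 1
        have "1 - 1 / (A * n) \<le> r" using 1 np A1 by (simp add: x_def field_simps)
        moreover have "x powr b * (r ^ (n - k)) powr p \<le> (1 / A) powr b * 1"
          using 1 x b r1 by (intro mult_mono powr_mono2) auto
        ultimately show ?thesis unfolding lhs using t3 r by simp
      next
        case 2
        have "1 - A' / n \<le> r" using 2 np by (simp add: x_def field_simps)
        moreover have "\<not> 1 - 1 / (A * n) \<le> r" using 2 np A1 by (simp add: x_def field_simps)
        moreover have "x powr b * (r ^ (n - k)) powr p \<le> A' powr b * 1"
          using 2 x b r1 by (intro mult_mono powr_mono2) auto
        ultimately show ?thesis unfolding lhs using t3 r by simp
      next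
        case 3
        have nk: "n4 + n4 \<le> n - k" using n4 n8 by linarith
        have "r ^ (n - k) \<le> r ^ n4 * r ^ n4" unfolding power_add[symmetric] using r nk by (intro power_decreasing) auto
        then have "(r ^ (n - k)) powr p \<le> (r ^ n4 * r ^ n4) powr p" using r p by (intro powr_mono2) auto
        also have "\<dots> = (r ^ n4) powr p * (r ^ n4) powr p" using r by (simp add: powr_mult)
        also have "\<dots> \<le> exp (- (p/8) * x) * (r ^ n4) powr p"
        proof (intro mult_right_mono)
          have "r \<le> exp (- (1 - r))" using exp_ge_add_one_self[of "- (1 - r)"] by simp
          then have "r ^ n4 \<le> exp (- (1 - r)) ^ n4" using r by (intro power_mono) auto
          also have "\<dots> = exp (- (real n4 * (1 - r)))" by (simp add: exp_of_nat_mult[symmetric] algebra_simps)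
          finally have "(r ^ n4) powr p \<le> exp (- (real n4 * (1 - r))) powr p" using r p by (intro powr_mono2) auto
          also have "\<dots> = exp (- (p * (real n4 * (1 - r))))" by (simp add: powr_def)
          also have "\<dots> \<le> exp (- (p/8) * x)"
          proof -
            have "real n * (1 - r) \<le> 8 * real n4 * (1 - r)" using n4(2) r by (intro mult_right_mono) auto
            then have "p * (real n * (1 - r)) \<le> p * (8 * (real n4 * (1 - r)))" using p by (intro mult_left_mono) auto
            then show ?thesis by (simp add: x_def)
          qed
          finally show "(r ^ n4) powr p \<le> exp (- (p/8) * x)" .
        qed simp
        finally have "x powr b * (r ^ (n - k)) powr p \<le> (x powr b * exp (- (p/8) * x)) * (r ^ n4) powr p"
          by (simp add: mult_left_mono mult.assoc)
        also have "\<dots> \<le> ep * (r ^ n4) powr p" using 3 by (intro mult_right_mono A'(2)) auto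
        finally have "x powr b * (r ^ (n - k)) powr p \<le> ep * (r ^ n4 * (1 - r) ^ 0) powr p" by simp
        then show ?thesis unfolding lhs by (simp add: add_increasing)
      qed
    qed
    define Z where "Z = {1 - A' / n..<1} - {1 - 1 / (A * n)..<1}"
    have mZ: "measure mu Z = m2 - m1"
      unfolding Z_def m1_def m2_def mh_def using An by (intro mu.finite_measure_Diff) auto
    have "1 / n \<le> 1 / real 8" using n8 by (intro divide_left_mono) auto
    then have n12: "1 / real n \<le> 1/2" by simp
    have "1 / (A * n) \<le> 1 / n" using A1 np by (simp add: field_simps)
    then have "c * m1 \<le> c * mh (1 / n)" unfolding m1_def using c by (intro mult_left_mono mh_mono) auto
    also have "\<dots> \<le> mom n 0"
      using mom0_ge[of "1 / n" n 1] n12 np by (simp add: c_def)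
    also have "\<dots> \<le> C * ((real n ^ k) powr p * mom (n - k) k)" by (rule C(2)[OF n8(2)])
    also have "(real n ^ k) powr p * mom (n - k) k \<le> (1 / A) powr b * m1 + A' powr b * (m2 - m1) + ep * mom n4 0"
    proof -
      have i1: "integrable mu (\<lambda>r. (r ^ i * (1 - r) ^ j) powr p)" for i j by (rule integrable_mu_bounded[OF _ abs_radial_powr_le_1]) auto
      have i2: "integrable mu (indicator S :: real \<Rightarrow> real)" if "S \<in> sets borel" for S
        using that by (intro integrable_mu_bounded[where B=1]) (auto split: split_indicator)
      have Zs: "Z \<in> sets borel" by (simp add: Z_def)
      have "(real n ^ k) powr p * mom (n - k) k = (\<integral>r. (real n ^ k) powr p * (r ^ (n - k) * (1 - r) ^ k) powr p \<partial>mu)"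
        by (simp add: mom_def)
      also have "\<dots> \<le> (\<integral>r. (1 / A) powr b * indicator {1 - 1 / (A * n)..<1} r + A' powr b * indicator Z r + ep * (r ^ n4 * (1 - r) ^ 0) powr p \<partial>mu)"
      proof (rule integral_mono_AE)
        show "AE r in mu. (real n ^ k) powr p * (r ^ (n - k) * (1 - r) ^ k) powr p \<le>
          (1 / A) powr b * indicator {1 - 1 / (A * n)..<1} r + A' powr b * indicator Z r + ep * (r ^ n4 * (1 - r) ^ 0) powr p"
          using AE_mu by eventually_elim (use pw in \<open>simp add: Z_def\<close>)
      qed (intro Bochner_Integration.integrable_add integrable_mult_right i1 i2 Zs | simp)+
      also have "\<dots> = (1 / A) powr b * m1 + A' powr b * measure mu Z + ep * mom n4 0"
      proof -
        have I1: "integrable mu (\<lambda>r. (1 / A) powr b * indicator {1 - 1 / (A * n)..<1} r)" by (intro integrable_mult_right i2) auto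
        have I2: "integrable mu (\<lambda>r. A' powr b * indicator Z r)" by (intro integrable_mult_right i2 Zs)
        have I3: "integrable mu (\<lambda>r. ep * (r ^ n4 * (1 - r) ^ 0) powr p)" by (intro integrable_mult_right i1)
        show ?thesis
          unfolding Bochner_Integration.integral_add[OF Bochner_Integration.integrable_add[OF I1 I2] I3]
            Bochner_Integration.integral_add[OF I1 I2]
          using Zs by (simp add: m1_def mh_def mom_def)
      qed
      finally show ?thesis by (simp add: mZ)
    qed
    also have "mom n4 0 \<le> 2 * (D ^ j * m1)"
    proof -
      have "mom n4 0 \<le> 2 * mh (B / n4)" by (rule B(2)[OF n4(1)])
      also have "mh (B / n4) \<le> mh (8 * B / n)"
      proof (rule mh_mono)
        have "B * real n \<le> B * (8 * real n4)" using n4(2) B(1) by (intro mult_left_mono) auto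
        then show "B / n4 \<le> 8 * B / n" using n4(4) np by (simp add: divide_simps mult_ac)
      qed
      also have "\<dots> \<le> D ^ j * mh (8 * B / n / 2 ^ j)" using nB np B(1) by (intro Dj) auto
      also have "mh (8 * B / n / 2 ^ j) \<le> m1"
        unfolding m1_def
      proof (rule mh_mono)
        show "8 * B / n / 2 ^ j \<le> 1 / (A * n)" using j A1 np by (simp add: field_simps)
      qed
      finally show ?thesis using D(1) by (simp add: mult_left_mono)
    qed
    finally have "c * m1 \<le> C * ((1 / A) powr b * m1 + A' powr b * (m2 - m1) + ep * (2 * (D ^ j * m1)))"
      using C(1) ep by (simp add: mult_left_mono add_mono)
    also have "\<dots> = (C * (1 / A) powr b) * m1 + C * A' powr b * (m2 - m1) + (C * ep * 2 * D ^ j) * m1" by (simp add: algebra_simps)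
    also have "C * ep * 2 * D ^ j = c / 4" using C(1) D(1) by (simp add: ep_def)
    also have "(C * (1 / A) powr b) * m1 \<le> c / 4 * m1"
      using Ab mh_pos[of "1 / (A * n)"] A1 np by (intro mult_right_mono) (auto simp: m1_def)
    \<comment> \<open>Two quarters of \<open>c * m1\<close> have been absorbed on the left.\<close>
    finally have "c / 2 * m1 \<le> C * A' powr b * (m2 - m1)" by (simp add: algebra_simps)
    then have "e * m1 \<le> m2 - m1" using C(1) A'(1) by (simp add: e_def field_simps)
    then show ?thesis by (simp add: m1_def[symmetric] m2_def[symmetric] algebra_simps)
  qed
  define N0 where "N0 = 8 * k + 8 + nat \<lceil>8 * B\<rceil>"
  show ?thesis
  \<comment> \<open>Below, \<open>n\<close> is \<open>A' / d\<close> rounded up, hence at most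
    \<open>2 * (A' / d)\<close>; this rounding accounts for the 2 in
    \<open>2 * A * A'\<close>.\<close>
  proof (rule that[of "2 * A * A'" e "A' / (real N0 + 1)"])
    have "1 * 1 \<le> A * A'" using A1 A'(1) by (intro mult_mono) auto
    then show "1 < 2 * A * A'" by simp
    show "0 < e" by (rule e)
    show "0 < A' / (real N0 + 1)" using A'(1) by simp
    fix d :: real assume d: "0 < d" "d \<le> A' / (real N0 + 1)"
    define n where "n = nat \<lceil>A' / d\<rceil>"
    have Ad: "real N0 + 1 \<le> A' / d" using d by (simp add: field_simps)
    have n1: "A' / d \<le> real n" "real n < A' / d + 1"
      unfolding n_def using A'(1) d by (simp_all add: of_nat_nat) linarith+
    have nN: "N0 \<le> n" using n1 Ad by simp
    have np: "0 < real n" using n1 Ad by linarith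
    have n2: "real n \<le> 2 * (A' / d)" using n1 Ad by linarith
    have "(1 + e) * mh (d / (2 * A * A')) \<le> (1 + e) * mh (1 / (A * n))"
    proof (intro mult_left_mono mh_mono)
      have "d * n \<le> 2 * A'" using n2 d by (simp add: field_simps)
      then have "d * (A * n) \<le> 2 * A * A'" using A1 by (simp add: mult.left_commute mult.assoc)
      then show "d / (2 * A * A') \<le> 1 / (A * n)" using A1 A'(1) np by (simp add: divide_simps)
    qed (use e in simp)
    also have "\<dots> \<le> mh (A' / n)" using main[of n] nN by (simp add: N0_def)
    also have "\<dots> \<le> mh d" using n1 np d by (intro mh_mono) (simp add: field_simps)
    finally show "(1 + e) * mh (d / (2 * A * A')) \<le> mh d" .
  qed
qed

end

section \<open>Radial weights\<close>

text \<open>A ray is a null set of the plane, so measurability on the disc says nothing about a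
  given ray. In polar coordinates almost every ray meets the exceptional set of a Borel version in a
  null set; along one such ray the Borel version yields the profile, because \<open>\<omega>\<close>
  has the same values on all rays.\<close>

lemma radial_weight_profile:
  assumes "radial_weight \<omega>"
  obtains w :: "real \<Rightarrow> real" where "w \<in> borel_measurable borel" "\<And>r. 0 \<le> w r"
    "\<And>r. r \<notin> {0<..<1} \<Longrightarrow> w r = 0"
    "AE r in lborel. r \<in> {0<..<1} \<longrightarrow> \<omega> (of_real r) = w r"
    "AE z in lborel. z \<in> ball 0 1 \<longrightarrow> \<omega> z = w (norm z)"
    "(\<integral>\<^sup>+r. ennreal (w r * r) \<partial>lborel) < \<infinity>"
proof -
  have nn: "0 \<le> \<omega> z" and rad: "\<omega> z = \<omega> (of_real (norm z))" if "z \<in> ball 0 1" for z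
    using assms that unfolding radial_weight_def weight_def by blast+
  define W where "W z = indicator (ball 0 1) z *\<^sub>R \<omega> z" for z
  have intW: "integrable lebesgue W"
    using assms unfolding radial_weight_def weight_def set_integrable_def W_def[abs_def] by blast
  have WM: "W \<in> borel_measurable lebesgue" using intW by (rule borel_measurable_integrable)
  obtain W' where W' [measurable]: "W' \<in> borel_measurable borel" and WW': "AE z in lborel. W z = W' z"
    using completion_ex_borel_measurable_real[OF WM] by auto
  obtain N where N: "{z. W z \<noteq> W' z} \<subseteq> N" "emeasure lborel N = 0" "N \<in> sets borel"
    using AE_E[OF WW'] by auto
  have [measurable]: "N \<in> sets borel" by (rule N)
  have [measurable]: "ray (indicator N) \<in> borel_measurable borel" by (rule ray_measurable) simp
  have "ennreal (2 * pi) * (\<integral>\<^sup>+x\<in>{0..<1}. ray (indicator N) (2 * pi * x) \<partial>lborel) = 0"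
    using nn_integral_polar[of "indicator N"] N(2) by simp
  then have "(\<integral>\<^sup>+x\<in>{0..<1::real}. ray (indicator N) (2 * pi * x) \<partial>lborel) = 0"
    using pi_gt_zero by (auto simp: ennreal_eq_0_iff)
  then have "AE x in lborel. ray (indicator N) (2 * pi * x) * indicator {0..<1} x = 0"
    by (subst (asm) nn_integral_0_iff_AE) simp_all
  then have 1: "AE x in lborel. x \<in> {0..<1::real} \<longrightarrow> ray (indicator N) (2 * pi * x) = 0"
    by eventually_elim (auto split: split_indicator_asm)
  have "\<exists>x. ray (indicator N) (2 * pi * x) = 0"
  proof (rule ccontr)
    assume "\<not> ?thesis"
    with 1 have "AE x in lborel. x \<notin> {0..<1::real}" by auto
    then have "emeasure lborel {0..<1::real} = 0" by (intro AE_iff_measurable[THEN iffD1]) auto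
    then show False by simp
  qed
  then obtain \<phi> where \<phi>: "ray (indicator N) \<phi> = 0" by blast
  have "AE r in lborel. ennreal r * indicator N (of_real r * cis \<phi>) * indicator {0<..} r = 0"
    using \<phi> unfolding ray_def by (subst (asm) nn_integral_0_iff_AE) auto
  then have AEr: "AE r in lborel. 0 < r \<longrightarrow> W (of_real r * cis \<phi>) = W' (of_real r * cis \<phi>)"
  proof eventually_elim
    case (elim r)
    then have "0 < r \<longrightarrow> of_real r * cis \<phi> \<notin> N" by (auto simp: ennreal_eq_0_iff split: split_indicator_asm)
    then show ?case using N(1) by auto
  qed
  define w where "w r = indicator {0<..<1} r * max 0 (W' (of_real r * cis \<phi>))" for r :: real
  have w [measurable]: "w \<in> borel_measurable borel" unfolding w_def[abs_def] by measurable
  have w0: "0 \<le> w r" for r by (simp add: w_def)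
  have w1: "r \<notin> {0<..<1} \<Longrightarrow> w r = 0" for r by (simp add: w_def)
  have w2: "AE r in lborel. r \<in> {0<..<1} \<longrightarrow> \<omega> (of_real r) = w r"
    using AEr
  proof eventually_elim
    case (elim r)
    show ?case
    proof
      assume r: "r \<in> {0<..<1}"
      have z: "of_real r * cis \<phi> \<in> ball 0 1" and nz: "norm (of_real r * cis \<phi>) = r" using r by (auto simp: norm_mult)
      have "W' (of_real r * cis \<phi>) = \<omega> (of_real r * cis \<phi>)" using elim r z by (simp add: W_def)
      also have "\<dots> = \<omega> (of_real r)" using rad[OF z] nz by simp
      finally show "\<omega> (of_real r) = w r" using r nn[of "of_real r"] by (simp add: w_def)
    qed
  qed
  \<comment> \<open>The converse passage: a null set \<open>M\<close> of radii gives a null set of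
    points, again by polar coordinates.\<close>
  obtain M where M: "{r. \<not> (r \<in> {0<..<1} \<longrightarrow> \<omega> (of_real r) = w r)} \<subseteq> M" "emeasure lborel M = 0" "M \<in> sets borel"
    using AE_E[OF w2] by auto
  have [measurable]: "M \<in> sets borel" by (rule M)
  have "AE r in lborel. r \<notin> M" using M by (intro AE_not_in) (auto simp: null_sets_def)
  then have "ray (\<lambda>z. indicator M (norm z)) x = 0" for x
    unfolding ray_def by (subst nn_integral_0_iff_AE) (auto simp: norm_mult split: split_indicator)
  then have "(\<integral>\<^sup>+z. indicator M (norm (z::complex)) \<partial>lborel) = 0"
    by (subst nn_integral_polar) auto
  then have "AE z in lborel. indicator M (norm (z::complex)) = (0::ennreal)"
    by (subst (asm) nn_integral_0_iff_AE) auto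
  moreover have "AE z in lborel. z \<noteq> (0::complex)" by (rule AE_lborel_singleton)
  ultimately have w3: "AE z in lborel. z \<in> ball 0 1 \<longrightarrow> \<omega> z = w (norm z)"
  proof eventually_elim
    case (elim z)
    then have "norm z \<notin> M" by (simp split: split_indicator_asm)
    then have "norm z \<in> {0<..<1} \<longrightarrow> \<omega> (of_real (norm z)) = w (norm z)" using M(1) by blast
    then show ?case using elim(2) rad[of z] by auto
  qed
  have "ennreal (2 * pi) * (\<integral>\<^sup>+r. ennreal (w r * r) \<partial>lborel) = (\<integral>\<^sup>+z. ennreal (w (norm (z::complex))) \<partial>lborel)"
  proof -
    have "ray (\<lambda>z. ennreal (w (norm z))) x = (\<integral>\<^sup>+r. ennreal (w r * r) \<partial>lborel)" for x
      unfolding ray_def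
      by (intro nn_integral_cong) (auto simp: norm_mult ennreal_mult'[symmetric] mult.commute w_def split: split_indicator)
    then show ?thesis by (subst nn_integral_polar) (auto simp: nn_integral_cmult)
  qed
  also have "\<dots> = (\<integral>\<^sup>+z. ennreal (W z) \<partial>lborel)"
    using w3 by (intro nn_integral_cong_AE, eventually_elim) (auto simp: W_def w_def split: split_indicator)
  also have "\<dots> = (\<integral>\<^sup>+z. ennreal (norm (W z)) \<partial>lebesgue)"
    unfolding nn_integral_completion using nn by (intro nn_integral_cong) (auto simp: W_def split: split_indicator)
  also have "\<dots> < \<infinity>" using intW unfolding integrable_iff_bounded by blast
  finally have w4: "(\<integral>\<^sup>+r. ennreal (w r * r) \<partial>lborel) < \<infinity>"
    by (auto simp: ennreal_mult_less_top)
  show ?thesis by (rule that[OF w w0 _ w2 w3 w4]) (rule w1)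
qed

locale radial_profile =
  fixes \<omega> :: "complex \<Rightarrow> real" and w :: "real \<Rightarrow> real"
  assumes w [measurable]: "w \<in> borel_measurable borel" and w_nonneg: "\<And>r. 0 \<le> w r"
    and w_zero: "\<And>r. r \<notin> {0<..<1} \<Longrightarrow> w r = 0"
    and AE_w: "AE r in lborel. r \<in> {0<..<1} \<longrightarrow> \<omega> (of_real r) = w r"
    and AE_w_norm: "AE z in lborel. z \<in> ball 0 1 \<longrightarrow> \<omega> z = w (norm z)"
    and w_integrable: "(\<integral>\<^sup>+r. ennreal (w r * r) \<partial>lborel) < \<infinity>"
    and tail_pos: "\<And>z. z \<in> ball 0 1 \<Longrightarrow> 0 < tail_integral \<omega> z"
begin

definition mu :: "real measure" where "mu = density lborel (\<lambda>r. ennreal (w r * r))"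

lemma sets_mu: "sets mu = sets borel" by (simp add: mu_def)

lemma nn_integral_mu: "F \<in> borel_measurable borel \<Longrightarrow> (\<integral>\<^sup>+r. F r \<partial>mu) = (\<integral>\<^sup>+r. ennreal (w r * r) * F r \<partial>lborel)"
  unfolding mu_def by (subst nn_integral_density) auto

lemma finite_measure_mu: "finite_measure mu"
  using w_integrable by (intro finite_measureI) (simp add: mu_def emeasure_density)

lemma AE_mu: "AE r in mu. 0 < r \<and> r < 1"
proof -
  have "0 < r \<and> r < 1" if "0 < ennreal (w r * r)" for r
    using that w_zero[of r] by (cases "r \<in> {0<..<1}") auto
  then have "AE r in lborel. 0 < ennreal (w r * r) \<longrightarrow> 0 < r \<and> r < 1" by blast
  then show ?thesis unfolding mu_def using AE_density[of "\<lambda>r. ennreal (w r * r)" lborel "\<lambda>r. 0 < r \<and> r < 1"] by simp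
qed

lemma AE_w_atLeast: 
  assumes "0 \<le> r" shows "AE s in lborel. s \<in> {r..<1} \<longrightarrow> \<omega> (of_real s) = w s"
  using AE_w AE_lborel_singleton[of "0::real"] by eventually_elim (use assms in auto)

lemma tail_integral_eq:
  assumes "0 \<le> r" shows "tail_integral \<omega> (of_real r) = (\<integral>\<^sup>+s\<in>{r..<1}. ennreal (w s) \<partial>lborel)"
  unfolding tail_integral_def nn_integral_completion
proof (rule nn_integral_cong_AE)
  show "AE s in lborel. ennreal (\<omega> (of_real s)) * indicator {norm (of_real r :: complex)..<1} s
      = ennreal (w s) * indicator {r..<1} s"
    using AE_w_atLeast[OF assms] by eventually_elim (use assms in \<open>auto split: split_indicator\<close>)
qed

lemma emeasure_mu: "emeasure mu {r..<1} = (\<integral>\<^sup>+s\<in>{r..<1}. ennreal (w s * s) \<partial>lborel)"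
  by (simp add: mu_def emeasure_density)

text \<open>On \<open>[r, 1)\<close> the extra factor \<open>s\<close> of the density lies between
  \<open>r\<close> and 1, so near the circle both tails are comparable.\<close>

lemma emeasure_mu_le:
  assumes "0 \<le> r" shows "emeasure mu {r..<1} \<le> tail_integral \<omega> (of_real r)"
  unfolding emeasure_mu tail_integral_eq[OF assms]
proof (rule nn_integral_mono)
  fix s
  have "w s * s \<le> w s * 1" if "s \<in> {r..<1}" using that w_nonneg[of s] by (intro mult_left_mono) auto
  then show "ennreal (w s * s) * indicator {r..<1} s \<le> ennreal (w s) * indicator {r..<1} s"
    by (cases "s \<in> {r..<1}") (simp_all add: ennreal_leI)
qed

lemma emeasure_mu_ge:
  assumes "0 \<le> r" shows "ennreal r * tail_integral \<omega> (of_real r) \<le> emeasure mu {r..<1}"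
proof -
  have "ennreal r * tail_integral \<omega> (of_real r) = (\<integral>\<^sup>+s. ennreal r * (ennreal (w s) * indicator {r..<1} s) \<partial>lborel)"
    unfolding tail_integral_eq[OF assms] by (subst nn_integral_cmult) auto
  also have "\<dots> \<le> emeasure mu {r..<1}" unfolding emeasure_mu
  proof (rule nn_integral_mono)
    fix s
    have "r * w s \<le> w s * s" if "s \<in> {r..<1}"
      using that w_nonneg[of s] by (subst mult.commute) (intro mult_left_mono, auto)
    then show "ennreal r * (ennreal (w s) * indicator {r..<1} s) \<le> ennreal (w s * s) * indicator {r..<1} s"
      using assms by (cases "s \<in> {r..<1}") (simp_all add: ennreal_leI ennreal_mult'[symmetric])
  qed
  finally show ?thesis .
qed

lemma measure_mu_pos:
  assumes "0 < d" shows "0 < measure mu {1 - d..<1}"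
proof -
  interpret finite_measure mu by (rule finite_measure_mu)
  define r where "r = max (1 - d) (1/2)"
  have r: "1/2 \<le> r" "r < 1" "1 - d \<le> r" using assms by (auto simp: r_def)
  have "0 < ennreal r * tail_integral \<omega> (of_real r)" using tail_pos[of "of_real r"] r by (simp add: ennreal_zero_less_mult_iff)
  also have "\<dots> \<le> emeasure mu {r..<1}" using r by (intro emeasure_mu_ge) auto
  also have "\<dots> \<le> emeasure mu {1 - d..<1}" using r by (intro emeasure_mono) (auto simp: sets_mu)
  finally show ?thesis unfolding emeasure_eq_measure by simp
qed

end

section \<open>The two norms as mixed norms\<close>

lemma cis_measurable [measurable]: "cis \<in> borel_measurable borel"
  by (intro borel_measurable_continuous_onI continuous_intros)

lemma nn_integral_0_2pi:
  assumes [measurable]: "F \<in> borel_measurable borel"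
  shows "(\<integral>\<^sup>+\<theta>\<in>{0..2 * pi}. F \<theta> \<partial>lborel) = ennreal (2 * pi) * (\<integral>\<^sup>+x. F (2 * pi * x) \<partial>circle)"
proof -
  have "(\<integral>\<^sup>+\<theta>\<in>{0..2 * pi}. F \<theta> \<partial>lborel) = ennreal (2 * pi) * (\<integral>\<^sup>+x. F (2 * pi * x) * indicator {0..2 * pi} (2 * pi * x) \<partial>lborel)"
    using nn_integral_real_affine[of "\<lambda>\<theta>. F \<theta> * indicator {0..2 * pi} \<theta>" "2 * pi" 0] by simp
  also have "(\<integral>\<^sup>+x. F (2 * pi * x) * indicator {0..2 * pi} (2 * pi * x) \<partial>lborel) = (\<integral>\<^sup>+x\<in>{0..<1}. F (2 * pi * x) \<partial>lborel)"
  proof (rule nn_integral_cong_AE)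
    show "AE x in lborel. F (2 * pi * x) * indicator {0..2 * pi} (2 * pi * x) = F (2 * pi * x) * indicator {0..<1} x"
      using AE_lborel_singleton[of "1::real"] by eventually_elim (auto simp: zero_le_mult_iff not_le[THEN iffD2, OF pi_gt_zero] split: split_indicator)
  qed
  finally show ?thesis by (simp add: nn_integral_circle)
qed

text \<open>The cosine is even, periodic and decreasing on \<open>[0, pi]\<close>, so one inequality
  between cosines replaces the search for the integer \<open>n\<close>.\<close>

lemma cos_gt_iff_close_mod_2pi:
  assumes b: "0 < b" "b \<le> pi"
  shows "(\<exists>n::int. \<bar>\<delta> + 2 * pi * of_int n\<bar> < b) \<longleftrightarrow> cos b < cos \<delta>"
proof -
  have cos_shift: "cos \<bar>\<delta> + 2 * pi * of_int n\<bar> = cos \<delta>" for n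
  proof -
    have "cos \<bar>\<delta> + 2 * pi * of_int n\<bar> = cos (\<delta> + 2 * pi * of_int n)" by simp
    also have "\<dots> = cos \<delta>" using sin_cos_eq_iff[of "\<delta> + 2 * pi * of_int n" \<delta>] by blast
    finally show ?thesis .
  qed
  show ?thesis
  proof
    assume "\<exists>n::int. \<bar>\<delta> + 2 * pi * of_int n\<bar> < b"
    then obtain n :: int where n: "\<bar>\<delta> + 2 * pi * of_int n\<bar> < b" by blast
    have "cos b < cos \<bar>\<delta> + 2 * pi * of_int n\<bar>" using n b by (intro cos_monotone_0_pi) auto
    then show "cos b < cos \<delta>" unfolding cos_shift .
  next
    assume c: "cos b < cos \<delta>"
    define n where "n = - round (\<delta> / (2 * pi))"
    have "\<bar>\<delta> + 2 * pi * of_int n\<bar> = 2 * pi * \<bar>of_int (round (\<delta> / (2 * pi))) - \<delta> / (2 * pi)\<bar>"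
    proof -
      have "\<delta> + 2 * pi * of_int n = 2 * pi * (\<delta> / (2 * pi) - of_int (round (\<delta> / (2 * pi))))"
        by (simp add: n_def right_diff_distrib)
      then show ?thesis by (simp add: abs_mult abs_minus_commute)
    qed
    also have "\<dots> \<le> 2 * pi * (1 / 2)" by (intro mult_left_mono of_int_round_abs_le) auto
    finally have "\<bar>\<delta> + 2 * pi * of_int n\<bar> \<le> pi" by simp
    moreover have "cos b < cos \<bar>\<delta> + 2 * pi * of_int n\<bar>" using c unfolding cos_shift .
    ultimately have "\<bar>\<delta> + 2 * pi * of_int n\<bar> < b"
      using b cos_monotone_0_pi_le[of b "\<bar>\<delta> + 2 * pi * of_int n\<bar>"] by linarith
    then show "\<exists>n::int. \<bar>\<delta> + 2 * pi * of_int n\<bar> < b" by blast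
  qed
qed

text \<open>The right-hand side is a Borel condition on \<open>z\<close>, free of the branch cut of \<open>Arg\<close>.\<close>

lemma tent_region_iff:
  assumes z: "0 < norm z" "norm z < 1"
  shows "z \<in> tent_region (cis \<theta>) \<longleftrightarrow> norm z * cos (1 - norm z) < Re (z * cis (- \<theta>))"
proof -
  have b: "0 < 1 - norm z" "1 - norm z \<le> pi" using z pi_gt3 by linarith+
  have "z \<in> tent_region (cis \<theta>) \<longleftrightarrow> cos (1 - norm z) < cos (Arg z - Arg (cis \<theta>))"
    using z by (simp add: tent_region_def cos_gt_iff_close_mod_2pi[OF b])
  also have "cos (Arg z - Arg (cis \<theta>)) = Re (cis (Arg z) * cnj (cis (Arg (cis \<theta>))))"
    by (simp add: cos_diff)
  also have "\<dots> = Re (sgn z * cnj (cis \<theta>))"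
    using z by (subst (1 2) cis_Arg) (auto simp: sgn_div_norm)
  also have "\<dots> = Re (z * cis (- \<theta>)) / norm z"
    by (simp add: sgn_div_norm cis_cnj) (simp add: field_simps)
  also have "cos (1 - norm z) < Re (z * cis (- \<theta>)) / norm z \<longleftrightarrow> norm z * cos (1 - norm z) < Re (z * cis (- \<theta>))"
    using z by (simp add: field_simps)
  finally show ?thesis .
qed

context radial_profile begin

definition dirac0 :: "real measure" where "dirac0 = distr (count_space {0}) borel (\<lambda>u. u)"

lemma nn_integral_dirac0: "F \<in> borel_measurable borel \<Longrightarrow> (\<integral>\<^sup>+u. F u \<partial>dirac0) = F 0"
  unfolding dirac0_def by (subst nn_integral_distr) (auto simp: nn_integral_count_space_finite)

lemma emeasure_dirac0: "emeasure dirac0 UNIV = 1"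
  unfolding dirac0_def by (subst emeasure_distr) auto

lemma mixed_norm_L: "0 < p \<Longrightarrow> 0 < q \<Longrightarrow> mixed_norm mu dirac0 p q"
proof (intro mixed_norm.intro)
  show "finite_measure dirac0" by (intro finite_measureI) (use emeasure_dirac0 in \<open>simp add: dirac0_def\<close>)
  show "sets dirac0 = sets borel" by (simp add: dirac0_def)
  show "AE u in dirac0. \<bar>u\<bar> \<le> 1" unfolding dirac0_def by (subst AE_distr_iff) (auto simp: AE_count_space)
  show "0 < measure dirac0 UNIV" using emeasure_dirac0 by (simp add: measure_def)
qed (use finite_measure_mu sets_mu AE_mu measure_mu_pos in auto)

text \<open>The factor \<open>1 / pi\<close> is the normalization of the area measure, so the total
  mass is \<open>2 / pi\<close>.\<close>

definition tau :: "real measure" where "tau = density lborel (\<lambda>u. ennreal (indicator {-1<..<1} u / pi))"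

lemma nn_integral_tau:
  assumes [measurable]: "F \<in> borel_measurable borel"
  shows "(\<integral>\<^sup>+u. F u \<partial>tau) = ennreal (1 / pi) * (\<integral>\<^sup>+u\<in>{-1<..<1}. F u \<partial>lborel)"
proof -
  have "(\<integral>\<^sup>+u. F u \<partial>tau) = (\<integral>\<^sup>+u. ennreal (indicator {-1<..<1} u / pi) * F u \<partial>lborel)"
    unfolding tau_def by (rule nn_integral_density) simp_all
  also have "\<dots> = (\<integral>\<^sup>+u. ennreal (1 / pi) * (F u * indicator {-1<..<1} u) \<partial>lborel)"
    by (intro nn_integral_cong) (auto split: split_indicator)
  finally show ?thesis by (simp add: nn_integral_cmult)
qed

lemma emeasure_tau: "emeasure tau UNIV = ennreal (2 / pi)"
  using nn_integral_tau[of "\<lambda>_. 1"] by (simp add: tau_def ennreal_mult''[symmetric] ennreal_numeral[symmetric] del: ennreal_numeral)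

lemma mixed_norm_T: "0 < p \<Longrightarrow> 0 < q \<Longrightarrow> mixed_norm mu tau p q"
proof (intro mixed_norm.intro)
  show "finite_measure tau" by (intro finite_measureI) (use emeasure_tau in \<open>simp add: tau_def\<close>)
  show "sets tau = sets borel" by (simp add: tau_def)
  show "AE u in tau. \<bar>u\<bar> \<le> 1" unfolding tau_def by (subst AE_density) (auto split: split_indicator)
  show "0 < measure tau UNIV" using emeasure_tau by (simp add: measure_def)
qed (use finite_measure_mu sets_mu AE_mu measure_mu_pos in auto)

context
  fixes p q :: real assumes p: "0 < p" and q: "0 < q"
begin

interpretation L: mixed_norm mu dirac0 p q by (rule mixed_norm_L[OF p q])
interpretation T: mixed_norm mu tau p q by (rule mixed_norm_T[OF p q])

lemma L_inner_eq:
  assumes f: "continuous_on (ball 0 1) f"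
  shows "(\<integral>\<^sup>+r\<in>{0..<1}. ennreal (norm (f (of_real r * cis (2 * pi * x))) powr p * \<omega> (of_real r) * r) \<partial>lebesgue) = L.inner f x"
proof -
  note [measurable] = trunc_measurable[OF f]
  define G where "G r = ennreal (norm (trunc f (pt x r 0)) powr p)" for r
  have [measurable]: "G \<in> borel_measurable borel" unfolding G_def[abs_def] pt_def by measurable
  have "(\<integral>\<^sup>+u. ennreal (norm (trunc f (pt x r u)) powr p) \<partial>dirac0) = G r" for r
    unfolding G_def pt_def by (subst nn_integral_dirac0) auto
  then have "L.inner f x = (\<integral>\<^sup>+r. ennreal (w r * r) * G r \<partial>lborel)"
    unfolding L.inner_def by (simp add: nn_integral_mu)
  also have "\<dots> = (\<integral>\<^sup>+r\<in>{0..<1}. ennreal (norm (f (of_real r * cis (2 * pi * x))) powr p * \<omega> (of_real r) * r) \<partial>lborel)"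
  proof (rule nn_integral_cong_AE)
    show "AE r in lborel. ennreal (w r * r) * G r =
        ennreal (norm (f (of_real r * cis (2 * pi * x))) powr p * \<omega> (of_real r) * r) * indicator {0..<1} r"
      using AE_w_atLeast[OF order_refl]
    proof eventually_elim
      case (elim r)
      show ?case
      proof (cases "r \<in> {0..<1}")
        case True
        then have "trunc f (pt x r 0) = f (of_real r * cis (2 * pi * x))" by (simp add: trunc_def pt_def norm_mult)
        then show ?thesis using True elim w_nonneg[of r]
          by (simp add: G_def ennreal_mult'[symmetric] mult_ac)
      next
        case False
        then show ?thesis using w_zero[of r] by auto
      qed
    qed
  qed
  finally show ?thesis by (simp add: nn_integral_completion)
qed

lemma L_norm_eq:
  assumes f: "continuous_on (ball 0 1) f"
  shows "L_norm p q \<omega> f = ennreal_powr (L.mnorm f) (1 / q)"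
proof -
  note [measurable] = L.inner_measurable[OF f]
  have "(\<integral>\<^sup>+\<theta>\<in>{0..2 * pi}. ennreal_powr (L.inner f (\<theta> / (2 * pi))) (q / p) \<partial>lborel) = ennreal (2 * pi) * L.mnorm f"
    by (subst nn_integral_0_2pi) (auto simp: L.mnorm_def)
  then have "ennreal (1 / (2 * pi)) * (\<integral>\<^sup>+\<theta>\<in>{0..2 * pi}. ennreal_powr (L.inner f (\<theta> / (2 * pi))) (q / p) \<partial>lborel) = L.mnorm f"
    by (simp add: mult.assoc[symmetric] ennreal_mult''[symmetric])
  then show ?thesis
    unfolding L_norm_def nn_integral_completion[of lborel] L_inner_eq[OF f, symmetric] by (simp add: nn_integral_completion)
qed

text \<open>In polar coordinates the arc of the tent at radius \<open>r\<close> has the angles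
  \<open>\<theta> + u * (1 - r)\<close> with \<open>|u| < 1\<close>; the Jacobian
  \<open>1 - r\<close> of this parametrization cancels the factor
  \<open>1 / (1 - |z|)\<close>.\<close>

lemma T_inner_eq:
  assumes f: "continuous_on (ball 0 1) f"
  shows "ennreal (1 / pi) * (\<integral>\<^sup>+z\<in>tent_region (cis \<theta>). ennreal (norm (f z) powr p * \<omega> z / (1 - norm z)) \<partial>lebesgue)
    = T.inner f (\<theta> / (2 * pi))"
proof -
  note [measurable] = trunc_measurable[OF f]
  define G where "G z = ennreal (norm (trunc f z) powr p)" for z
  have [measurable]: "G \<in> borel_measurable borel" unfolding G_def[abs_def] by measurable
  define S where "S = {z. norm z * cos (1 - norm z) < Re (z * cis (- \<theta>))}"
  have S [measurable]: "S \<in> sets borel"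
    unfolding S_def by (intro borel_open open_Collect_less continuous_intros)
  define g where "g z = indicator S z * (ennreal (w (norm z) / (1 - norm z)) * G z)" for z
  have [measurable]: "g \<in> borel_measurable borel" unfolding g_def[abs_def] by measurable
  define H where "H r x = indicator S (of_real r * cis (2 * pi * x)) * (ennreal (1 / (1 - r)) * G (of_real r * cis (2 * pi * x)))" for r x :: real
  have [measurable]: "case_prod H \<in> borel_measurable (borel \<Otimes>\<^sub>M borel)" unfolding H_def[abs_def] by measurable
  have [measurable]: "H r \<in> borel_measurable borel" for r unfolding H_def[abs_def] by measurable
  define J where "J r = (\<integral>\<^sup>+u. G (pt (\<theta> / (2 * pi)) r u) \<partial>tau)" for r

  have "(\<integral>\<^sup>+z\<in>tent_region (cis \<theta>). ennreal (norm (f z) powr p * \<omega> z / (1 - norm z)) \<partial>lebesgue) = (\<integral>\<^sup>+z. g z \<partial>lborel)"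
    unfolding nn_integral_completion
  proof (rule nn_integral_cong_AE)
    show "AE z in lborel. ennreal (norm (f z) powr p * \<omega> z / (1 - norm z)) * indicator (tent_region (cis \<theta>)) z = g z"
      using AE_w_norm AE_lborel_singleton[of "0::complex"]
    proof eventually_elim
      case (elim z)
      show ?case
      proof (cases "norm z < 1")
        case True
        then have "z \<in> tent_region (cis \<theta>) \<longleftrightarrow> z \<in> S" using elim tent_region_iff[of z \<theta>] by (simp add: S_def)
        then show ?thesis using True elim w_nonneg[of "norm z"]
          by (auto simp: g_def G_def trunc_def ennreal_mult'[symmetric] mult_ac split: split_indicator)
      next
        case False
        then have "z \<notin> tent_region (cis \<theta>)" by (simp add: tent_region_def)
        then show ?thesis using False w_zero[of "norm z"] by (simp add: g_def)
      qed
    qed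
  qed
  also have "\<dots> = ennreal (2 * pi) * (\<integral>\<^sup>+x\<in>{0..<1}. (\<integral>\<^sup>+r. ennreal (w r * r) * H r x \<partial>lborel) \<partial>lborel)"
  proof -
    have "ray g (2 * pi * x) = (\<integral>\<^sup>+r. ennreal (w r * r) * H r x \<partial>lborel)" for x
      unfolding ray_def
    proof (rule nn_integral_cong)
      fix r :: real
      show "ennreal r * g (of_real r * cis (2 * pi * x)) * indicator {0<..} r = ennreal (w r * r) * H r x"
      proof (cases "r \<in> {0<..<1}")
        case True
        have "ennreal r * g (of_real r * cis (2 * pi * x)) 
           = ennreal r * ennreal (w r / (1 - r)) * (indicator S (of_real r * cis (2 * pi * x)) * G (of_real r * cis (2 * pi * x)))"
          using True by (simp add: g_def norm_mult mult_ac)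
        also have "ennreal r * ennreal (w r / (1 - r)) = ennreal (w r * r) * ennreal (1 / (1 - r))"
          using True w_nonneg[of r] by (simp add: ennreal_mult'[symmetric] mult_ac)
        finally show ?thesis using True by (simp add: H_def mult_ac)
      next
        case False
        then show ?thesis using w_zero[of r] w_zero[of "\<bar>r\<bar>"] by (auto simp: g_def norm_mult)
      qed
    qed
    then show ?thesis by (subst nn_integral_polar) auto
  qed
  also have "(\<integral>\<^sup>+x\<in>{0..<1}. (\<integral>\<^sup>+r. ennreal (w r * r) * H r x \<partial>lborel) \<partial>lborel)
      = (\<integral>\<^sup>+x. (\<integral>\<^sup>+r. ennreal (w r * r) * H r x * indicator {0..<1} x \<partial>lborel) \<partial>lborel)"
    by (intro nn_integral_cong nn_integral_multc[symmetric]) measurable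
  also have "\<dots> = (\<integral>\<^sup>+r. (\<integral>\<^sup>+x. ennreal (w r * r) * H r x * indicator {0..<1} x \<partial>lborel) \<partial>lborel)"
    by (rule lborel_pair.Fubini') measurable
  also have "\<dots> = (\<integral>\<^sup>+r. ennreal (w r * r) * (\<integral>\<^sup>+x\<in>{0..<1}. H r x \<partial>lborel) \<partial>lborel)"
    unfolding mult.assoc by (intro nn_integral_cong nn_integral_cmult) measurable
  \<comment> \<open>The factor \<open>1 / 2\<close> is \<open>1 / (2 * pi)\<close>, from measuring
    angles in turns, relative to the \<open>1 / pi\<close> contained in \<open>tau\<close>.\<close>
  also have "\<dots> = (\<integral>\<^sup>+r. ennreal (1 / 2) * (ennreal (w r * r) * J r) \<partial>lborel)"
  proof (rule nn_integral_cong)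
    fix r :: real
    show "ennreal (w r * r) * (\<integral>\<^sup>+x\<in>{0..<1}. H r x \<partial>lborel) = ennreal (1 / 2) * (ennreal (w r * r) * J r)"
    proof (cases "r \<in> {0<..<1}")
      case False
      then show ?thesis using w_zero[of r] by simp
    next
      case True
      then have r: "0 < r" "r < 1" by auto
      \<comment> \<open>The period is centred at the vertex, so that
        \<open>|2 * pi * x - \<theta>| <= pi\<close> and the cosine condition becomes an interval
        condition.\<close>
      define a where "a = \<theta> / (2 * pi) - 1 / 2"
      define k where "k = (1 - r) / (2 * pi)"
      have k: "0 < k" using r by (simp add: k_def)
      have S_iff: "of_real r * cis (2 * pi * x) \<in> S \<longleftrightarrow> cos (1 - r) < cos (2 * pi * x - \<theta>)" for x
      proof -
        have "Re (of_real r * cis (2 * pi * x) * cis (- \<theta>)) = r * cos (2 * pi * x - \<theta>)"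
          unfolding mult.assoc cis_mult by simp
        then show ?thesis using r by (simp add: S_def norm_mult)
      qed
      have "(\<integral>\<^sup>+x\<in>{0..<1}. H r x \<partial>lborel) = (\<integral>\<^sup>+x\<in>{a..<a+1}. H r x \<partial>lborel)"
      proof (rule nn_integral_periodic[symmetric])
        show "H r (x + 1) = H r x" for x
          using pt_per[of x r 0] by (simp only: H_def pt_def mult_zero_left add_0_right)
      qed simp
      also have "\<dots> = (\<integral>\<^sup>+x. indicator {-1<..<1} ((2 * pi * x - \<theta>) / (1 - r)) * (ennreal (1 / (1 - r)) * G (of_real r * cis (2 * pi * x))) \<partial>lborel)"
      proof (rule nn_integral_cong)
        fix x :: real
        have "x \<in> {a..<a+1} \<and> of_real r * cis (2 * pi * x) \<in> S \<longleftrightarrow> \<bar>2 * pi * x - \<theta>\<bar> < 1 - r"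
        proof
          assume x: "x \<in> {a..<a+1} \<and> of_real r * cis (2 * pi * x) \<in> S"
          then have "\<bar>2 * pi * x - \<theta>\<bar> \<le> pi" by (auto simp: a_def field_simps abs_le_iff)
          moreover have "cos (1 - r) < cos \<bar>2 * pi * x - \<theta>\<bar>" using x S_iff by simp
          ultimately show "\<bar>2 * pi * x - \<theta>\<bar> < 1 - r"
            using r cos_monotone_0_pi_le[of "1 - r" "\<bar>2 * pi * x - \<theta>\<bar>"] pi_gt3 by linarith
        next
          assume x: "\<bar>2 * pi * x - \<theta>\<bar> < 1 - r"
          then have "cos (1 - r) < cos \<bar>2 * pi * x - \<theta>\<bar>" using r pi_gt3 by (intro cos_monotone_0_pi) auto
          then have "of_real r * cis (2 * pi * x) \<in> S" by (simp add: S_iff)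
          moreover have "2 * pi * x - \<theta> < pi" "- pi < 2 * pi * x - \<theta>" using x r pi_gt3 by linarith+
          then have "x \<in> {a..<a+1}" by (auto simp: a_def field_simps)
          ultimately show "x \<in> {a..<a+1} \<and> of_real r * cis (2 * pi * x) \<in> S" by blast
        qed
        also have "\<dots> \<longleftrightarrow> (2 * pi * x - \<theta>) / (1 - r) \<in> {-1<..<1}" using r by (auto simp: abs_less_iff field_simps)
        finally show "H r x * indicator {a..<a+1} x = indicator {-1<..<1} ((2 * pi * x - \<theta>) / (1 - r)) * (ennreal (1 / (1 - r)) * G (of_real r * cis (2 * pi * x)))"
          unfolding H_def by (auto split: split_indicator)
      qed
      also have "\<dots> = ennreal k * (\<integral>\<^sup>+u. indicator {-1<..<1} u * (ennreal (1 / (1 - r)) * G (pt (\<theta> / (2 * pi)) r u)) \<partial>lborel)"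
      proof -
        have e: "2 * pi * (\<theta> / (2 * pi) + k * u) = 2 * pi * (\<theta> / (2 * pi)) + u * (1 - r)" for u
          by (simp add: k_def field_simps)
        have e': "(2 * pi * (\<theta> / (2 * pi) + k * u) - \<theta>) / (1 - r) = u" for u
          using r unfolding e by simp
        show ?thesis
          by (subst nn_integral_real_affine[where c = k and t = "\<theta> / (2 * pi)"])
            (use k in \<open>simp_all add: e' pt_def e[symmetric] del: times_divide_eq_right\<close>)
      qed
      also have "\<dots> = ennreal k * (\<integral>\<^sup>+u. ennreal (1 / (1 - r)) * (G (pt (\<theta> / (2 * pi)) r u) * indicator {-1<..<1} u) \<partial>lborel)"
        by (simp only: mult_ac)
      also have "\<dots> = ennreal k * (ennreal (1 / (1 - r)) * (\<integral>\<^sup>+u\<in>{-1<..<1}. G (pt (\<theta> / (2 * pi)) r u) \<partial>lborel))"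
        unfolding pt_def by (subst nn_integral_cmult) auto
      also have "\<dots> = ennreal (1 / 2) * (ennreal (1 / pi) * (\<integral>\<^sup>+u\<in>{-1<..<1}. G (pt (\<theta> / (2 * pi)) r u) \<partial>lborel))"
      proof -
        have "k * (1 / (1 - r)) = 1 / 2 * (1 / pi)" using r by (simp add: k_def)
        then have "ennreal k * ennreal (1 / (1 - r)) = ennreal (1 / 2) * ennreal (1 / pi)"
          using k r by (simp only: ennreal_mult'[symmetric] less_imp_le zero_le_divide_1_iff zero_le_numeral pi_ge_zero diff_ge_0_iff_ge)
        then show ?thesis by (simp only: mult.assoc[symmetric])
      qed
      also have "\<dots> = ennreal (1 / 2) * J r"
        unfolding J_def pt_def by (subst nn_integral_tau) auto
      finally show ?thesis by (simp only: mult_ac)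
    qed
  qed
  also have "\<dots> = ennreal (1 / 2) * (\<integral>\<^sup>+r. ennreal (w r * r) * J r \<partial>lborel)"
    unfolding J_def pt_def by (rule nn_integral_cmult) (use T.sg.sigma_finite_measure_axioms in measurable)
  also have "(\<integral>\<^sup>+r. ennreal (w r * r) * J r \<partial>lborel) = T.inner f (\<theta> / (2 * pi))"
    unfolding T.inner_def J_def G_def using T.norm_trunc_measurable_r[OF f, of "\<theta> / (2 * pi)" p] T.sets_mu
    by (subst nn_integral_mu) (auto cong: measurable_cong_sets)
  finally have eq: "(\<integral>\<^sup>+z\<in>tent_region (cis \<theta>). ennreal (norm (f z) powr p * \<omega> z / (1 - norm z)) \<partial>lebesgue)
    = ennreal (2 * pi) * (ennreal (1 / 2) * T.inner f (\<theta> / (2 * pi)))" .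
  have e1: "ennreal (1 / pi * (2 * pi * (1 / 2))) = ennreal (1 / pi) * ennreal (2 * pi * (1 / 2))"
    by (rule ennreal_mult') simp
  have e2: "ennreal (2 * pi * (1 / 2)) = ennreal (2 * pi) * ennreal (1 / 2)" by (rule ennreal_mult') simp
  have e3: "1 / pi * (2 * pi * (1 / 2)) = 1" by simp
  have "1 = ennreal (1 / pi) * (ennreal (2 * pi) * ennreal (1 / 2))" using e1 unfolding e2 e3 ennreal_1 .
  then show ?thesis unfolding eq by (simp only: mult.assoc[symmetric] mult_1_left)
qed

text \<open>The outer integral runs over arc length without normalization, hence the factor
  \<open>(2 * pi) powr (1 / q)\<close>.\<close>

lemma T_norm_eq:
  assumes f: "continuous_on (ball 0 1) f"
  shows "T_norm p q \<omega> f = ennreal ((2 * pi) powr (1 / q)) * ennreal_powr (T.mnorm f) (1 / q)"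
proof -
  note [measurable] = T.inner_measurable[OF f]
  have "(\<integral>\<^sup>+\<theta>\<in>{0..2 * pi}. ennreal_powr (T.inner f (\<theta> / (2 * pi))) (q / p) \<partial>lborel) = ennreal (2 * pi) * T.mnorm f"
    by (subst nn_integral_0_2pi) (auto simp: T.mnorm_def)
  then show ?thesis
    unfolding T_norm_def T_inner_eq[OF f] by (simp add: nn_integral_completion ennreal_powr_cmult)
qed

end

end

section \<open>The characterization\<close>

lemma ennreal_inverse_mult_le_iff:
  assumes "0 < C"
  shows "ennreal (inverse C) * x \<le> y \<longleftrightarrow> x \<le> ennreal C * y"
proof
  assume "ennreal (inverse C) * x \<le> y"
  then have "ennreal C * (ennreal (inverse C) * x) \<le> ennreal C * y" by (rule mult_left_mono) simp
  then show "x \<le> ennreal C * y" using assms by (simp add: mult.assoc[symmetric] ennreal_mult''[symmetric])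
next
  assume "x \<le> ennreal C * y"
  then have "ennreal (inverse C) * x \<le> ennreal (inverse C) * (ennreal C * y)" by (rule mult_left_mono) simp
  then show "ennreal (inverse C) * x \<le> y" using assms by (simp add: mult.assoc[symmetric] ennreal_mult''[symmetric])
qed

text \<open>The norms carry the factor \<open>s\<close>, but the sum \<open>S\<close> of derivatives
  does not; the new constant has to allow for \<open>s\<close> above and below 1.\<close>

lemma comparable_on_H_unscale:
  assumes comp: "comparable_on_H A (\<lambda>f. B f + S f)" and s: "0 < s"
    and A: "\<And>f. f holomorphic_on ball 0 1 \<Longrightarrow> A f = ennreal s * A' f"
    and B: "\<And>f. f holomorphic_on ball 0 1 \<Longrightarrow> B f = ennreal s * B' f"
  shows "comparable_on_H A' (\<lambda>f. B' f + S f)"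
proof -
  obtain C where C: "0 < C" "\<And>f. f holomorphic_on ball 0 1 \<Longrightarrow> ennreal (inverse C) * (B f + S f) \<le> A f"
    "\<And>f. f holomorphic_on ball 0 1 \<Longrightarrow> A f \<le> ennreal C * (B f + S f)"
    using comp unfolding comparable_on_H_def by blast
  define m where "m = max 1 (1 / s)"
  have m: "1 \<le> m" "1 / s \<le> m" by (auto simp: m_def)
  define M where "M = max (m * C) (m * C * s)"
  have M: "m * C \<le> M" "m * C * s \<le> M" "0 < M" using m C s by (auto simp: M_def max_def mult_pos_pos)
  have "ennreal (inverse M) * (B' f + S f) \<le> A' f \<and> A' f \<le> ennreal M * (B' f + S f)"
    if f: "f holomorphic_on ball 0 1" for f
  proof
    have A1: "ennreal (1 / s) * A f = A' f" and B1: "ennreal (1 / s) * B f = B' f"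
      using s by (simp_all add: A[OF f] B[OF f] mult.assoc[symmetric] ennreal_mult''[symmetric])
    have "B' f + S f \<le> ennreal m * B f + ennreal m * S f"
    proof (rule add_mono)
      show "B' f \<le> ennreal m * B f" unfolding B1[symmetric] using m by (intro mult_right_mono ennreal_leI) auto
      show "S f \<le> ennreal m * S f" using mult_right_mono[of 1 "ennreal m" "S f"] m by simp
    qed
    also have "\<dots> = ennreal m * (B f + S f)" by (simp add: distrib_left)
    also have "\<dots> \<le> ennreal m * (ennreal C * A f)"
      using C(2)[OF f] C(1) by (intro mult_left_mono) (auto simp: ennreal_inverse_mult_le_iff)
    also have "\<dots> = ennreal (m * C * s) * A' f"
      using m C s by (simp add: A[OF f] ennreal_mult mult.assoc)
    also have "\<dots> \<le> ennreal M * A' f" using M by (intro mult_right_mono ennreal_leI) auto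
    finally show "ennreal (inverse M) * (B' f + S f) \<le> A' f" using M by (simp add: ennreal_inverse_mult_le_iff)
    have "A' f \<le> ennreal (1 / s) * (ennreal C * (B f + S f))"
      unfolding A1[symmetric] using C(3)[OF f] by (rule mult_left_mono) simp
    also have "\<dots> = ennreal C * (ennreal (1 / s) * B f) + ennreal C * (ennreal (1 / s) * S f)"
      by (simp only: distrib_left mult.left_commute)
    also have "\<dots> \<le> ennreal C * (ennreal m * B' f) + ennreal C * (ennreal m * S f)"
    proof (intro add_mono mult_left_mono)
      show "ennreal (1 / s) * B f \<le> ennreal m * B' f" unfolding B1 using mult_right_mono[of 1 "ennreal m" "B' f"] m by simp
      show "ennreal (1 / s) * S f \<le> ennreal m * S f" using m by (intro mult_right_mono ennreal_leI) auto
    qed auto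
    also have "\<dots> = ennreal (m * C) * (B' f + S f)"
      using m C by (simp add: ennreal_mult distrib_left mult_ac)
    also have "\<dots> \<le> ennreal M * (B' f + S f)" using M by (intro mult_right_mono ennreal_leI) auto
    finally show "A' f \<le> ennreal M * (B' f + S f)" .
  qed
  then show ?thesis unfolding comparable_on_H_def using M(3) by blast
qed

lemma comparable_on_H_scale_iff:
  assumes s: "0 < s"
    and A: "\<And>f. f holomorphic_on ball 0 1 \<Longrightarrow> A f = ennreal s * A' f"
    and B: "\<And>f. f holomorphic_on ball 0 1 \<Longrightarrow> B f = ennreal s * B' f"
  shows "comparable_on_H A (\<lambda>f. B f + S f) \<longleftrightarrow> comparable_on_H A' (\<lambda>f. B' f + S f)"
proof
  show "comparable_on_H A (\<lambda>f. B f + S f) \<Longrightarrow> comparable_on_H A' (\<lambda>f. B' f + S f)"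
    by (rule comparable_on_H_unscale[OF _ s A B])
  have inv: "X = ennreal (1 / s) * (ennreal s * X)" for X
    using s by (simp add: mult.assoc[symmetric] ennreal_mult''[symmetric])
  assume c: "comparable_on_H A' (\<lambda>f. B' f + S f)"
  show "comparable_on_H A (\<lambda>f. B f + S f)"
  proof (rule comparable_on_H_unscale[OF c])
    show "0 < 1 / s" using s by simp
    fix f :: "complex \<Rightarrow> complex" assume f: "f holomorphic_on ball 0 1"
    show "A' f = ennreal (1 / s) * A f" unfolding A[OF f] by (rule inv)
    show "B' f = ennreal (1 / s) * B f" unfolding B[OF f] by (rule inv)
  qed
qed

section \<open>The equivalence for mixed norms\<close>

context mixed_norm begin

definition doubling where
  "doubling \<longleftrightarrow> (\<exists>C d0. 0 < C \<and> 0 < d0 \<and> (\<forall>d. 0 < d \<and> d \<le> d0 \<longrightarrow> mh d \<le> C * mh (d / 2)))"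

definition decay where
  "decay \<longleftrightarrow> (\<exists>K C d0. 1 < K \<and> 1 < C \<and> 0 < d0 \<and> (\<forall>d. 0 < d \<and> d \<le> d0 \<longrightarrow> C * mh (d / K) \<le> mh d))"

text \<open>Both conditions are given for small \<open>d\<close> only. Doubling extends to all
  \<open>d > 0\<close> because \<open>mh\<close> is bounded, monotone and positive; decay extends to
  \<open>d <= 1\<close> by first shrinking \<open>d\<close> by the factor \<open>d3\<close>, which a
  larger \<open>l\<close> pays for.\<close>

lemma mixed_norm_D_of_doubling_decay:
  assumes "doubling" "decay"
  obtains l lam A0 where "mixed_norm_D mu sg p q l lam A0"
proof -
  obtain C d1 where C: "0 < C" "0 < d1" "\<And>d. 0 < d \<Longrightarrow> d \<le> d1 \<Longrightarrow> mh d \<le> C * mh (d / 2)"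
    using assms(1) unfolding doubling_def by blast
  obtain K c d2 where K: "1 < K" "1 < c" "0 < d2" "\<And>d. 0 < d \<Longrightarrow> d \<le> d2 \<Longrightarrow> c * mh (d / K) \<le> mh d"
    using assms(2) unfolding decay_def by blast
  define D where "D = max (max 1 C) (measure mu UNIV / mh (d1 / 2))"
  have D: "1 \<le> D" "C \<le> D" "measure mu UNIV / mh (d1 / 2) \<le> D" by (auto simp: D_def)
  have dbl: "mh d \<le> D * mh (d / 2)" if "0 < d" for d
  proof (cases "d \<le> d1")
    case True
    then have "mh d \<le> C * mh (d / 2)" using C(3) that by blast
    also have "\<dots> \<le> D * mh (d / 2)" using D mh_pos[of "d / 2"] that by (intro mult_right_mono) auto
    finally show ?thesis .
  next
    case False
    have p1: "0 < mh (d1 / 2)" using C by (intro mh_pos) auto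
    have "mh d \<le> measure mu UNIV / mh (d1 / 2) * mh (d1 / 2)" using mh_le_total[of d] p1 by simp
    also have "\<dots> \<le> D * mh (d / 2)" using False p1 D by (intro mult_mono mh_mono) auto
    finally show ?thesis .
  qed
  have dbl_pow: "mh d \<le> D ^ n * mh (d * (1 / 2) ^ n)" if "0 < d" for d n
  proof (induction n)
    case (Suc n)
    also have "D ^ n * mh (d * (1 / 2) ^ n) \<le> D ^ n * (D * mh (d * (1 / 2) ^ n / 2))"
      using D that by (intro mult_left_mono dbl) auto
    finally show ?case by (simp add: mult_ac)
  qed simp
  define d3 where "d3 = min d2 1"
  have d3: "0 < d3" "d3 \<le> 1" "d3 \<le> d2" using K by (auto simp: d3_def)
  obtain l0 :: nat where l0: "K / d3 < 2 ^ l0" using real_arch_pow[of 2 "K / d3"] by auto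
  define l where "l = Suc l0"
  have Kl: "K / d3 \<le> 2 ^ l"
    using l0 K d3 by (simp add: l_def) (smt (verit) divide_pos_pos)
  have dec: "mh (d * (1 / 2) ^ l) \<le> 1 / c * mh d" if d: "0 < d" "d \<le> 1" for d
  proof -
    have "(1 / 2) ^ l \<le> d3 / K" using Kl K d3 by (simp add: power_divide field_simps)
    then have "d * (1 / 2) ^ l \<le> d * d3 / K"
      using mult_left_mono[of "(1 / 2) ^ l" "d3 / K" d] d by simp
    then have "c * mh (d * (1 / 2) ^ l) \<le> c * mh (d * d3 / K)" using K by (intro mult_left_mono mh_mono) auto
    also have "\<dots> \<le> mh (d * d3)" using d d3 mult_mono[of d 1 d3 d2] by (intro K(4)) auto
    also have "\<dots> \<le> mh d" using d d3 mult_left_le[of d3 d] by (intro mh_mono) auto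
    finally show ?thesis using K by (simp add: field_simps)
  qed
  have "mixed_norm_D mu sg p q l (1 / c) (D ^ l)"
  proof (unfold_locales)
    fix n
    have e: "(1 / 2 :: real) ^ (l * Suc n) = (1 / 2) ^ (l * n) * (1 / 2) ^ l" by (simp add: power_add mult.commute)
    show "mh ((1 / 2) ^ (l * Suc n)) \<le> 1 / c * mh ((1 / 2) ^ (l * n))"
      unfolding e by (rule dec) (auto intro: power_le_one)
    show "mh ((1 / 2) ^ (l * n)) \<le> D ^ l * mh ((1 / 2) ^ (l * Suc n))"
      unfolding e by (rule dbl_pow) auto
  qed (use K D one_le_power[OF D(1), of l] in \<open>auto simp: l_def simp del: power_Suc\<close>)
  then show ?thesis by (rule that)
qed

theorem comparable_iff_doubling_decay:
  assumes k: "1 \<le> k"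
  shows "comparable_on_H (\<lambda>f. ennreal_powr (mnorm f) (1 / q))
     (\<lambda>f. ennreal_powr (mnorm (wd ((deriv ^^ k) f) k)) (1 / q) + ennreal (\<Sum>j<k. norm ((deriv ^^ j) f 0)))
    \<longleftrightarrow> doubling \<and> decay" (is "?C \<longleftrightarrow> _")
proof
  assume c: ?C
  obtain C where C: "1 \<le> C"
    "\<And>n. 2 * k \<le> n \<Longrightarrow> (real n ^ k) powr p * mom n k \<le> C * mom n 0"
    "\<And>n. 2 * k \<le> n \<Longrightarrow> mom n 0 \<le> C * ((real n ^ k) powr p * mom (n - k) k)"
    by (rule monomial_comparison[OF c k]) (rule that)
  obtain B D where B: "1 \<le> B" "\<And>n. 2 * k \<le> n \<Longrightarrow> mom n 0 \<le> 2 * mh (B / n)"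
    and D: "1 \<le> D" "\<And>d. 0 < d \<Longrightarrow> d \<le> 1 \<Longrightarrow> mh d \<le> D * mh (d / 2)"
    by (rule doubling_of_comparison[OF C(1) _ k]) (rule C(2), assumption, rule that)
  obtain K e d0 where K: "1 < K" "0 < e" "0 < d0" "\<And>d. 0 < d \<Longrightarrow> d \<le> d0 \<Longrightarrow> (1 + e) * mh (d / K) \<le> mh d"
    by (rule decay_of_comparison[OF C(1) _ k B(1) _ D(1)])
      (rule C(3), assumption, rule B(2), assumption, rule D(2), assumption, assumption, rule that)
  have doubling unfolding doubling_def using D by (intro exI[of _ D] exI[of _ 1]) auto
  moreover have decay unfolding decay_def
    by (rule exI[of _ K], rule exI[of _ "1 + e"], rule exI[of _ d0], intro conjI allI impI, rule K(1), simp add: K(2), rule K(3), erule conjE, rule K(4))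
  ultimately show "doubling \<and> decay" by blast
next
  assume "doubling \<and> decay"
  then obtain l lam A0 where "mixed_norm_D mu sg p q l lam A0" using mixed_norm_D_of_doubling_decay by blast
  then show ?C by (rule mixed_norm_D.comparable_mnorm)
qed

end

section \<open>From masses back to tail integrals\<close>

context radial_profile begin

definition mh where "mh d = measure mu {1 - d..<1}"

text \<open>Since \<open>mh d\<close> is finite and dominates \<open>1 - d\<close> times the tail
  integral, the tail integral is finite for \<open>d < 1\<close>.\<close>

lemma tail_integral_bounds:
  assumes d: "0 < d" "d < 1"
  obtains t where "tail_integral \<omega> (of_real (1 - d)) = ennreal t" "0 \<le> t" "(1 - d) * t \<le> mh d" "mh d \<le> t"
proof -
  interpret mu: finite_measure mu by (rule finite_measure_mu)
  have em: "emeasure mu {1 - d..<1} = ennreal (mh d)" unfolding mh_def by (rule mu.emeasure_eq_measure)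
  have ge: "ennreal (1 - d) * tail_integral \<omega> (of_real (1 - d)) \<le> ennreal (mh d)"
    using emeasure_mu_ge[of "1 - d"] d unfolding em by (meson diff_ge_0_iff_ge less_imp_le)
  have le: "ennreal (mh d) \<le> tail_integral \<omega> (of_real (1 - d))"
    using emeasure_mu_le[of "1 - d"] d unfolding em by (meson diff_ge_0_iff_ge less_imp_le)
  show ?thesis
  proof (cases "tail_integral \<omega> (of_real (1 - d))")
    case (real t)
    have "(1 - d) * t \<le> mh d" using ge real d by (simp add: ennreal_mult'[symmetric] mh_def)
    moreover have "mh d \<le> t" using le real by simp
    ultimately show ?thesis using that[of t] real by blast
  next
    case top
    then show ?thesis using ge d by (simp add: ennreal_mult_top top_unique)
  qed
qed

lemma mh_nonneg: "0 \<le> mh d" by (simp add: mh_def)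

lemma eventually_at_left_1_iff:
  "(\<forall>\<^sub>F r::real in at_left 1. P (1 - r)) \<longleftrightarrow> (\<exists>b>0. \<forall>d. 0 < d \<and> d < b \<longrightarrow> P d)"
proof
  assume "\<forall>\<^sub>F r::real in at_left 1. P (1 - r)"
  then obtain b where b: "b < 1" "\<And>y. b < y \<Longrightarrow> y < 1 \<Longrightarrow> P (1 - y)"
    unfolding eventually_at_left_field by blast
  have "P d" if "0 < d \<and> d < 1 - b" for d using b(2)[of "1 - d"] that by auto
  then show "\<exists>b>0. \<forall>d. 0 < d \<and> d < b \<longrightarrow> P d" using b(1) by (intro exI[of _ "1 - b"]) auto
next
  assume "\<exists>b>0. \<forall>d. 0 < d \<and> d < b \<longrightarrow> P d"
  then obtain b where "0 < b" "\<And>d. 0 < d \<Longrightarrow> d < b \<Longrightarrow> P d" by blast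
  then show "\<forall>\<^sub>F r::real in at_left 1. P (1 - r)"
    unfolding eventually_at_left_field by (intro exI[of _ "1 - b"]) auto
qed

text \<open>For \<open>d <= 1/2\<close> replacing tail integrals by masses costs at most a factor 2,
  which a doubling constant can take.\<close>

lemma D_hat_iff:
  assumes "radial_weight \<omega>"
  shows "\<omega> \<in> D_hat \<longleftrightarrow> (\<exists>C d0. 0 < C \<and> 0 < d0 \<and> (\<forall>d. 0 < d \<and> d \<le> d0 \<longrightarrow> mh d \<le> C * mh (d / 2)))"
proof -
  have half: "1 - (1 - r) / 2 = (1 + r) / 2" "1 - (1 - r) = r" for r :: real by (simp_all add: field_simps)
  have e: "(\<forall>\<^sub>F r in at_left 1. tail_integral \<omega> (of_real r) \<le> ennreal C * tail_integral \<omega> (of_real ((1 + r) / 2)))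
    \<longleftrightarrow> (\<exists>b>0. \<forall>d. 0 < d \<and> d < b \<longrightarrow> tail_integral \<omega> (of_real (1 - d)) \<le> ennreal C * tail_integral \<omega> (of_real (1 - d / 2)))" for C
    by (rule eventually_at_left_1_iff[of "\<lambda>d. tail_integral \<omega> (of_real (1 - d)) \<le> ennreal C * tail_integral \<omega> (of_real (1 - d / 2))", unfolded half])
  have 1: "\<omega> \<in> D_hat \<longleftrightarrow> (\<exists>C>0. \<exists>b>0. \<forall>d. 0 < d \<and> d < b \<longrightarrow>
      tail_integral \<omega> (of_real (1 - d)) \<le> ennreal C * tail_integral \<omega> (of_real (1 - d / 2)))"
    unfolding D_hat_def mem_Collect_eq e using assms by blast
  show ?thesis unfolding 1
  proof
    assume "\<exists>C>0. \<exists>b>0. \<forall>d. 0 < d \<and> d < b \<longrightarrow>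
      tail_integral \<omega> (of_real (1 - d)) \<le> ennreal C * tail_integral \<omega> (of_real (1 - d / 2))"
    then obtain C b where C: "0 < C" "0 < b" "\<And>d. 0 < d \<Longrightarrow> d < b \<Longrightarrow>
      tail_integral \<omega> (of_real (1 - d)) \<le> ennreal C * tail_integral \<omega> (of_real (1 - d / 2))" by blast
    have "mh d \<le> (2 * C) * mh (d / 2)" if d: "0 < d" "d \<le> min (b / 2) (1 / 2)" for d
    proof -
      have db: "d < b" "d < 1" using d C by auto
      obtain t where t: "tail_integral \<omega> (of_real (1 - d)) = ennreal t" "0 \<le> t" "(1 - d) * t \<le> mh d" "mh d \<le> t"
        using tail_integral_bounds[of d] d by auto
      obtain u where u: "tail_integral \<omega> (of_real (1 - d / 2)) = ennreal u" "0 \<le> u" "(1 - d / 2) * u \<le> mh (d / 2)" "mh (d / 2) \<le> u"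
        using tail_integral_bounds[of "d / 2"] d by auto
      have "t \<le> C * u" using C(3)[OF d(1) db(1)] C(1) t u by (simp add: ennreal_mult'[symmetric])
      moreover have "1 / 2 * u \<le> (1 - d / 2) * u" using d u by (intro mult_right_mono) auto
      then have "u \<le> 2 * mh (d / 2)" using u by linarith
      then have "C * u \<le> C * (2 * mh (d / 2))" using C by (intro mult_left_mono) auto
      ultimately show ?thesis using t by (simp add: mult_ac)
    qed
    then show "\<exists>C d0. 0 < C \<and> 0 < d0 \<and> (\<forall>d. 0 < d \<and> d \<le> d0 \<longrightarrow> mh d \<le> C * mh (d / 2))"
      using C by (intro exI[of _ "2 * C"] exI[of _ "min (b / 2) (1 / 2)"]) auto
  next
    assume "\<exists>C d0. 0 < C \<and> 0 < d0 \<and> (\<forall>d. 0 < d \<and> d \<le> d0 \<longrightarrow> mh d \<le> C * mh (d / 2))"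
    then obtain C b where C: "0 < C" "0 < b" "\<And>d. 0 < d \<Longrightarrow> d \<le> b \<Longrightarrow> mh d \<le> C * mh (d / 2)" by blast
    have "tail_integral \<omega> (of_real (1 - d)) \<le> ennreal (2 * C) * tail_integral \<omega> (of_real (1 - d / 2))"
      if d: "0 < d" "d < min b (1 / 2)" for d
    proof -
      obtain t where t: "tail_integral \<omega> (of_real (1 - d)) = ennreal t" "0 \<le> t" "(1 - d) * t \<le> mh d" "mh d \<le> t"
        using tail_integral_bounds[of d] d by auto
      obtain u where u: "tail_integral \<omega> (of_real (1 - d / 2)) = ennreal u" "0 \<le> u" "(1 - d / 2) * u \<le> mh (d / 2)" "mh (d / 2) \<le> u"
        using tail_integral_bounds[of "d / 2"] d by auto
      have "1 / 2 * t \<le> (1 - d) * t" using d t by (intro mult_right_mono) auto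
      then have "t \<le> 2 * mh d" using t by linarith
      also have "\<dots> \<le> 2 * (C * mh (d / 2))" using C(3)[of d] d by simp
      also have "\<dots> \<le> 2 * (C * u)" using C u by simp
      finally have "t \<le> 2 * C * u" by simp
      then have "ennreal t \<le> ennreal (2 * C * u)" by (rule ennreal_leI)
      also have "\<dots> = ennreal (2 * C) * ennreal u" using C by (intro ennreal_mult') auto
      finally show ?thesis unfolding t(1) u(1) .
    qed
    then show "\<exists>C>0. \<exists>b>0. \<forall>d. 0 < d \<and> d < b \<longrightarrow>
      tail_integral \<omega> (of_real (1 - d)) \<le> ennreal C * tail_integral \<omega> (of_real (1 - d / 2))"
      using C by (intro exI[of _ "2 * C"] conjI exI[of _ "min b (1 / 2)"]) auto
  qed
qed

text \<open>Here the constant must remain above 1, so the factor \<open>1 - d\<close> cannot simply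
  be bounded by \<open>1/2\<close>: for \<open>d <= (C - 1) / (2 * C)\<close> it lowers
  \<open>C\<close> to no less than \<open>(1 + C) / 2\<close>.\<close>

lemma D_check_iff:
  assumes "radial_weight \<omega>"
  shows "\<omega> \<in> D_check \<longleftrightarrow> (\<exists>K C d0. 1 < K \<and> 1 < C \<and> 0 < d0 \<and> (\<forall>d. 0 < d \<and> d \<le> d0 \<longrightarrow> C * mh (d / K) \<le> mh d))"
proof -
  have e: "(\<forall>\<^sub>F r in at_left 1. ennreal C * tail_integral \<omega> (of_real (1 - (1 - r) / K)) \<le> tail_integral \<omega> (of_real r))
    \<longleftrightarrow> (\<exists>b>0. \<forall>d. 0 < d \<and> d < b \<longrightarrow> ennreal C * tail_integral \<omega> (of_real (1 - d / K)) \<le> tail_integral \<omega> (of_real (1 - d)))" for C K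
    using eventually_at_left_1_iff[of "\<lambda>d. ennreal C * tail_integral \<omega> (of_real (1 - d / K)) \<le> tail_integral \<omega> (of_real (1 - d))"]
    unfolding diff_diff_eq2 add_diff_cancel_left' .
  have 1: "\<omega> \<in> D_check \<longleftrightarrow> (\<exists>K C. 1 < K \<and> 1 < C \<and> (\<exists>b>0. \<forall>d. 0 < d \<and> d < b \<longrightarrow>
      ennreal C * tail_integral \<omega> (of_real (1 - d / K)) \<le> tail_integral \<omega> (of_real (1 - d))))"
    unfolding D_check_def mem_Collect_eq e using assms by blast
  have shrink: "(1 + C) / 2 \<le> C * (1 - d)" if "1 < C" "d \<le> (C - 1) / (2 * C)" for C d :: real
    using that by (simp add: field_simps)
  show ?thesis unfolding 1
  proof
    assume "\<exists>K C. 1 < K \<and> 1 < C \<and> (\<exists>b>0. \<forall>d. 0 < d \<and> d < b \<longrightarrow>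
      ennreal C * tail_integral \<omega> (of_real (1 - d / K)) \<le> tail_integral \<omega> (of_real (1 - d)))"
    then obtain K C b where C: "1 < K" "1 < C" "0 < b" "\<And>d. 0 < d \<Longrightarrow> d < b \<Longrightarrow>
      ennreal C * tail_integral \<omega> (of_real (1 - d / K)) \<le> tail_integral \<omega> (of_real (1 - d))" by blast
    define d0 where "d0 = min (min (b / 2) (1 / 2)) ((C - 1) / (2 * C))"
    have d0: "0 < d0" "d0 < b" "d0 < 1" "d0 \<le> (C - 1) / (2 * C)" using C by (auto simp: d0_def)
    have "(1 + C) / 2 * mh (d / K) \<le> mh d" if d: "0 < d" "d \<le> d0" for d
    proof -
      have dK: "0 < d / K" "d / K < 1" using d d0 C by (auto simp: field_simps)
      obtain t where t: "tail_integral \<omega> (of_real (1 - d)) = ennreal t" "0 \<le> t" "(1 - d) * t \<le> mh d" "mh d \<le> t"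
        using tail_integral_bounds[of d] d d0 by auto
      obtain u where u: "tail_integral \<omega> (of_real (1 - d / K)) = ennreal u" "0 \<le> u" "(1 - d / K) * u \<le> mh (d / K)" "mh (d / K) \<le> u"
        using tail_integral_bounds[OF dK] by auto
      have "ennreal C * ennreal u \<le> ennreal t" using C(4)[of d] d d0 unfolding t(1) u(1) by auto
      then have Cu: "C * u \<le> t" using C t by (simp add: ennreal_mult'[symmetric])
      have "(1 + C) / 2 * mh (d / K) \<le> C * (1 - d) * u"
        using shrink[of C d] C d d0 u mh_nonneg[of "d / K"] by (intro mult_mono) auto
      also have "\<dots> \<le> (1 - d) * t" using Cu d d0 mult_left_mono[of "C * u" t "1 - d"] by (simp add: mult_ac)
      finally show ?thesis using t by linarith
    qed
    then show "\<exists>K C d0. 1 < K \<and> 1 < C \<and> 0 < d0 \<and> (\<forall>d. 0 < d \<and> d \<le> d0 \<longrightarrow> C * mh (d / K) \<le> mh d)"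
      using C d0 by (intro exI[of _ K] exI[of _ "(1 + C) / 2"] exI[of _ d0]) auto
  next
    assume "\<exists>K C d0. 1 < K \<and> 1 < C \<and> 0 < d0 \<and> (\<forall>d. 0 < d \<and> d \<le> d0 \<longrightarrow> C * mh (d / K) \<le> mh d)"
    then obtain K C b where C: "1 < K" "1 < C" "0 < b" "\<And>d. 0 < d \<Longrightarrow> d \<le> b \<Longrightarrow> C * mh (d / K) \<le> mh d" by blast
    define d0 where "d0 = min (min b (1 / 2)) ((C - 1) / (2 * C))"
    have d0: "0 < d0" "d0 \<le> b" "d0 < 1" "d0 \<le> (C - 1) / (2 * C)" using C by (auto simp: d0_def)
    have "ennreal ((1 + C) / 2) * tail_integral \<omega> (of_real (1 - d / K)) \<le> tail_integral \<omega> (of_real (1 - d))"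
      if d: "0 < d" "d < d0" for d
    proof -
      have dK: "0 < d / K" "d / K < 1" "d / K \<le> d" using d d0 C by (auto simp: field_simps)
      obtain t where t: "tail_integral \<omega> (of_real (1 - d)) = ennreal t" "0 \<le> t" "(1 - d) * t \<le> mh d" "mh d \<le> t"
        using tail_integral_bounds[of d] d d0 by auto
      obtain u where u: "tail_integral \<omega> (of_real (1 - d / K)) = ennreal u" "0 \<le> u" "(1 - d / K) * u \<le> mh (d / K)" "mh (d / K) \<le> u"
        using tail_integral_bounds[OF dK(1,2)] by auto
      have "(1 + C) / 2 * u \<le> C * (1 - d / K) * u"
        using shrink[of C "d / K"] C d d0 dK u by (intro mult_right_mono) auto
      also have "\<dots> \<le> C * mh (d / K)" using u C mult_left_mono[of "(1 - d / K) * u" "mh (d / K)" C] by (simp add: mult_ac)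
      also have "\<dots> \<le> mh d" using C(4)[of d] d d0 by auto
      also have "\<dots> \<le> t" by (rule t)
      finally have "ennreal ((1 + C) / 2 * u) \<le> ennreal t" by (rule ennreal_leI)
      then show ?thesis unfolding t(1) u(1) using C u by (simp add: ennreal_mult'[symmetric])
    qed
    then show "\<exists>K C. 1 < K \<and> 1 < C \<and> (\<exists>b>0. \<forall>d. 0 < d \<and> d < b \<longrightarrow>
      ennreal C * tail_integral \<omega> (of_real (1 - d / K)) \<le> tail_integral \<omega> (of_real (1 - d)))"
      using C d0 by (intro exI[of _ K] exI[of _ "(1 + C) / 2"] conjI exI[of _ d0]) auto
  qed
qed

text \<open>Common to both norms: \<open>s\<close> records how the norm is normalized, and
  \<open>sg\<close> will be \<open>tau\<close> or \<open>dirac0\<close>.\<close>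

lemma D_class_iff_comparable:
  assumes rw: "radial_weight \<omega>" and mn: "mixed_norm mu sg p q" and k: "1 \<le> k" and s: "0 < s"
    and N: "\<And>f. continuous_on (ball 0 1) f \<Longrightarrow> N f = ennreal s * ennreal_powr (mixed_norm.mnorm mu sg p q f) (1 / q)"
  shows "\<omega> \<in> D_class \<longleftrightarrow> comparable_on_H N
     (\<lambda>f. N (\<lambda>z. (deriv ^^ k) f z * of_real ((1 - norm z) ^ k)) + ennreal (\<Sum>j<k. norm ((deriv ^^ j) f 0)))"
proof -
  interpret M: mixed_norm mu sg p q by (rule mn)
  have mh: "M.mh = mh" by (simp add: fun_eq_iff M.mh_def mh_def)
  have "\<omega> \<in> D_class \<longleftrightarrow> M.doubling \<and> M.decay"
    unfolding D_class_def Int_iff D_hat_iff[OF rw] D_check_iff[OF rw] M.doubling_def M.decay_def mh ..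
  also have "\<dots> \<longleftrightarrow> comparable_on_H (\<lambda>f. ennreal_powr (M.mnorm f) (1 / q))
     (\<lambda>f. ennreal_powr (M.mnorm (wd ((deriv ^^ k) f) k)) (1 / q) + ennreal (\<Sum>j<k. norm ((deriv ^^ j) f 0)))"
    by (rule M.comparable_iff_doubling_decay[OF k, symmetric])
  also have "\<dots> \<longleftrightarrow> comparable_on_H N
     (\<lambda>f. N (wd ((deriv ^^ k) f) k) + ennreal (\<Sum>j<k. norm ((deriv ^^ j) f 0)))"
  proof (rule comparable_on_H_scale_iff[OF s, symmetric])
    fix f :: "complex \<Rightarrow> complex" assume f: "f holomorphic_on ball 0 1"
    show "N f = ennreal s * ennreal_powr (M.mnorm f) (1 / q)"
      using f by (intro N holomorphic_on_imp_continuous_on)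
    show "N (wd ((deriv ^^ k) f) k) = ennreal s * ennreal_powr (M.mnorm (wd ((deriv ^^ k) f) k)) (1 / q)"
      using f by (intro N wd_continuous holomorphic_on_imp_continuous_on holomorphic_on_funpow_deriv)
  qed
  finally show ?thesis unfolding wd_def[abs_def] .
qed

end

theorem theorem1p7:
  fixes p q :: real and k :: nat and \<omega> :: "complex \<Rightarrow> real"
  assumes "0 < p" and "0 < q" and "1 \<le> k"
    and "radial_weight \<omega>"
    and "\<forall>z\<in>ball 0 1. 0 < tail_integral \<omega> z"
  shows "(\<omega> \<in> D_class \<longleftrightarrow>
            comparable_on_H (T_norm p q \<omega>)
              (\<lambda>f. T_norm p q \<omega> (\<lambda>z. (deriv ^^ k) f z * of_real ((1 - norm z) ^ k))
                   + ennreal (\<Sum>j<k. norm ((deriv ^^ j) f 0))))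
       \<and> (\<omega> \<in> D_class \<longleftrightarrow>
            comparable_on_H (L_norm p q \<omega>)
              (\<lambda>f. L_norm p q \<omega> (\<lambda>z. (deriv ^^ k) f z * of_real ((1 - norm z) ^ k))
                   + ennreal (\<Sum>j<k. norm ((deriv ^^ j) f 0))))"
proof -
  obtain w :: "real \<Rightarrow> real" where w: "w \<in> borel_measurable borel" "\<And>r. 0 \<le> w r"
    "\<And>r. r \<notin> {0<..<1} \<Longrightarrow> w r = 0" "AE r in lborel. r \<in> {0<..<1} \<longrightarrow> \<omega> (of_real r) = w r"
    "AE z in lborel. z \<in> ball 0 1 \<longrightarrow> \<omega> z = w (norm z)" "(\<integral>\<^sup>+r. ennreal (w r * r) \<partial>lborel) < \<infinity>"
    by (rule radial_weight_profile[OF assms(4)]) (rule that)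
  interpret radial_profile \<omega> w
    by unfold_locales (use w(1) in assumption, rule w(2), rule w(3), assumption, rule w(4), rule w(5), rule w(6), rule assms(5)[rule_format])
  show ?thesis
  proof
    show "\<omega> \<in> D_class \<longleftrightarrow> comparable_on_H (T_norm p q \<omega>)
              (\<lambda>f. T_norm p q \<omega> (\<lambda>z. (deriv ^^ k) f z * of_real ((1 - norm z) ^ k))
                   + ennreal (\<Sum>j<k. norm ((deriv ^^ j) f 0)))"
      by (rule D_class_iff_comparable[OF assms(4) mixed_norm_T[OF assms(1,2)] assms(3) _ T_norm_eq[OF assms(1,2)]]) simp_all
    show "\<omega> \<in> D_class \<longleftrightarrow> comparable_on_H (L_norm p q \<omega>)
              (\<lambda>f. L_norm p q \<omega> (\<lambda>z. (deriv ^^ k) f z * of_real ((1 - norm z) ^ k))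
                   + ennreal (\<Sum>j<k. norm ((deriv ^^ j) f 0)))"
      by (rule D_class_iff_comparable[OF assms(4) mixed_norm_L[OF assms(1,2)] assms(3) zero_less_one])
        (simp add: L_norm_eq[OF assms(1,2)])
  qed
qed

end
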